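(* Let $H=H(x,y,t)$ be a strongly cubic integrable operator and assume that $1-H$ is invertible for the parameters $(x,y,t)$ in an open set of $\mathbb R^{3m}$. Write $\Phi_1=\begin{pmatrix}\mathsf q&\mathsf p\\ \mathsf r&\mathsf s\end{pmatrix}$ with blocks of sizes $m\times m$, $m\times 1$, $1\times m$, $1\times 1$. Let $\boldsymbol{\mathsf t}=\mathrm{diag}(t_1,\dots,t_m)$, $\boldsymbol{\mathsf y}=\mathrm{diag}(y_1,\dots,y_m)$, $\boldsymbol{\mathsf x}=\mathrm{diag}(x_1,\dots,x_m)$ and $\partial=\sum_{k=1}^mt_k\partial_{x_k}$. Then $\mathsf q,\mathsf p,\mathsf r$ satisfy $$3\partial^2\mathsf q-2[\partial\mathsf q,\boldsymbol{\mathsf y}]-3[[\mathsf q,\boldsymbol{\mathsf t}],\partial\mathsf q]+3\boldsymbol{\mathsf t}\mathsf p\,\partial\mathsf r+3(\partial\mathsf p)\mathsf r\boldsymbol{\mathsf t}+2[[\mathsf q,\boldsymbol{\mathsf t}],[\mathsf q,\boldsymbol{\mathsf y}]]-2\boldsymbol{\mathsf t}\mathsf p\mathsf r\boldsymbol{\mathsf y}+2\boldsymbol{\mathsf y}\mathsf p\mathsf r\boldsymbol{\mathsf t}+[[\mathsf q,\boldsymbol{\mathsf t}],\boldsymbol{\mathsf x}]=0,$$ $$3\partial^2\mathsf p+2\boldsymbol{\mathsf y}\,\partial\mathsf p-3(\partial\mathsf q)\boldsymbol{\mathsf t}\mathsf p-3[\mathsf q,\boldsymbol{\mathsf t}]\partial\mathsf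 p+3\boldsymbol{\mathsf t}\mathsf p\mathsf r\boldsymbol{\mathsf t}\mathsf p-2(\boldsymbol{\mathsf y}\mathsf q\boldsymbol{\mathsf t}-\boldsymbol{\mathsf t}\mathsf q\boldsymbol{\mathsf y})\mathsf p+\boldsymbol{\mathsf x}\boldsymbol{\mathsf t}\mathsf p=0,$$ $$3\partial^2\mathsf r-2(\partial\mathsf r)\boldsymbol{\mathsf y}-3\mathsf r\boldsymbol{\mathsf t}\,\partial\mathsf q+3(\partial\mathsf r)[\mathsf q,\boldsymbol{\mathsf t}]+3\mathsf r\boldsymbol{\mathsf t}\mathsf p\mathsf r\boldsymbol{\mathsf t}-2\mathsf r(\boldsymbol{\mathsf y}\mathsf q\boldsymbol{\mathsf t}-\boldsymbol{\mathsf t}\mathsf q\boldsymbol{\mathsf y})+\mathsf r\boldsymbol{\mathsf t}\boldsymbol{\mathsf x}=0.$$ In the particular case when $t_1=\cdots=t_m=:\tau$, they satisfy, with $\partial_{\mathsf x}:=\sum_{i=1}^m\partial_{x_i}$, $$\partial_{\mathsf x}\mathsf q+\mathsf p\mathsf r=0,$$ $$3\tau\,\partial_{\mathsf x}^2\mathsf p+2\boldsymbol{\mathsf y}\,\partial_{\mathsf x}\mathsf p+6\tau\,\mathsf p\mathsf r\mathsf p-2[\boldsymbol{\mathsf y},\mathsf q]\mathsf p+\boldsymbol{\mathsf x}\mathsf p=0,$$ $$3\tau\,\partial_{\mathsf x}^2\mathsf r-2(\partial_{\mathsf x}\mathsf r)\boldsymbol{\mathsf y}+6\tau\,\mathsf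 r\mathsf p\mathsf r-2\mathsf r[\boldsymbol{\mathsf y},\mathsf q]+\mathsf r\boldsymbol{\mathsf x}=0.$$
   Context: Setting. $m\ge 1$ is an integer. $\Omega\subset\mathbb C$ is a finite union of pairwise disjoint simple contours, each of which is closed or extends to infinity (no finite endpoints). $L^2(\Omega,\mu)$ denotes $L^2(\Omega,dz)$, $d\mu=dz$. Parameters: $x=(x_1,\dots,x_m)$, $y=(y_1,\dots,y_m)$, $t=(t_1,\dots,t_m)\in\mathbb R^m$. Put $m_j(z)=\exp(t_jz^3+y_jz^2+x_jz)$ and $\Delta(z)=\mathrm{diag}(m_1(z),\dots,m_m(z),1)$. $E_i$ is the $(m+1)\times(m+1)$ matrix with $(i,i)$ entry $1$ and all other entries $0$. $[A,B]=AB-BA$. Strongly cubic integrable operator. A bounded integral operator $H$ on $L^2(\Omega,\mu)$ with kernel $H(u,v)=\frac{f(u)^Tg(v)}{u-v}$ for $u\ne v$, $H(u,u)=0$, where $f(u)=c(u)\Delta(u)U(u)$ and $g(u)=c(u)^{-1}\Delta(u)^{-1}V(u)$; here $U,V:\Omega\to\mathbb C^{m+1}$ are column-vector functions not depending on $x,y,t$, constant on each connected component of $\Omega$, with $U(u)^TE_iV(u)=0$ for all $u\in\Omega$ and $i\in\{1,\dots,m+1\}$; $c$ is a non-vanishing scalar function on $\Omega$ (possibly depending on $x,y,t$); and $f,g\in L^2(\Omega,\mu)\cap L^\infty(\Omega,\mu)$. (So $H=H(x,y,t)$ depends on the parameters.) When $1-H$ is invertible set $\Phi_1=\Phi_1(x,y,t)=\int_\Omega((1-H)^{-1}f)(s)\,g(s)^T\,d\mu(s)$,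 an $(m+1)\times(m+1)$ matrix. *)

theory Defs
  imports "HOL-Analysis.Analysis"
begin

section \<open>Contours, arc length, and integration against \<open>dz\<close>\<close>

text \<open>
  A simple contour is given by a parameter interval and a parametrization. A closed contour is
  parametrized by \<open>{0..1}\<close>; a contour without end points that extends to infinity is
  parametrized by the whole real line and leaves every bounded set at both ends. The orientation
  is that of the parametrization.
\<close>

type_synonym contour = "real set \<times> (real \<Rightarrow> complex)"

definition closed_contour :: "contour \<Rightarrow> bool" where
  "closed_contour = (\<lambda>(I, \<gamma>). I = {0..1} \<and> valid_path \<gamma> \<and> simple_path \<gamma> \<and>
     pathfinish \<gamma> = pathstart \<gamma>)"

definition infinite_contour :: "contour \<Rightarrow> bool" where
  "infinite_contour = (\<lambda>(I, \<gamma>). I = UNIV \<and> inj \<gamma> \<and>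
     (\<forall>a b. \<gamma> piecewise_C1_differentiable_on {a..b}) \<and>
     filterlim \<gamma> at_infinity at_top \<and> filterlim \<gamma> at_infinity at_bot)"

definition contour_image :: "contour \<Rightarrow> complex set" where
  "contour_image = (\<lambda>(I, \<gamma>). \<gamma> ` I)"

definition contour_system :: "contour set \<Rightarrow> bool" where
  "contour_system \<Gamma> \<longleftrightarrow> finite \<Gamma> \<and>
     (\<forall>\<kappa>\<in>\<Gamma>. closed_contour \<kappa> \<or> infinite_contour \<kappa>) \<and> disjoint_family_on contour_image \<Gamma>"

text \<open>The set \<open>\<Omega>\<close>.\<close>

definition carrier_of :: "contour set \<Rightarrow> complex set" where
  "carrier_of \<Gamma> = (\<Union>\<kappa>\<in>\<Gamma>. contour_image \<kappa>)"

text \<open>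
  The arc length measure \<open>|dz|\<close> on the Borel sets of \<open>\<Omega>\<close>. Since \<open>dz\<close> is complex valued, the
  spaces \<open>L\<^sup>2\<close> and \<open>L\<^sup>\<infinity>\<close> over \<open>dz\<close> are those of its total variation \<open>|dz|\<close>.
\<close>

definition arclength :: "contour set \<Rightarrow> complex measure" where
  "arclength \<Gamma> =
     measure_of (carrier_of \<Gamma>) (sets (restrict_space borel (carrier_of \<Gamma>)))
       (\<lambda>A. \<Sum>(I, \<gamma>)\<in>\<Gamma>.
          \<integral>\<^sup>+ s. ennreal (norm (vector_derivative \<gamma> (at s))) * indicator {s\<in>I. \<gamma> s \<in> A} s \<partial>lborel)"

text \<open>The set function above is a measure, so that \<^const>\<open>measure_of\<close> does not degenerate.\<close>

lemma contour_borel: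
  assumes "closed_contour (I, \<gamma>) \<or> infinite_contour (I, \<gamma>)"
  shows "I \<in> sets borel" "continuous_on I \<gamma>"
    "(\<lambda>s. indicator I s *\<^sub>R vector_derivative \<gamma> (at s)) \<in> borel_measurable borel"
proof -
  show I: "I \<in> sets borel" using assms by (auto simp: closed_contour_def infinite_contour_def)
  have cov: "\<exists>C. countable C \<and> (\<forall>s\<in>I - C. isCont (\<lambda>s. indicator I s *\<^sub>R vector_derivative \<gamma> (at s)) s)"
  proof -
    have key: "\<exists>C. finite C \<and> (\<forall>s\<in>{a..b} - C. isCont (\<lambda>s. vector_derivative \<gamma> (at s)) s)"
      if "\<gamma> piecewise_C1_differentiable_on {a..b}" for a b :: real
    proof -
      obtain S where S: "finite S" "\<gamma> C1_differentiable_on ({a..b} - S)"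
        using \<open>\<gamma> piecewise_C1_differentiable_on {a..b}\<close> by (auto simp: piecewise_C1_differentiable_on_def)
      have c: "continuous_on ({a..b} - S) (\<lambda>s. vector_derivative \<gamma> (at s))"
        using S(2) by (simp add: C1_differentiable_on_eq)
      have "open ({a<..<b} - S)" using S(1) by (intro open_Diff finite_imp_closed) auto
      moreover have "continuous_on ({a<..<b} - S) (\<lambda>s. vector_derivative \<gamma> (at s))"
        by (rule continuous_on_subset[OF c]) auto
      ultimately have "\<forall>s\<in>{a<..<b} - S. isCont (\<lambda>s. vector_derivative \<gamma> (at s)) s"
        by (simp only: continuous_on_eq_continuous_at)
      then show ?thesis using S by (intro exI[of _ "S \<union> {a,b}"]) auto
    qed
    from assms show ?thesis
    proof
      assume "closed_contour (I, \<gamma>)"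
      then have I: "I = {0..1}" and "\<gamma> piecewise_C1_differentiable_on {0..1}"
        by (auto simp: closed_contour_def valid_path_def)
      then obtain C where C: "finite C" "\<forall>s\<in>{0..1} - C. isCont (\<lambda>s. vector_derivative \<gamma> (at s)) s"
        using key by blast
      have "isCont (\<lambda>s. indicator I s *\<^sub>R vector_derivative \<gamma> (at s)) s" if "s \<in> I - (C \<union> {0,1})" for s
      proof -
        have s: "s \<in> {0<..<1}" using that I by auto
        have "isCont (\<lambda>s. vector_derivative \<gamma> (at s)) s" using C that I by auto
        moreover have "\<forall>\<^sub>F z in nhds s. indicator I z *\<^sub>R vector_derivative \<gamma> (at z) = vector_derivative \<gamma> (at z)"
          using eventually_nhds_in_open[OF _ s] by (auto elim!: eventually_mono simp: I)
        ultimately show ?thesis by (simp only: isCont_cong)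
      qed
      then show ?thesis using C by (intro exI[of _ "C \<union> {0,1}"]) (auto simp: countable_finite)
    next
      assume "infinite_contour (I, \<gamma>)"
      then have I: "I = UNIV" and "\<And>a b. \<gamma> piecewise_C1_differentiable_on {a..b}"
        by (auto simp: infinite_contour_def)
      then have "\<forall>n::nat. \<exists>C. finite C \<and> (\<forall>s\<in>{-real n..real n} - C. isCont (\<lambda>s. vector_derivative \<gamma> (at s)) s)"
        using key by blast
      then obtain C where C: "\<And>n::nat. finite (C n)"
        "\<And>n s. s\<in>{-real n..real n} - C n \<Longrightarrow> isCont (\<lambda>s. vector_derivative \<gamma> (at s)) s"
        by metis
      have "isCont (\<lambda>s. vector_derivative \<gamma> (at s)) s" if "s \<notin> (\<Union>n. C n)" for s
      proof -
        obtain n where "\<bar>s\<bar> \<le> real n" using real_arch_simple by blast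
        then show ?thesis using that by (intro C(2)[of s n]) auto
      qed
      then show ?thesis using C(1) I
        by (intro exI[of _ "\<Union>n. C n"]) (auto simp: countable_finite)
    qed
  qed
  then obtain C where C: "countable C" "\<And>s. s \<in> I - C \<Longrightarrow> isCont (\<lambda>s. indicator I s *\<^sub>R vector_derivative \<gamma> (at s)) s"
    by blast
  show "(\<lambda>s. indicator I s *\<^sub>R vector_derivative \<gamma> (at s)) \<in> borel_measurable borel"
  proof -
    have "continuous_on (I - C) (\<lambda>s. indicator I s *\<^sub>R vector_derivative \<gamma> (at s))"
      using C(2) by (simp add: continuous_at_imp_continuous_on)
    then have 1: "(\<lambda>s. indicator (I - C) s *\<^sub>R (indicator I s *\<^sub>R vector_derivative \<gamma> (at s))) \<in> borel_measurable borel"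
    proof (rule borel_measurable_continuous_on_indicator[rotated])
      have "C \<in> sets borel" by (rule sets.countable[OF _ C(1)]) simp
      then show "I - C \<in> sets borel" using I by (rule sets.Diff[rotated])
    qed
    show ?thesis
      by (rule measurable_discrete_difference[OF 1 C(1)]) (auto simp: indicator_def)
  qed
  show "continuous_on I \<gamma>"
  proof (cases "I = UNIV")
    case False
    then show ?thesis using assms by (auto simp: closed_contour_def infinite_contour_def valid_path_def piecewise_C1_differentiable_on_def)
  next
    case True
    have "\<not> closed_contour (I, \<gamma>)"
    proof
      assume "closed_contour (I, \<gamma>)"
      then have "(2::real) \<in> {0..1}" using True by (auto simp: closed_contour_def)
      then show False by simp
    qed
    then have inf: "infinite_contour (I, \<gamma>)" using assms by simp
    have "isCont \<gamma> s" for s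
    proof -
      have "continuous_on {s-1..s+1} \<gamma>" using inf by (auto simp: infinite_contour_def piecewise_C1_differentiable_on_def)
      then have "continuous_on {s-1<..<s+1} \<gamma>" by (rule continuous_on_subset) auto
      then have "\<forall>z\<in>{s-1<..<s+1}. isCont \<gamma> z" by (simp only: continuous_on_eq_continuous_at open_greaterThanLessThan)
      then show ?thesis by simp
    qed
    then show ?thesis by (simp add: continuous_at_imp_continuous_on)
  qed
qed

lemma emeasure_arclength:
  assumes "contour_system \<Gamma>" and A: "A \<in> sets (restrict_space borel (carrier_of \<Gamma>))"
  shows "emeasure (arclength \<Gamma>) A = (\<Sum>(I, \<gamma>)\<in>\<Gamma>.
     \<integral>\<^sup>+ s. ennreal (norm (vector_derivative \<gamma> (at s))) * indicator {s\<in>I. \<gamma> s \<in> A} s \<partial>lborel)"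
proof -
  let ?\<Omega> = "carrier_of \<Gamma>" and ?B = "restrict_space borel (carrier_of \<Gamma>)"
  let ?n = "\<lambda>\<kappa>. density lborel (\<lambda>s. ennreal (norm (indicator (fst \<kappa>) s *\<^sub>R vector_derivative (snd \<kappa>) (at s))))"
  let ?\<nu> = "\<lambda>\<kappa>. distr (restrict_space (?n \<kappa>) (fst \<kappa>)) ?B (snd \<kappa>)"
  have con: "closed_contour \<kappa> \<or> infinite_contour \<kappa>" if "\<kappa> \<in> \<Gamma>" for \<kappa>
    using assms that by (auto simp: contour_system_def)
  have eq: "emeasure (?\<nu> \<kappa>) A = (\<integral>\<^sup>+ s. ennreal (norm (vector_derivative (snd \<kappa>) (at s))) * indicator {s\<in>fst \<kappa>. snd \<kappa> s \<in> A} s \<partial>lborel)"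
    if k: "\<kappa> \<in> \<Gamma>" and A: "A \<in> sets ?B" for \<kappa> A
  proof -
    obtain I \<gamma> where K: "\<kappa> = (I, \<gamma>)" by force
    note cb = contour_borel[OF con[OF k, unfolded K]]
    have sub: "\<gamma> ` I \<subseteq> ?\<Omega>" using k K by (auto simp: carrier_of_def contour_image_def intro!: bexI[of _ \<kappa>])
    have "\<gamma> \<in> measurable (restrict_space borel I) borel" using cb by (intro borel_measurable_continuous_on_restrict)
    then have m0: "\<gamma> \<in> measurable (restrict_space borel I) ?B" using sub
      by (intro measurable_restrict_space2) (auto simp: space_restrict_space)
    then have m: "\<gamma> \<in> measurable (restrict_space (?n \<kappa>) I) ?B"
      by (subst measurable_cong_sets[OF sets_restrict_space_cong refl]) auto
    have set0: "\<gamma> -` A \<inter> I \<in> sets (restrict_space borel I)"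
      using measurable_sets[OF m0 A] by (simp add: space_restrict_space)
    then have set: "\<gamma> -` A \<inter> I \<in> sets borel" using cb(1) by (auto simp: sets_restrict_space_iff)
    have "emeasure (?\<nu> \<kappa>) A = emeasure (restrict_space (?n \<kappa>) I) (\<gamma> -` A \<inter> I)"
      using m A by (simp add: emeasure_distr K space_restrict_space)
    also have "\<dots> = emeasure (?n \<kappa>) (\<gamma> -` A \<inter> I)"
      using cb(1) by (intro emeasure_restrict_space) auto
    also have "\<dots> = (\<integral>\<^sup>+s. ennreal (norm (indicator I s *\<^sub>R vector_derivative \<gamma> (at s))) * indicator (\<gamma> -` A \<inter> I) s \<partial>lborel)"
    proof (subst emeasure_density)
      show "(\<lambda>s. ennreal (norm (indicator (fst \<kappa>) s *\<^sub>R vector_derivative (snd \<kappa>) (at s)))) \<in> borel_measurable lborel"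
        using measurable_compose[OF measurable_compose[OF cb(3) borel_measurable_norm] measurable_ennreal] K
        by (simp del: norm_scaleR)
    qed (use set K in auto)
    also have "\<dots> = (\<integral>\<^sup>+ s. ennreal (norm (vector_derivative \<gamma> (at s))) * indicator {s\<in>I. \<gamma> s \<in> A} s \<partial>lborel)"
      by (intro nn_integral_cong) (auto simp: indicator_def)
    finally show ?thesis by (simp add: K)
  qed
  show ?thesis
    unfolding arclength_def
  proof (rule emeasure_measure_of_sigma)
    show "sigma_algebra ?\<Omega> (sets ?B)"
      using sets.sigma_algebra_axioms[of ?B] by (simp add: space_restrict_space)
    show "positive (sets ?B) (\<lambda>A. \<Sum>(I, \<gamma>)\<in>\<Gamma>. \<integral>\<^sup>+ s. ennreal (norm (vector_derivative \<gamma> (at s))) * indicator {s\<in>I. \<gamma> s \<in> A} s \<partial>lborel)"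
      by (auto simp: positive_def case_prod_unfold)
    show "countably_additive (sets ?B) (\<lambda>A. \<Sum>(I, \<gamma>)\<in>\<Gamma>. \<integral>\<^sup>+ s. ennreal (norm (vector_derivative \<gamma> (at s))) * indicator {s\<in>I. \<gamma> s \<in> A} s \<partial>lborel)"
    proof (rule countably_additiveI)
      fix F :: "nat \<Rightarrow> complex set"
      assume F: "range F \<subseteq> sets ?B" "disjoint_family F" "(\<Union>i. F i) \<in> sets ?B"
      have "(\<Sum>i. \<Sum>\<kappa>\<in>\<Gamma>. emeasure (?\<nu> \<kappa>) (F i)) = (\<Sum>\<kappa>\<in>\<Gamma>. \<Sum>i. emeasure (?\<nu> \<kappa>) (F i))"
        by (intro suminf_sum) auto
      also have "\<dots> = (\<Sum>\<kappa>\<in>\<Gamma>. emeasure (?\<nu> \<kappa>) (\<Union>i. F i))"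
        using F by (intro sum.cong suminf_emeasure) auto
      finally have fin: "(\<Sum>i. \<Sum>\<kappa>\<in>\<Gamma>. emeasure (?\<nu> \<kappa>) (F i)) = (\<Sum>\<kappa>\<in>\<Gamma>. emeasure (?\<nu> \<kappa>) (\<Union>i. F i))" .
      have e: "(\<Sum>\<kappa>\<in>\<Gamma>. emeasure (?\<nu> \<kappa>) B) = (\<Sum>(I, \<gamma>)\<in>\<Gamma>. \<integral>\<^sup>+ s. ennreal (norm (vector_derivative \<gamma> (at s))) * indicator {s\<in>I. \<gamma> s \<in> B} s \<partial>lborel)"
        if "B \<in> sets ?B" for B
        unfolding case_prod_unfold by (rule sum.cong[OF refl eq[OF _ that]])
      show "(\<Sum>i. \<Sum>(I, \<gamma>)\<in>\<Gamma>. \<integral>\<^sup>+ s. ennreal (norm (vector_derivative \<gamma> (at s))) * indicator {s\<in>I. \<gamma> s \<in> F i} s \<partial>lborel)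
        = (\<Sum>(I, \<gamma>)\<in>\<Gamma>. \<integral>\<^sup>+ s. ennreal (norm (vector_derivative \<gamma> (at s))) * indicator {s\<in>I. \<gamma> s \<in> (\<Union>i. F i)} s \<partial>lborel)"
        by (rule fin[unfolded e[OF F(3)] e[OF range_subsetD[OF F(1)]]])
    qed
    show "A \<in> sets ?B" by (rule A)
  qed
qed

definition dz_integrable :: "contour set \<Rightarrow> (complex \<Rightarrow> complex) \<Rightarrow> bool" where
  "dz_integrable \<Gamma> \<phi> \<longleftrightarrow>
     (\<forall>(I, \<gamma>)\<in>\<Gamma>. set_integrable lborel I (\<lambda>s. \<phi> (\<gamma> s) * vector_derivative \<gamma> (at s)))"

definition dz_integral :: "contour set \<Rightarrow> (complex \<Rightarrow> complex) \<Rightarrow> complex" where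
  "dz_integral \<Gamma> \<phi> =
     (\<Sum>(I, \<gamma>)\<in>\<Gamma>. LINT s:I|lborel. \<phi> (\<gamma> s) * vector_derivative \<gamma> (at s))"

section \<open>Function spaces and integral operators\<close>

text \<open>
  Elements of \<open>L\<^sup>2(\<Omega>)\<close> are represented by functions, identified when they agree almost
  everywhere; values outside \<open>\<Omega>\<close> are irrelevant.
\<close>

definition L2 :: "contour set \<Rightarrow> (complex \<Rightarrow> complex) set" where
  "L2 \<Gamma> = {\<phi> \<in> borel_measurable (arclength \<Gamma>). integrable (arclength \<Gamma>) (\<lambda>z. (norm (\<phi> z))\<^sup>2)}"

definition L2_norm :: "contour set \<Rightarrow> (complex \<Rightarrow> complex) \<Rightarrow> real" where
  "L2_norm \<Gamma> \<phi> = sqrt (\<integral>z. (norm (\<phi> z))\<^sup>2 \<partial>arclength \<Gamma>)"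

definition Linf :: "contour set \<Rightarrow> (complex \<Rightarrow> complex) set" where
  "Linf \<Gamma> = {\<phi> \<in> borel_measurable (arclength \<Gamma>). \<exists>K. AE z in arclength \<Gamma>. norm (\<phi> z) \<le> K}"

definition int_op ::
  "contour set \<Rightarrow> (complex \<Rightarrow> complex \<Rightarrow> complex) \<Rightarrow> (complex \<Rightarrow> complex) \<Rightarrow> complex \<Rightarrow> complex" where
  "int_op \<Gamma> K \<phi> u = dz_integral \<Gamma> (\<lambda>v. K u v * \<phi> v)"

definition bounded_on_L2 ::
  "contour set \<Rightarrow> ((complex \<Rightarrow> complex) \<Rightarrow> complex \<Rightarrow> complex) \<Rightarrow> bool" where
  "bounded_on_L2 \<Gamma> T \<longleftrightarrow>
     (\<forall>\<phi>\<in>L2 \<Gamma>. T \<phi> \<in> L2 \<Gamma>) \<and> (\<exists>B. \<forall>\<phi>\<in>L2 \<Gamma>. L2_norm \<Gamma> (T \<phi>) \<le> B * L2_norm \<Gamma> \<phi>)"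

definition bounded_integral_operator ::
  "contour set \<Rightarrow> (complex \<Rightarrow> complex \<Rightarrow> complex) \<Rightarrow> bool" where
  "bounded_integral_operator \<Gamma> K \<longleftrightarrow>
     (\<forall>\<phi>\<in>L2 \<Gamma>. AE u in arclength \<Gamma>. dz_integrable \<Gamma> (\<lambda>v. K u v * \<phi> v)) \<and>
     bounded_on_L2 \<Gamma> (int_op \<Gamma> K)"

text \<open>
  \<open>R\<close> is a bounded two-sided inverse of \<open>1 - H\<close> on \<open>L\<^sup>2(\<Omega>)\<close>. Such an \<open>R\<close> is unique up to
  equality almost everywhere (and hence linear up to it), so the choice below is harmless.
\<close>

definition is_inverse_one_minus ::
  "contour set \<Rightarrow> (complex \<Rightarrow> complex \<Rightarrow> complex) \<Rightarrow>
   ((complex \<Rightarrow> complex) \<Rightarrow> complex \<Rightarrow> complex) \<Rightarrow> bool" where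
  "is_inverse_one_minus \<Gamma> K R \<longleftrightarrow> bounded_on_L2 \<Gamma> R \<and>
     (\<forall>\<phi>\<in>L2 \<Gamma>. AE u in arclength \<Gamma>. R (\<lambda>v. \<phi> v - int_op \<Gamma> K \<phi> v) u = \<phi> u) \<and>
     (\<forall>\<phi>\<in>L2 \<Gamma>. AE u in arclength \<Gamma>. R \<phi> u - int_op \<Gamma> K (R \<phi>) u = \<phi> u)"

definition one_minus_invertible ::
  "contour set \<Rightarrow> (complex \<Rightarrow> complex \<Rightarrow> complex) \<Rightarrow> bool" where
  "one_minus_invertible \<Gamma> K \<longleftrightarrow> (\<exists>R. is_inverse_one_minus \<Gamma> K R)"

definition inverse_one_minus ::
  "contour set \<Rightarrow> (complex \<Rightarrow> complex \<Rightarrow> complex) \<Rightarrow> (complex \<Rightarrow> complex) \<Rightarrow> complex \<Rightarrow> complex" where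
  "inverse_one_minus \<Gamma> K = (SOME R. is_inverse_one_minus \<Gamma> K R)"

section \<open>Strongly cubic integrable operators\<close>

text \<open>
  The index set \<open>{1, \<dots>, m}\<close> is the finite type \<open>'m\<close>, and \<open>{1, \<dots>, m + 1}\<close> is \<open>'m option\<close>, with
  \<open>None\<close> in the role of \<open>m + 1\<close>. A parameter is a triple \<open>(x, y, t)\<close>.
\<close>

type_synonym 'm params = "(real^'m) \<times> (real^'m) \<times> (real^'m)"

definition diag_mat :: "complex^'n \<Rightarrow> complex^'n^'n" where
  "diag_mat d = (\<chi> i j. if i = j then d $ i else 0)"

definition real_diag :: "real^'n \<Rightarrow> complex^'n^'n" where
  "real_diag d = diag_mat (\<chi> i. complex_of_real (d $ i))"

definition unit_diag :: "'n \<Rightarrow> complex^'n^'n" where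
  "unit_diag k = (\<chi> i j. if i = k \<and> j = k then 1 else 0)"

definition commutator :: "complex^'n^'n \<Rightarrow> complex^'n^'n \<Rightarrow> complex^'n^'n" where
  "commutator A B = A ** B - B ** A"

definition cubic_exp :: "'m::finite params \<Rightarrow> 'm \<Rightarrow> complex \<Rightarrow> complex" where
  "cubic_exp = (\<lambda>(x, y, t) j z. exp (complex_of_real (t $ j) * z ^ 3 +
     complex_of_real (y $ j) * z\<^sup>2 + complex_of_real (x $ j) * z))"

definition Delta :: "'m::finite params \<Rightarrow> complex \<Rightarrow> complex^('m option)^('m option)" where
  "Delta \<omega> z = diag_mat (\<chi> i. case i of Some j \<Rightarrow> cubic_exp \<omega> j z | None \<Rightarrow> 1)"

text \<open>
  The data are \<open>c\<close> (a scalar function for every parameter), \<open>U\<close> and \<open>V\<close>.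
\<close>

definition f_vec ::
  "('m::finite params \<Rightarrow> complex \<Rightarrow> complex) \<Rightarrow> (complex \<Rightarrow> complex^('m option)) \<Rightarrow>
   'm params \<Rightarrow> complex \<Rightarrow> complex^('m option)" where
  "f_vec c U \<omega> u = c \<omega> u *s (Delta \<omega> u *v U u)"

definition g_vec ::
  "('m::finite params \<Rightarrow> complex \<Rightarrow> complex) \<Rightarrow> (complex \<Rightarrow> complex^('m option)) \<Rightarrow>
   'm params \<Rightarrow> complex \<Rightarrow> complex^('m option)" where
  "g_vec c V \<omega> u = inverse (c \<omega> u) *s (matrix_inv (Delta \<omega> u) *v V u)"

definition H_kernel ::
  "('m::finite params \<Rightarrow> complex \<Rightarrow> complex) \<Rightarrow> (complex \<Rightarrow> complex^('m option)) \<Rightarrow>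
   (complex \<Rightarrow> complex^('m option)) \<Rightarrow> 'm params \<Rightarrow> complex \<Rightarrow> complex \<Rightarrow> complex" where
  "H_kernel c U V \<omega> u v =
     (if u = v then 0 else scalar_product (f_vec c U \<omega> u) (g_vec c V \<omega> v) / (u - v))"

text \<open>
  The operator is required to be of the strongly cubic type at the given parameter only. For
  contours extending to infinity, membership of \<open>f\<close> and \<open>g\<close> in \<open>L\<^sup>2\<close> typically holds only for
  some parameters.
\<close>

definition strongly_cubic_integrable ::
  "contour set \<Rightarrow> ('m::finite params \<Rightarrow> complex \<Rightarrow> complex) \<Rightarrow> (complex \<Rightarrow> complex^('m option)) \<Rightarrow>
   (complex \<Rightarrow> complex^('m option)) \<Rightarrow> 'm params \<Rightarrow> bool" where
  "strongly_cubic_integrable \<Gamma> c U V \<omega> \<longleftrightarrow>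
     (\<forall>C\<in>components (carrier_of \<Gamma>). U constant_on C \<and> V constant_on C) \<and>
     (\<forall>u\<in>carrier_of \<Gamma>. \<forall>i. scalar_product (U u) (unit_diag i *v V u) = 0) \<and>
     (\<forall>u\<in>carrier_of \<Gamma>. c \<omega> u \<noteq> 0) \<and>
     (\<forall>i. (\<lambda>u. f_vec c U \<omega> u $ i) \<in> L2 \<Gamma> \<inter> Linf \<Gamma>) \<and>
     (\<forall>i. (\<lambda>u. g_vec c V \<omega> u $ i) \<in> L2 \<Gamma> \<inter> Linf \<Gamma>) \<and>
     bounded_integral_operator \<Gamma> (H_kernel c U V \<omega>)"

definition Phi1 ::
  "contour set \<Rightarrow> ('m::finite params \<Rightarrow> complex \<Rightarrow> complex) \<Rightarrow> (complex \<Rightarrow> complex^('m option)) \<Rightarrow>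
   (complex \<Rightarrow> complex^('m option)) \<Rightarrow> 'm params \<Rightarrow> complex^('m option)^('m option)" where
  "Phi1 \<Gamma> c U V \<omega> = (\<chi> i j. dz_integral \<Gamma> (\<lambda>s.
     inverse_one_minus \<Gamma> (H_kernel c U V \<omega>) (\<lambda>u. f_vec c U \<omega> u $ i) s * g_vec c V \<omega> s $ j))"

definition block_q :: "complex^('m::finite option)^('m option) \<Rightarrow> complex^'m^'m" where
  "block_q M = (\<chi> i j. M $ Some i $ Some j)"

definition block_p :: "complex^('m::finite option)^('m option) \<Rightarrow> complex^1^'m" where
  "block_p M = (\<chi> i j. M $ Some i $ None)"

definition block_r :: "complex^('m::finite option)^('m option) \<Rightarrow> complex^'m^1" where
  "block_r M = (\<chi> i j. M $ None $ Some j)"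

section \<open>Derivatives with respect to \<open>x\<close>\<close>

definition partial_x ::
  "'m::finite \<Rightarrow> ('m params \<Rightarrow> 'a::real_normed_vector) \<Rightarrow> 'm params \<Rightarrow> 'a" where
  "partial_x k F = (\<lambda>(x, y, t). vector_derivative (\<lambda>h. F (x + h *\<^sub>R axis k 1, y, t)) (at 0))"

definition has_partial_x ::
  "'m::finite \<Rightarrow> ('m params \<Rightarrow> 'a::real_normed_vector) \<Rightarrow> 'm params \<Rightarrow> bool" where
  "has_partial_x k F = (\<lambda>(x, y, t). (\<lambda>h. F (x + h *\<^sub>R axis k 1, y, t)) differentiable (at 0))"

text \<open>
  All first and second order partial derivatives in \<open>x\<close> exist, so that
  \<^const>\<open>vector_derivative\<close> in \<^const>\<open>partial_x\<close> is a genuine derivative.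
\<close>

definition twice_partial_x :: "('m::finite params \<Rightarrow> 'a::real_normed_vector) \<Rightarrow> 'm params \<Rightarrow> bool" where
  "twice_partial_x F \<omega> \<longleftrightarrow>
     (\<forall>k. has_partial_x k F \<omega>) \<and> (\<forall>k l. has_partial_x l (partial_x k F) \<omega>)"

text \<open>The operators \<open>\<Sum>\<^sub>k t\<^sub>k \<partial>\<^sub>x\<^sub>k\<close> and \<open>\<Sum>\<^sub>k \<partial>\<^sub>x\<^sub>k\<close>.\<close>

definition D_t :: "('m::finite params \<Rightarrow> 'a::real_normed_vector) \<Rightarrow> 'm params \<Rightarrow> 'a" where
  "D_t F = (\<lambda>(x, y, t). \<Sum>k\<in>UNIV. (t $ k) *\<^sub>R partial_x k F (x, y, t))"

definition D_x :: "('m::finite params \<Rightarrow> 'a::real_normed_vector) \<Rightarrow> 'm params \<Rightarrow> 'a" where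
  "D_x F \<omega> = (\<Sum>k\<in>UNIV. partial_x k F \<omega>)"

end

theory Submission
  imports Defs "HOL-Complex_Analysis.Cauchy_Integral_Formula" "HOL-Real_Asymp.Real_Asymp"
begin

text \<open>
  Without the gauge factor \<open>c\<close>, row \<open>a\<close> of \<open>(1 - H)\<^sup>-\<^sup>1 f\<close> is a function \<open>\<eta>\<^sub>a\<close> with
  \<open>\<eta>\<^sub>a(u) = \<Sum>\<^sub>i F\<^sub>i(u) (\<delta>\<^sub>a\<^sub>i + \<integral> G\<^sub>i(v) \<eta>\<^sub>a(v) / (u - v) dv)\<close>, where \<open>F = \<Delta> U\<close> and \<open>G = \<Delta>\<^sup>-\<^sup>1 V\<close>. Since \<open>U\<close> and \<open>V\<close> are
  constant on contours with \<open>U\<^sub>i V\<^sub>i = 0\<close>, the equation continues \<open>\<eta>\<^sub>a\<close> holomorphically across its contour. Let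
  \<open>M\<^sub>n = (\<integral> v\<^sup>n \<eta>\<^sub>a(v) G\<^sub>j(v) dv)\<^sub>a\<^sub>j\<close>, so \<open>\<Phi>\<^sub>1 = M\<^sub>0\<close>, and let \<open>E\<^sub>k\<close> be the diagonal matrix units. Two facts carry the proof:
  \<^item> the derivative \<open>\<eta>\<^sub>a'\<close> is a combination of the \<open>\<eta>\<^sub>b\<close> with coefficients quadratic in \<open>u\<close>, because the difference
    solves the homogeneous equation; integrating by parts gives a linear relation between \<open>M\<^sub>0\<close>, \<open>M\<^sub>1\<close> and \<open>M\<^sub>2\<close>;
  \<^item> \<open>\<partial>M\<^sub>n / \<partial>x\<^sub>k = [E\<^sub>k, M\<^sub>n\<^sub>+\<^sub>1] + [M\<^sub>0, E\<^sub>k] M\<^sub>n\<close>, because the solution for a shifted \<open>x\<^sub>k\<close> can be built from the \<open>\<eta>\<^sub>b\<close>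
    by a Fredholm equation with a small kernel.

  Eliminating \<open>M\<^sub>1\<close> and \<open>M\<^sub>2\<close> gives a second order equation for \<open>\<Phi>\<^sub>1\<close>, and the claims are its blocks. The analytic
  input is that on an open set of parameters \<open>F\<^sub>i G\<^sub>j\<close> is integrable with an exponential weight. This bounds the
  solutions by a polynomial times \<open>\<Sum>\<^sub>i \<bar>F\<^sub>i\<bar>\<close>, which justifies all integrations, and uniqueness follows from the
  invertibility of \<open>1 - H\<close> by a cutoff argument.
\<close>

section \<open>Cauchy integrals over arcs in a disc\<close>

text \<open>The gauge factor \<open>c\<close> may depend on the parameters in any way, so
  differentiability of \<open>Phi1\<close> cannot come from that of a family of operators. The
  solution at a neighbouring parameter is written down explicitly and identified by uniqueness,
  which must therefore hold in a class larger than L2: of the candidates one knows only that their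
  products with \<open>G\<close> are integrable. The growth bound is the main obstacle. Contours
  that extend to infinity may approach each other arbitrarily fast, so no distance estimate controls
  the Cauchy integrals, although they are never singular. What helps is that the densities continue
  holomorphically: arcs inside a small disc can be pushed to its boundary circle. The number of arcs
  is controlled by length and length by the exponential weight, because on discs of radius
  comparable to \<open>1 / (1 + cmod z)\<^sup>2\<close> all exponentials are constant up to a factor
  2. The push needs a bound of the density on a full disc, not only on the contour, and this is what
  the induction over the contours supplies.\<close>

lemma has_contour_integral_affine_reparam:
  fixes \<gamma> :: "real \<Rightarrow> complex"
  assumes "a < b"
    and "(f has_contour_integral i) (\<lambda>x. \<gamma> (a + (b - a) * x))"
    and diff: "finite S" "\<And>s. s \<in> {a..b} - S \<Longrightarrow> \<gamma> differentiable at s"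
  shows "((\<lambda>s. f (\<gamma> s) * vector_derivative \<gamma> (at s)) has_integral i) {a..b}"
proof -
  define g where "g = (\<lambda>x. \<gamma> (a + (b - a) * x))"
  define S' where "S' = (\<lambda>s. (s - a) / (b - a)) ` S"
  have fin: "finite S'" using diff(1) by (simp add: S'_def)
  have vd: "vector_derivative g (at x) = (b - a) *\<^sub>R vector_derivative \<gamma> (at (a + (b - a) * x))"
    if x: "x \<in> {0..1} - S'" for x
  proof -
    have "a + (b - a) * x \<notin> S"
      using x \<open>a < b\<close> by (auto simp: S'_def image_iff field_simps)
    moreover have "a + (b - a) * x \<in> {a..b}"
    proof -
      have "a + (b - a) * x \<le> a + (b - a) * 1" using x \<open>a < b\<close> by (intro add_left_mono mult_left_mono) auto
      moreover have "0 \<le> (b - a) * x" using x \<open>a < b\<close> by simp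
      ultimately show ?thesis by simp
    qed
    ultimately have "\<gamma> differentiable at (a + (b - a) * x)" using diff(2) by auto
    then have "(\<gamma> has_vector_derivative vector_derivative \<gamma> (at (a + (b - a) * x))) (at (a + (b - a) * x))"
      by (simp add: vector_derivative_works)
    moreover have "((\<lambda>x. a + (b - a) * x) has_vector_derivative (b - a)) (at x)"
      by (auto intro!: derivative_eq_intros simp flip: has_real_derivative_iff_has_vector_derivative)
    ultimately have "(g has_vector_derivative (b - a) *\<^sub>R vector_derivative \<gamma> (at (a + (b - a) * x))) (at x)"
      using vector_diff_chain_at[of "\<lambda>x. a + (b - a) * x" "b - a" x \<gamma>] by (simp add: g_def o_def)
    then show ?thesis by (rule vector_derivative_at)
  qed
  have "((\<lambda>x. f (g x) * vector_derivative g (at x)) has_integral i) {0..1}"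
    using assms(2) by (simp add: has_contour_integral g_def)
  then have "((\<lambda>x. f (g x) * ((b - a) *\<^sub>R vector_derivative \<gamma> (at (a + (b - a) * x)))) has_integral i) {0..1}"
    by (rule has_integral_spike_finite[OF fin, rotated]) (simp add: vd)
  then have "((\<lambda>x. (b - a) *\<^sub>R (f (\<gamma> ((b - a) * x + a)) * vector_derivative \<gamma> (at ((b - a) * x + a)))) has_integral i) (cbox 0 1)"
    by (simp add: g_def mult_ac add_ac scaleR_conv_of_real)
  then have "((\<lambda>x. (f (\<gamma> ((b - a) * x + a)) * vector_derivative \<gamma> (at ((b - a) * x + a)))) has_integral (inverse (b-a)) *\<^sub>R i) (cbox 0 1)"
    using \<open>a < b\<close> by (auto dest: has_integral_cmul[of _ _ _ "inverse (b - a)"])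
  then have "((\<lambda>x. (f (\<gamma> ((b - a) * ((1 / (b - a)) * x + - (a / (b - a))) + a)) * vector_derivative \<gamma> (at ((b - a) * ((1 / (b - a)) * x + - (a / (b - a))) + a))))
      has_integral (1 / \<bar>1 / (b - a)\<bar> ^ DIM(real)) *\<^sub>R (inverse (b-a)) *\<^sub>R i) ((\<lambda>x. (1 / (1 / (b - a))) *\<^sub>R x + - ((1 / (1 / (b - a))) *\<^sub>R - (a / (b - a)))) ` cbox 0 1)"
    using \<open>a < b\<close> has_integral_affinity[of "\<lambda>x. f (\<gamma> ((b - a) * x + a)) * vector_derivative \<gamma> (at ((b - a) * x + a))"
        "inverse (b-a) *\<^sub>R i" 0 1 "1 / (b - a)" "- (a / (b - a))"] by simp
  moreover have "(\<lambda>x. (1 / (1 / (b - a))) *\<^sub>R x + - ((1 / (1 / (b - a))) *\<^sub>R - (a / (b - a)))) ` cbox 0 1 = {a..b}"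
  proof -
    have "(\<lambda>x. (1 / (1 / (b - a))) *\<^sub>R x + - ((1 / (1 / (b - a))) *\<^sub>R - (a / (b - a)))) = (\<lambda>x. (b - a) * x + a)"
      using \<open>a < b\<close> by (auto simp: fun_eq_iff field_simps)
    then show ?thesis using \<open>a < b\<close> image_affinity_atLeastAtMost[of "b - a" a 0 1] by simp
  qed
  moreover have "(b - a) * ((1 / (b - a)) * x + - (a / (b - a))) + a = x" for x
    using \<open>a < b\<close> by (simp add: divide_simps)
  moreover have "(1 / \<bar>1 / (b - a)\<bar> ^ DIM(real)) *\<^sub>R (inverse (b-a)) *\<^sub>R i = i"
    using \<open>a < b\<close> by simp
  ultimately show ?thesis by (simp only:)
qed

text \<open>Holomorphy is differentiation under the integral sign. For \<open>u\<close> in the ball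
  of half the radius the denominator is at least \<open>\<rho> / 2\<close>, and the arc is shorter
  than \<open>2 * pi * \<rho>\<close>; this gives the constant \<open>4 * pi * M\<close>.\<close>

lemma contour_integral_circle_arc_holomorphic:
  assumes "0 < \<rho>" "continuous_on (sphere z0 \<rho>) H" "\<And>v. v \<in> sphere z0 \<rho> \<Longrightarrow> cmod (H v) \<le> M" "\<beta> < \<alpha>" "\<alpha> < \<beta> + 2 * pi"
  defines "k \<equiv> \<lambda>u. contour_integral (part_circlepath z0 \<rho> \<beta> \<alpha>) (\<lambda>w. H w / (w - u))"
  shows "k holomorphic_on ball z0 \<rho>"
    and "\<And>u. u \<in> ball z0 (\<rho> / 2) \<Longrightarrow> cmod (k u) \<le> 4 * pi * M"
    and "\<And>u. u \<in> ball z0 \<rho> \<Longrightarrow> (\<lambda>w. H w / (w - u)) contour_integrable_on part_circlepath z0 \<rho> \<beta> \<alpha>"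
proof -
  have sub: "path_image (part_circlepath z0 \<rho> \<beta> \<alpha>) \<subseteq> sphere z0 \<rho>"
    using assms(1) path_image_part_circlepath_subset'[of \<rho> z0 \<beta> \<alpha>] by simp
  have disj: "w \<noteq> u" if "u \<in> ball z0 \<rho>" "w \<in> sphere z0 \<rho>" for u w using that by auto
  show int: "(\<lambda>w. H w / (w - u)) contour_integrable_on part_circlepath z0 \<rho> \<beta> \<alpha>" if "u \<in> ball z0 \<rho>" for u
    using that sub disj
    by (intro contour_integrable_continuous_part_circlepath continuous_intros continuous_on_subset[OF assms(2)]) auto
  show "k holomorphic_on ball z0 \<rho>"
    unfolding holomorphic_on_def field_differentiable_def
  proof
    fix u assume u: "u \<in> ball z0 \<rho>"
    have "(k has_field_derivative (1 * contour_integral (part_circlepath z0 \<rho> \<beta> \<alpha>) (\<lambda>w. H w / (w - u) ^ Suc 1))) (at u)"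
    proof (rule Cauchy_next_derivative(2)[where S="ball z0 \<rho>" and B="\<rho> * (\<alpha> - \<beta>)" and k=1, simplified of_nat_1])
      show "continuous_on (path_image (part_circlepath z0 \<rho> \<beta> \<alpha>)) H"
        using continuous_on_subset[OF assms(2) sub] .
      show "cmod (vector_derivative (part_circlepath z0 \<rho> \<beta> \<alpha>) (at t)) \<le> \<rho> * (\<alpha> - \<beta>)" if "t \<in> {0..1}" for t
        using assms(1,4) by (simp add: vector_derivative_part_circlepath norm_mult flip: of_real_diff)
      show "((\<lambda>ua. H ua / (ua - w) ^ 1) has_contour_integral k w) (part_circlepath z0 \<rho> \<beta> \<alpha>)"
        if "w \<in> ball z0 \<rho> - path_image (part_circlepath z0 \<rho> \<beta> \<alpha>)" for w
        using int[of w] that by (simp add: k_def has_contour_integral_integral)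
      show "u \<in> ball z0 \<rho> - path_image (part_circlepath z0 \<rho> \<beta> \<alpha>)" using u sub disj by auto
    qed auto
    then show "\<exists>f'. (k has_field_derivative f') (at u within ball z0 \<rho>)"
      using has_field_derivative_at_within by blast
  qed
  show "cmod (k u) \<le> 4 * pi * M" if u: "u \<in> ball z0 (\<rho> / 2)" for u
  proof -
    have M: "0 \<le> M"
    proof -
      have "z0 + \<rho> \<in> sphere z0 \<rho>" using \<open>0 < \<rho>\<close> by (simp add: dist_norm)
      from assms(3)[OF this] show ?thesis using norm_ge_zero order_trans by blast
    qed
    have ub: "u \<in> ball z0 \<rho>" using u \<open>0 < \<rho>\<close> by auto
    have "cmod (k u) \<le> M / (\<rho> / 2) * \<rho> * (\<alpha> - \<beta>)"
    proof (rule has_contour_integral_bound_part_circlepath)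
      show "((\<lambda>w. H w / (w - u)) has_contour_integral k u) (part_circlepath z0 \<rho> \<beta> \<alpha>)"
        using int[OF ub] by (simp add: k_def has_contour_integral_integral)
      fix x assume "x \<in> path_image (part_circlepath z0 \<rho> \<beta> \<alpha>)"
      then have x: "x \<in> sphere z0 \<rho>" using sub by auto
      have "dist z0 x \<le> dist z0 u + dist u x" by (rule dist_triangle)
      then have "\<rho> / 2 \<le> cmod (x - u)" using x u by (simp add: dist_norm norm_minus_commute)
      then show "cmod (H x / (x - u)) \<le> M / (\<rho> / 2)"
        unfolding norm_divide using assms(3)[OF x] \<open>0 < \<rho>\<close> M by (intro frac_le) auto
    qed (use assms M in auto)
    also have "\<dots> = 2 * M * (\<alpha> - \<beta>)" using \<open>0 < \<rho>\<close> by simp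
    also have "\<dots> \<le> 2 * M * (2 * pi)" using assms M by (intro mult_left_mono) auto
    finally show ?thesis by (simp add: mult_ac)
  qed
qed

text \<open>Closing the arc by a piece of the circle gives a simple closed path inside the larger
  disc, where \<open>H\<close> is holomorphic. By Cauchy's formula the integral over the arc is
  \<open>2 * pi * \<i> * W' * H u\<close> minus the integral over the circular piece. The winding
  number is constant on the connected set \<open>C\<close> and has modulus at most 1, so both terms
  continue to the ball of half the radius, with the bound \<open>2 * pi * M + 4 * pi * M\<close>.
  The continuation \<open>k\<close> depends on the side of the arc on which \<open>C\<close>
  lies.\<close>

lemma arc_integral_analytic:
  fixes \<gamma> :: "real \<Rightarrow> complex"
  assumes "a < b" and inj: "inj_on \<gamma> {a..b}" and pc: "\<gamma> piecewise_C1_differentiable_on {a..b}"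
    and ends: "\<gamma> a \<in> sphere z0 \<rho>" "\<gamma> b \<in> sphere z0 \<rho>" and inside: "\<gamma> ` {a<..<b} \<subseteq> ball z0 \<rho>"
    and \<rho>: "0 < \<rho>" "\<rho> < \<rho>'" and H: "H holomorphic_on ball z0 \<rho>'" "\<And>v. v \<in> ball z0 \<rho>' \<Longrightarrow> cmod (H v) \<le> M"
    and C: "connected C" "C \<subseteq> ball z0 (\<rho> / 2) - \<gamma> ` {a..b}"
  obtains k where "k holomorphic_on ball z0 (\<rho> / 2)" "\<And>u. u \<in> ball z0 (\<rho> / 2) \<Longrightarrow> cmod (k u) \<le> 6 * pi * M"
    "\<And>u. u \<in> C \<Longrightarrow> ((\<lambda>s. H (\<gamma> s) / (\<gamma> s - u) * vector_derivative \<gamma> (at s)) has_integral k u) {a..b}"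
proof -
  define g where "g = (\<lambda>x. \<gamma> (a + (b - a) * x))"
  have aff: "(\<lambda>x. a + (b - a) * x) ` {0..1} = {a..b}"
    using \<open>a < b\<close> image_affinity_atLeastAtMost[of "b - a" a 0 1] by (simp add: add.commute)
  have aff': "(\<lambda>x. (b - a) * x + a) ` {0..1} = {a..b}"
    using \<open>a < b\<close> image_affinity_atLeastAtMost[of "b - a" a 0 1] by simp
  have pi_g: "path_image g = \<gamma> ` {a..b}"
    unfolding path_image_def g_def using aff image_image[of \<gamma> "\<lambda>x. a + (b - a) * x" "{0..1}"] by simp
  have vg: "valid_path g"
  proof -
    have "(\<gamma> \<circ> (\<lambda>x. (b - a) *\<^sub>R x + a)) piecewise_C1_differentiable_on {0..1}"
    proof (rule piecewise_C1_differentiable_compose)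
      show "(\<lambda>x. (b - a) *\<^sub>R x + a) piecewise_C1_differentiable_on {0..1}"
        by (auto simp: piecewise_C1_differentiable_on_def C1_differentiable_on_def
            intro!: continuous_intros exI[of _ "{}"] exI[of _ "\<lambda>_. b - a"] derivative_eq_intros 
            simp flip: has_real_derivative_iff_has_vector_derivative)
      show "\<gamma> piecewise_C1_differentiable_on (\<lambda>x. (b - a) *\<^sub>R x + a) ` {0..1}" using pc aff' by simp
      show "finite ({0..1} \<inter> (\<lambda>x. (b - a) *\<^sub>R x + a) -` {x})" for x
        using \<open>a < b\<close> finite_vimage_IntI[of "{x}" "\<lambda>x. (b - a) *\<^sub>R x + a" "{0..1}"]
        by (simp add: Int_commute inj_on_def)
    qed
    then show ?thesis by (simp add: valid_path_def g_def o_def add.commute)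
  qed
  have ag: "arc g"
  proof -
    have "inj_on g {0..1}"
      unfolding g_def
      by (rule comp_inj_on[of "\<lambda>x. a + (b - a) * x", unfolded o_def]) (use \<open>a < b\<close> aff inj in \<open>auto simp: inj_on_def\<close>)
    then show ?thesis using vg by (simp add: arc_def valid_path_imp_path)
  qed
  have gst: "pathstart g = \<gamma> a" "pathfinish g = \<gamma> b" by (simp_all add: g_def pathstart_def pathfinish_def)
  have "\<gamma> a \<noteq> \<gamma> b" using inj_onD[OF inj, of a b] \<open>a < b\<close> by auto
  have ang: "\<exists>\<theta>. w = z0 + \<rho> * exp (\<i> * \<theta>) \<and> - pi < \<theta> \<and> \<theta> \<le> pi" if "w \<in> sphere z0 \<rho>" for w
  proof (intro exI conjI)
    have "w - z0 \<noteq> 0" "cmod (w - z0) = \<rho>" using that \<rho> by (auto simp: dist_norm norm_minus_commute)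
    then show "w = z0 + \<rho> * exp (\<i> * Arg (w - z0))" using Arg_eq[of "w - z0"] by (simp add: algebra_simps)
  qed (auto simp: mpi_less_Arg Arg_le_pi)
  obtain \<theta>a :: real where ta: "\<gamma> a = z0 + \<rho> * exp (\<i> * \<theta>a)" "- pi < \<theta>a" "\<theta>a \<le> pi" using ang[OF ends(1)] by metis
  obtain \<beta> :: real where tb: "\<gamma> b = z0 + \<rho> * exp (\<i> * \<beta>)" "- pi < \<beta>" "\<beta> \<le> pi" using ang[OF ends(2)] by metis
  \<comment> \<open>The angle of \<open>\<gamma> a\<close> is moved into the open interval from
    \<open>\<beta>\<close> to \<open>\<beta> + 2 * pi\<close>, so that the circular piece from
    \<open>\<gamma> b\<close> back to \<open>\<gamma> a\<close> is less than a full turn and hence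
    injective.\<close>
  define \<alpha> where "\<alpha> = (if \<beta> < \<theta>a then \<theta>a else \<theta>a + 2 * pi)"
  have "\<theta>a \<noteq> \<beta>" using ta tb \<open>\<gamma> a \<noteq> \<gamma> b\<close> by auto
  then have al: "\<beta> < \<alpha>" "\<alpha> < \<beta> + 2 * pi" using ta tb by (auto simp: \<alpha>_def)
  have "exp (\<i> * complex_of_real \<alpha>) = exp (\<i> * \<theta>a)"
    by (simp add: \<alpha>_def distrib_left exp_add mult_ac)
  then have tal: "\<gamma> a = z0 + \<rho> * exp (\<i> * \<alpha>)" using ta by simp
  define cp where "cp = part_circlepath z0 \<rho> \<beta> \<alpha>"
  have cst: "pathstart cp = \<gamma> b" "pathfinish cp = \<gamma> a"
    using tb tal by (simp_all add: cp_def)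
  have acp: "arc cp" unfolding cp_def using \<rho> al by (intro arc_part_circlepath) auto
  have vcp: "valid_path cp" by (simp add: cp_def)
  have cps: "path_image cp \<subseteq> sphere z0 \<rho>"
    using \<rho> path_image_part_circlepath_subset'[of \<rho> z0 \<beta> \<alpha>] by (simp add: cp_def)
  have ab: "{a..b} = insert a (insert b {a<..<b})" using \<open>a < b\<close> by auto
  have "\<gamma> ` {a..b} \<inter> sphere z0 \<rho> \<subseteq> {\<gamma> a, \<gamma> b}" using inside unfolding ab by auto
  then have "path_image g \<inter> path_image cp \<subseteq> {pathstart g, pathstart cp}"
    using cps gst cst pi_g by auto
  then have sJ: "simple_path (g +++ cp)"
    by (intro simple_path_join_loop ag acp) (simp_all add: gst cst)
  have vJ: "valid_path (g +++ cp)" using vg vcp gst cst by (intro valid_path_join) auto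
  have cJ: "pathfinish (g +++ cp) = pathstart (g +++ cp)" using gst cst by simp
  have piJ: "path_image (g +++ cp) = \<gamma> ` {a..b} \<union> path_image cp"
    using gst cst pi_g by (subst path_image_join) auto
  have Jb: "path_image (g +++ cp) \<subseteq> ball z0 \<rho>'" using cps inside ends \<rho> unfolding piJ ab by auto
  have CJ: "C \<inter> path_image (g +++ cp) = {}" using C cps \<rho> unfolding piJ by fastforce
  have "winding_number (g +++ cp) constant_on C"
    using winding_number_constant[OF valid_path_imp_path[OF vJ] cJ C(1) CJ] .
  then obtain W where W: "\<And>u. u \<in> C \<Longrightarrow> winding_number (g +++ cp) u = W" by (auto simp: constant_on_def)
  \<comment> \<open>Nothing is known about \<open>W\<close> when \<open>C\<close> is empty; the
    value 0 keeps the bound \<open>nW\<close> valid in that case.\<close>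
  define W' where "W' = (if C = {} then 0 else W)"
  have W': "\<And>u. u \<in> C \<Longrightarrow> winding_number (g +++ cp) u = W'" using W by (auto simp: W'_def)
  have nW: "cmod W' \<le> 1"
  proof (cases "C = {}")
    case False
    then obtain u where u: "u \<in> C" by auto
    then have "W' \<in> {-1, 0, 1}" using simple_closed_path_winding_number_cases[OF sJ cJ, of u] CJ W'[OF u] by auto
    then show ?thesis by auto
  qed (simp add: W'_def)
  define kc where "kc = (\<lambda>u. contour_integral cp (\<lambda>w. H w / (w - u)))"
  have Hs: "continuous_on (sphere z0 \<rho>) H"
    by (rule continuous_on_subset[OF holomorphic_on_imp_continuous_on[OF H(1)]]) (use \<rho> in auto)
  have HM: "cmod (H v) \<le> M" if "v \<in> sphere z0 \<rho>" for v using that \<rho> H(2) by auto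
  have circ: "kc holomorphic_on ball z0 \<rho>" "\<And>u. u \<in> ball z0 (\<rho> / 2) \<Longrightarrow> cmod (kc u) \<le> 4 * pi * M"
    "\<And>u. u \<in> ball z0 \<rho> \<Longrightarrow> (\<lambda>w. H w / (w - u)) contour_integrable_on cp"
    using contour_integral_circle_arc_holomorphic[OF \<rho>(1) Hs HM al] unfolding kc_def cp_def by auto
  define k where "k = (\<lambda>u. 2 * pi * \<i> * W' * H u - kc u)"
  have M0: "0 \<le> M" using order_trans[OF norm_ge_zero H(2)[of z0]] \<rho> by auto
  show ?thesis
  proof (rule that[of k])
    have "H holomorphic_on ball z0 (\<rho> / 2)" "kc holomorphic_on ball z0 (\<rho> / 2)"
      using \<rho> by (auto intro!: holomorphic_on_subset[OF H(1)] holomorphic_on_subset[OF circ(1)])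
    then show "k holomorphic_on ball z0 (\<rho> / 2)" unfolding k_def by (intro holomorphic_intros)
    show "cmod (k u) \<le> 6 * pi * M" if u: "u \<in> ball z0 (\<rho> / 2)" for u
    proof -
      have "cmod (k u) \<le> 2 * pi * cmod W' * cmod (H u) + cmod (kc u)"
        unfolding k_def using norm_triangle_ineq4[of "2 * pi * \<i> * W' * H u" "kc u"] by (simp add: norm_mult)
      also have "\<dots> \<le> 2 * pi * 1 * M + 4 * pi * M"
        using u \<rho> nW H(2)[of u] circ(2)[OF u] M0 by (intro add_mono mult_mono) auto
      finally show ?thesis by (simp add: mult_ac)
    qed
    fix u assume u: "u \<in> C"
    then have ub: "u \<in> ball z0 \<rho>" "u \<in> ball z0 \<rho>'" using C \<rho> by auto
    have "((\<lambda>w. H w / (w - u)) has_contour_integral (2*pi * \<i> * winding_number (g +++ cp) u * H u)) (g +++ cp)"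
      using ub CJ u Jb
      by (intro Cauchy_integral_formula_convex_simple[OF convex_ball H(1) _ vJ _ cJ]) (auto simp: interior_open)
    then have J: "((\<lambda>w. H w / (w - u)) has_contour_integral (2*pi * \<i> * W' * H u)) (g +++ cp)" using W'[OF u] by simp
    then have "(\<lambda>w. H w / (w - u)) contour_integrable_on g"
      using contour_integrable_joinD1 vg has_contour_integral_integrable by blast
    then have g: "((\<lambda>w. H w / (w - u)) has_contour_integral contour_integral g (\<lambda>w. H w / (w - u))) g"
      by (rule has_contour_integral_integral)
    have cpi: "((\<lambda>w. H w / (w - u)) has_contour_integral kc u) cp"
      unfolding kc_def by (rule has_contour_integral_integral[OF circ(3)[OF ub(1)]])
    have "2*pi * \<i> * W' * H u = contour_integral g (\<lambda>w. H w / (w - u)) + kc u"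
      using has_contour_integral_unique[OF J has_contour_integral_join[OF g cpi vg vcp]] .
    then have gk: "((\<lambda>w. H w / (w - u)) has_contour_integral k u) g" using g by (simp add: k_def)
    obtain S where S: "finite S" "\<gamma> C1_differentiable_on ({a..b} - S)"
      using pc by (auto simp: piecewise_C1_differentiable_on_def)
    show "((\<lambda>s. H (\<gamma> s) / (\<gamma> s - u) * vector_derivative \<gamma> (at s)) has_integral k u) {a..b}"
      using has_contour_integral_affine_reparam[OF \<open>a < b\<close> gk[unfolded g_def] S(1)] S(2)
      by (auto simp: C1_differentiable_on_eq)
  qed
qed

lemma norm_integral_le:
  fixes f :: "'a \<Rightarrow> 'b :: {banach, second_countable_topology}"
  assumes "integrable M f" "integrable M g" "\<And>x. norm (f x) \<le> g x"
  shows "norm (integral\<^sup>L M f) \<le> integral\<^sup>L M g"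
proof -
  have "norm (integral\<^sup>L M f) \<le> (\<integral>x. norm (f x) \<partial>M)" by (rule integral_norm_bound)
  also have "\<dots> \<le> integral\<^sup>L M g" by (intro integral_mono integrable_norm assms)
  finally show ?thesis .
qed

lemma set_integral_subset_le:
  fixes f :: "'a \<Rightarrow> real"
  assumes "set_integrable M B f" "A \<in> sets M" "A \<subseteq> B" "\<And>x. 0 \<le> f x"
  shows "(LINT x:A|M. f x) \<le> (LINT x:B|M. f x)"
proof -
  have "set_integrable M A f" using assms set_integrable_subset by blast
  then show ?thesis
    using assms unfolding set_integrable_def set_lebesgue_integral_def
    by (intro integral_mono) (auto simp: indicator_def)
qed

text \<open>The distance condition concerns only parameters at which the density does not vanish, so
  \<open>z\<close> may lie on the path itself. For \<open>cmod h < d / 2\<close> the difference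
  quotient of \<open>1 / (z - \<gamma> s)\<close> differs from its limit by at most
  \<open>2 * cmod h / d ^ 3\<close>, uniformly in those parameters.\<close>

lemma Cauchy_transform_has_field_derivative:
  fixes f \<gamma> :: "'a \<Rightarrow> complex"
  assumes f: "integrable M f" and \<gamma>: "\<gamma> \<in> borel_measurable M" and "0 < d"
    and far: "\<And>s. f s \<noteq> 0 \<Longrightarrow> d \<le> cmod (z - \<gamma> s)"
  shows "integrable M (\<lambda>s. f s / (z - \<gamma> s))"
    and "cmod (\<integral>s. f s / (z - \<gamma> s) \<partial>M) \<le> (\<integral>s. cmod (f s) \<partial>M) / d"
    and "((\<lambda>w. \<integral>s. f s / (w - \<gamma> s) \<partial>M) has_field_derivative - (\<integral>s. f s / (z - \<gamma> s)\<^sup>2 \<partial>M)) (at z)"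
proof -
  have meas [measurable]: "f \<in> borel_measurable M" "\<gamma> \<in> borel_measurable M" using f \<gamma> by auto
  have int: "integrable M (\<lambda>s. f s / (w - \<gamma> s) ^ n)" if "cmod (w - z) \<le> d / 2" for w n
  proof (rule Bochner_Integration.integrable_bound[of _ "\<lambda>s. f s / (d / 2) ^ n"])
    show "AE s in M. cmod (f s / (w - \<gamma> s) ^ n) \<le> cmod (f s / (d / 2) ^ n)"
    proof (rule AE_I2)
      fix s
      show "cmod (f s / (w - \<gamma> s) ^ n) \<le> cmod (f s / (d / 2) ^ n)"
      proof (cases "f s = 0")
        case False
        have "cmod (z - \<gamma> s) \<le> cmod (w - \<gamma> s) + cmod (w - z)"
          using norm_triangle_ineq4[of "w - \<gamma> s" "w - z"] by simp
        then have "d / 2 \<le> cmod (w - \<gamma> s)" using far[OF False] that by linarith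
        then have "(d / 2) ^ n \<le> cmod (w - \<gamma> s) ^ n" using \<open>0 < d\<close> by (intro power_mono) auto
        moreover have "0 < (d / 2) ^ n" using \<open>0 < d\<close> by simp
        ultimately have "cmod (f s) / cmod (w - \<gamma> s) ^ n \<le> cmod (f s) / (d / 2) ^ n"
          by (intro divide_left_mono mult_pos_pos) auto
        then show ?thesis using \<open>0 < d\<close> by (simp add: norm_divide norm_power)
      qed simp
    qed
  qed (use f in auto)
  show i1: "integrable M (\<lambda>s. f s / (z - \<gamma> s))" using int[of z 1] \<open>0 < d\<close> by simp
  have "cmod (\<integral>s. f s / (z - \<gamma> s) \<partial>M) \<le> (\<integral>s. cmod (f s) / d \<partial>M)"
  proof (rule norm_integral_le[OF i1])
    show "cmod (f s / (z - \<gamma> s)) \<le> cmod (f s) / d" for s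
    proof (cases "f s = 0")
      case False
      then show ?thesis using far[OF False] \<open>0 < d\<close> by (auto simp: norm_divide intro!: divide_left_mono mult_pos_pos)
    qed simp
  qed (use f in auto)
  then show "cmod (\<integral>s. f s / (z - \<gamma> s) \<partial>M) \<le> (\<integral>s. cmod (f s) \<partial>M) / d" by simp
  let ?K = "2 / d ^ 3 * (\<integral>s. cmod (f s) \<partial>M)"
  have est: "cmod (((\<integral>s. f s / (z + h - \<gamma> s) \<partial>M) - (\<integral>s. f s / (z - \<gamma> s) \<partial>M)) / h - - (\<integral>s. f s / (z - \<gamma> s)\<^sup>2 \<partial>M)) \<le> cmod h * ?K"
    if h: "h \<noteq> 0" "cmod h < d / 2" for h
  proof -
    have i2: "integrable M (\<lambda>s. f s / (z + h - \<gamma> s))" using int[of "z + h" 1] h by simp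
    have i3: "integrable M (\<lambda>s. f s / (z - \<gamma> s)\<^sup>2)" using int[of z 2] \<open>0 < d\<close> by simp
    have pt: "cmod ((f s / (z + h - \<gamma> s) - f s / (z - \<gamma> s)) / h + f s / (z - \<gamma> s)\<^sup>2) \<le> cmod h * (2 / d ^ 3 * cmod (f s))" for s
    proof (cases "f s = 0")
      case False
      let ?a = "z - \<gamma> s"
      have a: "d \<le> cmod ?a" using far[OF False] .
      have "cmod ?a \<le> cmod (?a + h) + cmod h" using norm_triangle_ineq4[of "?a + h" h] by simp
      then have b: "d / 2 \<le> cmod (?a + h)" using a h by linarith
      have nz: "?a \<noteq> 0" "?a + h \<noteq> 0" using a b \<open>0 < d\<close> by auto
      have "(f s / (?a + h) - f s / ?a) / h + f s / ?a\<^sup>2 = h * f s / (?a\<^sup>2 * (?a + h))"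
        using nz h(1) by (simp add: divide_simps) (simp add: power2_eq_square algebra_simps)
      then have "cmod ((f s / (?a + h) - f s / ?a) / h + f s / ?a\<^sup>2) = cmod h * cmod (f s) / (cmod ?a ^ 2 * cmod (?a + h))"
        by (simp add: norm_divide norm_mult norm_power)
      also have "\<dots> \<le> cmod h * cmod (f s) / (d ^ 2 * (d / 2))"
        using a b \<open>0 < d\<close> nz by (intro divide_left_mono mult_mono power_mono mult_pos_pos) auto
      also have "\<dots> = cmod h * (2 / d ^ 3 * cmod (f s))"
        by (simp add: power2_eq_square power3_eq_cube)
      finally show ?thesis by (simp add: algebra_simps)
    qed simp
    have "((\<integral>s. f s / (z + h - \<gamma> s) \<partial>M) - (\<integral>s. f s / (z - \<gamma> s) \<partial>M)) / h - - (\<integral>s. f s / (z - \<gamma> s)\<^sup>2 \<partial>M)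
      = (\<integral>s. (f s / (z + h - \<gamma> s) - f s / (z - \<gamma> s)) / h + f s / (z - \<gamma> s)\<^sup>2 \<partial>M)"
      using i1 i2 i3 by simp
    also have "cmod \<dots> \<le> (\<integral>s. cmod h * (2 / d ^ 3 * cmod (f s)) \<partial>M)"
      using i1 i2 i3 f by (intro norm_integral_le pt) auto
    finally show ?thesis using f by simp
  qed
  show "((\<lambda>w. \<integral>s. f s / (w - \<gamma> s) \<partial>M) has_field_derivative - (\<integral>s. f s / (z - \<gamma> s)\<^sup>2 \<partial>M)) (at z)"
    unfolding DERIV_def LIM_zero_iff[of _ "- (\<integral>s. f s / (z - \<gamma> s)\<^sup>2 \<partial>M)", symmetric]
  proof (rule Lim_null_comparison)
    show "\<forall>\<^sub>F h in at 0. cmod (((\<integral>s. f s / (z + h - \<gamma> s) \<partial>M) - (\<integral>s. f s / (z - \<gamma> s) \<partial>M)) / h - - (\<integral>s. f s / (z - \<gamma> s)\<^sup>2 \<partial>M)) \<le> cmod h * ?K"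
      unfolding eventually_at using \<open>0 < d\<close> est by (intro exI[of _ "d / 2"]) auto
    show "((\<lambda>h. cmod h * ?K) \<longlongrightarrow> 0) (at 0)"
      by (rule tendsto_eq_intros refl tendsto_norm_zero tendsto_ident_at)+ simp
  qed
qed

text \<open>Meant for the set of parameters at which a path is inside an open disc: the end points
  of a component lie outside that set, so they are mapped to the boundary circle.\<close>

lemma component_of_open_real:
  fixes S :: "real set"
  assumes "open S" "bounded S" "A \<in> components S"
  obtains a b where "a < b" "A = {a<..<b}" "a \<notin> S" "b \<notin> S"
proof -
  have A: "open A" "connected A" "A \<noteq> {}" "A \<subseteq> S"
    using open_components[OF assms(1,3)] in_components_connected[OF assms(3)] in_components_nonempty[OF assms(3)]
      in_components_subset[OF assms(3)] by auto
  have "bounded A" using bounded_subset[OF assms(2) A(4)] .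
  then have bd: "bdd_below A" "bdd_above A" by (auto intro: bounded_imp_bdd_below bounded_imp_bdd_above)
  define a b where "a = Inf A" and "b = Sup A"
  have sub: "A \<subseteq> {a..b}" using bd by (auto simp: a_def b_def cInf_lower cSup_upper)
  have aA: "a \<notin> A"
  proof
    assume "a \<in> A"
    then obtain e where "0 < e" "ball a e \<subseteq> A" using A(1) open_contains_ball by blast
    then have "a - e / 2 \<in> A" by (auto simp: dist_norm)
    then show False using sub \<open>0 < e\<close> by auto
  qed
  have bA: "b \<notin> A"
  proof
    assume "b \<in> A"
    then obtain e where "0 < e" "ball b e \<subseteq> A" using A(1) open_contains_ball by blast
    then have "b + e / 2 \<in> A" by (auto simp: dist_norm)
    then show False using sub \<open>0 < e\<close> by auto
  qed
  have "x \<in> A" if "x \<in> {a<..<b}" for x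
  proof -
    have "\<exists>y\<in>A. y < x" "\<exists>z\<in>A. x < z"
      using that cInf_less_iff[OF A(3) bd(1), of x] less_cSup_iff[OF A(3) bd(2), of x] by (simp_all add: a_def b_def)
    then obtain y z where "y \<in> A" "y < x" "z \<in> A" "x < z" by blast
    then show ?thesis using A(2) by (meson connected_contains_Icc atLeastAtMost_iff less_imp_le subsetD)
  qed
  then have eq: "A = {a<..<b}" using sub aA bA by (force simp: less_le)
  then have ab: "a < b" using A(3) by auto
  have "a \<notin> S"
  proof
    assume "a \<in> S"
    then have "{a..<b} \<subseteq> S" using A(4) eq by force
    moreover have "connected {a..<b}" by simp
    moreover have "A \<inter> {a..<b} \<noteq> {}" using A(3) Int_absorb2[of A "{a..<b}"] eq by (simp add: subset_iff)
    ultimately have "{a..<b} \<subseteq> A" using components_maximal[OF assms(3)] by blast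
    then show False using ab aA by auto
  qed
  moreover have "b \<notin> S"
  proof
    assume "b \<in> S"
    then have "{a<..b} \<subseteq> S" using A(4) eq by force
    moreover have "connected {a<..b}" by simp
    moreover have "A \<inter> {a<..b} \<noteq> {}" using A(3) Int_absorb2[of A "{a<..b}"] eq by (simp add: subset_iff)
    ultimately have "{a<..b} \<subseteq> A" using components_maximal[OF assms(3)] by blast
    then show False using ab bA by auto
  qed
  ultimately show ?thesis using that ab eq by blast
qed

lemma dist_le_length:
  fixes \<gamma> :: "real \<Rightarrow> complex"
  assumes "a \<le> b" "\<gamma> piecewise_C1_differentiable_on {a..b}"
    and int: "set_integrable lborel {a..b} (\<lambda>s. vector_derivative \<gamma> (at s))"
  shows "cmod (\<gamma> b - \<gamma> a) \<le> (LINT s:{a..b}|lborel. cmod (vector_derivative \<gamma> (at s)))"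
proof -
  obtain S where S: "finite S" "\<gamma> C1_differentiable_on ({a..b} - S)" and c: "continuous_on {a..b} \<gamma>"
    using assms(2) by (auto simp: piecewise_C1_differentiable_on_def)
  have "((\<lambda>s. vector_derivative \<gamma> (at s)) has_integral (\<gamma> b - \<gamma> a)) {a..b}"
  proof (rule fundamental_theorem_of_calculus_interior_strong[OF S(1) assms(1)])
    show "(\<gamma> has_vector_derivative vector_derivative \<gamma> (at x)) (at x)" if "x \<in> {a<..<b} - S" for x
      using S(2) that by (auto simp: C1_differentiable_on_eq vector_derivative_works)
  qed (use c in auto)
  then have "\<gamma> b - \<gamma> a = (LINT s:{a..b}|lborel. vector_derivative \<gamma> (at s))"
    using set_borel_integral_eq_integral(2)[OF int] by (simp add: integral_unique)
  then show ?thesis using set_integral_norm_bound[OF int] by simp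
qed

lemma component_ends_on_sphere:
  fixes \<gamma> :: "real \<Rightarrow> complex"
  assumes cont: "continuous_on UNIV \<gamma>" and S: "S = \<gamma> -` ball z0 \<rho>" and \<rho>: "0 < \<rho>"
  and that: "a < b" "{a<..<b} \<in> components S" "a \<notin> S" "b \<notin> S"
  shows "\<gamma> a \<in> sphere z0 \<rho>" "\<gamma> b \<in> sphere z0 \<rho>" "\<gamma> ` {a<..<b} \<subseteq> ball z0 \<rho>"
proof -
  show im: "\<gamma> ` {a<..<b} \<subseteq> ball z0 \<rho>" using in_components_subset[OF that(2)] S by auto
  have cl: "closure {a<..<b} = {a..b}" using that(1) by simp
  have "\<gamma> ` closure {a<..<b} \<subseteq> closure (\<gamma> ` {a<..<b})"
    by (rule image_closure_subset[OF continuous_on_subset[OF cont]]) (auto intro: closure_subset[THEN subsetD])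
  also have "\<dots> \<subseteq> cball z0 \<rho>" using closure_mono[OF im] \<rho> by simp
  finally have "\<gamma> x \<in> cball z0 \<rho>" if "x \<in> {a..b}" for x using that unfolding cl by blast
  then have "\<gamma> a \<in> cball z0 \<rho>" "\<gamma> b \<in> cball z0 \<rho>" using that(1) by simp_all
  then show "\<gamma> a \<in> sphere z0 \<rho>" "\<gamma> b \<in> sphere z0 \<rho>" using that S by auto
qed

text \<open>The right end of the component is mapped to the circle of radius \<open>\<rho>\<close>,
  hence to distance at least \<open>\<rho> / 2\<close> from the visited point
  \<open>\<gamma> s\<close>. The portion of the component after \<open>s\<close> is already long
  enough.\<close>

lemma half_radius_le_length:
  fixes \<gamma> :: "real \<Rightarrow> complex"
  assumes pc: "\<And>a b. \<gamma> piecewise_C1_differentiable_on {a..b}"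
    and cont: "continuous_on UNIV \<gamma>" and S: "S = \<gamma> -` ball z0 \<rho>" "bounded S" and \<rho>: "0 < \<rho>"
    and len: "set_integrable lborel S (\<lambda>s. vector_derivative \<gamma> (at s))"
    and A: "A \<in> components S" and s: "s \<in> A" "\<gamma> s \<in> ball z0 (\<rho> / 2)"
  shows "\<rho> / 2 \<le> (LINT s:A|lborel. cmod (vector_derivative \<gamma> (at s)))"
proof -
  let ?d = "\<lambda>s. vector_derivative \<gamma> (at s)"
  have opS: "open S" using cont S(1) by (simp add: open_vimage continuous_on_eq_continuous_at)
  obtain a b where ab: "a < b" "A = {a<..<b}" "a \<notin> S" "b \<notin> S"
    using component_of_open_real[OF opS S(2) A] by metis
  have Ac: "{a<..<b} \<in> components S" using A ab by simp
  note e = component_ends_on_sphere[OF cont S(1) \<rho> ab(1) Ac ab(3,4)]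
  have "\<rho> / 2 \<le> dist (\<gamma> b) (\<gamma> s)" using e(2) s(2) dist_triangle[of z0 "\<gamma> b" "\<gamma> s"] by (auto simp: dist_commute)
  have il: "set_integrable lborel {a<..<b} ?d" using in_components_subset[OF Ac] by (intro set_integrable_subset[OF len]) auto
  have ic: "set_integrable lborel {s..b} ?d"
  proof -
    have "set_integrable lborel {s..<b} ?d" using s ab by (intro set_integrable_subset[OF il]) auto
    moreover have "set_integrable lborel {b} ?d"
    proof -
      have "(\<lambda>s. indicator {b} s *\<^sub>R ?d s) = (\<lambda>s. indicator {b} s *\<^sub>R ?d b)" by (auto simp: indicator_def)
      moreover have "integrable lborel (indicator {b} :: real \<Rightarrow> real)" by simp
      ultimately show ?thesis unfolding set_integrable_def using integrable_scaleR_left by metis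
    qed
    ultimately have "set_integrable lborel ({s..<b} \<union> {b}) ?d" by (intro set_integrable_Un) auto
    moreover have "{s..<b} \<union> {b} = {s..b}" using s ab by auto
    ultimately show ?thesis by simp
  qed
  have "cmod (\<gamma> b - \<gamma> s) \<le> (LINT s:{s..b}|lborel. cmod (?d s))"
    using s ab by (intro dist_le_length pc ic) auto
  also have "\<dots> = (LINT s:{s..<b}|lborel. cmod (?d s))"
    unfolding set_lebesgue_integral_def
    by (rule integral_discrete_difference[of "{b}"]) (auto simp: indicator_def)
  also have "\<dots> \<le> (LINT s:{a<..<b}|lborel. cmod (?d s))"
    using s ab by (intro set_integral_subset_le set_integrable_norm il) auto
  finally show ?thesis using \<open>\<rho> / 2 \<le> dist (\<gamma> b) (\<gamma> s)\<close> ab by (simp add: dist_norm)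
qed

text \<open>
  A component of the path that reaches the ball of half the radius has length at least \<open>\<rho> / 2\<close>, so there
  are at most \<open>2 * l / \<rho>\<close> of them; each such arc is pushed out to the circle of radius \<open>\<rho>\<close>.
\<close>

lemma integral_over_arcs_analytic:
  fixes \<gamma> :: "real \<Rightarrow> complex" and h :: "complex \<Rightarrow> complex"
  assumes inj: "inj \<gamma>" and pc: "\<And>a b. \<gamma> piecewise_C1_differentiable_on {a..b}"
    and cont: "continuous_on UNIV \<gamma>" and S: "S = \<gamma> -` ball z0 \<rho>" "bounded S"
    and \<rho>: "0 < \<rho>" "\<rho> < \<rho>'"
    and len: "set_integrable lborel S (\<lambda>s. vector_derivative \<gamma> (at s))"
      "(LINT s:S|lborel. cmod (vector_derivative \<gamma> (at s))) \<le> l"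
    and h: "integrable lborel (\<lambda>s. h (\<gamma> s) * vector_derivative \<gamma> (at s))"
      "(\<integral>s. cmod (h (\<gamma> s) * vector_derivative \<gamma> (at s)) \<partial>lborel) \<le> L"
    and loc: "\<And>A. A \<in> components S \<Longrightarrow> \<gamma> ` A \<inter> ball z0 (\<rho> / 2) \<noteq> {} \<Longrightarrow>
      \<exists>H. H holomorphic_on ball z0 \<rho>' \<and> (\<forall>v\<in>ball z0 \<rho>'. cmod (H v) \<le> M) \<and> (\<forall>s\<in>A. h (\<gamma> s) = H (\<gamma> s))"
    and C: "connected C" "C \<subseteq> ball z0 (\<rho> / 4) - range \<gamma>" and "0 \<le> M"
  obtains k where "k holomorphic_on ball z0 (\<rho> / 4)"
    "\<And>u. u \<in> ball z0 (\<rho> / 4) \<Longrightarrow> cmod (k u) \<le> 4 / \<rho> * L + l / \<rho> * (12 * pi * M)"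
    "\<And>u. u \<in> C \<Longrightarrow> (\<integral>s. h (\<gamma> s) * vector_derivative \<gamma> (at s) / (u - \<gamma> s) \<partial>lborel) = k u"
proof -
  let ?d = "\<lambda>s. vector_derivative \<gamma> (at s)"
  have opS: "open S" using cont S(1) by (simp add: open_vimage continuous_on_eq_continuous_at)
  define \<A> where "\<A> = {A \<in> components S. \<gamma> ` A \<inter> ball z0 (\<rho> / 2) \<noteq> {}}"
  have comp: "\<exists>a b. a < b \<and> A = {a<..<b} \<and> a \<notin> S \<and> b \<notin> S" if "A \<in> components S" for A
    using component_of_open_real[OF opS S(2) that] by metis
  have subS: "A \<subseteq> S" if "A \<in> components S" for A using that in_components_subset by blast
  note ends = component_ends_on_sphere[OF cont S(1) \<rho>(1)]
  have leb: "set_integrable lborel A ?d" if "A \<subseteq> S" "A \<in> sets borel" for A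
    using set_integrable_subset[OF len(1)] that by simp
  have long: "\<rho> / 2 \<le> (LINT s:A|lborel. cmod (?d s))" if A: "A \<in> \<A>" for A
  proof -
    obtain s where "s \<in> A" "\<gamma> s \<in> ball z0 (\<rho> / 2)" "A \<in> components S" using A by (auto simp: \<A>_def)
    then show ?thesis using half_radius_le_length[OF pc cont S \<rho>(1) len(1)] by blast
  qed
  have opA: "open A" if "A \<in> components S" for A using that opS open_components by blast
  have disj: "disjoint_family_on (\<lambda>A. A) \<F>" if "\<F> \<subseteq> \<A>" for \<F>
    using that components_nonoverlap[of _ S] by (force simp: disjoint_family_on_def \<A>_def)
  have count: "card \<F> * (\<rho> / 2) \<le> l" if F: "finite \<F>" "\<F> \<subseteq> \<A>" for \<F>
  proof -
    have "card \<F> * (\<rho> / 2) = (\<Sum>A\<in>\<F>. \<rho> / 2)" by simp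
    also have "\<dots> \<le> (\<Sum>A\<in>\<F>. LINT s:A|lborel. cmod (?d s))" using F long by (intro sum_mono) auto
    also have "\<dots> = (LINT s:(\<Union>A\<in>\<F>. A)|lborel. cmod (?d s))"
      using F subS opA disj[OF F(2)]
      by (intro set_integral_finite_Union[symmetric] set_integrable_norm leb) (auto simp: \<A>_def)
    also have "\<dots> \<le> (LINT s:S|lborel. cmod (?d s))"
    proof (intro set_integral_subset_le set_integrable_norm len)
      have "open (\<Union>A\<in>\<F>. A)" using F opA by (intro open_UN) (auto simp: \<A>_def)
      then show "(\<Union>A\<in>\<F>. A) \<in> sets lborel" by simp
    qed (use F subS in \<open>auto simp: \<A>_def\<close>)
    finally show ?thesis using len(2) by simp
  qed
  have finA: "finite \<A>"
  proof (rule ccontr)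
    assume "infinite \<A>"
    then obtain G where G: "G \<subseteq> \<A>" "finite G" "card G = Suc (nat \<lceil>l / (\<rho> / 2)\<rceil>)"
      using infinite_arbitrarily_large by blast
    have "real (card G) \<le> l / (\<rho> / 2)" using count[OF G(2,1)] \<rho> by (simp add: field_simps)
    then show False using G(3) by linarith
  qed
  have arc: "\<exists>k. k holomorphic_on ball z0 (\<rho> / 2) \<and> (\<forall>u\<in>ball z0 (\<rho> / 2). cmod (k u) \<le> 6 * pi * M) \<and>
     (\<forall>u\<in>C. set_integrable lborel A (\<lambda>s. h (\<gamma> s) * ?d s / (u - \<gamma> s)) \<and> (LINT s:A|lborel. h (\<gamma> s) * ?d s / (u - \<gamma> s)) = - k u)" if A: "A \<in> \<A>" for A
  proof -
    have "A \<in> components S" using A by (simp add: \<A>_def)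
    from comp[OF this] obtain a b where ab: "a < b" "A = {a<..<b}" "a \<notin> S" "b \<notin> S" by blast
    have Ac: "{a<..<b} \<in> components S" using A ab by (auto simp: \<A>_def)
    note e = ends[OF ab(1) Ac ab(3,4)]
    obtain H where H: "H holomorphic_on ball z0 \<rho>'" "\<And>v. v\<in>ball z0 \<rho>' \<Longrightarrow> cmod (H v) \<le> M" "\<And>s. s\<in>A \<Longrightarrow> h (\<gamma> s) = H (\<gamma> s)"
    proof -
      have "A \<in> components S" "\<gamma> ` A \<inter> ball z0 (\<rho> / 2) \<noteq> {}" using A by (simp_all add: \<A>_def)
      from loc[OF this] show ?thesis using that by blast
    qed
    have C': "C \<subseteq> ball z0 (\<rho> / 2) - \<gamma> ` {a..b}" using C \<rho> by fastforce
    obtain k where k: "k holomorphic_on ball z0 (\<rho> / 2)" "\<And>u. u \<in> ball z0 (\<rho> / 2) \<Longrightarrow> cmod (k u) \<le> 6 * pi * M"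
      "\<And>u. u \<in> C \<Longrightarrow> ((\<lambda>s. H (\<gamma> s) / (\<gamma> s - u) * ?d s) has_integral k u) {a..b}"
      using arc_integral_analytic[OF ab(1) inj_on_subset[OF inj] pc e \<rho> H(1,2) C(1) C'] by auto
    show ?thesis
    proof (intro exI[of _ k] conjI ballI k)
      fix u assume u: "u \<in> C"
      obtain d where d: "0 < d" "\<forall>s\<in>{a..b}. d \<le> cmod (u - \<gamma> s)"
      proof -
        have "compact (\<gamma> ` {a..b})" using cont by (intro compact_continuous_image continuous_on_subset[OF cont]) auto
        moreover have "u \<notin> \<gamma> ` {a..b}" using C' u by auto
        ultimately obtain e where "e > 0" "\<forall>y\<in>\<gamma> ` {a..b}. e \<le> dist u y"
          using separate_point_closed compact_imp_closed by metis
        then show ?thesis using that[of e] by (auto simp: dist_norm image_iff)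
      qed
      have iA: "integrable lborel (\<lambda>s. indicator A s *\<^sub>R (h (\<gamma> s) * ?d s))"
        using h(1) ab by (intro integrable_mult_indicator) auto
      have m\<gamma>: "\<gamma> \<in> borel_measurable lborel" using cont by (simp add: borel_measurable_continuous_onI)
      have "integrable lborel (\<lambda>s. indicator A s *\<^sub>R (h (\<gamma> s) * ?d s) / (u - \<gamma> s))"
        by (rule Cauchy_transform_has_field_derivative(1)[OF iA m\<gamma> d(1)]) (use d(2) ab in \<open>auto simp: indicator_def split: if_splits\<close>)
      then show int: "set_integrable lborel A (\<lambda>s. h (\<gamma> s) * ?d s / (u - \<gamma> s))"
        by (simp add: set_integrable_def scaleR_conv_of_real)
      have "(LINT s:A|lborel. h (\<gamma> s) * ?d s / (u - \<gamma> s)) = integral A (\<lambda>s. h (\<gamma> s) * ?d s / (u - \<gamma> s))"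
        by (rule set_borel_integral_eq_integral(2)[OF int])
      also have "\<dots> = integral A (\<lambda>s. - (H (\<gamma> s) / (\<gamma> s - u) * ?d s))"
      proof (rule integral_cong)
        fix s assume "s \<in> A"
        have "x / (u - g) = - (x / (g - u))" for x g :: complex
          by (metis minus_diff_eq minus_divide_right)
        then show "h (\<gamma> s) * ?d s / (u - \<gamma> s) = - (H (\<gamma> s) / (\<gamma> s - u) * ?d s)"
          using H(3)[OF \<open>s \<in> A\<close>] by simp
      qed
      also have "\<dots> = - integral A (\<lambda>s. H (\<gamma> s) / (\<gamma> s - u) * ?d s)" by (rule integral_neg)
      also have "integral A (\<lambda>s. H (\<gamma> s) / (\<gamma> s - u) * ?d s) = k u"
        using k(3)[OF u] unfolding ab(2) has_integral_Icc_iff_Ioo by (rule integral_unique)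
      finally show "(LINT s:A|lborel. h (\<gamma> s) * ?d s / (u - \<gamma> s)) = - k u" .
    qed
  qed
  define Q where "Q = (\<lambda>A k. k holomorphic_on ball z0 (\<rho> / 2) \<and> (\<forall>u\<in>ball z0 (\<rho> / 2). cmod (k u) \<le> 6 * pi * M) \<and>
     (\<forall>u\<in>C. set_integrable lborel A (\<lambda>s. h (\<gamma> s) * ?d s / (u - \<gamma> s)) \<and> (LINT s:A|lborel. h (\<gamma> s) * ?d s / (u - \<gamma> s)) = - k u))"
  have "\<forall>A\<in>\<A>. \<exists>k. Q A k" using arc unfolding Q_def by (rule ballI)
  from bchoice[OF this] obtain kA where kQ: "\<forall>A\<in>\<A>. Q A (kA A)" by (rule exE)
  have kA: "kA A holomorphic_on ball z0 (\<rho> / 2)"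
    "u\<in>ball z0 (\<rho> / 2) \<Longrightarrow> cmod (kA A u) \<le> 6 * pi * M"
    "u\<in>C \<Longrightarrow> set_integrable lborel A (\<lambda>s. h (\<gamma> s) * ?d s / (u - \<gamma> s))"
    "u\<in>C \<Longrightarrow> (LINT s:A|lborel. h (\<gamma> s) * ?d s / (u - \<gamma> s)) = - kA A u" if "A \<in> \<A>" for A u
    using bspec[OF kQ that] unfolding Q_def by simp_all
  define E where "E = (\<Union>A\<in>\<A>. A)"
  have Eop: "open E" using opA by (auto simp: E_def \<A>_def)
  then have Em: "E \<in> sets borel" by simp
  have outE: "\<rho> / 2 \<le> dist z0 (\<gamma> s)" if "s \<notin> E" for s
  proof (rule ccontr)
    assume "\<not> ?thesis"
    then have n: "\<gamma> s \<in> ball z0 (\<rho> / 2)" by auto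
    then have "s \<in> S" using S(1) \<rho> by auto
    then obtain A where "A \<in> components S" "s \<in> A" using Union_components[of S] by blast
    then have "A \<in> \<A>" using n by (auto simp: \<A>_def)
    then show False using that \<open>s \<in> A\<close> by (auto simp: E_def)
  qed
  \<comment> \<open>Outside the selected arcs the path stays at distance at least
    \<open>\<rho> / 2\<close> from the centre. This part of the density is therefore at distance at
    least \<open>\<rho> / 4\<close> from every \<open>u\<close> in question, and its Cauchy
    transform is holomorphic as it stands.\<close>
  define f where "f = (\<lambda>s. indicator (- E) s *\<^sub>R (h (\<gamma> s) * ?d s))"
  have fi: "integrable lborel f" unfolding f_def using h(1) Em by (intro integrable_mult_indicator) auto
  have m\<gamma>: "\<gamma> \<in> borel_measurable lborel" using cont by (simp add: borel_measurable_continuous_onI)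
  have far: "\<rho> / 4 \<le> cmod (u - \<gamma> s)" if "u \<in> ball z0 (\<rho> / 4)" "f s \<noteq> 0" for u s
  proof -
    have "s \<notin> E" using that by (auto simp: f_def indicator_def)
    then show ?thesis using outE[of s] that(1) dist_triangle[of z0 "\<gamma> s" u] by (auto simp: dist_norm)
  qed
  define r where "r = (\<lambda>u. \<integral>s. f s / (u - \<gamma> s) \<partial>lborel)"
  have rho4: "0 < \<rho> / 4" using \<rho> by simp
  note ct = Cauchy_transform_has_field_derivative[OF fi m\<gamma> rho4 far]
  have rhol: "r holomorphic_on ball z0 (\<rho> / 4)"
    unfolding holomorphic_on_def field_differentiable_def r_def
    using ct(3) has_field_derivative_at_within by blast
  have fL: "(\<integral>s. cmod (f s) \<partial>lborel) \<le> L"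
  proof -
    have "(\<integral>s. cmod (f s) \<partial>lborel) \<le> (\<integral>s. cmod (h (\<gamma> s) * ?d s) \<partial>lborel)"
      using fi h(1) by (intro integral_mono integrable_norm) (auto simp: f_def indicator_def)
    then show ?thesis using h(2) by simp
  qed
  define k where "k = (\<lambda>u. r u - (\<Sum>A\<in>\<A>. kA A u))"
  show ?thesis
  proof (rule that[of k])
    have "kA A holomorphic_on ball z0 (\<rho> / 4)" if "A \<in> \<A>" for A
      using holomorphic_on_subset[OF kA(1)[OF that]] \<rho> by (auto simp: subset_ball)
    then show "k holomorphic_on ball z0 (\<rho> / 4)"
      unfolding k_def using rhol by (intro holomorphic_intros)
    show "cmod (k u) \<le> 4 / \<rho> * L + l / \<rho> * (12 * pi * M)" if u: "u \<in> ball z0 (\<rho> / 4)" for u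
    proof -
      have "cmod (r u) \<le> L / (\<rho> / 4)"
        unfolding r_def using order_trans[OF ct(2)[OF u] divide_right_mono[OF fL]] \<rho> by simp
      moreover have "cmod (\<Sum>A\<in>\<A>. kA A u) \<le> card \<A> * (6 * pi * M)"
        using u \<rho> kA(2) by (intro order_trans[OF norm_sum] sum_bounded_above) auto
      moreover have "card \<A> * (6 * pi * M) \<le> (l / \<rho> * 2) * (6 * pi * M)"
        using count[OF finA order_refl] \<rho> \<open>0 \<le> M\<close> by (intro mult_right_mono) (auto simp: field_simps)
      ultimately show ?thesis unfolding k_def using norm_triangle_ineq4[of "r u" "\<Sum>A\<in>\<A>. kA A u"] by (simp add: mult_ac)
    qed
    fix u assume u: "u \<in> C"
    then have ub: "u \<in> ball z0 (\<rho> / 4)" using C by auto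
    have "(LINT s:E|lborel. h (\<gamma> s) * ?d s / (u - \<gamma> s)) = (\<Sum>A\<in>\<A>. LINT s:A|lborel. h (\<gamma> s) * ?d s / (u - \<gamma> s))"
      unfolding E_def using finA kA(3)[OF _ u] opA disj[of \<A>]
      by (intro set_integral_finite_Union) (auto simp: \<A>_def)
    also have "\<dots> = - (\<Sum>A\<in>\<A>. kA A u)" using kA(4)[OF _ u] by (simp add: sum_negf)
    finally have 1: "(LINT s:E|lborel. h (\<gamma> s) * ?d s / (u - \<gamma> s)) = - (\<Sum>A\<in>\<A>. kA A u)" .
    have 2: "set_integrable lborel E (\<lambda>s. h (\<gamma> s) * ?d s / (u - \<gamma> s))"
      unfolding E_def using finA kA(3)[OF _ u] opA by (intro set_integrable_UN) (auto simp: \<A>_def)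
    have 3: "set_integrable lborel (- E) (\<lambda>s. h (\<gamma> s) * ?d s / (u - \<gamma> s))"
      "(LINT s:- E|lborel. h (\<gamma> s) * ?d s / (u - \<gamma> s)) = r u"
      using ct(1)[OF ub] unfolding set_integrable_def set_lebesgue_integral_def r_def f_def
      by (simp_all add: scaleR_conv_of_real)
    have "(\<integral>s. h (\<gamma> s) * ?d s / (u - \<gamma> s) \<partial>lborel) = (LINT s:E \<union> - E|lborel. h (\<gamma> s) * ?d s / (u - \<gamma> s))"
      by (simp add: set_lebesgue_integral_def)
    also have "\<dots> = (LINT s:E|lborel. h (\<gamma> s) * ?d s / (u - \<gamma> s)) + (LINT s:- E|lborel. h (\<gamma> s) * ?d s / (u - \<gamma> s))"
      by (rule set_integral_Un[OF _ 2 3(1)]) simp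
    finally show "(\<integral>s. h (\<gamma> s) * ?d s / (u - \<gamma> s) \<partial>lborel) = k u" by (simp add: 1 3(2) k_def)
  qed
qed

section \<open>Integration against \<open>dz\<close>\<close>

definition line_integrable :: "contour \<Rightarrow> (complex \<Rightarrow> complex) \<Rightarrow> bool" where
  "line_integrable \<kappa> \<phi> \<longleftrightarrow> set_integrable lborel (fst \<kappa>) (\<lambda>s. \<phi> (snd \<kappa> s) * vector_derivative (snd \<kappa>) (at s))"

definition line_integral :: "contour \<Rightarrow> (complex \<Rightarrow> complex) \<Rightarrow> complex" where
  "line_integral \<kappa> \<phi> = (LINT s:fst \<kappa>|lborel. \<phi> (snd \<kappa> s) * vector_derivative (snd \<kappa>) (at s))"

definition line_norm :: "contour \<Rightarrow> (complex \<Rightarrow> complex) \<Rightarrow> real" where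
  "line_norm \<kappa> \<phi> = (LINT s:fst \<kappa>|lborel. cmod (\<phi> (snd \<kappa> s) * vector_derivative (snd \<kappa>) (at s)))"

definition dz_norm :: "contour set \<Rightarrow> (complex \<Rightarrow> complex) \<Rightarrow> real" where
  "dz_norm \<Gamma> \<phi> = (\<Sum>\<kappa>\<in>\<Gamma>. line_norm \<kappa> \<phi>)"

lemma dz_integrable_iff: "dz_integrable \<Gamma> \<phi> \<longleftrightarrow> (\<forall>\<kappa>\<in>\<Gamma>. line_integrable \<kappa> \<phi>)"
  by (simp add: dz_integrable_def line_integrable_def case_prod_unfold)

lemma dz_integral_eq: "dz_integral \<Gamma> \<phi> = (\<Sum>\<kappa>\<in>\<Gamma>. line_integral \<kappa> \<phi>)"
  by (simp add: dz_integral_def line_integral_def case_prod_unfold)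

lemma mem_contour_image: "s \<in> fst \<kappa> \<Longrightarrow> snd \<kappa> s \<in> contour_image \<kappa>"
  by (auto simp: contour_image_def case_prod_unfold)

lemma mem_carrier_of: "\<kappa> \<in> \<Gamma> \<Longrightarrow> s \<in> fst \<kappa> \<Longrightarrow> snd \<kappa> s \<in> carrier_of \<Gamma>"
  using mem_contour_image[of s \<kappa>] unfolding carrier_of_def by blast

lemma image_subset_carrier: "\<kappa> \<in> \<Gamma> \<Longrightarrow> v \<in> contour_image \<kappa> \<Longrightarrow> v \<in> carrier_of \<Gamma>"
  unfolding carrier_of_def by blast

lemma line_integrable_cong:
  "(\<And>v. v \<in> contour_image \<kappa> \<Longrightarrow> \<phi> v = \<psi> v) \<Longrightarrow> line_integrable \<kappa> \<phi> \<longleftrightarrow> line_integrable \<kappa> \<psi>"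
  unfolding line_integrable_def by (intro set_integrable_cong refl) (simp add: mem_contour_image)

lemma line_integral_cong:
  "(\<And>v. v \<in> contour_image \<kappa> \<Longrightarrow> \<phi> v = \<psi> v) \<Longrightarrow> line_integral \<kappa> \<phi> = line_integral \<kappa> \<psi>"
  unfolding line_integral_def set_lebesgue_integral_def
  by (rule Bochner_Integration.integral_cong[OF refl]) (auto simp: mem_contour_image indicator_def)

lemma dz_integrable_cong:
  "(\<And>v. v \<in> carrier_of \<Gamma> \<Longrightarrow> \<phi> v = \<psi> v) \<Longrightarrow> dz_integrable \<Gamma> \<phi> \<longleftrightarrow> dz_integrable \<Gamma> \<psi>"
  unfolding dz_integrable_iff by (intro ball_cong refl line_integrable_cong) (simp add: image_subset_carrier)

lemma dz_integral_cong:
  "(\<And>v. v \<in> carrier_of \<Gamma> \<Longrightarrow> \<phi> v = \<psi> v) \<Longrightarrow> dz_integral \<Gamma> \<phi> = dz_integral \<Gamma> \<psi>"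
  unfolding dz_integral_eq by (intro sum.cong refl line_integral_cong) (simp add: image_subset_carrier)

lemma line_integrable_0 [simp]: "line_integrable \<kappa> (\<lambda>v. 0)"
  by (simp add: line_integrable_def set_integrable_def)

lemma line_integral_0 [simp]: "line_integral \<kappa> (\<lambda>v. 0) = 0"
  by (simp add: line_integral_def)

lemma dz_integrable_0 [simp]: "dz_integrable \<Gamma> (\<lambda>v. 0)"
  by (simp add: dz_integrable_iff)

lemma dz_integral_0 [simp]: "dz_integral \<Gamma> (\<lambda>v. 0) = 0"
  by (simp add: dz_integral_eq)

lemma dz_integrable_add:
  "dz_integrable \<Gamma> \<phi> \<Longrightarrow> dz_integrable \<Gamma> \<psi> \<Longrightarrow> dz_integrable \<Gamma> (\<lambda>v. \<phi> v + \<psi> v)"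
  unfolding dz_integrable_iff line_integrable_def by (simp add: distrib_right)

lemma dz_integral_add:
  "dz_integrable \<Gamma> \<phi> \<Longrightarrow> dz_integrable \<Gamma> \<psi> \<Longrightarrow> dz_integral \<Gamma> (\<lambda>v. \<phi> v + \<psi> v) = dz_integral \<Gamma> \<phi> + dz_integral \<Gamma> \<psi>"
  unfolding dz_integrable_iff line_integrable_def dz_integral_eq line_integral_def
  by (simp add: distrib_right set_integral_add sum.distrib)

lemma dz_integrable_cmult: "dz_integrable \<Gamma> \<phi> \<Longrightarrow> dz_integrable \<Gamma> (\<lambda>v. a * \<phi> v)"
  unfolding dz_integrable_iff line_integrable_def by (simp add: mult.assoc)

lemma dz_integral_cmult [simp]: "dz_integral \<Gamma> (\<lambda>v. a * \<phi> v) = a * dz_integral \<Gamma> \<phi>"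
  unfolding dz_integral_eq line_integral_def by (simp add: mult.assoc sum_distrib_left)

lemma dz_integrable_minus: "dz_integrable \<Gamma> \<phi> \<Longrightarrow> dz_integrable \<Gamma> (\<lambda>v. - \<phi> v)"
  using dz_integrable_cmult[of \<Gamma> \<phi> "-1"] by simp

lemma dz_integral_minus: "dz_integral \<Gamma> (\<lambda>v. - \<phi> v) = - dz_integral \<Gamma> \<phi>"
  using dz_integral_cmult[of \<Gamma> "-1" \<phi>] by simp

lemma dz_integrable_diff:
  "dz_integrable \<Gamma> \<phi> \<Longrightarrow> dz_integrable \<Gamma> \<psi> \<Longrightarrow> dz_integrable \<Gamma> (\<lambda>v. \<phi> v - \<psi> v)"
  using dz_integrable_add[of \<Gamma> \<phi> "\<lambda>v. - \<psi> v"] dz_integrable_minus by simp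

lemma dz_integral_diff:
  "dz_integrable \<Gamma> \<phi> \<Longrightarrow> dz_integrable \<Gamma> \<psi> \<Longrightarrow> dz_integral \<Gamma> (\<lambda>v. \<phi> v - \<psi> v) = dz_integral \<Gamma> \<phi> - dz_integral \<Gamma> \<psi>"
  using dz_integral_add[of \<Gamma> \<phi> "\<lambda>v. - \<psi> v"] dz_integrable_minus by (simp add: dz_integral_minus)

lemma dz_integrable_sum:
  "(\<And>i. i \<in> A \<Longrightarrow> dz_integrable \<Gamma> (\<phi> i)) \<Longrightarrow> dz_integrable \<Gamma> (\<lambda>v. \<Sum>i\<in>A. \<phi> i v)"
  by (induction A rule: infinite_finite_induct) (auto intro: dz_integrable_add)

lemma dz_integral_sum:
  "(\<And>i. i \<in> A \<Longrightarrow> dz_integrable \<Gamma> (\<phi> i)) \<Longrightarrow> dz_integral \<Gamma> (\<lambda>v. \<Sum>i\<in>A. \<phi> i v) = (\<Sum>i\<in>A. dz_integral \<Gamma> (\<phi> i))"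
  by (induction A rule: infinite_finite_induct) (auto simp: dz_integral_add dz_integrable_sum)

lemma line_norm_nonneg: "0 \<le> line_norm \<kappa> \<phi>"
  unfolding line_norm_def set_lebesgue_integral_def by (intro integral_nonneg_AE) auto

lemma dz_norm_nonneg: "0 \<le> dz_norm \<Gamma> \<phi>"
  unfolding dz_norm_def by (intro sum_nonneg line_norm_nonneg)

lemma line_norm_mono:
  assumes "line_integrable \<kappa> \<phi>" "line_integrable \<kappa> \<psi>" "\<And>v. v \<in> contour_image \<kappa> \<Longrightarrow> cmod (\<phi> v) \<le> cmod (\<psi> v)"
  shows "line_norm \<kappa> \<phi> \<le> line_norm \<kappa> \<psi>"
  unfolding line_norm_def
proof (rule set_integral_mono)
  fix s assume "s \<in> fst \<kappa>"
  then have "cmod (\<phi> (snd \<kappa> s)) \<le> cmod (\<psi> (snd \<kappa> s))" by (intro assms(3) mem_contour_image)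
  then show "cmod (\<phi> (snd \<kappa> s) * vector_derivative (snd \<kappa>) (at s)) \<le> cmod (\<psi> (snd \<kappa> s) * vector_derivative (snd \<kappa>) (at s))"
    by (simp add: norm_mult mult_right_mono)
qed (use assms in \<open>auto simp: line_integrable_def intro!: set_integrable_norm\<close>)

lemma dz_norm_mono:
  assumes "dz_integrable \<Gamma> \<phi>" "dz_integrable \<Gamma> \<psi>" "\<And>v. v \<in> carrier_of \<Gamma> \<Longrightarrow> cmod (\<phi> v) \<le> cmod (\<psi> v)"
  shows "dz_norm \<Gamma> \<phi> \<le> dz_norm \<Gamma> \<psi>"
  unfolding dz_norm_def using assms by (intro sum_mono line_norm_mono) (simp_all add: dz_integrable_iff image_subset_carrier)

lemma norm_line_integral_le: "line_integrable \<kappa> \<phi> \<Longrightarrow> cmod (line_integral \<kappa> \<phi>) \<le> line_norm \<kappa> \<phi>"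
  unfolding line_integral_def line_norm_def line_integrable_def by (rule set_integral_norm_bound)

lemma norm_dz_integral_le: "dz_integrable \<Gamma> \<phi> \<Longrightarrow> cmod (dz_integral \<Gamma> \<phi>) \<le> dz_norm \<Gamma> \<phi>"
  unfolding dz_integral_eq dz_norm_def dz_integrable_iff
  by (intro order_trans[OF norm_sum] sum_mono norm_line_integral_le) auto

lemma dz_norm_cmult: "dz_norm \<Gamma> (\<lambda>v. a * \<phi> v) = cmod a * dz_norm \<Gamma> \<phi>"
  unfolding dz_norm_def line_norm_def by (simp add: norm_mult mult.assoc sum_distrib_left)

lemma line_norm_le_dz_norm: "finite \<Gamma> \<Longrightarrow> \<kappa> \<in> \<Gamma> \<Longrightarrow> line_norm \<kappa> \<phi> \<le> dz_norm \<Gamma> \<phi>"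
  unfolding dz_norm_def by (rule member_le_sum) (auto simp: line_norm_nonneg)

lemma contour_cases:
  assumes "contour_system \<Gamma>" "\<kappa> \<in> \<Gamma>"
  shows "closed_contour \<kappa> \<or> infinite_contour \<kappa>"
  using assms unfolding contour_system_def by blast

lemma contour_domain:
  assumes "contour_system \<Gamma>" "\<kappa> \<in> \<Gamma>"
  shows "fst \<kappa> \<in> sets borel" "continuous_on (fst \<kappa>) (snd \<kappa>)" "0 \<in> fst \<kappa>" "connected (fst \<kappa>)"
proof -
  have c: "closed_contour (fst \<kappa>, snd \<kappa>) \<or> infinite_contour (fst \<kappa>, snd \<kappa>)"
    using contour_cases[OF assms] by simp
  then show "fst \<kappa> \<in> sets borel" "continuous_on (fst \<kappa>) (snd \<kappa>)" by (rule contour_borel)+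
  have "fst \<kappa> = {0..1}" if "closed_contour (fst \<kappa>, snd \<kappa>)" using that unfolding closed_contour_def case_prod_conv by (rule conjunct1)
  moreover have "fst \<kappa> = UNIV" if "infinite_contour (fst \<kappa>, snd \<kappa>)" using that unfolding infinite_contour_def case_prod_conv by (rule conjunct1)
  ultimately consider "fst \<kappa> = {0..1}" | "fst \<kappa> = UNIV" using c by metis
  then show "0 \<in> fst \<kappa>" "connected (fst \<kappa>)" by (cases; simp)+
qed

lemma contour_measurable:
  assumes "contour_system \<Gamma>" "\<kappa> \<in> \<Gamma>" "continuous_on (contour_image \<kappa>) k"
  shows "(\<lambda>s. indicator (fst \<kappa>) s *\<^sub>R (k (snd \<kappa> s) :: complex)) \<in> borel_measurable lborel"
proof -
  have "continuous_on (fst \<kappa>) (\<lambda>s. k (snd \<kappa> s))"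
    by (rule continuous_on_compose2[OF assms(3) contour_domain(2)[OF assms(1,2)]]) (auto simp: mem_contour_image)
  then show ?thesis
    using borel_measurable_continuous_on_indicator[OF contour_domain(1)[OF assms(1,2)]] by simp
qed

text \<open>Domination needs a measurable integrand, but measurability is known only for the product
  of \<open>\<phi>\<close> with the derivative of the path, not for \<open>\<phi>\<close> along the
  path alone. Multiplying that product by the continuous function \<open>k\<close> preserves
  it.\<close>

lemma line_integrable_bound:
  assumes "contour_system \<Gamma>" "\<kappa> \<in> \<Gamma>" "continuous_on (contour_image \<kappa>) k"
    and "line_integrable \<kappa> \<phi>" "line_integrable \<kappa> \<theta>"
    and "\<And>v. v \<in> contour_image \<kappa> \<Longrightarrow> cmod (k v * \<phi> v) \<le> cmod (\<theta> v)"
  shows "line_integrable \<kappa> (\<lambda>v. k v * \<phi> v)"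
proof -
  have "(\<lambda>s. (indicator (fst \<kappa>) s *\<^sub>R k (snd \<kappa> s)) * (indicator (fst \<kappa>) s *\<^sub>R (\<phi> (snd \<kappa> s) * vector_derivative (snd \<kappa>) (at s)))) \<in> borel_measurable lborel"
  proof (rule borel_measurable_times[OF contour_measurable[OF assms(1-3)]])
    show "(\<lambda>s. indicator (fst \<kappa>) s *\<^sub>R (\<phi> (snd \<kappa> s) * vector_derivative (snd \<kappa>) (at s))) \<in> borel_measurable lborel"
      using assms(4) unfolding line_integrable_def set_integrable_def by (rule borel_measurable_integrable)
  qed
  also have "(\<lambda>s. (indicator (fst \<kappa>) s *\<^sub>R k (snd \<kappa> s)) * (indicator (fst \<kappa>) s *\<^sub>R (\<phi> (snd \<kappa> s) * vector_derivative (snd \<kappa>) (at s))))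
    = (\<lambda>s. indicator (fst \<kappa>) s *\<^sub>R (k (snd \<kappa> s) * \<phi> (snd \<kappa> s) * vector_derivative (snd \<kappa>) (at s)))"
    by (auto simp: fun_eq_iff indicator_def)
  finally have m: "(\<lambda>s. indicator (fst \<kappa>) s *\<^sub>R (k (snd \<kappa> s) * \<phi> (snd \<kappa> s) * vector_derivative (snd \<kappa>) (at s))) \<in> borel_measurable lborel" .
  show ?thesis unfolding line_integrable_def set_integrable_def
  proof (rule Bochner_Integration.integrable_bound[OF assms(5)[unfolded line_integrable_def set_integrable_def] m AE_I2])
    fix s
    show "norm (indicator (fst \<kappa>) s *\<^sub>R (k (snd \<kappa> s) * \<phi> (snd \<kappa> s) * vector_derivative (snd \<kappa>) (at s)))
       \<le> norm (indicator (fst \<kappa>) s *\<^sub>R (\<theta> (snd \<kappa> s) * vector_derivative (snd \<kappa>) (at s)))"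
    proof (cases "s \<in> fst \<kappa>")
      case True
      then have "cmod (k (snd \<kappa> s) * \<phi> (snd \<kappa> s)) \<le> cmod (\<theta> (snd \<kappa> s))" by (intro assms(6) mem_contour_image)
      then have "cmod (k (snd \<kappa> s) * \<phi> (snd \<kappa> s)) * cmod (vector_derivative (snd \<kappa>) (at s)) \<le> cmod (\<theta> (snd \<kappa> s)) * cmod (vector_derivative (snd \<kappa>) (at s))"
        by (rule mult_right_mono) simp
      then show ?thesis using True by (simp add: norm_mult)
    qed simp
  qed
qed

lemma dz_integrable_bound:
  assumes "contour_system \<Gamma>" "\<And>\<kappa>. \<kappa> \<in> \<Gamma> \<Longrightarrow> continuous_on (contour_image \<kappa>) k"
    and "dz_integrable \<Gamma> \<phi>" "dz_integrable \<Gamma> \<theta>"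
    and "\<And>v. v \<in> carrier_of \<Gamma> \<Longrightarrow> cmod (k v * \<phi> v) \<le> cmod (\<theta> v)"
  shows "dz_integrable \<Gamma> (\<lambda>v. k v * \<phi> v)"
  unfolding dz_integrable_iff
proof
  fix \<kappa> assume "\<kappa> \<in> \<Gamma>"
  then show "line_integrable \<kappa> (\<lambda>v. k v * \<phi> v)"
    using assms by (intro line_integrable_bound[OF assms(1), of _ k \<phi> \<theta>]) (simp_all add: dz_integrable_iff image_subset_carrier)
qed

text \<open>For an infinite contour: a convergent sequence is bounded, and the path leaves every
  bounded set at both ends, so the parameters stay in a compact interval. Closedness gives each
  contour a neighbourhood free of the others.\<close>

lemma closed_contour_image:
  assumes "contour_system \<Gamma>" "\<kappa> \<in> \<Gamma>"
  shows "closed (contour_image \<kappa>)"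
  using contour_cases[OF assms]
proof
  assume "closed_contour \<kappa>"
  then have "path (snd \<kappa>)" "contour_image \<kappa> = path_image (snd \<kappa>)"
    unfolding closed_contour_def contour_image_def path_image_def case_prod_unfold
    by (simp_all add: valid_path_imp_path)
  then show ?thesis by (simp add: closed_path_image)
next
  assume i: "infinite_contour \<kappa>"
  then have I: "fst \<kappa> = UNIV" and lim: "filterlim (snd \<kappa>) at_infinity at_top" "filterlim (snd \<kappa>) at_infinity at_bot"
    unfolding infinite_contour_def case_prod_unfold by simp_all
  have cont: "continuous_on UNIV (snd \<kappa>)" using contour_domain(2)[OF assms] I by simp
  show ?thesis unfolding closed_sequential_limits
  proof (intro allI impI)
    fix X l assume X: "(\<forall>n. X n \<in> contour_image \<kappa>) \<and> X \<longlonglongrightarrow> l"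
    then obtain s where s: "\<And>n. X n = snd \<kappa> (s n)"
      by (simp add: contour_image_def case_prod_unfold image_iff) metis
    have "Bseq X" using X convergent_imp_Bseq convergentI by blast
    then obtain B where B: "\<And>n. cmod (X n) \<le> B" by (auto simp: Bseq_def)
    have B0: "0 < B + 1" using order_trans[OF norm_ge_zero B[of 0]] by simp
    have "\<forall>\<^sub>F s in at_top. B + 1 \<le> cmod (snd \<kappa> s)" "\<forall>\<^sub>F s in at_bot. B + 1 \<le> cmod (snd \<kappa> s)"
      using lim B0 by (auto simp: filterlim_at_infinity[of 0])
    then obtain a b where a: "\<And>s. s \<ge> a \<Longrightarrow> B + 1 \<le> cmod (snd \<kappa> s)" and b: "\<And>s. s \<le> b \<Longrightarrow> B + 1 \<le> cmod (snd \<kappa> s)"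
      unfolding eventually_at_top_linorder eventually_at_bot_linorder by blast
    have sn: "s n \<in> {b..a}" for n using a[of "s n"] b[of "s n"] B[of n] s[of n] by force
    have "compact (snd \<kappa> ` {b..a})" by (intro compact_continuous_image continuous_on_subset[OF cont]) auto
    then have "closed (snd \<kappa> ` {b..a})" by (rule compact_imp_closed)
    moreover have "X n \<in> snd \<kappa> ` {b..a}" for n unfolding s by (rule imageI[OF sn])
    ultimately have "l \<in> snd \<kappa> ` {b..a}" using X closed_sequentially by blast
    then show "l \<in> contour_image \<kappa>" using I by (auto simp: contour_image_def case_prod_unfold)
  qed
qed

section \<open>The singular integral equation without gauge factor\<close>

definition cubic :: "('n \<Rightarrow> real \<times> real \<times> real) \<Rightarrow> 'n \<Rightarrow> complex \<Rightarrow> complex" where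
  "cubic w i z = (case w i of (t, y, x) \<Rightarrow> of_real t * z ^ 3 + of_real y * z\<^sup>2 + of_real x * z)"

lemma holomorphic_cubic [holomorphic_intros]: "(\<lambda>z. cubic w i z) holomorphic_on A"
  unfolding cubic_def case_prod_unfold by (intro holomorphic_intros)

lemma continuous_on_cubic [continuous_intros]: "continuous_on A (\<lambda>z. cubic w i z)"
  by (intro holomorphic_on_imp_continuous_on holomorphic_cubic)

lemma dz_Cauchy_transform:
  assumes sys: "contour_system \<Gamma>" and int: "dz_integrable \<Gamma> \<phi>" and "0 < d"
    and far: "\<And>v. v \<in> carrier_of \<Gamma> \<Longrightarrow> \<phi> v \<noteq> 0 \<Longrightarrow> d \<le> cmod (z - v)"
  shows "dz_integrable \<Gamma> (\<lambda>v. \<phi> v / (z - v))"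
    and "cmod (dz_integral \<Gamma> (\<lambda>v. \<phi> v / (z - v))) \<le> dz_norm \<Gamma> \<phi> / d"
    and "((\<lambda>w. dz_integral \<Gamma> (\<lambda>v. \<phi> v / (w - v))) has_field_derivative - dz_integral \<Gamma> (\<lambda>v. \<phi> v / (z - v)\<^sup>2)) (at z)"
proof -
  have *: "line_integrable \<kappa> (\<lambda>v. \<phi> v / (z - v)) \<and> cmod (line_integral \<kappa> (\<lambda>v. \<phi> v / (z - v))) \<le> line_norm \<kappa> \<phi> / d \<and>
    ((\<lambda>w. line_integral \<kappa> (\<lambda>v. \<phi> v / (w - v))) has_field_derivative - line_integral \<kappa> (\<lambda>v. \<phi> v / (z - v)\<^sup>2)) (at z)"
    if k: "\<kappa> \<in> \<Gamma>" for \<kappa>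
  proof -
    let ?f = "\<lambda>s. indicator (fst \<kappa>) s *\<^sub>R (\<phi> (snd \<kappa> s) * vector_derivative (snd \<kappa>) (at s))"
    let ?g = "\<lambda>s. indicator (fst \<kappa>) s *\<^sub>R snd \<kappa> s"
    have f: "integrable lborel ?f" using int k by (auto simp: dz_integrable_iff line_integrable_def set_integrable_def)
    have g: "?g \<in> borel_measurable lborel" using contour_measurable[OF sys k, of "\<lambda>z. z"] by simp
    have fa: "d \<le> cmod (z - ?g s)" if "?f s \<noteq> 0" for s
      using that far[of "snd \<kappa> s"] mem_carrier_of[OF k, of s] by (auto simp: indicator_def split: if_splits)
    note ct = Cauchy_transform_has_field_derivative[OF f g \<open>0 < d\<close> fa]
    have e: "?f s / (w - ?g s) ^ n = indicator (fst \<kappa>) s *\<^sub>R (\<phi> (snd \<kappa> s) / (w - snd \<kappa> s) ^ n * vector_derivative (snd \<kappa>) (at s))" for s w n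
      by (auto simp: indicator_def)
    have e1: "?f s / (w - ?g s) = indicator (fst \<kappa>) s *\<^sub>R (\<phi> (snd \<kappa> s) / (w - snd \<kappa> s) * vector_derivative (snd \<kappa>) (at s))" for s w
      by (auto simp: indicator_def)
    have nf: "cmod (?f s) = indicator (fst \<kappa>) s *\<^sub>R cmod (\<phi> (snd \<kappa> s) * vector_derivative (snd \<kappa>) (at s))" for s
      by (auto simp: indicator_def)
    show ?thesis using ct unfolding e e1 nf
      by (simp add: line_integrable_def line_integral_def line_norm_def set_integrable_def set_lebesgue_integral_def)
  qed
  show "dz_integrable \<Gamma> (\<lambda>v. \<phi> v / (z - v))" using * by (simp add: dz_integrable_iff)
  have "cmod (dz_integral \<Gamma> (\<lambda>v. \<phi> v / (z - v))) \<le> (\<Sum>\<kappa>\<in>\<Gamma>. line_norm \<kappa> \<phi> / d)"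
    unfolding dz_integral_eq using * by (intro order_trans[OF norm_sum] sum_mono) auto
  then show "cmod (dz_integral \<Gamma> (\<lambda>v. \<phi> v / (z - v))) \<le> dz_norm \<Gamma> \<phi> / d" by (simp add: dz_norm_def sum_divide_distrib)
  show "((\<lambda>w. dz_integral \<Gamma> (\<lambda>v. \<phi> v / (w - v))) has_field_derivative - dz_integral \<Gamma> (\<lambda>v. \<phi> v / (z - v)\<^sup>2)) (at z)"
    unfolding dz_integral_eq sum_negf[symmetric] using * by (intro DERIV_sum) auto
qed

text \<open>
  Every index carries its own triple \<open>(t, y, x)\<close>; the index without exponential factor has the triple \<open>(0, 0, 0)\<close>.
  By \<open>orth\<close>, \<open>G w i\<close> vanishes on each contour where \<open>F w i\<close> does not, so the Cauchy integrals in \<open>sol\<close> that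
  count are never singular. The functions \<open>F\<close> and \<open>G\<close> are \<open>f / c\<close> and \<open>c * g\<close>, and \<open>sol w e \<eta>\<close> says that
  \<open>c * \<eta>\<close> solves \<open>(1 - H) (c * \<eta>) = \<Sum>\<^sub>i e\<^sub>i f\<^sub>i\<close>.
\<close>

locale jump_data =
  fixes \<Gamma> :: "contour set" and U V :: "complex \<Rightarrow> 'n::finite \<Rightarrow> complex"
  assumes system: "contour_system \<Gamma>"
    and U_const: "\<And>\<kappa> u v. \<kappa> \<in> \<Gamma> \<Longrightarrow> u \<in> contour_image \<kappa> \<Longrightarrow> v \<in> contour_image \<kappa> \<Longrightarrow> U u = U v"
    and V_const: "\<And>\<kappa> u v. \<kappa> \<in> \<Gamma> \<Longrightarrow> u \<in> contour_image \<kappa> \<Longrightarrow> v \<in> contour_image \<kappa> \<Longrightarrow> V u = V v"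
    and orth: "\<And>u i. u \<in> carrier_of \<Gamma> \<Longrightarrow> U u i * V u i = 0"
begin

abbreviation "\<Omega> \<equiv> carrier_of \<Gamma>"

definition F :: "('n \<Rightarrow> real \<times> real \<times> real) \<Rightarrow> 'n \<Rightarrow> complex \<Rightarrow> complex" where
  "F w i u = exp (cubic w i u) * U u i"

definition G :: "('n \<Rightarrow> real \<times> real \<times> real) \<Rightarrow> 'n \<Rightarrow> complex \<Rightarrow> complex" where
  "G w i u = V u i * exp (- cubic w i u)"

definition sol :: "('n \<Rightarrow> real \<times> real \<times> real) \<Rightarrow> ('n \<Rightarrow> complex) \<Rightarrow> (complex \<Rightarrow> complex) \<Rightarrow> bool" where
  "sol w e \<eta> \<longleftrightarrow> (\<forall>i. dz_integrable \<Gamma> (\<lambda>v. G w i v * \<eta> v)) \<and>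
     (\<forall>u\<in>\<Omega>. \<eta> u = (\<Sum>i\<in>UNIV. F w i u * (e i + dz_integral \<Gamma> (\<lambda>v. G w i v * \<eta> v / (u - v)))))"

text \<open>Only products of an \<open>F\<close> with a \<open>G\<close> can be controlled by the
  conditions on the operator: the gauge factor cancels in them, whereas it can shift size from one
  factor to the other.\<close>

definition margin :: "('n \<Rightarrow> real \<times> real \<times> real) \<Rightarrow> real \<Rightarrow> bool" where
  "margin w \<delta> \<longleftrightarrow> 0 < \<delta> \<and> (\<forall>i j. dz_integrable \<Gamma> (\<lambda>v. of_real (exp (\<delta> * cmod v)) * (F w i v * G w j v)))"

text \<open>The parameter 0 belongs to both kinds of parameter interval, so it can serve as base
  point of every contour.\<close>

definition Uc :: "contour \<Rightarrow> 'n \<Rightarrow> complex" where "Uc \<kappa> = U (snd \<kappa> 0)"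
definition Vc :: "contour \<Rightarrow> 'n \<Rightarrow> complex" where "Vc \<kappa> = V (snd \<kappa> 0)"

lemma base_point: "\<kappa> \<in> \<Gamma> \<Longrightarrow> snd \<kappa> 0 \<in> contour_image \<kappa>"
  using contour_domain(3)[OF system] mem_contour_image by blast

lemma U_eq: "\<kappa> \<in> \<Gamma> \<Longrightarrow> u \<in> contour_image \<kappa> \<Longrightarrow> U u = Uc \<kappa>"
  unfolding Uc_def using U_const base_point by blast

lemma V_eq: "\<kappa> \<in> \<Gamma> \<Longrightarrow> u \<in> contour_image \<kappa> \<Longrightarrow> V u = Vc \<kappa>"
  unfolding Vc_def using V_const base_point by blast

lemma orth_c: "\<kappa> \<in> \<Gamma> \<Longrightarrow> Uc \<kappa> i * Vc \<kappa> i = 0"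
  using orth[of "snd \<kappa> 0" i] base_point[of \<kappa>] by (auto simp: image_subset_carrier Uc_def Vc_def)

lemma finite_\<Gamma>: "finite \<Gamma>"
  using system by (simp add: contour_system_def)

lemma disjoint_images: "\<kappa> \<in> \<Gamma> \<Longrightarrow> \<kappa>' \<in> \<Gamma> \<Longrightarrow> \<kappa> \<noteq> \<kappa>' \<Longrightarrow> contour_image \<kappa> \<inter> contour_image \<kappa>' = {}"
  using system by (auto simp: contour_system_def disjoint_family_on_def)

text \<open>The contour \<open>\<kappa>\<close> itself is not removed: the indices that are active
  on it, those with \<open>Uc \<kappa> i \<noteq> 0\<close>, see only the other contours.\<close>

definition nbhd :: "contour \<Rightarrow> complex set" where
  "nbhd \<kappa> = - (\<Union>\<kappa>'\<in>\<Gamma> - {\<kappa>}. contour_image \<kappa>')"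

lemma closed_others: "closed (\<Union>\<kappa>'\<in>\<Gamma> - {\<kappa>}. contour_image \<kappa>')"
proof -
  have "\<forall>\<kappa>'\<in>\<Gamma> - {\<kappa>}. closed (contour_image \<kappa>')" using closed_contour_image[OF system] by blast
  then show ?thesis using finite_\<Gamma> closed_UN[of "\<Gamma> - {\<kappa>}"] by blast
qed

lemma open_nbhd: "open (nbhd \<kappa>)"
  unfolding nbhd_def using closed_others by (rule open_Compl)

lemma image_subset_nbhd: "\<kappa> \<in> \<Gamma> \<Longrightarrow> contour_image \<kappa> \<subseteq> nbhd \<kappa>"
  unfolding nbhd_def using disjoint_images by fastforce

text \<open>An index with \<open>Uc \<kappa> i \<noteq> 0\<close> has
  \<open>Vc \<kappa> i = 0\<close>, so \<open>G w i\<close> lives on the other contours, and these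
  form a closed set that avoids \<open>z\<close>. This distance makes every Cauchy integral that
  counts on \<open>\<kappa>\<close> differentiable at the points of \<open>\<kappa>\<close>.\<close>

lemma G_far:
  assumes "\<kappa> \<in> \<Gamma>" "z \<in> nbhd \<kappa>" 
  obtains d where "0 < d" "\<And>v i. v \<in> \<Omega> \<Longrightarrow> Uc \<kappa> i \<noteq> 0 \<Longrightarrow> G w i v \<noteq> 0 \<Longrightarrow> d \<le> cmod (z - v)"
proof -
  obtain d where d: "0 < d" "\<forall>v\<in>(\<Union>\<kappa>'\<in>\<Gamma> - {\<kappa>}. contour_image \<kappa>'). d \<le> dist z v"
    using separate_point_closed[OF closed_others, of z \<kappa>] assms(2) unfolding nbhd_def by blast
  show ?thesis
  proof (rule that[OF d(1)])
    fix v i assume v: "v \<in> \<Omega>" "Uc \<kappa> i \<noteq> 0" "G w i v \<noteq> 0"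
    have "v \<notin> contour_image \<kappa>"
    proof
      assume "v \<in> contour_image \<kappa>"
      then have "Vc \<kappa> i \<noteq> 0" using v(3) V_eq[OF assms(1)] by (auto simp: G_def)
      then show False using orth_c[OF assms(1), of i] v(2) by simp
    qed
    then have "v \<in> (\<Union>\<kappa>'\<in>\<Gamma> - {\<kappa>}. contour_image \<kappa>')" using v(1) by (auto simp: carrier_of_def)
    then show "d \<le> cmod (z - v)" using d(2) by (auto simp: dist_norm)
  qed
qed

text \<open>
  The right-hand side of the equation, continued off the contour \<open>\<kappa>\<close>.
\<close>

definition ext :: "('n \<Rightarrow> real \<times> real \<times> real) \<Rightarrow> ('n \<Rightarrow> complex) \<Rightarrow> (complex \<Rightarrow> complex) \<Rightarrow> contour \<Rightarrow> complex \<Rightarrow> complex" where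
  "ext w e \<eta> \<kappa> z = (\<Sum>i\<in>UNIV. exp (cubic w i z) * Uc \<kappa> i * (e i + dz_integral \<Gamma> (\<lambda>v. G w i v * \<eta> v / (z - v))))"

lemma ext_eq:
  assumes "sol w e \<eta>" "\<kappa> \<in> \<Gamma>" "u \<in> contour_image \<kappa>"
  shows "ext w e \<eta> \<kappa> u = \<eta> u"
proof -
  have "u \<in> \<Omega>" using assms image_subset_carrier by blast
  then show ?thesis using assms U_eq[OF assms(2,3)] by (simp add: ext_def sol_def F_def)
qed

lemma Cauchy_term_derivative:
  assumes "\<kappa> \<in> \<Gamma>" "z \<in> nbhd \<kappa>" "Uc \<kappa> i \<noteq> 0" "dz_integrable \<Gamma> (\<lambda>v. G w i v * \<eta> v)"
  shows "((\<lambda>z. dz_integral \<Gamma> (\<lambda>v. G w i v * \<eta> v / (z - v))) has_field_derivative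
     - dz_integral \<Gamma> (\<lambda>v. G w i v * \<eta> v / (z - v)\<^sup>2)) (at z)"
proof -
  obtain d where d: "0 < d" "\<And>v i. v \<in> \<Omega> \<Longrightarrow> Uc \<kappa> i \<noteq> 0 \<Longrightarrow> G w i v \<noteq> 0 \<Longrightarrow> d \<le> cmod (z - v)"
    using G_far[OF assms(1,2)] by metis
  show ?thesis
    by (rule dz_Cauchy_transform(3)[OF system assms(4) d(1)]) (use d(2) assms(3) in auto)
qed

lemma ext_holomorphic:
  assumes "\<And>i. dz_integrable \<Gamma> (\<lambda>v. G w i v * \<eta> v)" "\<kappa> \<in> \<Gamma>"
  shows "ext w e \<eta> \<kappa> holomorphic_on nbhd \<kappa>"
  unfolding ext_def
proof (intro holomorphic_on_sum)
  fix i :: 'n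
  show "(\<lambda>z. exp (cubic w i z) * Uc \<kappa> i * (e i + dz_integral \<Gamma> (\<lambda>v. G w i v * \<eta> v / (z - v)))) holomorphic_on nbhd \<kappa>"
  proof (cases "Uc \<kappa> i = 0")
    case False
    have "(\<lambda>z. dz_integral \<Gamma> (\<lambda>v. G w i v * \<eta> v / (z - v))) holomorphic_on nbhd \<kappa>"
      unfolding holomorphic_on_def field_differentiable_def
      using Cauchy_term_derivative[OF assms(2) _ False assms(1)] has_field_derivative_at_within by blast
    then show ?thesis by (intro holomorphic_intros)
  qed simp
qed

text \<open>The definition of \<open>sol\<close> mentions no regularity; a solution inherits it from
  the right-hand side of its equation.\<close>

lemma sol_continuous:
  assumes "sol w e \<eta>" "\<kappa> \<in> \<Gamma>"
  shows "continuous_on (contour_image \<kappa>) \<eta>"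
proof -
  have "continuous_on (contour_image \<kappa>) (ext w e \<eta> \<kappa>)"
    using assms by (intro continuous_on_subset[OF holomorphic_on_imp_continuous_on[OF ext_holomorphic] image_subset_nbhd]) (auto simp: sol_def)
  then show ?thesis by (rule continuous_on_eq) (use ext_eq[OF assms] in auto)
qed

lemma continuous_on_F: "\<kappa> \<in> \<Gamma> \<Longrightarrow> continuous_on (contour_image \<kappa>) (F w i)"
proof -
  assume k: "\<kappa> \<in> \<Gamma>"
  have "continuous_on (contour_image \<kappa>) (\<lambda>u. exp (cubic w i u) * Uc \<kappa> i)" by (intro continuous_intros)
  then show ?thesis by (rule continuous_on_eq) (use U_eq[OF k] in \<open>auto simp: F_def\<close>)
qed

lemma continuous_on_G: "\<kappa> \<in> \<Gamma> \<Longrightarrow> continuous_on (contour_image \<kappa>) (G w i)"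
proof -
  assume k: "\<kappa> \<in> \<Gamma>"
  have "continuous_on (contour_image \<kappa>) (\<lambda>u. Vc \<kappa> i * exp (- cubic w i u))" by (intro continuous_intros)
  then show ?thesis by (rule continuous_on_eq) (use V_eq[OF k] in \<open>auto simp: G_def\<close>)
qed

lemma Cauchy_term_integrable:
  assumes "\<kappa> \<in> \<Gamma>" "z \<in> nbhd \<kappa>" "Uc \<kappa> i \<noteq> 0" "dz_integrable \<Gamma> (\<lambda>v. G w i v * \<eta> v)"
  shows "dz_integrable \<Gamma> (\<lambda>v. G w i v * \<eta> v / (z - v))"
proof -
  obtain d where d: "0 < d" "\<And>v i. v \<in> \<Omega> \<Longrightarrow> Uc \<kappa> i \<noteq> 0 \<Longrightarrow> G w i v \<noteq> 0 \<Longrightarrow> d \<le> cmod (z - v)"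
    using G_far[OF assms(1,2)] by metis
  show ?thesis
    by (rule dz_Cauchy_transform(1)[OF system assms(4) d(1)]) (use d(2) assms(3) in auto)
qed

lemma Cauchy_term_integrable':
  assumes "u \<in> \<Omega>" "U u i \<noteq> 0" "dz_integrable \<Gamma> (\<lambda>v. G w i v * \<eta> v)"
  shows "dz_integrable \<Gamma> (\<lambda>v. G w i v * \<eta> v / (u - v))"
proof -
  obtain \<kappa> where k: "\<kappa> \<in> \<Gamma>" "u \<in> contour_image \<kappa>" using assms(1) unfolding carrier_of_def by blast
  show ?thesis
    using Cauchy_term_integrable[OF k(1) _ _ assms(3)] image_subset_nbhd[OF k(1)] k(2) assms(2) U_eq[OF k] by auto
qed

text \<open>
  Where \<open>U u i = 0\<close> the Cauchy integral is multiplied by zero, but it need not converge.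
\<close>

definition cterm :: "('n \<Rightarrow> real \<times> real \<times> real) \<Rightarrow> (complex \<Rightarrow> complex) \<Rightarrow> 'n \<Rightarrow> complex \<Rightarrow> complex" where
  "cterm w \<eta> i u = (if U u i = 0 then 0 else dz_integral \<Gamma> (\<lambda>v. G w i v * \<eta> v / (u - v)))"

lemma F_cterm: "F w i u * dz_integral \<Gamma> (\<lambda>v. G w i v * \<eta> v / (u - v)) = F w i u * cterm w \<eta> i u"
  by (simp add: cterm_def F_def)

lemma continuous_cterm:
  assumes "\<kappa> \<in> \<Gamma>" "dz_integrable \<Gamma> (\<lambda>v. G w i v * \<eta> v)"
  shows "continuous_on (contour_image \<kappa>) (cterm w \<eta> i)"
proof (cases "Uc \<kappa> i = 0")
  case True
  then have "continuous_on (contour_image \<kappa>) (\<lambda>_. 0 :: complex)" by simp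
  then show ?thesis by (rule continuous_on_eq) (use True U_eq[OF assms(1)] in \<open>auto simp: cterm_def\<close>)
next
  case False
  have "continuous_on (contour_image \<kappa>) (\<lambda>u. dz_integral \<Gamma> (\<lambda>v. G w i v * \<eta> v / (u - v)))"
  proof (intro continuous_at_imp_continuous_on ballI)
    fix u assume "u \<in> contour_image \<kappa>"
    then have "u \<in> nbhd \<kappa>" using image_subset_nbhd[OF assms(1)] by blast
    from Cauchy_term_derivative[OF assms(1) this False assms(2)]
    show "isCont (\<lambda>u. dz_integral \<Gamma> (\<lambda>v. G w i v * \<eta> v / (u - v))) u" by (rule DERIV_isCont)
  qed
  then show ?thesis by (rule continuous_on_eq) (use False U_eq[OF assms(1)] in \<open>auto simp: cterm_def\<close>)
qed

end

section \<open>Growth of solutions\<close>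

text \<open>The derivative of a cubic grows like \<open>(1 + cmod z)\<^sup>2\<close>, so on a disc
  of radius \<open>1 / (b * (1 + cmod z)\<^sup>2)\<close> the cubic changes by at most 1/2 and the
  modulus of its exponential by a factor of at most 2. This radius is the length scale of all local
  estimates of the growth.\<close>

lemma norm_exp_cubic_near:
  fixes w :: "'n::finite \<Rightarrow> real \<times> real \<times> real"
  obtains b :: real where "1 \<le> b"
    "\<And>i z v. cmod (v - z) * (b * (1 + cmod z)\<^sup>2) \<le> 1 \<Longrightarrow> cmod (exp (cubic w i v)) \<le> 2 * cmod (exp (cubic w i z))"
    "\<And>i z v. cmod (v - z) * (b * (1 + cmod z)\<^sup>2) \<le> 1 \<Longrightarrow> cmod (exp (- cubic w i v)) \<le> 2 * cmod (exp (- cubic w i z))"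
proof -
  define k where "k = (\<lambda>i. case w i of (t, y, x) \<Rightarrow> 3 * \<bar>t\<bar> + 2 * \<bar>y\<bar> + \<bar>x\<bar>)"
  define b where "b = 1 + 2 * (\<Sum>i\<in>UNIV. k i)"
  have k0: "0 \<le> k i" for i by (simp add: k_def split: prod.split)
  have kb: "2 * k i \<le> b" for i
    using member_le_sum[of i UNIV k] k0 by (simp add: b_def)
  have b1: "1 \<le> b" using sum_nonneg[of UNIV k] k0 by (simp add: b_def)
  have diff: "cmod (cubic w i v - cubic w i z) \<le> 1 / 2" if v: "cmod (v - z) * (b * (1 + cmod z)\<^sup>2) \<le> 1" for i z v
  proof -
    obtain t y x where w: "w i = (t, y, x)" by (cases "w i")
    let ?q = "(1 + cmod z)"
    have q1: "1 \<le> ?q\<^sup>2" by simp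
    have "1 \<le> b * ?q\<^sup>2" using b1 q1 mult_mono[of 1 b 1 "?q\<^sup>2"] by simp
    then have "cmod (v - z) * 1 \<le> cmod (v - z) * (b * ?q\<^sup>2)" by (intro mult_left_mono) auto
    then have "cmod (v - z) \<le> 1" using v by simp
    then have nv: "cmod v \<le> ?q" using norm_triangle_ineq[of "v - z" z] by simp
    have nz: "cmod z \<le> ?q" by simp
    have eq: "cubic w i v - cubic w i z = (v - z) * (of_real t * (v\<^sup>2 + v * z + z\<^sup>2) + of_real y * (v + z) + of_real x)"
      by (simp add: cubic_def w power2_eq_square power3_eq_cube algebra_simps)
    have s1: "cmod (v\<^sup>2 + v * z + z\<^sup>2) \<le> ?q\<^sup>2 + ?q * ?q + ?q\<^sup>2"
      by (intro order_trans[OF norm_triangle_ineq] add_mono)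
        (auto simp: norm_power norm_mult intro!: power_mono mult_mono nv nz)
    have s2: "cmod (v + z) \<le> ?q + ?q"
      by (intro order_trans[OF norm_triangle_ineq] add_mono nv nz)
    have "?q * 1 \<le> ?q * ?q" by (intro mult_left_mono) auto
    then have q: "?q \<le> ?q\<^sup>2" by (simp add: power2_eq_square)
    have "cmod (of_real t * (v\<^sup>2 + v * z + z\<^sup>2) + of_real y * (v + z) + of_real x)
      \<le> \<bar>t\<bar> * (3 * ?q\<^sup>2) + \<bar>y\<bar> * (2 * ?q\<^sup>2) + \<bar>x\<bar> * ?q\<^sup>2"
    proof (intro order_trans[OF norm_triangle_ineq] add_mono)
      show "cmod (of_real t * (v\<^sup>2 + v * z + z\<^sup>2)) \<le> \<bar>t\<bar> * (3 * ?q\<^sup>2)"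
        unfolding norm_mult norm_of_real using s1 by (intro mult_left_mono) (auto simp: power2_eq_square)
      show "cmod (of_real y * (v + z)) \<le> \<bar>y\<bar> * (2 * ?q\<^sup>2)"
        unfolding norm_mult norm_of_real using s2 q by (intro mult_left_mono) auto
      show "cmod (of_real x) \<le> \<bar>x\<bar> * ?q\<^sup>2"
        using q1 mult_left_mono[of 1 "?q\<^sup>2" "\<bar>x\<bar>"] by simp
    qed
    also have "\<dots> = k i * ?q\<^sup>2" by (simp add: k_def w algebra_simps)
    also have "\<dots> \<le> (b / 2) * ?q\<^sup>2" using kb[of i] by (intro mult_right_mono) auto
    finally have "cmod (cubic w i v - cubic w i z) \<le> cmod (v - z) * ((b / 2) * ?q\<^sup>2)"
      unfolding eq norm_mult by (intro mult_left_mono) auto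
    then show ?thesis using v by simp
  qed
  show ?thesis
  proof (rule that[OF b1])
    fix i z v assume v: "cmod (v - z) * (b * (1 + cmod z)\<^sup>2) \<le> 1"
    have "exp (cubic w i v) = exp (cubic w i v - cubic w i z) * exp (cubic w i z)"
      by (simp flip: exp_add)
    then show "cmod (exp (cubic w i v)) \<le> 2 * cmod (exp (cubic w i z))"
      using exp_bound_half[OF diff[OF v]] by (metis mult_right_mono norm_ge_zero norm_mult)
    have d': "cmod (- (cubic w i v - cubic w i z)) \<le> 1 / 2" using diff[OF v, of i] by (simp only: norm_minus_cancel)
    have "exp (- cubic w i v) = exp (- (cubic w i v - cubic w i z)) * exp (- cubic w i z)"
      by (simp flip: exp_add)
    then show "cmod (exp (- cubic w i v)) \<le> 2 * cmod (exp (- cubic w i z))"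
      using exp_bound_half[OF d'] by (metis mult_right_mono norm_ge_zero norm_mult)
  qed
qed

lemma set_integrable_sum:
  fixes f :: "'i \<Rightarrow> 'a \<Rightarrow> 'b :: {banach, second_countable_topology}"
  assumes "\<And>i. i \<in> I \<Longrightarrow> set_integrable M A (f i)"
  shows "set_integrable M A (\<lambda>x. \<Sum>i\<in>I. f i x)"
    and "(LINT x:A|M. \<Sum>i\<in>I. f i x) = (\<Sum>i\<in>I. LINT x:A|M. f i x)"
  using assms unfolding set_integrable_def set_lebesgue_integral_def scaleR_sum_right
  by (auto intro!: Bochner_Integration.integrable_sum Bochner_Integration.integral_sum)

lemma infinite_contour_facts:
  assumes sys: "contour_system \<Gamma>" and k: "\<kappa> \<in> \<Gamma>" "infinite_contour \<kappa>"
  shows "fst \<kappa> = UNIV" "inj (snd \<kappa>)" "\<And>a b. snd \<kappa> piecewise_C1_differentiable_on {a..b}"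
    "continuous_on UNIV (snd \<kappa>)" "contour_image \<kappa> = range (snd \<kappa>)" "\<And>z0 \<rho>. bounded (snd \<kappa> -` ball z0 \<rho>)"
    "filterlim (snd \<kappa>) at_infinity at_top" "filterlim (snd \<kappa>) at_infinity at_bot"
proof -
  show I: "fst \<kappa> = UNIV" and "inj (snd \<kappa>)" and "\<And>a b. snd \<kappa> piecewise_C1_differentiable_on {a..b}"
    and lim: "filterlim (snd \<kappa>) at_infinity at_top" "filterlim (snd \<kappa>) at_infinity at_bot"
    using k(2) unfolding infinite_contour_def case_prod_unfold by simp_all
  show "continuous_on UNIV (snd \<kappa>)" using contour_domain(2)[OF sys k(1)] I by simp
  show "contour_image \<kappa> = range (snd \<kappa>)" using I by (simp add: contour_image_def case_prod_unfold)
  fix z0 \<rho>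
  define B where "B = \<bar>\<rho>\<bar> + cmod z0 + 1"
  have B0: "0 < B" using abs_ge_zero[of \<rho>] norm_ge_zero[of z0] unfolding B_def by linarith
  have "\<forall>\<^sub>F s in at_top. B \<le> cmod (snd \<kappa> s)" "\<forall>\<^sub>F s in at_bot. B \<le> cmod (snd \<kappa> s)"
    using lim B0 by (auto simp: filterlim_at_infinity[of 0])
  then obtain a b where a: "\<And>s. s \<ge> a \<Longrightarrow> B \<le> cmod (snd \<kappa> s)" and b: "\<And>s. s \<le> b \<Longrightarrow> B \<le> cmod (snd \<kappa> s)"
    unfolding eventually_at_top_linorder eventually_at_bot_linorder by blast
  have "snd \<kappa> -` ball z0 \<rho> \<subseteq> {b..a}"
  proof
    fix s assume "s \<in> snd \<kappa> -` ball z0 \<rho>"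
    then have "cmod (snd \<kappa> s - z0) < \<rho>" by (simp add: dist_norm norm_minus_commute)
    then have "cmod (snd \<kappa> s) < B" using norm_triangle_ineq[of "snd \<kappa> s - z0" z0] by (simp add: B_def)
    then show "s \<in> {b..a}" using a[of s] b[of s] by force
  qed
  then show "bounded (snd \<kappa> -` ball z0 \<rho>)" by (rule bounded_subset[rotated]) simp
qed

section \<open>Length of contours and Cauchy integrals in small discs\<close>

context jump_data
begin

text \<open>
  \<open>sz\<close> and \<open>gz\<close> measure the size of \<open>F\<close> and \<open>G\<close> on \<open>\<kappa>\<close>, with the exponentials taken at a point \<open>z\<close> that need
  not lie on \<open>\<kappa>\<close>.
\<close>

definition sz :: "('n \<Rightarrow> real \<times> real \<times> real) \<Rightarrow> contour \<Rightarrow> complex \<Rightarrow> real" where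
  "sz w \<kappa> z = (\<Sum>i\<in>UNIV. cmod (exp (cubic w i z)) * cmod (Uc \<kappa> i))"

definition gz :: "('n \<Rightarrow> real \<times> real \<times> real) \<Rightarrow> contour \<Rightarrow> complex \<Rightarrow> real" where
  "gz w \<kappa> z = (\<Sum>i\<in>UNIV. cmod (Vc \<kappa> i) * cmod (exp (- cubic w i z)))"

definition mass :: "('n \<Rightarrow> real \<times> real \<times> real) \<Rightarrow> real \<Rightarrow> real" where
  "mass w \<delta> = (\<Sum>i\<in>UNIV. \<Sum>j\<in>UNIV. dz_norm \<Gamma> (\<lambda>v. of_real (exp (\<delta> * cmod v)) * (F w i v * G w j v)))"

lemma sz_nonneg: "0 \<le> sz w \<kappa> z" and gz_nonneg: "0 \<le> gz w \<kappa> z"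
  unfolding sz_def gz_def by (auto intro!: sum_nonneg)

lemma sz_ge: "cmod (exp (cubic w i z)) * cmod (Uc \<kappa> i) \<le> sz w \<kappa> z"
  unfolding sz_def by (rule member_le_sum) auto

lemma gz_ge: "cmod (Vc \<kappa> i) * cmod (exp (- cubic w i z)) \<le> gz w \<kappa> z"
  unfolding gz_def by (rule member_le_sum) auto

lemma mass_nonneg: "0 \<le> mass w \<delta>"
  unfolding mass_def by (intro sum_nonneg dz_norm_nonneg)

lemma sz_image: "\<kappa> \<in> \<Gamma> \<Longrightarrow> u \<in> contour_image \<kappa> \<Longrightarrow> sz w \<kappa> u = (\<Sum>i\<in>UNIV. cmod (F w i u))"
  using U_eq by (simp add: sz_def F_def norm_mult)

lemma gz_image: "\<kappa> \<in> \<Gamma> \<Longrightarrow> u \<in> contour_image \<kappa> \<Longrightarrow> gz w \<kappa> u = (\<Sum>i\<in>UNIV. cmod (G w i u))"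
  using V_eq by (simp add: gz_def G_def norm_mult)

text \<open>On \<open>S\<close> the product \<open>sz * gz\<close> is at least a quarter of its
  value at \<open>z0\<close>. On the contour it is the sum of the moduli of all products of an
  \<open>F\<close> with a \<open>G\<close>, whose weighted integrals add up to
  \<open>mass w \<delta>\<close>; and the weight on \<open>S\<close> is at least
  \<open>exp (\<delta> * (cmod z0 - 1))\<close>.\<close>

lemma length_bound:
  assumes m: "margin w \<delta>" and k: "\<kappa> \<in> \<Gamma>" and S: "S \<in> sets borel" "S \<subseteq> fst \<kappa>"
    and near: "\<And>s. s \<in> S \<Longrightarrow> cmod (snd \<kappa> s - z0) \<le> 1"
      "\<And>s. s \<in> S \<Longrightarrow> sz w \<kappa> z0 \<le> 2 * sz w \<kappa> (snd \<kappa> s)" "\<And>s. s \<in> S \<Longrightarrow> gz w \<kappa> z0 \<le> 2 * gz w \<kappa> (snd \<kappa> s)"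
    and pos: "0 < sz w \<kappa> z0" "0 < gz w \<kappa> z0"
  shows "set_integrable lborel S (\<lambda>s. vector_derivative (snd \<kappa>) (at s))"
    and "(LINT s:S|lborel. cmod (vector_derivative (snd \<kappa>) (at s))) * (sz w \<kappa> z0 * gz w \<kappa> z0)
      \<le> 4 * mass w \<delta> * exp (\<delta> - \<delta> * cmod z0)"
proof -
  let ?d = "\<lambda>s. vector_derivative (snd \<kappa>) (at s)"
  have d0: "0 < \<delta>" using m by (simp add: margin_def)
  define q where "q = (\<lambda>i j s. cmod (of_real (exp (\<delta> * cmod (snd \<kappa> s))) * (F w i (snd \<kappa> s) * G w j (snd \<kappa> s)) * ?d s))"
  define Q where "Q = (\<lambda>s. \<Sum>i\<in>UNIV. \<Sum>j\<in>UNIV. q i j s)"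
  have qi: "set_integrable lborel (fst \<kappa>) (q i j)" for i j
    using m k unfolding q_def margin_def dz_integrable_iff line_integrable_def by (intro set_integrable_norm) blast
  have Qi: "set_integrable lborel (fst \<kappa>) Q" unfolding Q_def by (intro set_integrable_sum(1) qi)
  have Qint: "(LINT s:fst \<kappa>|lborel. Q s) \<le> mass w \<delta>"
  proof -
    have "(LINT s:fst \<kappa>|lborel. Q s) = (\<Sum>i\<in>UNIV. \<Sum>j\<in>UNIV. LINT s:fst \<kappa>|lborel. q i j s)"
      unfolding Q_def using qi by (simp add: set_integrable_sum)
    also have "\<dots> = (\<Sum>i\<in>UNIV. \<Sum>j\<in>UNIV. line_norm \<kappa> (\<lambda>v. of_real (exp (\<delta> * cmod v)) * (F w i v * G w j v)))"
      by (simp add: q_def line_norm_def)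
    also have "\<dots> \<le> mass w \<delta>"
      unfolding mass_def by (intro sum_mono line_norm_le_dz_norm finite_\<Gamma> k)
    finally show ?thesis .
  qed
  define a where "a = sz w \<kappa> z0 * gz w \<kappa> z0"
  have a0: "0 < a" using pos by (simp add: a_def)
  define E where "E = 4 * exp (\<delta> - \<delta> * cmod z0)"
  have pt: "a * cmod (?d s) \<le> E * Q s" if s: "s \<in> S" for s
  proof -
    let ?v = "snd \<kappa> s"
    have vi: "?v \<in> contour_image \<kappa>" using s S mem_contour_image by blast
    have "cmod z0 - 1 \<le> cmod ?v" using near(1)[OF s] norm_triangle_ineq3[of ?v z0] by linarith
    then have "\<delta> * (cmod z0 - 1) \<le> \<delta> * cmod ?v" using d0 by (intro mult_left_mono) auto
    then have e1: "1 \<le> exp (\<delta> - \<delta> * cmod z0) * exp (\<delta> * cmod ?v)"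
      by (simp add: algebra_simps flip: exp_add)
    have "a \<le> (2 * sz w \<kappa> ?v) * (2 * gz w \<kappa> ?v)"
      unfolding a_def using near(2,3)[OF s] pos by (intro mult_mono) (auto simp: sz_nonneg)
    also have "\<dots> = 4 * (\<Sum>i\<in>UNIV. \<Sum>j\<in>UNIV. cmod (F w i ?v) * cmod (G w j ?v)) * 1"
      unfolding sz_image[OF k vi] gz_image[OF k vi] by (simp add: sum_product)
    also have "\<dots> \<le> 4 * (\<Sum>i\<in>UNIV. \<Sum>j\<in>UNIV. cmod (F w i ?v) * cmod (G w j ?v)) * (exp (\<delta> - \<delta> * cmod z0) * exp (\<delta> * cmod ?v))"
      by (intro mult_left_mono e1 mult_nonneg_nonneg sum_nonneg) auto
    finally have "a * cmod (?d s) \<le> 4 * (\<Sum>i\<in>UNIV. \<Sum>j\<in>UNIV. cmod (F w i ?v) * cmod (G w j ?v)) * (exp (\<delta> - \<delta> * cmod z0) * exp (\<delta> * cmod ?v)) * cmod (?d s)"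
      by (rule mult_right_mono) simp
    also have "\<dots> = E * Q s"
      by (simp add: E_def Q_def q_def norm_mult sum_distrib_left sum_distrib_right mult_ac)
    finally show ?thesis .
  qed
  have dm: "(\<lambda>s. indicator (fst \<kappa>) s *\<^sub>R ?d s) \<in> borel_measurable borel"
    using contour_borel(3)[of "fst \<kappa>" "snd \<kappa>"] contour_cases[OF system k] by simp
  have "(\<lambda>s. indicator S s *\<^sub>R (indicator (fst \<kappa>) s *\<^sub>R ?d s)) \<in> borel_measurable borel"
    using S dm by measurable
  moreover have "(\<lambda>s. indicator S s *\<^sub>R (indicator (fst \<kappa>) s *\<^sub>R ?d s)) = (\<lambda>s. indicator S s *\<^sub>R ?d s)"
    using S by (auto simp: indicator_def fun_eq_iff)
  ultimately have dmS: "(\<lambda>s. indicator S s *\<^sub>R ?d s) \<in> borel_measurable lborel" by simp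
  have QS: "set_integrable lborel S Q" using S by (intro set_integrable_subset[OF Qi]) auto
  show dS: "set_integrable lborel S ?d" unfolding set_integrable_def
  proof (rule Bochner_Integration.integrable_bound[OF _ dmS AE_I2])
    show "integrable lborel (\<lambda>s. (E / a) * (indicator S s *\<^sub>R Q s))"
      using QS unfolding set_integrable_def by (rule integrable_mult_right)
    show "norm (indicator S s *\<^sub>R ?d s) \<le> norm ((E / a) * (indicator S s *\<^sub>R Q s))" for s
    proof (cases "s \<in> S")
      case True
      then have "cmod (?d s) \<le> E / a * Q s" using pt[OF True] a0 by (simp add: field_simps)
      then have "cmod (?d s) \<le> \<bar>E / a * Q s\<bar>" by linarith
      then show ?thesis using True by (simp only: indicator_simps(1) scaleR_one real_norm_def)
    qed simp
  qed
  have "(LINT s:S|lborel. cmod (?d s)) * a = (LINT s:S|lborel. a * cmod (?d s))" by simp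
  also have "\<dots> \<le> (LINT s:S|lborel. E * Q s)"
    using dS QS pt by (intro set_integral_mono set_integrable_mult_right set_integrable_norm) auto
  also have "\<dots> = E * (LINT s:S|lborel. Q s)" by simp
  also have "\<dots> \<le> E * (LINT s:fst \<kappa>|lborel. Q s)"
  proof (intro mult_left_mono set_integral_subset_le[OF Qi])
    show "0 \<le> Q x" for x unfolding Q_def q_def by (intro sum_nonneg norm_ge_zero)
  qed (use S in \<open>auto simp: E_def\<close>)
  also have "\<dots> \<le> E * mass w \<delta>" using Qint by (intro mult_left_mono) (auto simp: E_def)
  finally show "(LINT s:S|lborel. cmod (?d s)) * (sz w \<kappa> z0 * gz w \<kappa> z0) \<le> 4 * mass w \<delta> * exp (\<delta> - \<delta> * cmod z0)"
    by (simp add: a_def E_def mult_ac)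
qed


lemma sz_cmp:
  assumes "\<And>i. cmod (exp (cubic w i a)) \<le> 2 * cmod (exp (cubic w i b))"
  shows "sz w \<kappa> a \<le> 2 * sz w \<kappa> b" "gz w \<kappa> b \<le> 2 * gz w \<kappa> a"
proof -
  show "sz w \<kappa> a \<le> 2 * sz w \<kappa> b"
    unfolding sz_def sum_distrib_left using mult_right_mono[OF assms norm_ge_zero]
    by (intro sum_mono) (simp add: mult.assoc)
  have "cmod (exp (- cubic w i b)) \<le> 2 * cmod (exp (- cubic w i a))" for i
    using assms[of i] unfolding norm_exp_eq_Re by (simp add: exp_minus field_simps)
  from mult_left_mono[OF this norm_ge_zero]
  show "gz w \<kappa> b \<le> 2 * gz w \<kappa> a"
    unfolding gz_def sum_distrib_left by (intro sum_mono) (simp only: mult.left_commute[of 2])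
qed

lemma sz_pos: "Uc \<kappa> i \<noteq> 0 \<Longrightarrow> 0 < sz w \<kappa> z"
  by (rule less_le_trans[OF _ sz_ge[of w i z \<kappa>]]) auto

lemma gz_pos: "Vc \<kappa> i \<noteq> 0 \<Longrightarrow> 0 < gz w \<kappa> z"
  by (rule less_le_trans[OF _ gz_ge[of \<kappa> i w z]]) auto

lemma line_Cauchy_transform:
  assumes k: "\<kappa> \<in> \<Gamma>" and int: "line_integrable \<kappa> \<phi>" and "0 < d"
    and far: "\<And>v. v \<in> contour_image \<kappa> \<Longrightarrow> \<phi> v \<noteq> 0 \<Longrightarrow> d \<le> cmod (z - v)"
  shows "cmod (line_integral \<kappa> (\<lambda>v. \<phi> v / (z - v))) \<le> line_norm \<kappa> \<phi> / d"
    and "((\<lambda>w. line_integral \<kappa> (\<lambda>v. \<phi> v / (w - v))) has_field_derivative - line_integral \<kappa> (\<lambda>v. \<phi> v / (z - v)\<^sup>2)) (at z)"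
proof -
  have s: "contour_system {\<kappa>}"
    using contour_cases[OF system k] by (simp add: contour_system_def disjoint_family_on_def)
  have c: "carrier_of {\<kappa>} = contour_image \<kappa>" by (simp add: carrier_of_def)
  have "dz_integrable {\<kappa>} \<phi>" using int by (simp add: dz_integrable_iff)
  from dz_Cauchy_transform[OF s this \<open>0 < d\<close>, unfolded c, OF far]
  show "cmod (line_integral \<kappa> (\<lambda>v. \<phi> v / (z - v))) \<le> line_norm \<kappa> \<phi> / d"
    "((\<lambda>w. line_integral \<kappa> (\<lambda>v. \<phi> v / (w - v))) has_field_derivative - line_integral \<kappa> (\<lambda>v. \<phi> v / (z - v)\<^sup>2)) (at z)"
    by (simp_all add: dz_integral_eq dz_norm_def)
qed

text \<open>The last conclusion drives the induction over the contours: a contour that reaches the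
  ball of half the radius has length at least \<open>\<rho> / 2\<close> inside the ball, so
  \<open>length_bound\<close> forces \<open>sz * gz\<close> to be small at
  \<open>z0\<close>.\<close>

lemma length_in_ball:
  assumes m: "margin w \<delta>" and k: "\<kappa> \<in> \<Gamma>" "infinite_contour \<kappa>"
    and \<rho>: "0 < \<rho>" "\<rho> \<le> 1" and cmp: "\<And>i v. v \<in> ball z0 \<rho> \<Longrightarrow> cmod (exp (cubic w i v)) \<le> 2 * cmod (exp (cubic w i z0)) \<and>
      cmod (exp (cubic w i z0)) \<le> 2 * cmod (exp (cubic w i v))"
    and act: "Uc \<kappa> i \<noteq> 0" "Vc \<kappa> j \<noteq> 0"
  defines "S \<equiv> snd \<kappa> -` ball z0 \<rho>" and "B \<equiv> 4 * mass w \<delta> * exp (\<delta> - \<delta> * cmod z0)"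
  shows "set_integrable lborel S (\<lambda>s. vector_derivative (snd \<kappa>) (at s))"
    and "(LINT s:S|lborel. cmod (vector_derivative (snd \<kappa>) (at s))) \<le> B / (sz w \<kappa> z0 * gz w \<kappa> z0)"
    and "contour_image \<kappa> \<inter> ball z0 (\<rho> / 2) \<noteq> {} \<Longrightarrow> \<rho> / 2 * (sz w \<kappa> z0 * gz w \<kappa> z0) \<le> B"
proof -
  note i = infinite_contour_facts[OF system k]
  have pos: "0 < sz w \<kappa> z0" "0 < gz w \<kappa> z0" using act sz_pos gz_pos by auto
  have opS: "open S" using i(4) by (simp add: S_def open_vimage continuous_on_eq_continuous_at)
  have Sb: "snd \<kappa> s \<in> ball z0 \<rho>" if "s \<in> S" for s using that by (simp add: S_def)
  have n1: "cmod (snd \<kappa> s - z0) \<le> 1" if "s \<in> S" for s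
    using Sb[OF that] \<rho> by (simp add: dist_norm norm_minus_commute)
  have n2: "sz w \<kappa> z0 \<le> 2 * sz w \<kappa> (snd \<kappa> s)" if "s \<in> S" for s
    using sz_cmp(1)[OF conjunct2[OF cmp[OF Sb[OF that]]]] .
  have n3: "gz w \<kappa> z0 \<le> 2 * gz w \<kappa> (snd \<kappa> s)" if "s \<in> S" for s
    using sz_cmp(2)[OF conjunct1[OF cmp[OF Sb[OF that]]]] .
  have lb: "set_integrable lborel S (\<lambda>s. vector_derivative (snd \<kappa>) (at s))"
    "(LINT s:S|lborel. cmod (vector_derivative (snd \<kappa>) (at s))) * (sz w \<kappa> z0 * gz w \<kappa> z0) \<le> B"
    unfolding B_def using length_bound[OF m k(1) _ _ n1 n2 n3 pos] borel_open[OF opS] i(1) by auto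
  show "set_integrable lborel S (\<lambda>s. vector_derivative (snd \<kappa>) (at s))" by (rule lb)
  show "(LINT s:S|lborel. cmod (vector_derivative (snd \<kappa>) (at s))) \<le> B / (sz w \<kappa> z0 * gz w \<kappa> z0)"
    using lb(2) pos by (simp add: pos_le_divide_eq)
  assume "contour_image \<kappa> \<inter> ball z0 (\<rho> / 2) \<noteq> {}"
  then obtain s where s: "snd \<kappa> s \<in> ball z0 (\<rho> / 2)" using i(5) by auto
  then have "s \<in> S" using \<rho> by (auto simp: S_def)
  then obtain A where A: "A \<in> components S" "s \<in> A" using Union_components[of S] by blast
  have "\<rho> / 2 \<le> (LINT s:A|lborel. cmod (vector_derivative (snd \<kappa>) (at s)))"
    using half_radius_le_length[OF i(3,4) S_def[unfolded atomize_eq] _ \<rho>(1) lb(1) A s] i(6) S_def by simp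
  also have "\<dots> \<le> (LINT s:S|lborel. cmod (vector_derivative (snd \<kappa>) (at s)))"
    using open_components[OF opS A(1)] in_components_subset[OF A(1)] lb(1)
    by (intro set_integral_subset_le set_integrable_norm) auto
  finally have "\<rho> / 2 * (sz w \<kappa> z0 * gz w \<kappa> z0) \<le> (LINT s:S|lborel. cmod (vector_derivative (snd \<kappa>) (at s))) * (sz w \<kappa> z0 * gz w \<kappa> z0)"
    using pos by (intro mult_right_mono) auto
  then show "\<rho> / 2 * (sz w \<kappa> z0 * gz w \<kappa> z0) \<le> B" using lb(2) by simp
qed

text \<open>If \<open>\<kappa>'\<close> avoids the ball of radius \<open>\<rho> / 4\<close>, or the
  solution vanishes on it, its contribution is analytic in the ball of radius
  \<open>\<rho> / 8\<close> by distance alone. Otherwise the smallness of \<open>B\<close> makes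
  \<open>sz w \<kappa>' z0\<close> smaller than \<open>sz w \<kappa> z0\<close>; then
  \<open>IH\<close> continues the solution from each arc of \<open>\<kappa>'\<close> to the ball of
  radius \<open>\<rho>\<close>, and the arcs can be pushed to the circle of radius
  \<open>\<rho> / 2\<close>.\<close>

lemma near_term:
  assumes sl: "sol w e \<eta>" and m: "margin w \<delta>" and k: "\<kappa> \<in> \<Gamma>" "\<kappa>' \<in> \<Gamma>" and act: "Uc \<kappa> i \<noteq> 0" "Vc \<kappa>' i \<noteq> 0"
    and \<rho>: "0 < \<rho>" "\<rho> \<le> 1" and cmp: "\<And>i v. v \<in> ball z0 \<rho> \<Longrightarrow> cmod (exp (cubic w i v)) \<le> 2 * cmod (exp (cubic w i z0)) \<and>
      cmod (exp (cubic w i z0)) \<le> 2 * cmod (exp (cubic w i v))"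
    and B: "B = 4 * mass w \<delta> * exp (\<delta> - \<delta> * cmod z0)" "4 * B / \<rho> < cmod (Uc \<kappa> i) * cmod (Vc \<kappa>' i)"
    and closed: "closed_contour \<kappa>' \<Longrightarrow> contour_image \<kappa>' \<inter> ball z0 \<rho> = {}"
    and L: "line_norm \<kappa>' (\<lambda>v. G w i v * \<eta> v) \<le> L" and K: "0 \<le> K"
    and IH: "\<And>C. sz w \<kappa>' z0 < sz w \<kappa> z0 \<Longrightarrow> connected C \<Longrightarrow> C \<subseteq> ball z0 \<rho> \<inter> nbhd \<kappa>' \<Longrightarrow>
       \<exists>a. a holomorphic_on ball z0 \<rho> \<and> (\<forall>v\<in>ball z0 \<rho>. cmod (a v) \<le> K * sz w \<kappa>' z0) \<and> (\<forall>u\<in>C. ext w e \<eta> \<kappa>' u = a u)"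
    and C: "connected C" "C \<subseteq> ball z0 (\<rho> / 8) \<inter> nbhd \<kappa>"
  shows "\<exists>k. k holomorphic_on ball z0 (\<rho> / 8) \<and> (\<forall>u\<in>ball z0 (\<rho> / 8). cmod (k u) \<le> (8 * L + 48 * pi * B * K) / \<rho>) \<and>
     (\<forall>u\<in>C. line_integral \<kappa>' (\<lambda>v. G w i v * \<eta> v / (u - v)) = k u)"
proof -
  define h where "h = (\<lambda>v. G w i v * \<eta> v)"
  have hi: "line_integrable \<kappa>' h" using sl k by (simp add: sol_def dz_integrable_iff h_def)
  have B0: "0 \<le> B" unfolding B(1) using mass_nonneg by simp
  have L0: "0 \<le> L" using L line_norm_nonneg order_trans by blast
  have ne: "\<kappa> \<noteq> \<kappa>'" using orth_c[OF k(1), of i] act by auto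
  show ?thesis
  proof (cases "contour_image \<kappa>' \<inter> ball z0 (\<rho> / 4) = {} \<or> Uc \<kappa>' = (\<lambda>_. 0)")
    case True
    have far: "\<rho> / 8 \<le> cmod (u - v)" if "u \<in> ball z0 (\<rho> / 8)" "v \<in> contour_image \<kappa>'" "h v \<noteq> 0" for u v
    proof -
      have "Uc \<kappa>' \<noteq> (\<lambda>_. 0)"
        using that ext_eq[OF sl k(2) that(2)] by (auto simp: h_def ext_def)
      then have "\<rho> / 4 \<le> dist z0 v" using True that(2) by force
      then show ?thesis using that(1) dist_triangle[of z0 v u] by (auto simp: dist_norm)
    qed
    have r8: "0 < \<rho> / 8" using \<rho> by simp
    note ct = line_Cauchy_transform[OF k(2) hi r8 far]
    show ?thesis
    proof (intro exI[of _ "\<lambda>u. line_integral \<kappa>' (\<lambda>v. h v / (u - v))"] conjI ballI)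
      show "(\<lambda>u. line_integral \<kappa>' (\<lambda>v. h v / (u - v))) holomorphic_on ball z0 (\<rho> / 8)"
        unfolding holomorphic_on_def field_differentiable_def
        using ct(2) has_field_derivative_at_within by blast
      fix u assume "u \<in> ball z0 (\<rho> / 8)"
      then have "cmod (line_integral \<kappa>' (\<lambda>v. h v / (u - v))) \<le> line_norm \<kappa>' h / (\<rho> / 8)" by (rule ct(1))
      also have "\<dots> \<le> (8 * L) / \<rho>" using L \<rho> by (simp add: h_def divide_right_mono)
      also have "\<dots> \<le> (8 * L + 48 * pi * B * K) / \<rho>" using \<rho> B0 K by (intro divide_right_mono) auto
      finally show "cmod (line_integral \<kappa>' (\<lambda>v. h v / (u - v))) \<le> (8 * L + 48 * pi * B * K) / \<rho>" .
    qed (simp add: h_def)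
  next
    case False
    then obtain j where j: "Uc \<kappa>' j \<noteq> 0" by (auto simp: fun_eq_iff)
    have meet: "contour_image \<kappa>' \<inter> ball z0 (\<rho> / 4) \<noteq> {}" using False by simp
    have "ball z0 (\<rho> / 4) \<subseteq> ball z0 \<rho>" using \<rho> by (auto simp: subset_ball)
    then have inf: "infinite_contour \<kappa>'" using contour_cases[OF system k(2)] closed meet by blast
    note i = infinite_contour_facts[OF system k(2) inf]
    let ?\<gamma> = "snd \<kappa>'"
    define S where "S = ?\<gamma> -` ball z0 (\<rho> / 2)"
    have bS: "bounded S" unfolding S_def by (rule i(6))
    have r2: "0 < \<rho> / 2" "\<rho> / 2 \<le> 1" "\<rho> / 2 < \<rho>" using \<rho> by auto
    have cmp2: "cmod (exp (cubic w i v)) \<le> 2 * cmod (exp (cubic w i z0)) \<and> cmod (exp (cubic w i z0)) \<le> 2 * cmod (exp (cubic w i v))"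
      if "v \<in> ball z0 (\<rho> / 2)" for i v using cmp[of v i] that \<rho> by auto
    note len = length_in_ball[OF m k(2) inf r2(1,2) cmp2 j act(2), folded B(1) S_def]
    have pos: "0 < sz w \<kappa>' z0" "0 < gz w \<kappa>' z0" using j act sz_pos gz_pos by auto
    let ?s = "sz w \<kappa>' z0" and ?g = "gz w \<kappa>' z0" and ?x = "cmod (exp (cubic w i z0))"
    have x0: "0 < ?x" by simp
    have gV: "cmod (Vc \<kappa>' i) / ?x \<le> ?g"
      using gz_ge[of \<kappa>' i w z0] by (simp add: exp_minus norm_inverse divide_inverse)
    \<comment> \<open>The factor \<open>?x\<close> cancels: \<open>?s * ?g\<close> is below
      \<open>cmod (Uc \<kappa> i) * cmod (Vc \<kappa>' i)\<close>, while \<open>?g\<close> is at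
      least \<open>cmod (Vc \<kappa>' i) / ?x\<close> and \<open>sz w \<kappa> z0\<close> at least
      \<open>?x * cmod (Uc \<kappa> i)\<close>.\<close>
    have lt: "?s < sz w \<kappa> z0"
    proof -
      have "\<rho> / 2 / 2 * (?s * ?g) \<le> B" using len(3) meet by simp
      then have 1: "?s * ?g \<le> 4 * B / \<rho>" using \<rho> by (simp add: field_simps)
      have "?s * (cmod (Vc \<kappa>' i) / ?x) \<le> ?s * ?g" using gV pos by (intro mult_left_mono) auto
      also have "\<dots> < cmod (Uc \<kappa> i) * cmod (Vc \<kappa>' i)" using 1 B(2) by linarith
      finally have "?s < ?x * cmod (Uc \<kappa> i)" using x0 act(2) by (simp add: field_simps)
      then show ?thesis using sz_ge[of w i z0 \<kappa>] by linarith
    qed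
    define M where "M = 2 * (cmod (Vc \<kappa>' i) / ?x) * (K * ?s)"
    have loc: "\<exists>H. H holomorphic_on ball z0 \<rho> \<and> (\<forall>v\<in>ball z0 \<rho>. cmod (H v) \<le> M) \<and> (\<forall>s\<in>A. h (?\<gamma> s) = H (?\<gamma> s))"
      if A: "A \<in> components S" and "?\<gamma> ` A \<inter> ball z0 (\<rho> / 2 / 2) \<noteq> {}" for A
    proof -
      have "connected (?\<gamma> ` A)"
        by (rule connected_continuous_image[OF continuous_on_subset[OF i(4)] in_components_connected[OF A]]) simp
      moreover have "?\<gamma> ` A \<subseteq> ball z0 \<rho>" using in_components_subset[OF A] \<rho> by (auto simp: S_def)
      moreover have "?\<gamma> ` A \<subseteq> contour_image \<kappa>'" using i(5) by auto
      ultimately obtain a where a: "a holomorphic_on ball z0 \<rho>" "\<And>v. v\<in>ball z0 \<rho> \<Longrightarrow> cmod (a v) \<le> K * ?s"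
        "\<And>u. u\<in>?\<gamma> ` A \<Longrightarrow> ext w e \<eta> \<kappa>' u = a u"
        using IH[OF lt, of "?\<gamma> ` A"] image_subset_nbhd[OF k(2)] by blast
      show ?thesis
      proof (intro exI[of _ "\<lambda>v. Vc \<kappa>' i * exp (- cubic w i v) * a v"] conjI ballI)
        show "(\<lambda>v. Vc \<kappa>' i * exp (- cubic w i v) * a v) holomorphic_on ball z0 \<rho>"
          using a(1) by (intro holomorphic_intros)
        fix v assume v: "v \<in> ball z0 \<rho>"
        have "cmod (exp (- cubic w i v)) \<le> 2 / ?x"
          using cmp[OF v, of i] unfolding norm_exp_eq_Re by (simp add: exp_minus field_simps)
        then have "cmod (Vc \<kappa>' i) * cmod (exp (- cubic w i v)) * cmod (a v) \<le> cmod (Vc \<kappa>' i) * (2 / ?x) * (K * ?s)"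
          using a(2)[OF v] by (intro mult_mono) auto
        then show "cmod (Vc \<kappa>' i * exp (- cubic w i v) * a v) \<le> M" by (simp add: norm_mult M_def mult_ac)
      next
        fix s assume "s \<in> A"
        have im: "?\<gamma> s \<in> contour_image \<kappa>'" using i(5) by auto
        have "h (?\<gamma> s) = G w i (?\<gamma> s) * ext w e \<eta> \<kappa>' (?\<gamma> s)" using ext_eq[OF sl k(2) im] by (simp add: h_def)
        then show "h (?\<gamma> s) = Vc \<kappa>' i * exp (- cubic w i (?\<gamma> s)) * a (?\<gamma> s)"
          using a(3) \<open>s \<in> A\<close> V_eq[OF k(2) im] by (simp add: G_def)
      qed
    qed
    have h1: "integrable lborel (\<lambda>s. h (?\<gamma> s) * vector_derivative ?\<gamma> (at s))"
      "(\<integral>s. cmod (h (?\<gamma> s) * vector_derivative ?\<gamma> (at s)) \<partial>lborel) \<le> L"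
      using hi L i(1) by (simp_all add: line_integrable_def line_norm_def set_integrable_def set_lebesgue_integral_def h_def)
    have M0: "0 \<le> M" using K pos by (simp add: M_def)
    have Cr: "C \<subseteq> ball z0 (\<rho> / 2 / 4) - range ?\<gamma>" using C(2) ne k i(5) by (auto simp: nbhd_def)
    obtain kk where kk: "kk holomorphic_on ball z0 (\<rho> / 2 / 4)"
      "\<And>u. u \<in> ball z0 (\<rho> / 2 / 4) \<Longrightarrow> cmod (kk u) \<le> 4 / (\<rho> / 2) * L + B / (?s * ?g) / (\<rho> / 2) * (12 * pi * M)"
      "\<And>u. u \<in> C \<Longrightarrow> (\<integral>s. h (?\<gamma> s) * vector_derivative ?\<gamma> (at s) / (u - ?\<gamma> s) \<partial>lborel) = kk u"
      using integral_over_arcs_analytic[OF i(2,3,4) S_def bS r2(1,3) len(1,2) h1 loc C(1) Cr M0] by blast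
    \<comment> \<open>The length bound carries \<open>?s * ?g\<close> in its denominator, and the
      density bound \<open>M\<close> is at most \<open>2 * ?g * K * ?s\<close>. Their product is at
      most \<open>2 * B * K\<close>, free of the sizes of \<open>F\<close> and
      \<open>G\<close>.\<close>
    have bd: "4 / (\<rho> / 2) * L + B / (?s * ?g) / (\<rho> / 2) * (12 * pi * M) \<le> (8 * L + 48 * pi * B * K) / \<rho>"
    proof -
      have "B / (?s * ?g) * M = 2 * B * K * ((cmod (Vc \<kappa>' i) / ?x) / ?g)"
        using pos by (simp add: M_def mult_ac)
      also have "\<dots> \<le> 2 * B * K * 1"
      proof (rule mult_left_mono)
        show "cmod (Vc \<kappa>' i) / ?x / ?g \<le> 1" using gV pos by (simp only: divide_le_eq_1_pos)
      qed (use B0 K in simp)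
      finally have "B / (?s * ?g) * M * (24 * pi) \<le> 2 * B * K * (24 * pi)" by (intro mult_right_mono) auto
      then have "(8 * L + B / (?s * ?g) * M * (24 * pi)) / \<rho> \<le> (8 * L + 48 * pi * B * K) / \<rho>"
        using \<rho> by (intro divide_right_mono) (auto simp: mult_ac)
      moreover have "4 / (\<rho> / 2) * L + B / (?s * ?g) / (\<rho> / 2) * (12 * pi * M) = (8 * L + B / (?s * ?g) * M * (24 * pi)) / \<rho>"
        by (simp add: add_divide_distrib mult_ac)
      ultimately show ?thesis by simp
    qed
    show ?thesis
    proof (intro exI[of _ kk] conjI ballI)
      fix u assume "u \<in> C"
      then show "line_integral \<kappa>' (\<lambda>v. G w i v * \<eta> v / (u - v)) = kk u"
        using kk(3) i(1) by (simp add: line_integral_def h_def set_lebesgue_integral_def)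
    qed (use kk(1,2) bd order_trans in auto)
  qed
qed

end

lemma exp_poly_small:
  fixes a b \<delta> \<mu> :: real
  assumes "0 < \<delta>" "0 < \<mu>"
  obtains X where "\<And>x. X \<le> x \<Longrightarrow> a * exp (\<delta> - \<delta> * x) * (b * (1 + x)\<^sup>2) < \<mu>"
proof -
  have "((\<lambda>x. exp (\<delta> - \<delta> * x) * (1 + x)\<^sup>2) \<longlongrightarrow> 0) at_top"
    using assms(1) by real_asymp
  then have "((\<lambda>x. (a * b) * (exp (\<delta> - \<delta> * x) * (1 + x)\<^sup>2)) \<longlongrightarrow> (a * b) * 0) at_top"
    by (rule tendsto_mult_left)
  then have "\<forall>\<^sub>F x in at_top. (a * b) * (exp (\<delta> - \<delta> * x) * (1 + x)\<^sup>2) < \<mu>"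
    using assms(2) by (intro order_tendstoD(2)) auto
  then obtain X where "\<And>x. X \<le> x \<Longrightarrow> (a * b) * (exp (\<delta> - \<delta> * x) * (1 + x)\<^sup>2) < \<mu>"
    unfolding eventually_at_top_linorder by blast
  then show ?thesis by (intro that[of X]) (simp add: mult_ac)
qed

section \<open>Induction over the contours and global growth bounds\<close>

context jump_data
begin

lemma closed_contours_bounded:
  obtains R where "\<And>\<kappa> v. \<kappa> \<in> \<Gamma> \<Longrightarrow> closed_contour \<kappa> \<Longrightarrow> v \<in> contour_image \<kappa> \<Longrightarrow> cmod v \<le> R"
proof -
  have "bounded (contour_image \<kappa>)" if "closed_contour \<kappa>" for \<kappa>
  proof -
    have "path (snd \<kappa>)" "contour_image \<kappa> = path_image (snd \<kappa>)"
      using that unfolding closed_contour_def contour_image_def path_image_def case_prod_unfold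
      by (simp_all add: valid_path_imp_path)
    then show ?thesis by (simp add: bounded_path_image)
  qed
  then have "bounded (\<Union>\<kappa>\<in>{\<kappa>\<in>\<Gamma>. closed_contour \<kappa>}. contour_image \<kappa>)"
    using finite_\<Gamma> by (intro bounded_UN) auto
  then obtain R where "\<And>v. v \<in> (\<Union>\<kappa>\<in>{\<kappa>\<in>\<Gamma>. closed_contour \<kappa>}. contour_image \<kappa>) \<Longrightarrow> cmod v \<le> R"
    unfolding bounded_iff by blast
  then show ?thesis by (intro that[of R]) blast
qed

text \<open>A minimum over the finitely many nonzero products; the inserted 1 keeps the set
  nonempty.\<close>

lemma active_lower_bound:
  obtains \<mu> where "0 < \<mu>" "\<And>\<kappa> \<kappa>' i. \<kappa> \<in> \<Gamma> \<Longrightarrow> \<kappa>' \<in> \<Gamma> \<Longrightarrow> Uc \<kappa> i \<noteq> 0 \<Longrightarrow> Vc \<kappa>' i \<noteq> 0 \<Longrightarrow> \<mu> \<le> cmod (Uc \<kappa> i) * cmod (Vc \<kappa>' i)"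
proof -
  define P where "P = (\<lambda>(\<kappa>, \<kappa>', i). cmod (Uc \<kappa> i) * cmod (Vc \<kappa>' i)) ` (\<Gamma> \<times> \<Gamma> \<times> UNIV)"
  have "finite P" unfolding P_def using finite_\<Gamma> by simp
  then have f: "finite (insert 1 (P - {0}))" by simp
  have P0: "0 \<le> p" if "p \<in> P" for p using that by (auto simp: P_def)
  show ?thesis
  proof (rule that[of "Min (insert 1 (P - {0}))"])
    have "0 < p" if "p \<in> insert 1 (P - {0})" for p using that P0[of p] by auto
    then show "0 < Min (insert 1 (P - {0}))" using f by (subst Min_gr_iff) auto
    fix \<kappa> \<kappa>' and i assume "\<kappa> \<in> \<Gamma>" "\<kappa>' \<in> \<Gamma>" "Uc \<kappa> i \<noteq> 0" "Vc \<kappa>' i \<noteq> 0"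
    then have "cmod (Uc \<kappa> i) * cmod (Vc \<kappa>' i) \<in> insert 1 (P - {0})" by (force simp: P_def)
    then show "Min (insert 1 (P - {0})) \<le> cmod (Uc \<kappa> i) * cmod (Vc \<kappa>' i)" using f by (rule Min_le[rotated])
  qed
qed

text \<open>The Cauchy integral of each active index splits into the contributions of the single
  contours. Those with \<open>Vc \<kappa>' i = 0\<close> are zero, the others are covered by
  \<open>near_term\<close>, which costs a factor 8 in the radius.\<close>

lemma ext_local_step:
  assumes sl: "sol w e \<eta>" and m: "margin w \<delta>" and k: "\<kappa> \<in> \<Gamma>"
    and \<rho>: "0 < \<rho>" "\<rho> \<le> 1" and cmp: "\<And>i v. v \<in> ball z0 \<rho> \<Longrightarrow> cmod (exp (cubic w i v)) \<le> 2 * cmod (exp (cubic w i z0)) \<and>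
      cmod (exp (cubic w i z0)) \<le> 2 * cmod (exp (cubic w i v))"
    and B: "B = 4 * mass w \<delta> * exp (\<delta> - \<delta> * cmod z0)"
      "\<And>\<kappa>' i. \<kappa>' \<in> \<Gamma> \<Longrightarrow> Uc \<kappa> i \<noteq> 0 \<Longrightarrow> Vc \<kappa>' i \<noteq> 0 \<Longrightarrow> 4 * B / \<rho> < cmod (Uc \<kappa> i) * cmod (Vc \<kappa>' i)"
    and closed: "\<And>\<kappa>'. \<kappa>' \<in> \<Gamma> \<Longrightarrow> closed_contour \<kappa>' \<Longrightarrow> contour_image \<kappa>' \<inter> ball z0 \<rho> = {}"
    and L: "\<And>\<kappa>' i. \<kappa>' \<in> \<Gamma> \<Longrightarrow> line_norm \<kappa>' (\<lambda>v. G w i v * \<eta> v) \<le> L" and K: "0 \<le> K" "0 \<le> L"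
    and IH: "\<And>\<kappa>' C. \<kappa>' \<in> \<Gamma> \<Longrightarrow> sz w \<kappa>' z0 < sz w \<kappa> z0 \<Longrightarrow> connected C \<Longrightarrow> C \<subseteq> ball z0 \<rho> \<inter> nbhd \<kappa>' \<Longrightarrow>
       \<exists>a. a holomorphic_on ball z0 \<rho> \<and> (\<forall>v\<in>ball z0 \<rho>. cmod (a v) \<le> K * sz w \<kappa>' z0) \<and> (\<forall>u\<in>C. ext w e \<eta> \<kappa>' u = a u)"
    and C: "connected C" "C \<subseteq> ball z0 (\<rho> / 8) \<inter> nbhd \<kappa>"
  shows "\<exists>a. a holomorphic_on ball z0 (\<rho> / 8) \<and> (\<forall>v\<in>ball z0 (\<rho> / 8). cmod (a v) \<le>
      2 * ((\<Sum>i\<in>UNIV. cmod (e i)) + card \<Gamma> * ((8 * L + 48 * pi * B * K) / \<rho>)) * sz w \<kappa> z0) \<and> (\<forall>u\<in>C. ext w e \<eta> \<kappa> u = a u)"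
proof -
  define D where "D = (8 * L + 48 * pi * B * K) / \<rho>"
  have B0: "0 \<le> B" unfolding B(1) using mass_nonneg by simp
  have D0: "0 \<le> D" using B0 K \<rho> by (simp add: D_def)
  define Q where "Q = (\<lambda>i \<kappa>' k. k holomorphic_on ball z0 (\<rho> / 8) \<and> (\<forall>u\<in>ball z0 (\<rho> / 8). cmod (k u) \<le> D) \<and>
     (\<forall>u\<in>C. line_integral \<kappa>' (\<lambda>v. G w i v * \<eta> v / (u - v)) = k u))"
  have "\<exists>k. Q i \<kappa>' k" if "\<kappa>' \<in> \<Gamma>" "Uc \<kappa> i \<noteq> 0" for i \<kappa>'
  proof (cases "Vc \<kappa>' i = 0")
    case True
    then have "line_integral \<kappa>' (\<lambda>v. G w i v * \<eta> v / (u - v)) = line_integral \<kappa>' (\<lambda>v. 0)" for u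
      by (intro line_integral_cong) (simp add: G_def V_eq[OF that(1)])
    then show ?thesis using D0 by (intro exI[of _ "\<lambda>_. 0"]) (simp add: Q_def)
  next
    case False
    show ?thesis unfolding Q_def D_def
      by (rule near_term[OF sl m k that(1,2) False \<rho> cmp B(1) B(2)[OF that False] closed[OF that(1)] L[OF that(1)] K(1) IH[OF that(1)] C])
  qed
  then have "\<forall>i. \<forall>\<kappa>'. \<exists>k. \<kappa>' \<in> \<Gamma> \<longrightarrow> Uc \<kappa> i \<noteq> 0 \<longrightarrow> Q i \<kappa>' k" by blast
  then obtain kk where kk: "\<And>i \<kappa>'. \<kappa>' \<in> \<Gamma> \<Longrightarrow> Uc \<kappa> i \<noteq> 0 \<Longrightarrow> Q i \<kappa>' (kk i \<kappa>')" by metis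
  define a where "a = (\<lambda>u. \<Sum>i\<in>{i. Uc \<kappa> i \<noteq> 0}. exp (cubic w i u) * Uc \<kappa> i * (e i + (\<Sum>\<kappa>'\<in>\<Gamma>. kk i \<kappa>' u)))"
  show ?thesis
  proof (intro exI[of _ a] conjI ballI)
    show "a holomorphic_on ball z0 (\<rho> / 8)" unfolding a_def
      using kk by (intro holomorphic_intros) (auto simp: Q_def)
    fix u assume u: "u \<in> ball z0 (\<rho> / 8)"
    then have u': "u \<in> ball z0 \<rho>" using \<rho> by auto
    have "cmod (a u) \<le> (\<Sum>i\<in>{i. Uc \<kappa> i \<noteq> 0}. 2 * (cmod (exp (cubic w i z0)) * cmod (Uc \<kappa> i)) * ((\<Sum>i\<in>UNIV. cmod (e i)) + card \<Gamma> * D))"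
      unfolding a_def
    proof (intro order_trans[OF norm_sum] sum_mono)
      fix i assume i: "i \<in> {i. Uc \<kappa> i \<noteq> 0}"
      have f1: "cmod (e i + (\<Sum>\<kappa>'\<in>\<Gamma>. kk i \<kappa>' u)) \<le> (\<Sum>i\<in>UNIV. cmod (e i)) + card \<Gamma> * D"
      proof (intro order_trans[OF norm_triangle_ineq] add_mono)
        show "cmod (e i) \<le> (\<Sum>i\<in>UNIV. cmod (e i))" by (rule member_le_sum) auto
        show "cmod (\<Sum>\<kappa>'\<in>\<Gamma>. kk i \<kappa>' u) \<le> card \<Gamma> * D"
          using kk i u by (intro order_trans[OF norm_sum] sum_bounded_above) (auto simp: Q_def)
      qed
      have f2: "cmod (exp (cubic w i u)) * cmod (Uc \<kappa> i) \<le> 2 * (cmod (exp (cubic w i z0)) * cmod (Uc \<kappa> i))"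
        using mult_right_mono[OF conjunct1[OF cmp[OF u', of i]] norm_ge_zero[of "Uc \<kappa> i"]] by (simp only: mult.assoc)
      show "cmod (exp (cubic w i u) * Uc \<kappa> i * (e i + (\<Sum>\<kappa>'\<in>\<Gamma>. kk i \<kappa>' u))) \<le>
         2 * (cmod (exp (cubic w i z0)) * cmod (Uc \<kappa> i)) * ((\<Sum>i\<in>UNIV. cmod (e i)) + card \<Gamma> * D)"
        unfolding norm_mult by (rule mult_mono[OF f2 f1]) auto
    qed
    also have "\<dots> \<le> (\<Sum>i\<in>UNIV. 2 * (cmod (exp (cubic w i z0)) * cmod (Uc \<kappa> i)) * ((\<Sum>i\<in>UNIV. cmod (e i)) + card \<Gamma> * D))"
      using D0 by (intro sum_mono2 mult_nonneg_nonneg add_nonneg_nonneg sum_nonneg) auto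
    also have "\<dots> = 2 * ((\<Sum>i\<in>UNIV. cmod (e i)) + card \<Gamma> * D) * sz w \<kappa> z0"
      unfolding sz_def by (simp only: sum_distrib_left mult_ac)
    finally show "cmod (a u) \<le> 2 * ((\<Sum>i\<in>UNIV. cmod (e i)) + card \<Gamma> * ((8 * L + 48 * pi * B * K) / \<rho>)) * sz w \<kappa> z0"
      by (simp add: D_def)
  next
    fix u assume u: "u \<in> C"
    have "ext w e \<eta> \<kappa> u = (\<Sum>i\<in>{i. Uc \<kappa> i \<noteq> 0}. exp (cubic w i u) * Uc \<kappa> i * (e i + dz_integral \<Gamma> (\<lambda>v. G w i v * \<eta> v / (u - v))))"
      unfolding ext_def by (rule sum.mono_neutral_right) auto
    also have "\<dots> = a u"
      unfolding a_def dz_integral_eq using kk u by (intro sum.cong refl) (auto simp: Q_def)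
    finally show "ext w e \<eta> \<kappa> u = a u" .
  qed
qed

text \<open>
  If \<open>\<kappa>'\<close> comes close to \<open>z0\<close>, its length there is bounded below, hence \<open>sz w \<kappa>' z0 * gz w \<kappa>' z0\<close> is exponentially
  small by \<open>length_bound\<close>, whereas \<open>sz w \<kappa> z0 * gz w \<kappa>' z0\<close> is bounded below as soon as \<open>\<kappa>'\<close> contributes to the
  equation on \<open>\<kappa>\<close>. So only contours of smaller \<open>sz\<close> interfere with \<open>\<kappa>\<close>, and induction on the rank is possible.
\<close>

definition rank :: "('n \<Rightarrow> real \<times> real \<times> real) \<Rightarrow> complex \<Rightarrow> contour \<Rightarrow> nat" where
  "rank w z \<kappa> = card {\<kappa>'\<in>\<Gamma>. sz w \<kappa>' z < sz w \<kappa> z}"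

lemma rank_less: "\<kappa>' \<in> \<Gamma> \<Longrightarrow> sz w \<kappa>' z < sz w \<kappa> z \<Longrightarrow> rank w z \<kappa>' < rank w z \<kappa>"
  unfolding rank_def using finite_\<Gamma> by (intro psubset_card_mono) force+

text \<open>The initial radius \<open>1 / q z0\<close> is the scale on which the exponentials change
  by a factor of at most 2. Each rank costs a factor 8 in the radius and one power of
  \<open>q z0\<close> in the bound, and may enlarge \<open>K\<close> and \<open>R0\<close>; none of
  these constants depends on \<open>z0\<close>. The connected set \<open>C\<close> occurs in the
  statement because the continuation of an arc integral depends on the side of the arc.\<close>

lemma ext_local:
  assumes sl: "sol w e \<eta>" and m: "margin w \<delta>" and b: "1 \<le> b"
    and cmp: "\<And>i z v. cmod (v - z) * (b * (1 + cmod z)\<^sup>2) \<le> 1 \<Longrightarrow> cmod (exp (cubic w i v)) \<le> 2 * cmod (exp (cubic w i z)) \<and>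
      cmod (exp (cubic w i z)) \<le> 2 * cmod (exp (cubic w i v))"
  defines "q \<equiv> \<lambda>z::complex. b * (1 + cmod z)\<^sup>2"
  shows "\<exists>K N R0. 0 \<le> K \<and> (\<forall>z0 \<kappa> C. R0 \<le> cmod z0 \<longrightarrow> \<kappa> \<in> \<Gamma> \<longrightarrow> rank w z0 \<kappa> < n \<longrightarrow> connected C \<longrightarrow>
     C \<subseteq> ball z0 (1 / (q z0 * 8 ^ n)) \<inter> nbhd \<kappa> \<longrightarrow>
     (\<exists>a. a holomorphic_on ball z0 (1 / (q z0 * 8 ^ n)) \<and> (\<forall>v\<in>ball z0 (1 / (q z0 * 8 ^ n)). cmod (a v) \<le> K * q z0 ^ N * sz w \<kappa> z0) \<and>
       (\<forall>u\<in>C. ext w e \<eta> \<kappa> u = a u)))"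
proof (induction n)
  case 0
  show ?case by (intro exI[of _ 0]) simp
next
  case (Suc n)
  then obtain K N R0 where K: "0 \<le> K" and IH: "\<And>z0 \<kappa> C. R0 \<le> cmod z0 \<Longrightarrow> \<kappa> \<in> \<Gamma> \<Longrightarrow> rank w z0 \<kappa> < n \<Longrightarrow> connected C \<Longrightarrow>
     C \<subseteq> ball z0 (1 / (q z0 * 8 ^ n)) \<inter> nbhd \<kappa> \<Longrightarrow>
     \<exists>a. a holomorphic_on ball z0 (1 / (q z0 * 8 ^ n)) \<and> (\<forall>v\<in>ball z0 (1 / (q z0 * 8 ^ n)). cmod (a v) \<le> K * q z0 ^ N * sz w \<kappa> z0) \<and>
       (\<forall>u\<in>C. ext w e \<eta> \<kappa> u = a u)" by blast
  have d0: "0 < \<delta>" using m by (simp add: margin_def)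
  have q1: "1 \<le> q z" for z
  proof -
    have "1 \<le> (1 + cmod z)\<^sup>2" by simp
    then show ?thesis using b mult_mono[of 1 b 1 "(1 + cmod z)\<^sup>2"] by (simp add: q_def)
  qed
  obtain \<mu> where mu: "0 < \<mu>" "\<And>\<kappa> \<kappa>' i. \<kappa> \<in> \<Gamma> \<Longrightarrow> \<kappa>' \<in> \<Gamma> \<Longrightarrow> Uc \<kappa> i \<noteq> 0 \<Longrightarrow> Vc \<kappa>' i \<noteq> 0 \<Longrightarrow> \<mu> \<le> cmod (Uc \<kappa> i) * cmod (Vc \<kappa>' i)"
    using active_lower_bound by metis
  \<comment> \<open>Beyond \<open>R1\<close> the exponential factor of \<open>B\<close> beats the
    polynomial \<open>1 / \<rho>\<close>, and \<open>4 * B / \<rho>\<close> falls below the least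
    active product \<open>\<mu>\<close>. Beyond \<open>R2 + 1\<close> no closed contour meets the
    ball, whose radius is at most 1.\<close>
  obtain R1 where R1: "\<And>x. R1 \<le> x \<Longrightarrow> (16 * mass w \<delta> * 8 ^ n) * exp (\<delta> - \<delta> * x) * (b * (1 + x)\<^sup>2) < \<mu>"
    using exp_poly_small[OF d0 mu(1)] by metis
  obtain R2 where R2: "\<And>\<kappa> v. \<kappa> \<in> \<Gamma> \<Longrightarrow> closed_contour \<kappa> \<Longrightarrow> v \<in> contour_image \<kappa> \<Longrightarrow> cmod v \<le> R2"
    using closed_contours_bounded by metis
  define L where "L = (\<Sum>i\<in>UNIV. dz_norm \<Gamma> (\<lambda>v. G w i v * \<eta> v))"
  have L0: "0 \<le> L" unfolding L_def by (intro sum_nonneg dz_norm_nonneg)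
  have L: "line_norm \<kappa>' (\<lambda>v. G w i v * \<eta> v) \<le> L" if "\<kappa>' \<in> \<Gamma>" for \<kappa>' i
    using line_norm_le_dz_norm[OF finite_\<Gamma> that] member_le_sum[of i UNIV "\<lambda>i. dz_norm \<Gamma> (\<lambda>v. G w i v * \<eta> v)"]
    unfolding L_def by (auto simp: dz_norm_nonneg intro: order_trans)
  define B0 where "B0 = 4 * mass w \<delta> * exp \<delta>"
  have B00: "0 \<le> B0" unfolding B0_def using mass_nonneg by simp
  define e0 where "e0 = (\<Sum>i\<in>UNIV. cmod (e i))"
  have e0: "0 \<le> e0" unfolding e0_def by (intro sum_nonneg) auto
  define K' where "K' = 2 * (e0 + card \<Gamma> * ((8 * L + 48 * pi * B0 * K) * 8 ^ n))"
  have K'0: "0 \<le> K'" using e0 L0 B00 K by (simp add: K'_def)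
  show ?case
  proof (rule exI[of _ K'], rule exI[of _ "Suc N"], rule exI[of _ "max R0 (max R1 (R2 + 1))"], intro conjI K'0 allI impI)
    fix z0 \<kappa> C
    assume z0: "max R0 (max R1 (R2 + 1)) \<le> cmod z0" and k: "\<kappa> \<in> \<Gamma>" and rk: "rank w z0 \<kappa> < Suc n"
      and C: "connected C" "C \<subseteq> ball z0 (1 / (q z0 * 8 ^ Suc n)) \<inter> nbhd \<kappa>"
    define \<rho> where "\<rho> = 1 / (q z0 * 8 ^ n)"
    have q0: "0 < q z0" using q1[of z0] by linarith
    have one: "(1::real) \<le> 8 ^ n" by simp
    have q8: "1 \<le> q z0 * 8 ^ n" using q1[of z0] one mult_mono[of 1 "q z0" 1 "8 ^ n"] by simp
    have \<rho>: "0 < \<rho>" "\<rho> \<le> 1" using q0 q8 by (auto simp: \<rho>_def)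
    have \<rho>8: "1 / (q z0 * 8 ^ Suc n) = \<rho> / 8" by (simp add: \<rho>_def)
    have c: "cmod (exp (cubic w i v)) \<le> 2 * cmod (exp (cubic w i z0)) \<and> cmod (exp (cubic w i z0)) \<le> 2 * cmod (exp (cubic w i v))"
      if "v \<in> ball z0 \<rho>" for i v
    proof (rule cmp)
      have "cmod (v - z0) \<le> \<rho>" using that by (simp add: dist_norm norm_minus_commute)
      then have "cmod (v - z0) * q z0 \<le> \<rho> * q z0" using q0 by (intro mult_right_mono) auto
      also have "\<dots> \<le> 1" using q0 one by (simp add: \<rho>_def)
      finally show "cmod (v - z0) * (b * (1 + cmod z0)\<^sup>2) \<le> 1" by (simp add: q_def)
    qed
    define B where "B = 4 * mass w \<delta> * exp (\<delta> - \<delta> * cmod z0)"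
    have "4 * B / \<rho> < \<mu>" using R1[of "cmod z0"] z0 by (simp add: B_def \<rho>_def q_def mult_ac)
    then have B2: "4 * B / \<rho> < cmod (Uc \<kappa> i) * cmod (Vc \<kappa>' i)" if "\<kappa>' \<in> \<Gamma>" "Uc \<kappa> i \<noteq> 0" "Vc \<kappa>' i \<noteq> 0" for \<kappa>' i
      using mu(2)[OF k that] by linarith
    have cl: "contour_image \<kappa>' \<inter> ball z0 \<rho> = {}" if "\<kappa>' \<in> \<Gamma>" "closed_contour \<kappa>'" for \<kappa>'
    proof -
      have "v \<notin> ball z0 \<rho>" if v: "v \<in> contour_image \<kappa>'" for v
      proof -
        have "cmod v \<le> R2" using R2 \<open>\<kappa>' \<in> \<Gamma>\<close> \<open>closed_contour \<kappa>'\<close> v by blast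
        then show ?thesis using z0 \<rho> norm_triangle_ineq[of "z0 - v" v] by (auto simp: dist_norm)
      qed
      then show ?thesis by blast
    qed
    have Kq: "0 \<le> K * q z0 ^ N" using K q0 by simp
    have ih: "\<exists>a. a holomorphic_on ball z0 \<rho> \<and> (\<forall>v\<in>ball z0 \<rho>. cmod (a v) \<le> K * q z0 ^ N * sz w \<kappa>' z0) \<and> (\<forall>u\<in>C. ext w e \<eta> \<kappa>' u = a u)"
      if "\<kappa>' \<in> \<Gamma>" "sz w \<kappa>' z0 < sz w \<kappa> z0" "connected C" "C \<subseteq> ball z0 \<rho> \<inter> nbhd \<kappa>'" for \<kappa>' C
      using IH[of z0 \<kappa>' C] that rank_less[OF that(1,2)] rk z0 unfolding \<rho>_def by simp
    have "B \<le> B0" unfolding B_def B0_def using d0 mass_nonneg by (intro mult_left_mono) auto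
    have qN: "1 \<le> q z0 ^ N" using q1 by (rule one_le_power)
    have bound: "2 * (e0 + card \<Gamma> * ((8 * L + 48 * pi * B * (K * q z0 ^ N)) / \<rho>)) \<le> K' * q z0 ^ Suc N"
    proof -
      have "8 * L + 48 * pi * B * (K * q z0 ^ N) \<le> 8 * L * q z0 ^ N + 48 * pi * B0 * (K * q z0 ^ N)"
        using \<open>B \<le> B0\<close> Kq L0 qN mult_left_mono[OF qN, of "8 * L"] by (intro add_mono mult_right_mono) auto
      then have "(8 * L + 48 * pi * B * (K * q z0 ^ N)) * (q z0 * 8 ^ n) \<le> (8 * L * q z0 ^ N + 48 * pi * B0 * (K * q z0 ^ N)) * (q z0 * 8 ^ n)"
        using q0 by (intro mult_right_mono) auto
      also have "\<dots> = (8 * L + 48 * pi * B0 * K) * 8 ^ n * q z0 ^ Suc N" by (simp add: algebra_simps)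
      finally have c: "card \<Gamma> * ((8 * L + 48 * pi * B * (K * q z0 ^ N)) / \<rho>) \<le> card \<Gamma> * ((8 * L + 48 * pi * B0 * K) * 8 ^ n * q z0 ^ Suc N)"
        by (intro mult_left_mono) (simp_all add: \<rho>_def)
      have e: "e0 \<le> e0 * q z0 ^ Suc N" using mult_left_mono[OF one_le_power[OF q1] e0, of z0 "Suc N"] by simp
      have "2 * (e0 + card \<Gamma> * ((8 * L + 48 * pi * B * (K * q z0 ^ N)) / \<rho>))
        \<le> 2 * (e0 * q z0 ^ Suc N + card \<Gamma> * ((8 * L + 48 * pi * B0 * K) * 8 ^ n * q z0 ^ Suc N))"
        by (intro mult_left_mono add_mono c e) simp
      also have "\<dots> = K' * q z0 ^ Suc N" unfolding K'_def by (simp only: algebra_simps)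
      finally show ?thesis .
    qed
    obtain a where a: "a holomorphic_on ball z0 (\<rho> / 8)"
      "\<And>v. v\<in>ball z0 (\<rho> / 8) \<Longrightarrow> cmod (a v) \<le> 2 * (e0 + card \<Gamma> * ((8 * L + 48 * pi * B * (K * q z0 ^ N)) / \<rho>)) * sz w \<kappa> z0"
      "\<And>u. u\<in>C \<Longrightarrow> ext w e \<eta> \<kappa> u = a u"
      using ext_local_step[OF sl m k \<rho> c B_def B2 cl L Kq L0 ih C[unfolded \<rho>8]] unfolding e0_def by blast
    show "\<exists>a. a holomorphic_on ball z0 (1 / (q z0 * 8 ^ Suc n)) \<and>
        (\<forall>v\<in>ball z0 (1 / (q z0 * 8 ^ Suc n)). cmod (a v) \<le> K' * q z0 ^ Suc N * sz w \<kappa> z0) \<and> (\<forall>u\<in>C. ext w e \<eta> \<kappa> u = a u)"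
      unfolding \<rho>8
    proof (intro exI[of _ a] conjI ballI a)
      fix v assume "v \<in> ball z0 (\<rho> / 8)"
      from order_trans[OF a(2)[OF this] mult_right_mono[OF bound sz_nonneg]]
      show "cmod (a v) \<le> K' * q z0 ^ Suc N * sz w \<kappa> z0" .
    qed
  qed
qed


lemma cubic_compare:
  fixes w :: "'n \<Rightarrow> real \<times> real \<times> real"
  obtains b :: real where "1 \<le> b"
    "\<And>i z v. cmod (v - z) * (b * (1 + cmod z)\<^sup>2) \<le> 1 \<Longrightarrow> cmod (exp (cubic w i v)) \<le> 2 * cmod (exp (cubic w i z)) \<and>
      cmod (exp (cubic w i z)) \<le> 2 * cmod (exp (cubic w i v))"
proof -
  obtain b :: real where b: "1 \<le> b"
    "\<And>i z v. cmod (v - z) * (b * (1 + cmod z)\<^sup>2) \<le> 1 \<Longrightarrow> cmod (exp (cubic w i v)) \<le> 2 * cmod (exp (cubic w i z))"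
    "\<And>i z v. cmod (v - z) * (b * (1 + cmod z)\<^sup>2) \<le> 1 \<Longrightarrow> cmod (exp (- cubic w i v)) \<le> 2 * cmod (exp (- cubic w i z))"
    using norm_exp_cubic_near[of w] by metis
  show ?thesis
  proof (rule that[OF b(1)])
    fix i z v assume v: "cmod (v - z) * (b * (1 + cmod z)\<^sup>2) \<le> 1"
    have "cmod (exp (cubic w i z)) \<le> 2 * cmod (exp (cubic w i v))"
      using b(3)[OF v, of i] unfolding norm_exp_eq_Re by (simp add: exp_minus field_simps)
    then show "cmod (exp (cubic w i v)) \<le> 2 * cmod (exp (cubic w i z)) \<and> cmod (exp (cubic w i z)) \<le> 2 * cmod (exp (cubic w i v))"
      using b(2)[OF v, of i] by simp
  qed
qed

text \<open>The local continuation is used at points \<open>z0 = u\<close> of the contours, with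
  \<open>n\<close> above every possible rank and with \<open>C\<close> the component of
  \<open>u\<close> in the disc without the other contours. It agrees with \<open>ext\<close> near
  \<open>u\<close>, so Cauchy's inequality on the circle of half the radius bounds the derivative
  too, at the cost of one more power of \<open>q\<close>.\<close>

lemma growth_far:
  assumes sl: "sol w e \<eta>" and m: "margin w \<delta>"
  shows "\<exists>K N R0. 0 \<le> K \<and> (\<forall>\<kappa>\<in>\<Gamma>. \<forall>u\<in>contour_image \<kappa>. R0 \<le> cmod u \<longrightarrow>
    cmod (\<eta> u) \<le> K * (1 + cmod u) ^ N * sz w \<kappa> u \<and> cmod (deriv (ext w e \<eta> \<kappa>) u) \<le> K * (1 + cmod u) ^ N * sz w \<kappa> u)"
proof -
  obtain b :: real where b: "1 \<le> b"
    "\<And>i z v. cmod (v - z) * (b * (1 + cmod z)\<^sup>2) \<le> 1 \<Longrightarrow> cmod (exp (cubic w i v)) \<le> 2 * cmod (exp (cubic w i z)) \<and>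
      cmod (exp (cubic w i z)) \<le> 2 * cmod (exp (cubic w i v))"
    using cubic_compare[of w] by metis
  define q where "q = (\<lambda>z::complex. b * (1 + cmod z)\<^sup>2)"
  define n where "n = Suc (card \<Gamma>)"
  obtain K N R0 where K: "0 \<le> K" and loc: "\<And>z0 \<kappa> C. R0 \<le> cmod z0 \<Longrightarrow> \<kappa> \<in> \<Gamma> \<Longrightarrow> rank w z0 \<kappa> < n \<Longrightarrow> connected C \<Longrightarrow>
     C \<subseteq> ball z0 (1 / (q z0 * 8 ^ n)) \<inter> nbhd \<kappa> \<Longrightarrow>
     \<exists>a. a holomorphic_on ball z0 (1 / (q z0 * 8 ^ n)) \<and> (\<forall>v\<in>ball z0 (1 / (q z0 * 8 ^ n)). cmod (a v) \<le> K * q z0 ^ N * sz w \<kappa> z0) \<and>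
       (\<forall>u\<in>C. ext w e \<eta> \<kappa> u = a u)"
    using ext_local[OF sl m b, of n] unfolding q_def by blast
  have q1: "1 \<le> q z" for z
  proof -
    have "1 \<le> (1 + cmod z)\<^sup>2" by simp
    then show ?thesis using b(1) mult_mono[of 1 b 1 "(1 + cmod z)\<^sup>2"] by (simp add: q_def)
  qed
  define K' where "K' = 2 * 8 ^ n * K * b ^ Suc N"
  have bd: "2 * 8 ^ n * (K * q u ^ Suc N) \<le> K' * (1 + cmod u) ^ (2 * Suc N)" for u
    by (simp only: K'_def q_def power_mult_distrib power_mult mult.assoc order_refl)
  have small: "K * q u ^ N \<le> 2 * 8 ^ n * (K * q u ^ Suc N)" for u
  proof -
    have "q u ^ N * 1 \<le> q u ^ N * q u" using q1[of u] by (intro mult_left_mono) auto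
    then have "K * q u ^ N \<le> K * q u ^ Suc N" using K by (intro mult_left_mono) (auto simp: mult.commute)
    also have "\<dots> = 1 * (K * q u ^ Suc N)" by simp
    also have "\<dots> \<le> (2 * 8 ^ n) * (K * q u ^ Suc N)"
    proof (rule mult_right_mono)
      have "(1::real) \<le> 8 ^ n" by simp
      then show "(1::real) \<le> 2 * 8 ^ n" by linarith
      show "0 \<le> K * q u ^ Suc N" using K q1[of u] by simp
    qed
    finally show ?thesis .
  qed
  show ?thesis
  proof (rule exI[of _ K'], rule exI[of _ "2 * Suc N"], rule exI[of _ R0], rule conjI[OF _ ballI[OF ballI[OF impI]]])
    show "0 \<le> K'" using K b(1) by (simp add: K'_def)
    fix \<kappa> u assume k: "\<kappa> \<in> \<Gamma>" and u: "u \<in> contour_image \<kappa>" and R: "R0 \<le> cmod u"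
    define \<rho> where "\<rho> = 1 / (q u * 8 ^ n)"
    have \<rho>: "0 < \<rho>" using q1[of u] by (simp add: \<rho>_def)
    define W where "W = ball u \<rho> \<inter> nbhd \<kappa>"
    define C where "C = connected_component_set W u"
    have W: "open W" "u \<in> W" using \<rho> image_subset_nbhd[OF k] u open_nbhd[of \<kappa>] by (auto simp: W_def)
    have C: "open C" "u \<in> C" "connected C" "C \<subseteq> W"
      using W by (auto simp: C_def open_connected_component connected_component_subset)
    have "rank w u \<kappa> < n" unfolding rank_def n_def by (intro le_imp_less_Suc card_mono finite_\<Gamma>) auto
    from loc[OF R k this C(3)] C(4)[unfolded W_def \<rho>_def]
    obtain a where a: "a holomorphic_on ball u \<rho>" "\<And>v. v\<in>ball u \<rho> \<Longrightarrow> cmod (a v) \<le> K * q u ^ N * sz w \<kappa> u"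
      "\<And>v. v\<in>C \<Longrightarrow> ext w e \<eta> \<kappa> v = a v" unfolding \<rho>_def by blast
    have "cmod (\<eta> u) \<le> K * q u ^ N * sz w \<kappa> u"
      using a(2)[of u] a(3)[OF C(2)] ext_eq[OF sl k u] \<rho> by simp
    also have "\<dots> \<le> (K' * (1 + cmod u) ^ (2 * Suc N)) * sz w \<kappa> u"
      by (rule mult_right_mono[OF order_trans[OF small bd] sz_nonneg])
    finally have 1: "cmod (\<eta> u) \<le> K' * (1 + cmod u) ^ (2 * Suc N) * sz w \<kappa> u" .
    have ev: "\<forall>\<^sub>F v in nhds u. ext w e \<eta> \<kappa> v = a v"
      using eventually_nhds_in_open[OF C(1,2)] by (rule eventually_mono) (rule a(3))
    have "deriv (ext w e \<eta> \<kappa>) u = deriv a u" by (rule deriv_cong_ev[OF ev refl])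
    moreover have "cmod ((deriv ^^ 1) a u) \<le> fact 1 * (K * q u ^ N * sz w \<kappa> u) / (\<rho> / 2) ^ 1"
    proof (rule Cauchy_inequality)
      have sub: "cball u (\<rho> / 2) \<subseteq> ball u \<rho>" using \<rho> by auto
      show "a holomorphic_on ball u (\<rho> / 2)" using \<rho> by (intro holomorphic_on_subset[OF a(1)]) auto
      show "continuous_on (cball u (\<rho> / 2)) a"
        by (rule continuous_on_subset[OF holomorphic_on_imp_continuous_on[OF a(1)] sub])
      show "cmod (a v) \<le> K * q u ^ N * sz w \<kappa> u" if "cmod (u - v) = \<rho> / 2" for v
        using that \<rho> by (intro a(2)) (auto simp: dist_norm)
    qed (use \<rho> in simp)
    ultimately have "cmod (deriv (ext w e \<eta> \<kappa>) u) \<le> 2 * 8 ^ n * (K * q u ^ Suc N) * sz w \<kappa> u"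
      by (simp add: \<rho>_def mult_ac)
    also have "\<dots> \<le> (K' * (1 + cmod u) ^ (2 * Suc N)) * sz w \<kappa> u"
      by (rule mult_right_mono[OF bd sz_nonneg])
    finally show "cmod (\<eta> u) \<le> K' * (1 + cmod u) ^ (2 * Suc N) * sz w \<kappa> u \<and> cmod (deriv (ext w e \<eta> \<kappa>) u) \<le> K' * (1 + cmod u) ^ (2 * Suc N) * sz w \<kappa> u"
      using 1 by simp
  qed
qed

lemma continuous_on_sz: "continuous_on A (sz w \<kappa>)"
  unfolding sz_def by (intro continuous_intros)

lemma deriv_ext_continuous:
  assumes "sol w e \<eta>" "\<kappa> \<in> \<Gamma>"
  shows "continuous_on (contour_image \<kappa>) (deriv (ext w e \<eta> \<kappa>))"
proof (rule continuous_on_subset[OF _ image_subset_nbhd[OF assms(2)]])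
  have "ext w e \<eta> \<kappa> holomorphic_on nbhd \<kappa>" using ext_holomorphic assms by (auto simp: sol_def)
  then show "continuous_on (nbhd \<kappa>) (deriv (ext w e \<eta> \<kappa>))"
    by (intro holomorphic_on_imp_continuous_on holomorphic_deriv open_nbhd)
qed

text \<open>Far out this is \<open>growth_far\<close>; on the compact remainder of a contour the
  quotient by \<open>sz\<close> is continuous, hence bounded. On a contour with
  \<open>Uc \<kappa> = (\<lambda>_. 0)\<close> the divisor is 0, but there the solution and its
  continuation vanish.\<close>

theorem growth:
  assumes sl: "sol w e \<eta>" and m: "margin w \<delta>"
  obtains K N where "0 \<le> K"
    "\<And>\<kappa> u. \<kappa> \<in> \<Gamma> \<Longrightarrow> u \<in> contour_image \<kappa> \<Longrightarrow> cmod (\<eta> u) \<le> K * (1 + cmod u) ^ N * (\<Sum>i\<in>UNIV. cmod (F w i u))"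
    "\<And>\<kappa> u. \<kappa> \<in> \<Gamma> \<Longrightarrow> u \<in> contour_image \<kappa> \<Longrightarrow> cmod (deriv (ext w e \<eta> \<kappa>) u) \<le> K * (1 + cmod u) ^ N * (\<Sum>i\<in>UNIV. cmod (F w i u))"
proof -
  obtain K N R0 where K: "0 \<le> K" and far: "\<And>\<kappa> u. \<kappa>\<in>\<Gamma> \<Longrightarrow> u\<in>contour_image \<kappa> \<Longrightarrow> R0 \<le> cmod u \<Longrightarrow>
    cmod (\<eta> u) \<le> K * (1 + cmod u) ^ N * sz w \<kappa> u \<and> cmod (deriv (ext w e \<eta> \<kappa>) u) \<le> K * (1 + cmod u) ^ N * sz w \<kappa> u"
    using growth_far[OF sl m] by blast
  have "\<exists>K1\<ge>0. \<forall>u\<in>contour_image \<kappa>. cmod u \<le> R0 \<longrightarrow> cmod (\<eta> u) \<le> K1 * sz w \<kappa> u \<and> cmod (deriv (ext w e \<eta> \<kappa>) u) \<le> K1 * sz w \<kappa> u"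
    if k: "\<kappa> \<in> \<Gamma>" for \<kappa>
  proof (cases "Uc \<kappa> = (\<lambda>_. 0)")
    case True
    then have "ext w e \<eta> \<kappa> = (\<lambda>_. 0)" by (simp add: ext_def fun_eq_iff)
    then show ?thesis using ext_eq[OF sl k] sz_nonneg by (intro exI[of _ 0]) auto
  next
    case False
    then obtain j where "Uc \<kappa> j \<noteq> 0" by (auto simp: fun_eq_iff)
    then have pos: "0 < sz w \<kappa> u" for u by (rule sz_pos)
    define X where "X = contour_image \<kappa> \<inter> cball 0 R0"
    have X: "compact X" unfolding X_def using closed_contour_image[OF system k] by (intro closed_Int_compact) auto
    have "continuous_on X (\<lambda>u. (cmod (\<eta> u) + cmod (deriv (ext w e \<eta> \<kappa>) u)) / sz w \<kappa> u)"
      using pos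
      by (intro continuous_intros continuous_on_subset[OF sol_continuous[OF sl k]] continuous_on_subset[OF deriv_ext_continuous[OF sl k]] continuous_on_sz)
        (auto simp: X_def less_imp_neq[OF pos, symmetric])
    then have "bounded ((\<lambda>u. (cmod (\<eta> u) + cmod (deriv (ext w e \<eta> \<kappa>) u)) / sz w \<kappa> u) ` X)"
      by (intro compact_imp_bounded compact_continuous_image X)
    then obtain K1 where K1: "\<And>u. u \<in> X \<Longrightarrow> (cmod (\<eta> u) + cmod (deriv (ext w e \<eta> \<kappa>) u)) / sz w \<kappa> u \<le> K1"
      unfolding bounded_iff by (auto simp: abs_le_iff)
    show ?thesis
    proof (intro exI[of _ "max 0 K1"] conjI ballI impI)
      fix u assume "u \<in> contour_image \<kappa>" "cmod u \<le> R0"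
      then have "u \<in> X" by (simp add: X_def)
      from K1[OF this] have "cmod (\<eta> u) + cmod (deriv (ext w e \<eta> \<kappa>) u) \<le> K1 * sz w \<kappa> u"
        using pos[of u] by (simp add: pos_divide_le_eq)
      also have "\<dots> \<le> max 0 K1 * sz w \<kappa> u" using sz_nonneg by (intro mult_right_mono) auto
      finally have *: "cmod (\<eta> u) + cmod (deriv (ext w e \<eta> \<kappa>) u) \<le> max 0 K1 * sz w \<kappa> u" .
      show "cmod (\<eta> u) \<le> max 0 K1 * sz w \<kappa> u" using * norm_ge_zero[of "deriv (ext w e \<eta> \<kappa>) u"] by linarith
      show "cmod (deriv (ext w e \<eta> \<kappa>) u) \<le> max 0 K1 * sz w \<kappa> u" using * norm_ge_zero[of "\<eta> u"] by linarith
    qed simp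
  qed
  then obtain K1 where K1: "\<And>\<kappa>. \<kappa> \<in> \<Gamma> \<Longrightarrow> 0 \<le> K1 \<kappa>" "\<And>\<kappa> u. \<kappa> \<in> \<Gamma> \<Longrightarrow> u\<in>contour_image \<kappa> \<Longrightarrow> cmod u \<le> R0 \<Longrightarrow>
    cmod (\<eta> u) \<le> K1 \<kappa> * sz w \<kappa> u \<and> cmod (deriv (ext w e \<eta> \<kappa>) u) \<le> K1 \<kappa> * sz w \<kappa> u" by metis
  define K2 where "K2 = K + (\<Sum>\<kappa>\<in>\<Gamma>. K1 \<kappa>)"
  have S0: "0 \<le> (\<Sum>\<kappa>\<in>\<Gamma>. K1 \<kappa>)" using K1(1) by (intro sum_nonneg)
  have main: "cmod (\<eta> u) \<le> K2 * (1 + cmod u) ^ N * sz w \<kappa> u \<and> cmod (deriv (ext w e \<eta> \<kappa>) u) \<le> K2 * (1 + cmod u) ^ N * sz w \<kappa> u"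
    if k: "\<kappa> \<in> \<Gamma>" and u: "u \<in> contour_image \<kappa>" for \<kappa> u
  proof -
    have p1: "1 \<le> (1 + cmod u) ^ N" by (intro one_le_power) simp
    show ?thesis
    proof (cases "cmod u \<le> R0")
      case True
      have "K1 \<kappa> \<le> K2" using K member_le_sum[of \<kappa> \<Gamma> K1] K1(1) k finite_\<Gamma> by (simp add: K2_def)
      then have "K1 \<kappa> * 1 \<le> K2 * (1 + cmod u) ^ N" using p1 K1(1)[OF k] by (intro mult_mono) auto
      from mult_right_mono[OF this sz_nonneg[of w \<kappa> u]] show ?thesis using K1(2)[OF k u True] by (auto intro: order_trans)
    next
      case False
      have "K * (1 + cmod u) ^ N \<le> K2 * (1 + cmod u) ^ N" using S0 by (intro mult_right_mono) (auto simp: K2_def)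
      from mult_right_mono[OF this sz_nonneg[of w \<kappa> u]] show ?thesis using far[OF k u] False by (auto intro: order_trans)
    qed
  qed
  show ?thesis
    by (rule that[of K2 N]) (use K S0 main sz_image in \<open>auto simp: K2_def\<close>)
qed

text \<open>Integrability turns into pointwise decay: a contour through \<open>u\<close> has a
  definite length near \<open>u\<close>, so \<open>length_in_ball\<close> bounds
  \<open>sz * gz\<close> at \<open>u\<close> by an exponential divided by the radius, that is, times
  a polynomial. Halving the rate absorbs the polynomial.\<close>

theorem FG_decay:
  assumes m: "margin w \<delta>"
  obtains K where "\<And>u i j. u \<in> \<Omega> \<Longrightarrow> cmod (F w i u * G w j u) \<le> K * exp (- (\<delta> / 2) * cmod u)"
proof -
  obtain b :: real where b: "1 \<le> b"
    "\<And>i z v. cmod (v - z) * (b * (1 + cmod z)\<^sup>2) \<le> 1 \<Longrightarrow> cmod (exp (cubic w i v)) \<le> 2 * cmod (exp (cubic w i z)) \<and>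
      cmod (exp (cubic w i z)) \<le> 2 * cmod (exp (cubic w i v))"
    using cubic_compare[of w] by metis
  have d0: "0 < \<delta>" using m by (simp add: margin_def)
  obtain R2 where R2: "\<And>\<kappa> v. \<kappa> \<in> \<Gamma> \<Longrightarrow> closed_contour \<kappa> \<Longrightarrow> v \<in> contour_image \<kappa> \<Longrightarrow> cmod v \<le> R2"
    using closed_contours_bounded by metis
  obtain X where X: "\<And>x. X \<le> x \<Longrightarrow> (8 * mass w \<delta> * exp (\<delta> / 2)) * exp (\<delta> / 2 - \<delta> / 2 * x) * (b * (1 + x)\<^sup>2) < 1"
    using exp_poly_small[of "\<delta> / 2" 1] d0 by auto
  have "\<exists>K. \<forall>u\<in>contour_image \<kappa>. sz w \<kappa> u * gz w \<kappa> u \<le> K * exp (- (\<delta> / 2) * cmod u)" if k: "\<kappa> \<in> \<Gamma>" for \<kappa>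
  proof -
    define Y where "Y = contour_image \<kappa> \<inter> cball 0 (max X R2)"
    have cY: "compact Y" unfolding Y_def using closed_contour_image[OF system k] by (intro closed_Int_compact) auto
    have "continuous_on Y (\<lambda>u. sz w \<kappa> u * gz w \<kappa> u)"
      unfolding gz_def by (intro continuous_intros continuous_on_sz)
    then have "bounded ((\<lambda>u. sz w \<kappa> u * gz w \<kappa> u) ` Y)" by (intro compact_imp_bounded compact_continuous_image cY)
    then obtain K1 where K1: "\<And>u. u \<in> Y \<Longrightarrow> sz w \<kappa> u * gz w \<kappa> u \<le> K1"
      unfolding bounded_iff by (auto simp: abs_le_iff)
    show ?thesis
    proof (intro exI[of _ "max 1 (max 0 K1 * exp (\<delta> / 2 * max X R2))"] ballI)
      fix u assume u: "u \<in> contour_image \<kappa>"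
      let ?M = "max 1 (max 0 K1 * exp (\<delta> / 2 * max X R2))"
      show "sz w \<kappa> u * gz w \<kappa> u \<le> ?M * exp (- (\<delta> / 2) * cmod u)"
      proof (cases "cmod u \<le> max X R2")
        case True
        then have "u \<in> Y" using u by (simp add: Y_def)
        then have "sz w \<kappa> u * gz w \<kappa> u \<le> max 0 K1 * 1" using K1 by fastforce
        also have "\<dots> \<le> max 0 K1 * (exp (\<delta> / 2 * max X R2) * exp (- (\<delta> / 2) * cmod u))"
          using True d0 mult_left_mono[OF True, of "\<delta> / 2"] by (intro mult_left_mono) (auto simp flip: exp_add)
        also have "\<dots> \<le> ?M * exp (- (\<delta> / 2) * cmod u)"
          by (simp only: mult.assoc[symmetric]) (intro mult_right_mono, auto)
        finally show ?thesis .
      next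
        case False
        show ?thesis
        proof (cases "\<exists>i j. Uc \<kappa> i \<noteq> 0 \<and> Vc \<kappa> j \<noteq> 0")
          case True
          then obtain i j where act: "Uc \<kappa> i \<noteq> 0" "Vc \<kappa> j \<noteq> 0" by auto
          have inf: "infinite_contour \<kappa>" using contour_cases[OF system k] R2[OF k _ u] False by auto
          define \<rho> where "\<rho> = 1 / (b * (1 + cmod u)\<^sup>2)"
          have q1: "1 \<le> b * (1 + cmod u)\<^sup>2"
          proof -
            have "1 \<le> (1 + cmod u)\<^sup>2" by simp
            then show ?thesis using b(1) mult_mono[of 1 b 1 "(1 + cmod u)\<^sup>2"] by simp
          qed
          have \<rho>: "0 < \<rho>" "\<rho> \<le> 1" using q1 by (auto simp: \<rho>_def)
          have c: "cmod (exp (cubic w i v)) \<le> 2 * cmod (exp (cubic w i u)) \<and> cmod (exp (cubic w i u)) \<le> 2 * cmod (exp (cubic w i v))"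
            if "v \<in> ball u \<rho>" for i v
          proof (rule b(2))
            have "cmod (v - u) \<le> 1 / (b * (1 + cmod u)\<^sup>2)" using that by (simp add: \<rho>_def dist_norm norm_minus_commute)
            then show "cmod (v - u) * (b * (1 + cmod u)\<^sup>2) \<le> 1" using q1 by (simp add: le_divide_eq)
          qed
          have "u \<in> contour_image \<kappa> \<inter> ball u (\<rho> / 2)" using u \<rho> by simp
          then have "\<rho> / 2 * (sz w \<kappa> u * gz w \<kappa> u) \<le> 4 * mass w \<delta> * exp (\<delta> - \<delta> * cmod u)"
            using length_in_ball(3)[OF m k inf \<rho> c act] by blast
          then have "sz w \<kappa> u * gz w \<kappa> u \<le> 8 * mass w \<delta> * exp (\<delta> - \<delta> * cmod u) * (b * (1 + cmod u)\<^sup>2)"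
            using q1 by (simp add: \<rho>_def field_simps)
          also have "exp (\<delta> - \<delta> * cmod u) = exp (\<delta> / 2) * exp (\<delta> / 2 - \<delta> / 2 * cmod u) * exp (- (\<delta> / 2) * cmod u)"
            by (simp flip: exp_add)
          also have "8 * mass w \<delta> * (exp (\<delta> / 2) * exp (\<delta> / 2 - \<delta> / 2 * cmod u) * exp (- (\<delta> / 2) * cmod u)) * (b * (1 + cmod u)\<^sup>2)
            = ((8 * mass w \<delta> * exp (\<delta> / 2)) * exp (\<delta> / 2 - \<delta> / 2 * cmod u) * (b * (1 + cmod u)\<^sup>2)) * exp (- (\<delta> / 2) * cmod u)"
            by (simp only: mult_ac)
          also have "\<dots> \<le> ?M * exp (- (\<delta> / 2) * cmod u)"
          proof (rule mult_right_mono)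
            have "X \<le> cmod u" using \<open>\<not> cmod u \<le> max X R2\<close> by linarith
            then show "8 * mass w \<delta> * exp (\<delta> / 2) * exp (\<delta> / 2 - \<delta> / 2 * cmod u) * (b * (1 + cmod u)\<^sup>2) \<le> ?M"
              by (rule order_trans[OF less_imp_le[OF X] max.cobounded1])
          qed simp
          finally show ?thesis .
        next
          case False
          then have "sz w \<kappa> u * gz w \<kappa> u = 0" by (auto simp: sz_def gz_def)
          moreover have "0 \<le> ?M * exp (- (\<delta> / 2) * cmod u)" by (intro mult_nonneg_nonneg) auto
          ultimately show ?thesis by linarith
        qed
      qed
    qed
  qed
  then obtain K where K: "\<And>\<kappa> u. \<kappa> \<in> \<Gamma> \<Longrightarrow> u \<in> contour_image \<kappa> \<Longrightarrow> sz w \<kappa> u * gz w \<kappa> u \<le> K \<kappa> * exp (- (\<delta> / 2) * cmod u)" by metis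
  show ?thesis
  proof (rule that[of "\<Sum>\<kappa>\<in>\<Gamma>. \<bar>K \<kappa>\<bar>"])
    fix u i j assume "u \<in> \<Omega>"
    then obtain \<kappa> where k: "\<kappa> \<in> \<Gamma>" "u \<in> contour_image \<kappa>" unfolding carrier_of_def by blast
    have "cmod (F w i u * G w j u) \<le> sz w \<kappa> u * gz w \<kappa> u"
      unfolding norm_mult sz_image[OF k] gz_image[OF k] by (intro mult_mono member_le_sum sum_nonneg) auto
    also have "\<dots> \<le> K \<kappa> * exp (- (\<delta> / 2) * cmod u)" by (rule K[OF k])
    also have "\<dots> \<le> (\<Sum>\<kappa>\<in>\<Gamma>. \<bar>K \<kappa>\<bar>) * exp (- (\<delta> / 2) * cmod u)"
      using member_le_sum[of \<kappa> \<Gamma> "\<lambda>\<kappa>. \<bar>K \<kappa>\<bar>"] k finite_\<Gamma> by (intro mult_right_mono) auto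
    finally show "cmod (F w i u * G w j u) \<le> (\<Sum>\<kappa>\<in>\<Gamma>. \<bar>K \<kappa>\<bar>) * exp (- (\<delta> / 2) * cmod u)" .
  qed
qed

end

section \<open>Differentiation in the spectral variable\<close>

lemma one_plus_power_le_exp:
  fixes a :: real
  assumes "0 < a"
  obtains K where "0 \<le> K" "\<And>x. 0 \<le> x \<Longrightarrow> (1 + x) ^ N \<le> K * exp (a * x)"
proof (cases "N = 0")
  case True
  then show ?thesis using assms by (intro that[of 1]) auto
next
  case False
  show ?thesis
  proof (rule that[of "(N / a) ^ N * exp a"])
    fix x :: real assume x: "0 \<le> x"
    have "a * (1 + x) / N \<le> exp (a * (1 + x) / N)" using exp_ge_add_one_self[of "a * (1 + x) / N"] by linarith
    then have "(a * (1 + x) / N) ^ N \<le> exp (a * (1 + x) / N) ^ N" using x assms by (intro power_mono) auto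
    also have "\<dots> = exp (a * (1 + x))" using False by (simp flip: exp_of_nat_mult)
    finally have "(N / a) ^ N * (a * (1 + x) / N) ^ N \<le> (N / a) ^ N * exp (a * (1 + x))"
      using assms by (intro mult_left_mono) auto
    moreover have "(N / a) ^ N * (a * (1 + x) / N) ^ N = (1 + x) ^ N"
      using assms False by (simp flip: power_mult_distrib)
    ultimately show "(1 + x) ^ N \<le> (N / a) ^ N * exp a * exp (a * x)"
      by (simp add: distrib_left exp_add mult.assoc)
  qed (use assms in simp)
qed

lemma dz_integrable_dominated:
  assumes sys: "contour_system \<Gamma>" and c: "\<And>\<kappa>. \<kappa> \<in> \<Gamma> \<Longrightarrow> continuous_on (contour_image \<kappa>) \<phi>"
    and \<theta>: "\<And>i. i \<in> I \<Longrightarrow> dz_integrable \<Gamma> (\<theta> i)"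
    and le: "\<And>v. v \<in> carrier_of \<Gamma> \<Longrightarrow> cmod (\<phi> v) \<le> (\<Sum>i\<in>I. cmod (\<theta> i v))"
  shows "dz_integrable \<Gamma> \<phi>"
  unfolding dz_integrable_iff line_integrable_def set_integrable_def
proof
  fix \<kappa> assume k: "\<kappa> \<in> \<Gamma>"
  let ?d = "\<lambda>s. vector_derivative (snd \<kappa>) (at s)"
  show "integrable lborel (\<lambda>s. indicator (fst \<kappa>) s *\<^sub>R (\<phi> (snd \<kappa> s) * ?d s))"
  proof (rule Bochner_Integration.integrable_bound)
    show "integrable lborel (\<lambda>s. \<Sum>i\<in>I. cmod (indicator (fst \<kappa>) s *\<^sub>R (\<theta> i (snd \<kappa> s) * ?d s)))"
      using \<theta> k by (intro Bochner_Integration.integrable_sum integrable_norm)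
        (auto simp: dz_integrable_iff line_integrable_def set_integrable_def)
    have "(\<lambda>s. indicator (fst \<kappa>) s *\<^sub>R ?d s) \<in> borel_measurable lborel"
      using contour_borel(3)[of "fst \<kappa>" "snd \<kappa>"] contour_cases[OF sys k] by simp
    from borel_measurable_times[OF contour_measurable[OF sys k c[OF k]] this]
    show "(\<lambda>s. indicator (fst \<kappa>) s *\<^sub>R (\<phi> (snd \<kappa> s) * ?d s)) \<in> borel_measurable lborel"
      by (rule measurable_cong[THEN iffD1, rotated]) (auto simp: indicator_def)
    show "AE s in lborel. norm (indicator (fst \<kappa>) s *\<^sub>R (\<phi> (snd \<kappa> s) * ?d s))
       \<le> norm (\<Sum>i\<in>I. cmod (indicator (fst \<kappa>) s *\<^sub>R (\<theta> i (snd \<kappa> s) * ?d s)))"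
    proof (intro AE_I2)
      fix s
      show "norm (indicator (fst \<kappa>) s *\<^sub>R (\<phi> (snd \<kappa> s) * ?d s))
       \<le> norm (\<Sum>i\<in>I. cmod (indicator (fst \<kappa>) s *\<^sub>R (\<theta> i (snd \<kappa> s) * ?d s)))"
      proof (cases "s \<in> fst \<kappa>")
        case True
        have "cmod (\<phi> (snd \<kappa> s)) * cmod (?d s) \<le> (\<Sum>i\<in>I. cmod (\<theta> i (snd \<kappa> s))) * cmod (?d s)"
          by (intro mult_right_mono le mem_carrier_of[OF k True]) simp
        then show ?thesis using True by (simp add: norm_mult sum_distrib_right order_trans[OF _ abs_ge_self])
      qed simp
    qed
  qed
qed

text \<open>On a closed contour the two boundary terms cancel. On an infinite one the integrals over
  the parameters from \<open>- n\<close> to \<open>n\<close> converge to the full integral by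
  domination, and their boundary terms tend to 0 by \<open>lim\<close>.\<close>

lemma line_integral_deriv_eq_0:
  assumes sys: "contour_system \<Gamma>" and k: "\<kappa> \<in> \<Gamma>"
    and H: "\<And>v. v \<in> contour_image \<kappa> \<Longrightarrow> (H has_field_derivative H' v) (at v)"
    and int: "line_integrable \<kappa> H'"
    and lim: "\<And>e. 0 < e \<Longrightarrow> \<exists>X. \<forall>v\<in>contour_image \<kappa>. X \<le> cmod v \<longrightarrow> cmod (H v) \<le> e"
  shows "line_integral \<kappa> H' = 0"
proof -
  let ?\<gamma> = "snd \<kappa>"
  let ?d = "\<lambda>s. vector_derivative ?\<gamma> (at s)"
  let ?h = "\<lambda>s. H' (?\<gamma> s) * ?d s"
  have ftc: "(LINT s:{a..b}|lborel. ?h s) = H (?\<gamma> b) - H (?\<gamma> a)"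
    if ab: "a \<le> b" "{a..b} \<subseteq> fst \<kappa>" and pc: "?\<gamma> piecewise_C1_differentiable_on {a..b}" for a b
  proof -
    obtain S where S: "finite S" "?\<gamma> C1_differentiable_on ({a..b} - S)" and c: "continuous_on {a..b} ?\<gamma>"
      using pc by (auto simp: piecewise_C1_differentiable_on_def)
    have im: "?\<gamma> s \<in> contour_image \<kappa>" if "s \<in> {a..b}" for s using that ab(2) mem_contour_image by blast
    have hi: "(?h has_integral (H (?\<gamma> b) - H (?\<gamma> a))) {a..b}"
    proof (rule fundamental_theorem_of_calculus_interior_strong[OF S(1) ab(1), where f="\<lambda>s. H (?\<gamma> s)"])
      fix s assume s: "s \<in> {a<..<b} - S"
      then have "(?\<gamma> has_vector_derivative ?d s) (at s)"
        using S(2) by (auto simp: C1_differentiable_on_eq vector_derivative_works)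
      from field_vector_diff_chain_at[OF this H[OF im]] s
      show "((\<lambda>s. H (?\<gamma> s)) has_vector_derivative ?h s) (at s)" by (simp add: o_def mult.commute)
    next
      show "continuous_on {a..b} (\<lambda>s. H (?\<gamma> s))"
      proof (rule continuous_on_compose2[OF _ c])
        show "continuous_on (?\<gamma> ` {a..b}) H"
        proof (intro continuous_at_imp_continuous_on ballI)
          fix v assume "v \<in> ?\<gamma> ` {a..b}"
          then have "v \<in> contour_image \<kappa>" using im by blast
          then show "isCont H v" by (rule DERIV_isCont[OF H])
        qed
      qed simp
    qed
    have "set_integrable lborel {a..b} ?h"
      by (rule set_integrable_subset[OF int[unfolded line_integrable_def] _ ab(2)]) simp
    from set_borel_integral_eq_integral(2)[OF this] show ?thesis using integral_unique[OF hi] by simp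
  qed
  from contour_cases[OF sys k] show ?thesis
  proof
    assume "closed_contour \<kappa>"
    then have I: "fst \<kappa> = {0..1}" "valid_path ?\<gamma>" "?\<gamma> 1 = ?\<gamma> 0"
      unfolding closed_contour_def case_prod_unfold pathfinish_def pathstart_def by simp_all
    then show ?thesis using ftc[of 0 1] by (simp add: line_integral_def valid_path_def)
  next
    assume inf: "infinite_contour \<kappa>"
    note i = infinite_contour_facts[OF sys k inf]
    have int': "integrable lborel ?h" using int i(1) by (simp add: line_integrable_def set_integrable_def)
    have "(\<lambda>n. LINT s:{- real n..real n}|lborel. ?h s) \<longlonglongrightarrow> (LINT s|lborel. ?h s)"
      unfolding set_lebesgue_integral_def
    proof (rule integral_dominated_convergence[where w="\<lambda>s. cmod (?h s)"])
      show "AE s in lborel. (\<lambda>n. indicat_real {- real n..real n} s *\<^sub>R ?h s) \<longlonglongrightarrow> ?h s"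
      proof (intro AE_I2 tendsto_eventually)
        fix s :: real
        obtain m where "\<bar>s\<bar> \<le> real m" using real_arch_simple by blast
        then show "\<forall>\<^sub>F n in sequentially. indicat_real {- real n..real n} s *\<^sub>R ?h s = ?h s"
          by (intro eventually_sequentiallyI[of m]) (auto simp: indicator_def)
      qed
      show "(\<lambda>s. indicat_real {- real n..real n} s *\<^sub>R ?h s) \<in> borel_measurable lborel" for n
        using int' by (intro borel_measurable_scaleR) auto
    qed (use int' in \<open>auto simp: indicator_def\<close>)
    then have A: "(\<lambda>n. H (?\<gamma> (real n)) - H (?\<gamma> (- real n))) \<longlonglongrightarrow> (LINT s|lborel. ?h s)"
      using ftc[OF _ _ i(3)] i(1) by simp
    have z: "(\<lambda>n. H (?\<gamma> (f n))) \<longlonglongrightarrow> 0" if f: "filterlim (\<lambda>n. ?\<gamma> (f n)) at_infinity sequentially" for f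
      unfolding tendsto_iff
    proof (intro allI impI)
      fix e :: real assume "0 < e"
      then obtain X where X: "\<forall>v\<in>contour_image \<kappa>. X \<le> cmod v \<longrightarrow> cmod (H v) \<le> e / 2" using lim[of "e / 2"] by auto
      have "\<forall>\<^sub>F n in sequentially. max 1 X \<le> cmod (?\<gamma> (f n))"
        using f[unfolded filterlim_at_infinity[OF order_refl], rule_format, of "max 1 X"] by simp
      then show "\<forall>\<^sub>F n in sequentially. dist (H (?\<gamma> (f n))) 0 < e"
      proof (rule eventually_mono)
        fix n assume "max 1 X \<le> cmod (?\<gamma> (f n))"
        then have "cmod (H (?\<gamma> (f n))) \<le> e / 2" using X i(5) by auto
        then show "dist (H (?\<gamma> (f n))) 0 < e" using \<open>0 < e\<close> by simp
      qed
    qed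
    have "(\<lambda>n. H (?\<gamma> (real n))) \<longlonglongrightarrow> 0" "(\<lambda>n. H (?\<gamma> (- real n))) \<longlonglongrightarrow> 0"
      by (intro z filterlim_compose[OF i(7)] filterlim_compose[OF i(8)] filterlim_real_sequentially
          filterlim_compose[OF filterlim_uminus_at_bot_at_top])+
    from tendsto_diff[OF this] have "(LINT s|lborel. ?h s) = 0" using LIMSEQ_unique[OF A] by simp
    then show ?thesis using i(1) by (simp add: line_integral_def set_lebesgue_integral_def)
  qed
qed

definition cubic' :: "('n \<Rightarrow> real \<times> real \<times> real) \<Rightarrow> 'n \<Rightarrow> complex \<Rightarrow> complex" where
  "cubic' w i z = (case w i of (t, y, x) \<Rightarrow> 3 * of_real t * z\<^sup>2 + 2 * of_real y * z + of_real x)"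

lemma has_field_derivative_cubic: "(cubic w i has_field_derivative cubic' w i z) (at z)"
  unfolding cubic_def[abs_def] cubic'_def case_prod_unfold
  by (auto intro!: derivative_eq_intros simp: power2_eq_square)

lemma continuous_on_cubic' [continuous_intros]: "continuous_on A (\<lambda>z. cubic' w i z)"
  unfolding cubic'_def case_prod_unfold by (intro continuous_intros)

lemma norm_cubic'_le: "\<exists>K\<ge>0. \<forall>z. cmod (cubic' w i z) \<le> K * (1 + cmod z)\<^sup>2"
proof -
  obtain t y x where w: "w i = (t, y, x)" by (cases "w i")
  show ?thesis
  proof (intro exI[of _ "3 * \<bar>t\<bar> + 2 * \<bar>y\<bar> + \<bar>x\<bar>"] conjI allI)
    fix z :: complex
    have "cmod (cubic' w i z) \<le> 3 * \<bar>t\<bar> * (cmod z)\<^sup>2 + 2 * \<bar>y\<bar> * cmod z + \<bar>x\<bar>"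
      unfolding cubic'_def w prod.case
      by (intro order_trans[OF norm_triangle_ineq] add_mono) (auto simp: norm_mult norm_power)
    also have "\<dots> \<le> 3 * \<bar>t\<bar> * (1 + cmod z)\<^sup>2 + 2 * \<bar>y\<bar> * (1 + cmod z)\<^sup>2 + \<bar>x\<bar> * (1 + cmod z)\<^sup>2"
    proof (intro add_mono mult_left_mono)
      show "(cmod z)\<^sup>2 \<le> (1 + cmod z)\<^sup>2" by (intro power_mono) auto
      have z0: "0 \<le> cmod z" "0 \<le> (cmod z)\<^sup>2" by auto
      show "cmod z \<le> (1 + cmod z)\<^sup>2" using z0 by (simp add: power2_eq_square algebra_simps)
      have "\<bar>x\<bar> * 1 \<le> \<bar>x\<bar> * (1 + cmod z)\<^sup>2" by (intro mult_left_mono) auto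
      then show "\<bar>x\<bar> \<le> \<bar>x\<bar> * (1 + cmod z)\<^sup>2" by simp
    qed auto
    finally show "cmod (cubic' w i z) \<le> (3 * \<bar>t\<bar> + 2 * \<bar>y\<bar> + \<bar>x\<bar>) * (1 + cmod z)\<^sup>2" by (simp add: algebra_simps)
  qed auto
qed

context jump_data
begin

definition Fsum :: "('n \<Rightarrow> real \<times> real \<times> real) \<Rightarrow> complex \<Rightarrow> real" where
  "Fsum w v = (\<Sum>i\<in>UNIV. cmod (F w i v))"

lemma weighted_integrable:
  assumes m: "margin w \<delta>" and c: "\<And>\<kappa>. \<kappa> \<in> \<Gamma> \<Longrightarrow> continuous_on (contour_image \<kappa>) \<psi>"
    and le: "\<And>v. v \<in> \<Omega> \<Longrightarrow> cmod (\<psi> v) \<le> K * exp (\<delta> / 2 * cmod v) * (1 + cmod v) ^ N * cmod (G w j v) * Fsum w v" and K: "0 \<le> K"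
  shows "dz_integrable \<Gamma> \<psi>"
proof -
  have d0: "0 < \<delta> / 2" using m by (simp add: margin_def)
  obtain K' where K': "0 \<le> K'" "\<And>x. 0 \<le> x \<Longrightarrow> (1 + x) ^ N \<le> K' * exp (\<delta> / 2 * x)"
    using one_plus_power_le_exp[OF d0] by metis
  show ?thesis
  proof (rule dz_integrable_dominated[OF system c, where I=UNIV and \<theta>="\<lambda>i v. of_real (K * K') * (of_real (exp (\<delta> * cmod v)) * (F w i v * G w j v))"])
    show "dz_integrable \<Gamma> (\<lambda>v. of_real (K * K') * (of_real (exp (\<delta> * cmod v)) * (F w i v * G w j v)))" for i
      using m by (intro dz_integrable_cmult) (simp add: margin_def)
    fix v assume v: "v \<in> \<Omega>"
    have "cmod (\<psi> v) \<le> K * exp (\<delta> / 2 * cmod v) * (1 + cmod v) ^ N * cmod (G w j v) * Fsum w v" by (rule le[OF v])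
    also have "\<dots> = K * exp (\<delta> / 2 * cmod v) * (cmod (G w j v) * Fsum w v) * (1 + cmod v) ^ N" by (simp only: mult_ac)
    also have "\<dots> \<le> K * exp (\<delta> / 2 * cmod v) * (cmod (G w j v) * Fsum w v) * (K' * exp (\<delta> / 2 * cmod v))"
      using K by (intro mult_left_mono K'(2)) (auto simp: Fsum_def intro!: mult_nonneg_nonneg sum_nonneg)
    also have "\<dots> = (K * K') * (exp (\<delta> / 2 * cmod v) * exp (\<delta> / 2 * cmod v)) * (cmod (G w j v) * Fsum w v)" by (simp only: mult_ac)
    also have "exp (\<delta> / 2 * cmod v) * exp (\<delta> / 2 * cmod v) = exp (\<delta> * cmod v)" by (simp flip: exp_add)
    also have "(K * K') * exp (\<delta> * cmod v) * (cmod (G w j v) * Fsum w v) = (\<Sum>i\<in>UNIV. cmod (of_real (K * K') * (of_real (exp (\<delta> * cmod v)) * (F w i v * G w j v))))"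
      using K K'(1) by (simp add: norm_mult Fsum_def sum_distrib_left mult_ac)
    finally show "cmod (\<psi> v) \<le> (\<Sum>i\<in>UNIV. cmod (of_real (K * K') * (of_real (exp (\<delta> * cmod v)) * (F w i v * G w j v))))" .
  qed
qed

text \<open>A solution has a meaning only on the contours, so its derivative is that of the
  holomorphic continuation; disjointness makes the chosen contour unique.\<close>

definition der :: "('n \<Rightarrow> real \<times> real \<times> real) \<Rightarrow> ('n \<Rightarrow> complex) \<Rightarrow> (complex \<Rightarrow> complex) \<Rightarrow> complex \<Rightarrow> complex" where
  "der w e \<eta> u = deriv (ext w e \<eta> (SOME \<kappa>. \<kappa> \<in> \<Gamma> \<and> u \<in> contour_image \<kappa>)) u"

lemma der_eq:
  assumes "\<kappa> \<in> \<Gamma>" "u \<in> contour_image \<kappa>"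
  shows "der w e \<eta> u = deriv (ext w e \<eta> \<kappa>) u"
proof -
  have "(SOME \<kappa>. \<kappa> \<in> \<Gamma> \<and> u \<in> contour_image \<kappa>) = \<kappa>"
    using assms disjoint_images by (intro some_equality) blast+
  then show ?thesis by (simp add: der_def)
qed

lemma der_continuous:
  assumes "sol w e \<eta>" "\<kappa> \<in> \<Gamma>"
  shows "continuous_on (contour_image \<kappa>) (der w e \<eta>)"
  by (rule continuous_on_eq[OF deriv_ext_continuous[OF assms]]) (simp add: der_eq[OF assms(2)])

lemma sol_growth:
  assumes "sol w e \<eta>" "margin w \<delta>"
  obtains K N where "0 \<le> K" "\<And>u. u \<in> \<Omega> \<Longrightarrow> cmod (\<eta> u) \<le> K * (1 + cmod u) ^ N * Fsum w u"
    "\<And>u. u \<in> \<Omega> \<Longrightarrow> cmod (der w e \<eta> u) \<le> K * (1 + cmod u) ^ N * Fsum w u"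
proof -
  obtain K N where g: "0 \<le> K"
    "\<And>\<kappa> u. \<kappa> \<in> \<Gamma> \<Longrightarrow> u \<in> contour_image \<kappa> \<Longrightarrow> cmod (\<eta> u) \<le> K * (1 + cmod u) ^ N * (\<Sum>i\<in>UNIV. cmod (F w i u))"
    "\<And>\<kappa> u. \<kappa> \<in> \<Gamma> \<Longrightarrow> u \<in> contour_image \<kappa> \<Longrightarrow> cmod (deriv (ext w e \<eta> \<kappa>) u) \<le> K * (1 + cmod u) ^ N * (\<Sum>i\<in>UNIV. cmod (F w i u))"
    using growth[OF assms] by metis
  show ?thesis
  proof (rule that[OF g(1)])
    fix u assume "u \<in> \<Omega>"
    then obtain \<kappa> where k: "\<kappa> \<in> \<Gamma>" "u \<in> contour_image \<kappa>" unfolding carrier_of_def by blast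
    show "cmod (\<eta> u) \<le> K * (1 + cmod u) ^ N * Fsum w u" using g(2)[OF k] by (simp add: Fsum_def)
    show "cmod (der w e \<eta> u) \<le> K * (1 + cmod u) ^ N * Fsum w u" using g(3)[OF k] by (simp add: Fsum_def der_eq[OF k])
  qed
qed

text \<open>By the growth bound, a solution times \<open>G w j\<close> is dominated by a polynomial
  times the products of the \<open>F w i\<close> with \<open>G w j\<close>, to which the margin
  applies.\<close>

lemma sol_weighted:
  assumes sl: "sol w e \<eta>" and m: "margin w \<delta>"
    and c: "\<And>\<kappa>. \<kappa> \<in> \<Gamma> \<Longrightarrow> continuous_on (contour_image \<kappa>) k"
    and le: "\<And>v. v \<in> \<Omega> \<Longrightarrow> cmod (k v) \<le> B * exp (\<delta> / 2 * cmod v) * (1 + cmod v) ^ n" and B: "0 \<le> B"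
  shows "dz_integrable \<Gamma> (\<lambda>v. k v * (G w j v * \<eta> v))" "dz_integrable \<Gamma> (\<lambda>v. k v * (G w j v * der w e \<eta> v))"
proof -
  obtain K N where g: "0 \<le> K" "\<And>u. u \<in> \<Omega> \<Longrightarrow> cmod (\<eta> u) \<le> K * (1 + cmod u) ^ N * Fsum w u"
    "\<And>u. u \<in> \<Omega> \<Longrightarrow> cmod (der w e \<eta> u) \<le> K * (1 + cmod u) ^ N * Fsum w u"
    using sol_growth[OF sl m] by metis
  have *: "dz_integrable \<Gamma> (\<lambda>v. k v * (G w j v * \<phi> v))"
    if \<phi>: "\<And>u. u \<in> \<Omega> \<Longrightarrow> cmod (\<phi> u) \<le> K * (1 + cmod u) ^ N * Fsum w u" "\<And>\<kappa>. \<kappa> \<in> \<Gamma> \<Longrightarrow> continuous_on (contour_image \<kappa>) \<phi>" for \<phi>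
  proof (rule weighted_integrable[OF m, where K="B * K" and N="n + N" and j=j])
    show "continuous_on (contour_image \<kappa>) (\<lambda>v. k v * (G w j v * \<phi> v))" if "\<kappa> \<in> \<Gamma>" for \<kappa>
      by (intro continuous_intros c continuous_on_G \<phi>(2) that)
    fix v assume v: "v \<in> \<Omega>"
    have "cmod (k v) * cmod (\<phi> v) \<le> (B * exp (\<delta> / 2 * cmod v) * (1 + cmod v) ^ n) * (K * (1 + cmod v) ^ N * Fsum w v)"
      using B by (intro mult_mono le[OF v] \<phi>(1)[OF v]) auto
    from mult_right_mono[OF this norm_ge_zero[of "G w j v"]]
    show "cmod (k v * (G w j v * \<phi> v)) \<le> B * K * exp (\<delta> / 2 * cmod v) * (1 + cmod v) ^ (n + N) * cmod (G w j v) * Fsum w v"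
      by (simp add: norm_mult power_add mult_ac)
  qed (use B g(1) in simp)
  show "dz_integrable \<Gamma> (\<lambda>v. k v * (G w j v * \<eta> v))" by (rule *[OF g(2) sol_continuous[OF sl]])
  show "dz_integrable \<Gamma> (\<lambda>v. k v * (G w j v * der w e \<eta> v))" by (rule *[OF g(3) der_continuous[OF sl]])
qed

lemma sol_poly:
  assumes sl: "sol w e \<eta>" and m: "margin w \<delta>"
  shows "dz_integrable \<Gamma> (\<lambda>v. v ^ n * (G w j v * \<eta> v))" "dz_integrable \<Gamma> (\<lambda>v. v ^ n * (G w j v * der w e \<eta> v))"
    "dz_integrable \<Gamma> (\<lambda>v. cubic' w i v * (G w j v * \<eta> v))"
proof -
  have d0: "0 < \<delta>" using m by (simp add: margin_def)
  have e1: "1 \<le> exp (\<delta> / 2 * cmod v)" for v :: complex using d0 by simp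
  have b: "cmod (v ^ n) \<le> 1 * exp (\<delta> / 2 * cmod v) * (1 + cmod v) ^ n" for v :: complex
  proof -
    have "cmod (v ^ n) \<le> 1 * (1 + cmod v) ^ n" unfolding norm_power by (simp add: power_mono)
    also have "\<dots> \<le> exp (\<delta> / 2 * cmod v) * (1 + cmod v) ^ n" by (intro mult_right_mono e1) auto
    finally show ?thesis by simp
  qed
  have c: "continuous_on A (\<lambda>v. v ^ n)" for A :: "complex set" by (intro continuous_intros)
  show "dz_integrable \<Gamma> (\<lambda>v. v ^ n * (G w j v * \<eta> v))" by (rule sol_weighted(1)[OF sl m c b]) simp
  show "dz_integrable \<Gamma> (\<lambda>v. v ^ n * (G w j v * der w e \<eta> v))" by (rule sol_weighted(2)[OF sl m c b]) simp
  obtain K where K: "0 \<le> K" "\<And>z. cmod (cubic' w i z) \<le> K * (1 + cmod z)\<^sup>2" using norm_cubic'_le by metis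
  have b': "cmod (cubic' w i v) \<le> K * exp (\<delta> / 2 * cmod v) * (1 + cmod v) ^ 2" for v
  proof -
    have "K * 1 * (1 + cmod v)\<^sup>2 \<le> K * exp (\<delta> / 2 * cmod v) * (1 + cmod v)\<^sup>2"
      using K(1) by (intro mult_right_mono mult_left_mono e1) auto
    then show ?thesis using K(2)[of v] by simp
  qed
  show "dz_integrable \<Gamma> (\<lambda>v. cubic' w i v * (G w j v * \<eta> v))"
    by (rule sol_weighted(1)[OF sl m _ b' K(1)]) (intro continuous_intros)
qed

end

definition unit_row :: "'n \<Rightarrow> 'n \<Rightarrow> complex" where
  "unit_row a i = (if i = a then 1 else 0)"

lemma sum_unit_row: "(\<Sum>b\<in>UNIV. f b * unit_row b i) = f i" for f :: "'n::finite \<Rightarrow> complex"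
proof -
  have "(\<Sum>b\<in>UNIV. f b * unit_row b i) = (\<Sum>b\<in>UNIV. if b = i then f b else 0)"
    by (intro sum.cong) (auto simp: unit_row_def)
  then show ?thesis by simp
qed

section \<open>Algebra of the Cauchy terms, integration by parts and the linear relation between the
  moments\<close>

context jump_data
begin

lemma cterm_cmult: "cterm w (\<lambda>v. a * \<phi> v) i u = a * cterm w \<phi> i u"
proof -
  have "dz_integral \<Gamma> (\<lambda>v. G w i v * (a * \<phi> v) / (u - v)) = dz_integral \<Gamma> (\<lambda>v. a * (G w i v * \<phi> v / (u - v)))"
    by (simp only: mult.left_commute times_divide_eq_right)
  then show ?thesis by (simp add: cterm_def del: times_divide_eq_right)
qed

lemma cterm_add:
  assumes u: "u \<in> \<Omega>" and "dz_integrable \<Gamma> (\<lambda>v. G w i v * \<phi> v)" "dz_integrable \<Gamma> (\<lambda>v. G w i v * \<psi> v)"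
  shows "cterm w (\<lambda>v. \<phi> v + \<psi> v) i u = cterm w \<phi> i u + cterm w \<psi> i u"
proof (cases "U u i = 0")
  case False
  have "dz_integral \<Gamma> (\<lambda>v. G w i v * (\<phi> v + \<psi> v) / (u - v)) = dz_integral \<Gamma> (\<lambda>v. G w i v * \<phi> v / (u - v) + G w i v * \<psi> v / (u - v))"
    by (simp only: distrib_left add_divide_distrib)
  then show ?thesis using False
    by (simp add: cterm_def dz_integral_add Cauchy_term_integrable'[OF u False] assms)
qed (simp add: cterm_def)

lemma cterm_diff:
  assumes "u \<in> \<Omega>" "dz_integrable \<Gamma> (\<lambda>v. G w i v * \<phi> v)" "dz_integrable \<Gamma> (\<lambda>v. G w i v * \<psi> v)"
  shows "cterm w (\<lambda>v. \<phi> v - \<psi> v) i u = cterm w \<phi> i u - cterm w \<psi> i u"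
  using cterm_add[OF assms(1,2), of "\<lambda>v. (-1) * \<psi> v"] cterm_cmult[of w "-1" \<psi> i u] dz_integrable_minus[OF assms(3)] by simp

lemma cterm_sum:
  assumes u: "u \<in> \<Omega>" and "\<And>b. b \<in> B \<Longrightarrow> dz_integrable \<Gamma> (\<lambda>v. G w i v * \<phi> b v)" "finite B"
  shows "cterm w (\<lambda>v. \<Sum>b\<in>B. \<phi> b v) i u = (\<Sum>b\<in>B. cterm w (\<phi> b) i u)"
  using assms(3,2)
proof (induction B rule: finite_induct)
  case empty
  then show ?case by (simp add: cterm_def)
next
  case (insert b B)
  have "dz_integrable \<Gamma> (\<lambda>v. \<Sum>b\<in>B. G w i v * \<phi> b v)" using insert by (intro dz_integrable_sum) auto
  then have "dz_integrable \<Gamma> (\<lambda>v. G w i v * (\<Sum>b\<in>B. \<phi> b v))" by (simp add: sum_distrib_left)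
  then show ?case using insert by (simp add: cterm_add[OF u])
qed

text \<open>Since \<open>u / (u - v) = v / (u - v) + 1\<close>, moving a factor \<open>u\<close>
  under the Cauchy integral costs one moment. The factor \<open>F w i u\<close> is kept on both
  sides because \<open>cterm\<close> is 0 by definition where \<open>U u i = 0\<close>, while the
  moment need not be.\<close>

lemma F_mult_cterm:
  assumes u: "u \<in> \<Omega>" and "dz_integrable \<Gamma> (\<lambda>v. G w i v * \<phi> v)"
  shows "F w i u * (u * cterm w \<phi> i u) = F w i u * (cterm w (\<lambda>v. v * \<phi> v) i u + dz_integral \<Gamma> (\<lambda>v. G w i v * \<phi> v))"
proof (cases "U u i = 0")
  case True
  then show ?thesis by (simp add: F_def)
next
  case False
  note i = Cauchy_term_integrable'[OF u False assms(2)]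
  have "dz_integral \<Gamma> (\<lambda>v. G w i v * (v * \<phi> v) / (u - v)) = dz_integral \<Gamma> (\<lambda>v. u * (G w i v * \<phi> v / (u - v)) - G w i v * \<phi> v)"
  proof (rule dz_integral_cong)
    fix v assume v: "v \<in> \<Omega>"
    have "V u i = 0" using orth[OF u, of i] False by simp
    \<comment> \<open>At \<open>v = u\<close> the quotients are 0 by convention, and there
      \<open>G w i v\<close> vanishes as well.\<close>
    then have "G w i v = 0 \<or> u - v \<noteq> 0" by (auto simp: G_def)
    then show "G w i v * (v * \<phi> v) / (u - v) = u * (G w i v * \<phi> v / (u - v)) - G w i v * \<phi> v"
      by (auto simp: field_simps)
  qed
  also have "\<dots> = u * dz_integral \<Gamma> (\<lambda>v. G w i v * \<phi> v / (u - v)) - dz_integral \<Gamma> (\<lambda>v. G w i v * \<phi> v)"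
    by (simp only: dz_integral_diff[OF dz_integrable_cmult[OF i] assms(2)] dz_integral_cmult)
  finally show ?thesis using False by (simp add: cterm_def)
qed

lemma sol_cterm: "sol w e \<eta> \<Longrightarrow> u \<in> \<Omega> \<Longrightarrow> \<eta> u = (\<Sum>i\<in>UNIV. F w i u * (e i + cterm w \<eta> i u))"
  by (simp add: sol_def distrib_left F_cterm)

lemma ext_has_derivative:
  assumes "sol w e \<eta>" "\<kappa> \<in> \<Gamma>" "v \<in> contour_image \<kappa>"
  shows "(ext w e \<eta> \<kappa> has_field_derivative der w e \<eta> v) (at v)"
  unfolding der_eq[OF assms(2,3)]
  by (rule holomorphic_derivI[OF ext_holomorphic[OF _ assms(2)] open_nbhd subsetD[OF image_subset_nbhd[OF assms(2)] assms(3)]])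
    (use assms(1) in \<open>simp add: sol_def\<close>)

text \<open>Products of an \<open>F\<close> with a \<open>G\<close> decay at rate
  \<open>\<delta> / 2\<close>. Half of this rate pays for the polynomial growth of the solution and
  \<open>\<delta> / 4\<close> is left; this disposes of the boundary terms in all integrations by
  parts.\<close>

lemma G_sol_vanishes:
  assumes sl: "sol w e \<eta>" and m: "margin w \<delta>" and "0 < \<epsilon>"
  shows "\<exists>X. \<forall>v\<in>\<Omega>. X \<le> cmod v \<longrightarrow> cmod (G w j v * \<eta> v) \<le> \<epsilon>"
proof -
  obtain K N where g: "0 \<le> K" "\<And>u. u \<in> \<Omega> \<Longrightarrow> cmod (\<eta> u) \<le> K * (1 + cmod u) ^ N * Fsum w u"
    using sol_growth[OF sl m] by metis
  obtain K2 where K2: "\<And>u i j. u \<in> \<Omega> \<Longrightarrow> cmod (F w i u * G w j u) \<le> K2 * exp (- (\<delta> / 2) * cmod u)"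
    using FG_decay[OF m] by metis
  have d0: "0 < \<delta> / 4" using m by (simp add: margin_def)
  obtain K3 where K3: "0 \<le> K3" "\<And>x. 0 \<le> x \<Longrightarrow> (1 + x) ^ N \<le> K3 * exp (\<delta> / 4 * x)"
    using one_plus_power_le_exp[OF d0] by metis
  define C where "C = K * K3 * (CARD('n) * \<bar>K2\<bar>)"
  have b: "cmod (G w j v * \<eta> v) \<le> C * exp (- (\<delta> / 4) * cmod v)" if v: "v \<in> \<Omega>" for v
  proof -
    have "cmod (G w j v) * Fsum w v = (\<Sum>i\<in>UNIV. cmod (F w i v * G w j v))"
      by (simp add: Fsum_def sum_distrib_left norm_mult mult.commute)
    also have "\<dots> \<le> CARD('n) * (\<bar>K2\<bar> * exp (- (\<delta> / 2) * cmod v))"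
      using order_trans[OF K2[OF v] mult_right_mono[OF abs_ge_self]] by (intro sum_bounded_above) simp
    finally have 1: "cmod (G w j v) * Fsum w v \<le> CARD('n) * (\<bar>K2\<bar> * exp (- (\<delta> / 2) * cmod v))" .
    have "cmod (G w j v * \<eta> v) \<le> cmod (G w j v) * (K * (1 + cmod v) ^ N * Fsum w v)"
      unfolding norm_mult by (intro mult_left_mono g(2)[OF v]) simp
    also have "\<dots> = K * (1 + cmod v) ^ N * (cmod (G w j v) * Fsum w v)" by (simp only: mult_ac)
    also have "\<dots> \<le> K * (K3 * exp (\<delta> / 4 * cmod v)) * (CARD('n) * (\<bar>K2\<bar> * exp (- (\<delta> / 2) * cmod v)))"
    proof (rule mult_mono[OF mult_left_mono[OF K3(2) g(1)] 1])
      show "0 \<le> K * (K3 * exp (\<delta> / 4 * cmod v))" using g(1) K3(1) by simp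
      show "0 \<le> cmod (G w j v) * Fsum w v" by (simp add: Fsum_def sum_nonneg)
    qed simp
    also have "\<dots> = C * (exp (\<delta> / 4 * cmod v) * exp (- (\<delta> / 2) * cmod v))" by (simp only: C_def mult_ac)
    also have "exp (\<delta> / 4 * cmod v) * exp (- (\<delta> / 2) * cmod v) = exp (- (\<delta> / 4) * cmod v)" by (simp flip: exp_add)
    finally show ?thesis .
  qed
  have "((\<lambda>x. C * exp (- (\<delta> / 4) * x)) \<longlongrightarrow> 0) at_top" using d0 by real_asymp
  then have "\<forall>\<^sub>F x in at_top. C * exp (- (\<delta> / 4) * x) < \<epsilon>" using \<open>0 < \<epsilon>\<close> by (rule order_tendstoD(2))
  then obtain X where X: "\<And>x. X \<le> x \<Longrightarrow> C * exp (- (\<delta> / 4) * x) < \<epsilon>" unfolding eventually_at_top_linorder by blast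
  have "cmod (G w j v * \<eta> v) \<le> \<epsilon>" if "v \<in> \<Omega>" "X \<le> cmod v" for v
    using b[OF that(1)] X[OF that(2)] by linarith
  then show ?thesis by blast
qed

text \<open>Multiplied by \<open>G w j\<close> this is the derivative of
  \<open>G w j * \<eta>\<close> along the contours.\<close>

definition Dop :: "('n \<Rightarrow> real \<times> real \<times> real) \<Rightarrow> ('n \<Rightarrow> complex) \<Rightarrow> (complex \<Rightarrow> complex) \<Rightarrow> 'n \<Rightarrow> complex \<Rightarrow> complex" where
  "Dop w e \<eta> j v = der w e \<eta> v - cubic' w j v * \<eta> v"

lemma G_ext_derivative:
  assumes sl: "sol w e \<eta>" and k: "\<kappa> \<in> \<Gamma>" "v \<in> contour_image \<kappa>"
  shows "((\<lambda>z. Vc \<kappa> j * exp (- cubic w j z) * ext w e \<eta> \<kappa> z) has_field_derivative G w j v * Dop w e \<eta> j v) (at v)"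
proof -
  have "((\<lambda>z. Vc \<kappa> j * exp (- cubic w j z) * ext w e \<eta> \<kappa> z) has_field_derivative
     (Vc \<kappa> j * (exp (- cubic w j v) * - cubic' w j v)) * ext w e \<eta> \<kappa> v + der w e \<eta> v * (Vc \<kappa> j * exp (- cubic w j v))) (at v)"
    by (intro DERIV_mult ext_has_derivative[OF sl k] DERIV_cmult DERIV_fun_exp DERIV_minus has_field_derivative_cubic)
  then show ?thesis
    by (rule DERIV_cong) (simp add: ext_eq[OF sl k] V_eq[OF k] G_def Dop_def algebra_simps)
qed

lemma G_ext_eq: "sol w e \<eta> \<Longrightarrow> \<kappa> \<in> \<Gamma> \<Longrightarrow> v \<in> contour_image \<kappa> \<Longrightarrow>
    Vc \<kappa> j * exp (- cubic w j v) * ext w e \<eta> \<kappa> v = G w j v * \<eta> v"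
  by (simp add: ext_eq V_eq G_def)

lemma Dop_integrable:
  assumes "sol w e \<eta>" "margin w \<delta>"
  shows "dz_integrable \<Gamma> (\<lambda>v. G w j v * Dop w e \<eta> j v)"
proof -
  have "dz_integrable \<Gamma> (\<lambda>v. v ^ 0 * (G w j v * der w e \<eta> v) - cubic' w j v * (G w j v * \<eta> v))"
    by (intro dz_integrable_diff sol_poly[OF assms])
  then show ?thesis by (simp add: Dop_def right_diff_distrib mult.left_commute)
qed

text \<open>The integrand is a derivative, and its primitive \<open>G w j * \<eta>\<close> vanishes
  at infinity.\<close>

lemma integral_Dop:
  assumes sl: "sol w e \<eta>" and m: "margin w \<delta>"
  shows "dz_integral \<Gamma> (\<lambda>v. G w j v * Dop w e \<eta> j v) = 0"
  unfolding dz_integral_eq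
proof (intro sum.neutral ballI)
  fix \<kappa> assume k: "\<kappa> \<in> \<Gamma>"
  show "line_integral \<kappa> (\<lambda>v. G w j v * Dop w e \<eta> j v) = 0"
  proof (rule line_integral_deriv_eq_0[OF system k G_ext_derivative[OF sl k]])
    show "line_integrable \<kappa> (\<lambda>v. G w j v * Dop w e \<eta> j v)" using Dop_integrable[OF sl m] k by (simp add: dz_integrable_iff)
    fix \<epsilon> :: real assume "0 < \<epsilon>"
    from G_sol_vanishes[OF sl m this, of j]
    show "\<exists>X. \<forall>v\<in>contour_image \<kappa>. X \<le> cmod v \<longrightarrow> cmod (Vc \<kappa> j * exp (- cubic w j v) * ext w e \<eta> \<kappa> v) \<le> \<epsilon>"
      using G_ext_eq[OF sl k] image_subset_carrier[OF k] by (simp add: Ball_def) blast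
  qed
qed

text \<open>The primitive is \<open>G w i v * \<eta> v / (u - v)\<close>. Contours with
  \<open>Vc \<kappa> i = 0\<close> contribute nothing, and the others keep the distance
  \<open>d\<close> from \<open>u\<close>, so division by \<open>u - v\<close> does no harm to the
  vanishing at infinity.\<close>

lemma integral_by_parts:
  assumes sl: "sol w e \<eta>" and m: "margin w \<delta>" and u: "u \<in> \<Omega>" "U u i \<noteq> 0"
  shows "- dz_integral \<Gamma> (\<lambda>v. G w i v * \<eta> v / (u - v)\<^sup>2) = dz_integral \<Gamma> (\<lambda>v. G w i v * Dop w e \<eta> i v / (u - v))"
proof -
  obtain \<kappa>0 where k0: "\<kappa>0 \<in> \<Gamma>" "u \<in> contour_image \<kappa>0" using u(1) unfolding carrier_of_def by blast
  have U0: "Uc \<kappa>0 i \<noteq> 0" using u(2) U_eq[OF k0] by simp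
  obtain d where d: "0 < d" "\<And>v i. v \<in> \<Omega> \<Longrightarrow> Uc \<kappa>0 i \<noteq> 0 \<Longrightarrow> G w i v \<noteq> 0 \<Longrightarrow> d \<le> cmod (u - v)"
    using G_far[OF k0(1)] image_subset_nbhd[OF k0(1)] k0(2) by (metis subsetD)
  have i0: "dz_integrable \<Gamma> (\<lambda>v. G w i v * \<eta> v)" using sl by (simp add: sol_def)
  have A: "dz_integrable \<Gamma> (\<lambda>v. G w i v * Dop w e \<eta> i v / (u - v))"
    by (rule Cauchy_term_integrable'[OF u Dop_integrable[OF sl m]])
  have "dz_integrable \<Gamma> (\<lambda>v. G w i v * (\<eta> v / (u - v)) / (u - v))"
    using Cauchy_term_integrable'[OF u i0] by (intro Cauchy_term_integrable'[OF u]) simp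
  then have B: "dz_integrable \<Gamma> (\<lambda>v. G w i v * \<eta> v / (u - v)\<^sup>2)" by (simp add: power2_eq_square)
  have "dz_integral \<Gamma> (\<lambda>v. G w i v * Dop w e \<eta> i v / (u - v) + G w i v * \<eta> v / (u - v)\<^sup>2) = 0"
    unfolding dz_integral_eq
  proof (intro sum.neutral ballI)
    fix \<kappa> assume k: "\<kappa> \<in> \<Gamma>"
    show "line_integral \<kappa> (\<lambda>v. G w i v * Dop w e \<eta> i v / (u - v) + G w i v * \<eta> v / (u - v)\<^sup>2) = 0"
    proof (cases "Vc \<kappa> i = 0")
      case True
      then have "line_integral \<kappa> (\<lambda>v. G w i v * Dop w e \<eta> i v / (u - v) + G w i v * \<eta> v / (u - v)\<^sup>2) = line_integral \<kappa> (\<lambda>v. 0)"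
        by (intro line_integral_cong) (simp add: G_def V_eq[OF k])
      then show ?thesis by simp
    next
      case False
      have nz: "G w i v \<noteq> 0" if "v \<in> contour_image \<kappa>" for v using False V_eq[OF k that] by (simp add: G_def)
      have far: "d \<le> cmod (u - v)" if "v \<in> contour_image \<kappa>" for v
        using d(2)[OF image_subset_carrier[OF k that] U0 nz[OF that]] .
      show ?thesis
      proof (rule line_integral_deriv_eq_0[OF system k, where H="\<lambda>v. Vc \<kappa> i * exp (- cubic w i v) * ext w e \<eta> \<kappa> v / (u - v)"])
        fix v assume v: "v \<in> contour_image \<kappa>"
        have uv: "u - v \<noteq> 0" using far[OF v] d(1) by auto
        have "((\<lambda>v. Vc \<kappa> i * exp (- cubic w i v) * ext w e \<eta> \<kappa> v / (u - v)) has_field_derivative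
          (G w i v * Dop w e \<eta> i v * (u - v) - Vc \<kappa> i * exp (- cubic w i v) * ext w e \<eta> \<kappa> v * (0 - 1)) / ((u - v) * (u - v))) (at v)"
          by (intro DERIV_divide G_ext_derivative[OF sl k v] DERIV_diff DERIV_const DERIV_ident uv)
        then show "((\<lambda>v. Vc \<kappa> i * exp (- cubic w i v) * ext w e \<eta> \<kappa> v / (u - v)) has_field_derivative
          G w i v * Dop w e \<eta> i v / (u - v) + G w i v * \<eta> v / (u - v)\<^sup>2) (at v)"
          unfolding G_ext_eq[OF sl k v]
          by (rule DERIV_cong) (use uv in \<open>simp add: power2_eq_square add_divide_distrib diff_divide_distrib\<close>)
      next
        show "line_integrable \<kappa> (\<lambda>v. G w i v * Dop w e \<eta> i v / (u - v) + G w i v * \<eta> v / (u - v)\<^sup>2)"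
          using dz_integrable_add[OF A B] k by (simp add: dz_integrable_iff)
        fix \<epsilon> :: real assume "0 < \<epsilon>"
        then have "0 < \<epsilon> * d" using d(1) by simp
        from G_sol_vanishes[OF sl m this, of i] obtain X where X: "\<And>v. v \<in> \<Omega> \<Longrightarrow> X \<le> cmod v \<Longrightarrow> cmod (G w i v * \<eta> v) \<le> \<epsilon> * d" by blast
        show "\<exists>X. \<forall>v\<in>contour_image \<kappa>. X \<le> cmod v \<longrightarrow> cmod (Vc \<kappa> i * exp (- cubic w i v) * ext w e \<eta> \<kappa> v / (u - v)) \<le> \<epsilon>"
        proof (intro exI[of _ X] ballI impI)
          fix v assume v: "v \<in> contour_image \<kappa>" "X \<le> cmod v"
          have "cmod (G w i v * \<eta> v) \<le> \<epsilon> * cmod (u - v)"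
            using order_trans[OF X[OF image_subset_carrier[OF k v(1)] v(2)] mult_left_mono[OF far[OF v(1)] less_imp_le[OF \<open>0 < \<epsilon>\<close>]]] .
          moreover have "0 < cmod (u - v)" using far[OF v(1)] d(1) by linarith
          ultimately show "cmod (Vc \<kappa> i * exp (- cubic w i v) * ext w e \<eta> \<kappa> v / (u - v)) \<le> \<epsilon>"
            unfolding G_ext_eq[OF sl k v(1)] norm_divide by (simp add: pos_divide_le_eq)
        qed
      qed
    qed
  qed
  then show ?thesis using dz_integral_add[OF A B] by (simp add: neg_eq_iff_add_eq_0 add.commute)
qed

text \<open>The equation is differentiated under the integral, and the derivative of the Cauchy
  kernel is moved to the density. The derivative of a solution thus satisfies an equation of the
  same shape, with a density \<open>Dop\<close> that depends on the index.\<close>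

lemma der_formula:
  assumes sl: "sol w e \<eta>" and m: "margin w \<delta>" and u: "u \<in> \<Omega>"
  shows "der w e \<eta> u = (\<Sum>i\<in>UNIV. F w i u * (cubic' w i u * (e i + cterm w \<eta> i u) + cterm w (Dop w e \<eta> i) i u))"
proof -
  obtain \<kappa> where k: "\<kappa> \<in> \<Gamma>" "u \<in> contour_image \<kappa>" using u unfolding carrier_of_def by blast
  have un: "u \<in> nbhd \<kappa>" using image_subset_nbhd k by blast
  have "((\<lambda>z. exp (cubic w i z) * Uc \<kappa> i * (e i + dz_integral \<Gamma> (\<lambda>v. G w i v * \<eta> v / (z - v)))) has_field_derivative
     F w i u * (cubic' w i u * (e i + cterm w \<eta> i u) + cterm w (Dop w e \<eta> i) i u)) (at u)" for i
  proof (cases "Uc \<kappa> i = 0")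
    case True
    then show ?thesis using U_eq[OF k] by (simp add: F_def)
  next
    case False
    have U0: "U u i \<noteq> 0" using False U_eq[OF k] by simp
    have "((\<lambda>z. exp (cubic w i z) * Uc \<kappa> i * (e i + dz_integral \<Gamma> (\<lambda>v. G w i v * \<eta> v / (z - v)))) has_field_derivative
      (exp (cubic w i u) * cubic' w i u) * Uc \<kappa> i * (e i + dz_integral \<Gamma> (\<lambda>v. G w i v * \<eta> v / (u - v)))
      + (0 + - dz_integral \<Gamma> (\<lambda>v. G w i v * \<eta> v / (u - v)\<^sup>2)) * (exp (cubic w i u) * Uc \<kappa> i)) (at u)"
      by (intro DERIV_mult DERIV_cmult_right DERIV_fun_exp has_field_derivative_cubic DERIV_add DERIV_const
          Cauchy_term_derivative[OF k(1) un False]) (use sl in \<open>simp add: sol_def\<close>)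
    then show ?thesis unfolding integral_by_parts[OF sl m u U0]
      by (rule DERIV_cong) (use U0 in \<open>simp add: cterm_def F_def U_eq[OF k] algebra_simps\<close>)
  qed
  then have "(ext w e \<eta> \<kappa> has_field_derivative (\<Sum>i\<in>UNIV. F w i u * (cubic' w i u * (e i + cterm w \<eta> i u) + cterm w (Dop w e \<eta> i) i u))) (at u)"
    unfolding ext_def[abs_def] by (intro DERIV_sum) auto
  then show ?thesis using ext_has_derivative[OF sl k] by (rule DERIV_unique[rotated])
qed

definition moment :: "('n \<Rightarrow> real \<times> real \<times> real) \<Rightarrow> (complex \<Rightarrow> complex) \<Rightarrow> nat \<Rightarrow> 'n \<Rightarrow> complex" where
  "moment w \<eta> n j = dz_integral \<Gamma> (\<lambda>v. v ^ n * (G w j v * \<eta> v))"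

text \<open>One use of \<open>F_mult_cterm\<close> for each power of \<open>u\<close>; the moments
  collected on the way become inhomogeneous terms in the equation for the derivative.\<close>

lemma F_cubic'_cterm:
  assumes sl: "sol w e \<eta>" and m: "margin w \<delta>" and u: "u \<in> \<Omega>" and w: "w i = (t, y, x)"
  shows "F w i u * (cubic' w i u * cterm w \<eta> i u - cterm w (\<lambda>v. cubic' w i v * \<eta> v) i u) =
    F w i u * (3 * of_real t * (moment w \<eta> 1 i + u * moment w \<eta> 0 i) + 2 * of_real y * moment w \<eta> 0 i)"
    and "F w i u * (u\<^sup>2 * cterm w \<eta> i u) = F w i u * (cterm w (\<lambda>v. v\<^sup>2 * \<eta> v) i u + moment w \<eta> 1 i + u * moment w \<eta> 0 i)"
    and "F w i u * (u * cterm w \<eta> i u) = F w i u * (cterm w (\<lambda>v. v * \<eta> v) i u + moment w \<eta> 0 i)"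
proof -
  have i: "dz_integrable \<Gamma> (\<lambda>v. G w i v * (v ^ n * \<eta> v))" for n
    using sol_poly(1)[OF sl m, of n i] by (simp add: mult.left_commute)
  have i0: "dz_integrable \<Gamma> (\<lambda>v. G w i v * \<eta> v)" and i1: "dz_integrable \<Gamma> (\<lambda>v. G w i v * (v * \<eta> v))"
    and i2: "dz_integrable \<Gamma> (\<lambda>v. G w i v * (v\<^sup>2 * \<eta> v))"
    using i[of 0] i[of 1] i[of 2] by simp_all
  have m0: "dz_integral \<Gamma> (\<lambda>v. G w i v * \<eta> v) = moment w \<eta> 0 i" by (simp add: moment_def)
  have m1: "dz_integral \<Gamma> (\<lambda>v. G w i v * (v * \<eta> v)) = moment w \<eta> 1 i" by (simp add: moment_def mult.left_commute)
  show one: "F w i u * (u * cterm w \<eta> i u) = F w i u * (cterm w (\<lambda>v. v * \<eta> v) i u + moment w \<eta> 0 i)"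
    using F_mult_cterm[OF u i0] by (simp only: m0)
  have "F w i u * (u\<^sup>2 * cterm w \<eta> i u) = u * (F w i u * (u * cterm w \<eta> i u))" by (simp add: power2_eq_square mult_ac)
  also have "\<dots> = F w i u * (u * cterm w (\<lambda>v. v * \<eta> v) i u) + F w i u * (u * moment w \<eta> 0 i)" unfolding one by (simp add: algebra_simps)
  also have "F w i u * (u * cterm w (\<lambda>v. v * \<eta> v) i u) = F w i u * (cterm w (\<lambda>v. v * (v * \<eta> v)) i u + moment w \<eta> 1 i)"
    using F_mult_cterm[OF u i1] by (simp only: m1)
  finally show two: "F w i u * (u\<^sup>2 * cterm w \<eta> i u) = F w i u * (cterm w (\<lambda>v. v\<^sup>2 * \<eta> v) i u + moment w \<eta> 1 i + u * moment w \<eta> 0 i)"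
    by (simp add: power2_eq_square mult.assoc distrib_left)
  have "cterm w (\<lambda>v. cubic' w i v * \<eta> v) i u = cterm w (\<lambda>v. (3 * of_real t * (v\<^sup>2 * \<eta> v) + 2 * of_real y * (v * \<eta> v)) + of_real x * \<eta> v) i u"
    by (simp add: cubic'_def w algebra_simps)
  also have "\<dots> = 3 * of_real t * cterm w (\<lambda>v. v\<^sup>2 * \<eta> v) i u + 2 * of_real y * cterm w (\<lambda>v. v * \<eta> v) i u + of_real x * cterm w \<eta> i u"
  proof -
    have k: "dz_integrable \<Gamma> (\<lambda>v. G w i v * (a * \<phi> v))" if "dz_integrable \<Gamma> (\<lambda>v. G w i v * \<phi> v)" for a \<phi>
      using dz_integrable_cmult[OF that] by (simp only: mult.left_commute)
    have k2: "dz_integrable \<Gamma> (\<lambda>v. G w i v * (3 * of_real t * (v\<^sup>2 * \<eta> v) + 2 * of_real y * (v * \<eta> v)))"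
      unfolding distrib_left[of "G w i _"] by (intro dz_integrable_add k i1 i2)
    show ?thesis by (simp only: cterm_add[OF u k2 k[OF i0]] cterm_add[OF u k[OF i2] k[OF i1]] cterm_cmult)
  qed
  finally have c: "cterm w (\<lambda>v. cubic' w i v * \<eta> v) i u = 3 * of_real t * cterm w (\<lambda>v. v\<^sup>2 * \<eta> v) i u + 2 * of_real y * cterm w (\<lambda>v. v * \<eta> v) i u + of_real x * cterm w \<eta> i u" .
  have "F w i u * (cubic' w i u * cterm w \<eta> i u - cterm w (\<lambda>v. cubic' w i v * \<eta> v) i u) =
    3 * of_real t * (F w i u * (u\<^sup>2 * cterm w \<eta> i u) - F w i u * cterm w (\<lambda>v. v\<^sup>2 * \<eta> v) i u)
    + 2 * of_real y * (F w i u * (u * cterm w \<eta> i u) - F w i u * cterm w (\<lambda>v. v * \<eta> v) i u)"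
    unfolding c unfolding cubic'_def w by (simp add: algebra_simps)
  also have "\<dots> = F w i u * (3 * of_real t * (moment w \<eta> 1 i + u * moment w \<eta> 0 i) + 2 * of_real y * moment w \<eta> 0 i)"
    unfolding one two by (simp add: algebra_simps)
  finally show "F w i u * (cubic' w i u * cterm w \<eta> i u - cterm w (\<lambda>v. cubic' w i v * \<eta> v) i u) =
    F w i u * (3 * of_real t * (moment w \<eta> 1 i + u * moment w \<eta> 0 i) + 2 * of_real y * moment w \<eta> 0 i)" .
qed


lemma G_mult_integrable:
  assumes "dz_integrable \<Gamma> (\<lambda>v. G w i v * \<phi> v)"
  shows "dz_integrable \<Gamma> (\<lambda>v. G w i v * (a * \<phi> v))"
  using dz_integrable_cmult[OF assms] by (simp only: mult.left_commute)

text \<open>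
  The difference of \<open>\<eta>\<^sub>a'\<close> and \<open>3 t\<^sub>a v\<^sup>2 \<eta>\<^sub>a + \<Sum>\<^sub>b (P\<^sub>a\<^sub>b v + Q\<^sub>a\<^sub>b) \<eta>\<^sub>b\<close> solves the homogeneous equation, for the
  coefficients \<open>P\<close> and \<open>Q\<close> that remove the inhomogeneity. The identity is obtained by integrating against \<open>G w j\<close>.
\<close>

lemma string_identity:
  fixes t y x :: "'n \<Rightarrow> real" and \<eta> :: "'n \<Rightarrow> complex \<Rightarrow> complex"
  assumes w: "\<And>i. w i = (t i, y i, x i)" and sl: "\<And>a. sol w (unit_row a) (\<eta> a)" and m: "margin w \<delta>"
    and uniq: "\<forall>\<zeta>. sol w (\<lambda>_. 0) \<zeta> \<longrightarrow> (\<forall>z\<in>\<Omega>. \<zeta> z = 0)"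
  defines "M \<equiv> \<lambda>n a j. moment w (\<eta> a) n j"
  defines "P \<equiv> \<lambda>a b. 2 * of_real (y a) * unit_row a b + 3 * of_real (t b) * M 0 a b - 3 * of_real (t a) * M 0 a b"
  defines "Q \<equiv> \<lambda>a b. of_real (x a) * unit_row a b + 3 * of_real (t b) * M 1 a b + 2 * of_real (y b) * M 0 a b
    - 3 * of_real (t a) * M 1 a b - (\<Sum>c\<in>UNIV. P a c * M 0 c b)"
  shows "3 * of_real (t a) * M 2 a j + (\<Sum>b\<in>UNIV. P a b * M 1 b j) + (\<Sum>b\<in>UNIV. Q a b * M 0 b j)
    = 3 * of_real (t j) * M 2 a j + 2 * of_real (y j) * M 1 a j + of_real (x j) * M 0 a j"
proof -
  have i: "dz_integrable \<Gamma> (\<lambda>v. G w i v * (v ^ n * \<eta> b v))" for i n b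
    using sol_poly(1)[OF sl m, of n i b] by (simp add: mult.left_commute)
  have i0: "dz_integrable \<Gamma> (\<lambda>v. G w i v * \<eta> b v)" and i1: "dz_integrable \<Gamma> (\<lambda>v. G w i v * (v * \<eta> b v))"
    and i2: "dz_integrable \<Gamma> (\<lambda>v. G w i v * (v\<^sup>2 * \<eta> b v))" for i b
    using i[of i 0 b] i[of i 1 b] i[of i 2 b] by simp_all
  let ?d = "der w (unit_row a) (\<eta> a)"
  have id: "dz_integrable \<Gamma> (\<lambda>v. G w i v * ?d v)" for i
    using sol_poly(2)[OF sl m, of 0 i a] by simp
  have ic: "dz_integrable \<Gamma> (\<lambda>v. G w i v * (cubic' w i v * \<eta> a v))" for i
    using sol_poly(3)[OF sl m, of i i a] by (simp add: mult.left_commute)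
  define R where "R = (\<lambda>v. 3 * of_real (t a) * (v\<^sup>2 * \<eta> a v) + ((\<Sum>b\<in>UNIV. P a b * (v * \<eta> b v)) + (\<Sum>b\<in>UNIV. Q a b * \<eta> b v)))"
  have s1: "dz_integrable \<Gamma> (\<lambda>v. G w i v * (P a b * (v * \<eta> b v)))" for i b
    by (rule G_mult_integrable[OF i1])
  have s0: "dz_integrable \<Gamma> (\<lambda>v. G w i v * (Q a b * \<eta> b v))" for i b
    by (rule G_mult_integrable[OF i0])
  have s2: "dz_integrable \<Gamma> (\<lambda>v. G w i v * (3 * of_real (t a) * (v\<^sup>2 * \<eta> a v)))" for i
    by (rule G_mult_integrable[OF i2])
  have S1: "dz_integrable \<Gamma> (\<lambda>v. G w i v * (\<Sum>b\<in>UNIV. P a b * (v * \<eta> b v)))" for i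
    unfolding sum_distrib_left by (intro dz_integrable_sum s1)
  have S0: "dz_integrable \<Gamma> (\<lambda>v. G w i v * (\<Sum>b\<in>UNIV. Q a b * \<eta> b v))" for i
    unfolding sum_distrib_left by (intro dz_integrable_sum s0)
  have S10: "dz_integrable \<Gamma> (\<lambda>v. G w i v * ((\<Sum>b\<in>UNIV. P a b * (v * \<eta> b v)) + (\<Sum>b\<in>UNIV. Q a b * \<eta> b v)))" for i
    unfolding distrib_left by (intro dz_integrable_add S1 S0)
  have iR: "dz_integrable \<Gamma> (\<lambda>v. G w i v * R v)" for i
    unfolding R_def distrib_left[of "G w i _"] by (intro dz_integrable_add s2 S1 S0)
  have cR: "cterm w R i u = 3 * of_real (t a) * cterm w (\<lambda>v. v\<^sup>2 * \<eta> a v) i u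
      + ((\<Sum>b\<in>UNIV. P a b * cterm w (\<lambda>v. v * \<eta> b v) i u) + (\<Sum>b\<in>UNIV. Q a b * cterm w (\<eta> b) i u))" if u: "u \<in> \<Omega>" for i u
    unfolding R_def
    by (simp only: cterm_add[OF u s2 S10] cterm_add[OF u S1 S0] cterm_sum[OF u s1 finite] cterm_sum[OF u s0 finite] cterm_cmult)
  have sol0: "sol w (\<lambda>_. 0) (\<lambda>v. ?d v - R v)"
    unfolding sol_def
  proof (intro conjI allI ballI)
    fix i show "dz_integrable \<Gamma> (\<lambda>v. G w i v * (?d v - R v))"
      unfolding right_diff_distrib by (intro dz_integrable_diff id iR)
  next
    fix u assume u: "u \<in> \<Omega>"
    have Fterm: "F w i u * (cubic' w i u * (unit_row a i + cterm w (\<eta> a) i u) + cterm w (Dop w (unit_row a) (\<eta> a) i) i u)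
        = F w i u * cterm w (\<lambda>v. ?d v - R v) i u
        + (3 * of_real (t a) * (u\<^sup>2 * (F w i u * (unit_row a i + cterm w (\<eta> a) i u)))
          + ((\<Sum>b\<in>UNIV. P a b * (u * (F w i u * (unit_row b i + cterm w (\<eta> b) i u))))
          + (\<Sum>b\<in>UNIV. Q a b * (F w i u * (unit_row b i + cterm w (\<eta> b) i u)))))" for i
    proof -
      have D: "cterm w (Dop w (unit_row a) (\<eta> a) i) i u = cterm w ?d i u - cterm w (\<lambda>v. cubic' w i v * \<eta> a v) i u"
        unfolding Dop_def[abs_def] by (rule cterm_diff[OF u id ic])
      have c: "cterm w (\<lambda>v. ?d v - R v) i u = cterm w ?d i u - cterm w R i u" by (rule cterm_diff[OF u id iR])
      note f1 = F_cubic'_cterm(1)[OF sl m u w, of i a] and f3 = F_cubic'_cterm(3)[OF sl m u w]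
        and f2 = F_cubic'_cterm(2)[OF sl m u w, of i a]
      have a2: "u\<^sup>2 * (F w i u * (unit_row a i + cterm w (\<eta> a) i u)) =
         F w i u * (u\<^sup>2 * unit_row a i + cterm w (\<lambda>v. v\<^sup>2 * \<eta> a v) i u + M 1 a i + u * M 0 a i)"
        using f2 unfolding M_def by (simp add: algebra_simps)
      have a1: "P a b * (u * (F w i u * (unit_row b i + cterm w (\<eta> b) i u))) =
         F w i u * (P a b * unit_row b i * u + P a b * cterm w (\<lambda>v. v * \<eta> b v) i u + P a b * M 0 b i)" for b
      proof -
        have "P a b * (u * (F w i u * (unit_row b i + cterm w (\<eta> b) i u))) = P a b * (F w i u * (u * unit_row b i) + F w i u * (u * cterm w (\<eta> b) i u))"
          by (simp add: algebra_simps)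
        then show ?thesis unfolding f3[of i b] M_def by (simp add: algebra_simps)
      qed
      have sP: "(\<Sum>b\<in>UNIV. P a b * (u * (F w i u * (unit_row b i + cterm w (\<eta> b) i u))))
        = F w i u * (P a i * u + (\<Sum>b\<in>UNIV. P a b * cterm w (\<lambda>v. v * \<eta> b v) i u) + (\<Sum>b\<in>UNIV. P a b * M 0 b i))"
        unfolding a1 sum_distrib_left[symmetric] sum.distrib sum_distrib_right[symmetric] sum_unit_row ..
      have sQ: "(\<Sum>b\<in>UNIV. Q a b * (F w i u * (unit_row b i + cterm w (\<eta> b) i u)))
        = F w i u * (Q a i + (\<Sum>b\<in>UNIV. Q a b * cterm w (\<eta> b) i u))"
      proof -
        have "(\<Sum>b\<in>UNIV. Q a b * (F w i u * (unit_row b i + cterm w (\<eta> b) i u))) = (\<Sum>b\<in>UNIV. F w i u * (Q a b * unit_row b i + Q a b * cterm w (\<eta> b) i u))"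
          by (intro sum.cong refl) (simp add: algebra_simps)
        then show ?thesis by (simp only: sum_distrib_left[symmetric] sum.distrib sum_unit_row)
      qed
      \<comment> \<open>This identity determines the coefficients: the squares of \<open>u\<close>
        match through the leading term \<open>3 * of_real (t a)\<close>, the terms linear in
        \<open>u\<close> give \<open>P\<close>, and the constant terms give
        \<open>Q\<close>.\<close>
      have co: "cubic' w i u * unit_row a i + 3 * of_real (t i) * (M 1 a i + u * M 0 a i) + 2 * of_real (y i) * M 0 a i
        = 3 * of_real (t a) * (u\<^sup>2 * unit_row a i + M 1 a i + u * M 0 a i) + P a i * u + (\<Sum>b\<in>UNIV. P a b * M 0 b i) + Q a i"
      proof -
        have "cubic' w i u * unit_row a i = (3 * of_real (t a) * u\<^sup>2 + 2 * of_real (y a) * u + of_real (x a)) * unit_row a i"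
          by (auto simp: unit_row_def cubic'_def w)
        then show ?thesis unfolding Q_def by (simp add: P_def algebra_simps)
      qed
      have "F w i u * (cubic' w i u * (unit_row a i + cterm w (\<eta> a) i u) + cterm w (Dop w (unit_row a) (\<eta> a) i) i u)
        = F w i u * (cubic' w i u * unit_row a i) + F w i u * (cubic' w i u * cterm w (\<eta> a) i u - cterm w (\<lambda>v. cubic' w i v * \<eta> a v) i u)
          + F w i u * cterm w ?d i u"
        unfolding D by (simp add: algebra_simps)
      also have "\<dots> = F w i u * (cubic' w i u * unit_row a i + 3 * of_real (t i) * (M 1 a i + u * M 0 a i) + 2 * of_real (y i) * M 0 a i)
          + F w i u * cterm w ?d i u"
        unfolding f1 M_def by (simp add: algebra_simps)
      finally show ?thesis unfolding co c cR[OF u] a2 sP sQ by (simp add: algebra_simps)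
    qed
    have "?d u = (\<Sum>i\<in>UNIV. F w i u * cterm w (\<lambda>v. ?d v - R v) i u) + R u"
      unfolding der_formula[OF sl m u] Fterm sum.distrib
      by (simp only: R_def sol_cterm[OF sl u] sum_distrib_left[symmetric] sum.swap[of "\<lambda>i b. P a b * (u * (F w i u * (unit_row b i + cterm w (\<eta> b) i u)))"]
          sum.swap[of "\<lambda>i b. Q a b * (F w i u * (unit_row b i + cterm w (\<eta> b) i u))"])
    then show "?d u - R u = (\<Sum>i\<in>UNIV. F w i u * (0 + dz_integral \<Gamma> (\<lambda>v. G w i v * (?d v - R v) / (u - v))))"
      by (simp add: F_cterm)
  qed
  have dR: "?d v = R v" if "v \<in> \<Omega>" for v
    using uniq[rule_format, OF sol0 that] by simp
  \<comment> \<open>Uniqueness has identified the derivative with \<open>R\<close>, and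
    \<open>G w j * Dop\<close> integrates to zero. What remains is a relation between
    moments.\<close>
  have "dz_integral \<Gamma> (\<lambda>v. G w j v * R v - G w j v * (cubic' w j v * \<eta> a v)) = dz_integral \<Gamma> (\<lambda>v. G w j v * Dop w (unit_row a) (\<eta> a) j v)"
    by (rule dz_integral_cong) (simp add: Dop_def dR algebra_simps)
  then have 0: "dz_integral \<Gamma> (\<lambda>v. G w j v * R v) = dz_integral \<Gamma> (\<lambda>v. G w j v * (cubic' w j v * \<eta> a v))"
    using integral_Dop[OF sl m, of j a] dz_integral_diff[OF iR[of j] ic[of j]] by simp
  have mm: "dz_integral \<Gamma> (\<lambda>v. G w j v * (c * (v ^ n * \<eta> b v))) = c * M n b j" for c n b
  proof -
    have "dz_integral \<Gamma> (\<lambda>v. G w j v * (c * (v ^ n * \<eta> b v))) = dz_integral \<Gamma> (\<lambda>v. c * (v ^ n * (G w j v * \<eta> b v)))"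
      by (simp only: mult_ac)
    then show ?thesis by (simp only: dz_integral_cmult M_def moment_def)
  qed
  have "dz_integral \<Gamma> (\<lambda>v. G w j v * R v) = dz_integral \<Gamma> (\<lambda>v. G w j v * (3 * of_real (t a) * (v\<^sup>2 * \<eta> a v)))
     + ((\<Sum>b\<in>UNIV. dz_integral \<Gamma> (\<lambda>v. G w j v * (P a b * (v * \<eta> b v)))) + (\<Sum>b\<in>UNIV. dz_integral \<Gamma> (\<lambda>v. G w j v * (Q a b * \<eta> b v))))"
    unfolding R_def distrib_left[of "G w j _"] dz_integral_add[OF s2 dz_integrable_add[OF S1 S0]] dz_integral_add[OF S1 S0]
    unfolding sum_distrib_left by (simp only: dz_integral_sum[OF s1] dz_integral_sum[OF s0])
  also have "\<dots> = 3 * of_real (t a) * M 2 a j + ((\<Sum>b\<in>UNIV. P a b * M 1 b j) + (\<Sum>b\<in>UNIV. Q a b * M 0 b j))"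
    using mm[of _ 2] mm[of _ 1] mm[of _ 0] by simp
  finally have L: "dz_integral \<Gamma> (\<lambda>v. G w j v * R v) = \<dots>" .
  have "dz_integral \<Gamma> (\<lambda>v. G w j v * (cubic' w j v * \<eta> a v)) = dz_integral \<Gamma> (\<lambda>v. G w j v * (3 * of_real (t j) * (v ^ 2 * \<eta> a v))
      + (G w j v * (2 * of_real (y j) * (v ^ 1 * \<eta> a v)) + G w j v * (of_real (x j) * (v ^ 0 * \<eta> a v))))"
    by (intro dz_integral_cong) (simp add: cubic'_def w algebra_simps)
  also have "\<dots> = 3 * of_real (t j) * M 2 a j + (2 * of_real (y j) * M 1 a j + of_real (x j) * M 0 a j)"
  proof -
    have k: "dz_integrable \<Gamma> (\<lambda>v. G w j v * (c * (v ^ n * \<eta> a v)))" for c n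
      by (rule G_mult_integrable[OF i])
    show ?thesis by (simp only: dz_integral_add[OF k dz_integrable_add[OF k k]] dz_integral_add[OF k k] mm)
  qed
  finally show ?thesis using 0 L by (simp add: add.assoc)
qed

end

section \<open>Square integrable solutions and uniqueness\<close>

lemma space_arclength [simp]: "space (arclength \<Gamma>) = carrier_of \<Gamma>"
  unfolding arclength_def by (rule space_measure_of) (use sets.sets_into_space[of _ "restrict_space borel (carrier_of \<Gamma>)"] in \<open>auto simp: space_restrict_space\<close>)

lemma sets_arclength: "sets (arclength \<Gamma>) = sets (restrict_space borel (carrier_of \<Gamma>))"
proof -
  have "sets (restrict_space borel (carrier_of \<Gamma>)) \<subseteq> Pow (carrier_of \<Gamma>)"
    using sets.space_closed[of "restrict_space borel (carrier_of \<Gamma>)"] by (simp add: space_restrict_space)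
  then have "sets (arclength \<Gamma>) = sigma_sets (carrier_of \<Gamma>) (sets (restrict_space borel (carrier_of \<Gamma>)))"
    unfolding arclength_def by (rule sets_measure_of)
  then show ?thesis
    using sets.sigma_sets_eq[of "restrict_space borel (carrier_of \<Gamma>)"] by (simp add: space_restrict_space)
qed

lemma measurable_arclength: "measurable (arclength \<Gamma>) N = measurable (restrict_space borel (carrier_of \<Gamma>)) N"
  by (rule measurable_cong_sets[OF sets_arclength refl])

definition speed :: "contour \<Rightarrow> real \<Rightarrow> ennreal" where
  "speed \<kappa> s = ennreal (norm (indicator (fst \<kappa>) s *\<^sub>R vector_derivative (snd \<kappa>) (at s)))"

context
  fixes \<Gamma> :: "contour set"
  assumes sys: "contour_system \<Gamma>"
begin

lemma speed_measurable: "\<kappa> \<in> \<Gamma> \<Longrightarrow> speed \<kappa> \<in> borel_measurable lborel"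
proof -
  assume k: "\<kappa> \<in> \<Gamma>"
  have "(\<lambda>s. indicator (fst \<kappa>) s *\<^sub>R vector_derivative (snd \<kappa>) (at s)) \<in> borel_measurable borel"
    using contour_borel(3)[of "fst \<kappa>" "snd \<kappa>"] contour_cases[OF sys k] by simp
  from measurable_compose[OF measurable_compose[OF this borel_measurable_norm] measurable_ennreal]
  show ?thesis by (simp add: speed_def[abs_def] del: norm_scaleR)
qed

lemma pullback_measurable:
  assumes k: "\<kappa> \<in> \<Gamma>" and h: "h \<in> borel_measurable (arclength \<Gamma>)"
  shows "(\<lambda>s. h (snd \<kappa> s)) \<in> borel_measurable (restrict_space borel (fst \<kappa>))"
proof -
  have "snd \<kappa> \<in> borel_measurable (restrict_space borel (fst \<kappa>))"
    by (rule borel_measurable_continuous_on_restrict[OF contour_domain(2)[OF sys k]])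
  then have "snd \<kappa> \<in> measurable (restrict_space borel (fst \<kappa>)) (restrict_space borel (carrier_of \<Gamma>))"
    by (rule measurable_restrict_space2[rotated]) (auto simp: space_restrict_space mem_carrier_of[OF k])
  from measurable_compose[OF this h[unfolded measurable_arclength]] show ?thesis .
qed

lemma pullback_speed_measurable:
  fixes h :: "complex \<Rightarrow> ennreal"
  assumes k: "\<kappa> \<in> \<Gamma>" and h: "h \<in> borel_measurable (arclength \<Gamma>)"
  shows "(\<lambda>s. speed \<kappa> s * h (snd \<kappa> s)) \<in> borel_measurable lborel"
proof -
  have "(\<lambda>s. h (snd \<kappa> s) * indicator (fst \<kappa>) s) \<in> borel_measurable borel"
    using pullback_measurable[OF k h] contour_domain(1)[OF sys k]
    by (simp add: borel_measurable_restrict_space_iff_ennreal)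
  then have "(\<lambda>s. speed \<kappa> s * (h (snd \<kappa> s) * indicator (fst \<kappa>) s)) \<in> borel_measurable lborel"
    using speed_measurable[OF k] by measurable
  also have "(\<lambda>s. speed \<kappa> s * (h (snd \<kappa> s) * indicator (fst \<kappa>) s)) = (\<lambda>s. speed \<kappa> s * h (snd \<kappa> s))"
    by (auto simp: speed_def indicator_def)
  finally show ?thesis .
qed

lemma nn_integral_arclength:
  fixes h :: "complex \<Rightarrow> ennreal"
  assumes h: "h \<in> borel_measurable (arclength \<Gamma>)"
  shows "(\<integral>\<^sup>+ z. h z \<partial>arclength \<Gamma>) = (\<Sum>\<kappa>\<in>\<Gamma>. \<integral>\<^sup>+ s. speed \<kappa> s * h (snd \<kappa> s) \<partial>lborel)"
  using h
proof (induction h rule: borel_measurable_induct)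
  case (cong f g)
  have "(\<integral>\<^sup>+ s. speed \<kappa> s * g (snd \<kappa> s) \<partial>lborel) = (\<integral>\<^sup>+ s. speed \<kappa> s * f (snd \<kappa> s) \<partial>lborel)" if k: "\<kappa> \<in> \<Gamma>" for \<kappa>
    using cong(3) mem_carrier_of[OF k] by (intro nn_integral_cong) (auto simp: speed_def indicator_def)
  moreover have "(\<integral>\<^sup>+ z. f z \<partial>arclength \<Gamma>) = (\<integral>\<^sup>+ z. g z \<partial>arclength \<Gamma>)"
    using cong(3) by (intro nn_integral_cong) auto
  ultimately show ?case using cong(4) by (simp cong: sum.cong)
next
  case (set A)
  have "(\<integral>\<^sup>+ z. indicator A z \<partial>arclength \<Gamma>) = emeasure (arclength \<Gamma>) A" using set by simp
  also have "\<dots> = (\<Sum>(I, \<gamma>)\<in>\<Gamma>. \<integral>\<^sup>+ s. ennreal (norm (vector_derivative \<gamma> (at s))) * indicator {s\<in>I. \<gamma> s \<in> A} s \<partial>lborel)"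
    using set by (intro emeasure_arclength[OF sys]) (simp add: sets_arclength)
  also have "\<dots> = (\<Sum>\<kappa>\<in>\<Gamma>. \<integral>\<^sup>+ s. speed \<kappa> s * indicator A (snd \<kappa> s) \<partial>lborel)"
    unfolding case_prod_unfold
    by (intro sum.cong refl nn_integral_cong) (auto simp: speed_def indicator_def)
  finally show ?case .
next
  case (mult f c)
  have "(\<integral>\<^sup>+ s. speed \<kappa> s * (c * f (snd \<kappa> s)) \<partial>lborel) = c * (\<integral>\<^sup>+ s. speed \<kappa> s * f (snd \<kappa> s) \<partial>lborel)" if "\<kappa> \<in> \<Gamma>" for \<kappa>
    using pullback_speed_measurable[OF that mult(2)]
    by (subst nn_integral_cmult[symmetric]) (auto simp: mult_ac)
  then show ?case using mult by (simp add: nn_integral_cmult sum_distrib_left cong: sum.cong)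
next
  case (add f g)
  have "(\<integral>\<^sup>+ s. speed \<kappa> s * (g (snd \<kappa> s) + f (snd \<kappa> s)) \<partial>lborel) =
     (\<integral>\<^sup>+ s. speed \<kappa> s * g (snd \<kappa> s) \<partial>lborel) + (\<integral>\<^sup>+ s. speed \<kappa> s * f (snd \<kappa> s) \<partial>lborel)" if "\<kappa> \<in> \<Gamma>" for \<kappa>
    using pullback_speed_measurable[OF that] add by (simp add: distrib_left nn_integral_add)
  then show ?case using add by (simp add: nn_integral_add sum.distrib cong: sum.cong)
next
  case (seq U)
  have inc: "incseq U" by (rule seq)
  have "(\<integral>\<^sup>+ s. speed \<kappa> s * (SUP i. U i) (snd \<kappa> s) \<partial>lborel) = (SUP i. \<integral>\<^sup>+ s. speed \<kappa> s * U i (snd \<kappa> s) \<partial>lborel)" if k: "\<kappa> \<in> \<Gamma>" for \<kappa>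
  proof -
    have "(\<integral>\<^sup>+ s. speed \<kappa> s * (SUP i. U i) (snd \<kappa> s) \<partial>lborel) = (\<integral>\<^sup>+ s. (SUP i. speed \<kappa> s * U i (snd \<kappa> s)) \<partial>lborel)"
      by (simp add: SUP_mult_left_ennreal image_comp)
    also have "\<dots> = (SUP i. \<integral>\<^sup>+ s. speed \<kappa> s * U i (snd \<kappa> s) \<partial>lborel)"
      using inc pullback_speed_measurable[OF k seq(1)]
      by (intro nn_integral_monotone_convergence_SUP) (auto simp: incseq_def le_fun_def intro!: mult_left_mono)
    finally show ?thesis .
  qed
  then have "(\<Sum>\<kappa>\<in>\<Gamma>. \<integral>\<^sup>+ s. speed \<kappa> s * (SUP i. U i) (snd \<kappa> s) \<partial>lborel) = (\<Sum>\<kappa>\<in>\<Gamma>. SUP i. \<integral>\<^sup>+ s. speed \<kappa> s * U i (snd \<kappa> s) \<partial>lborel)"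
    by (simp cong: sum.cong)
  also have "\<dots> = (SUP i. \<Sum>\<kappa>\<in>\<Gamma>. \<integral>\<^sup>+ s. speed \<kappa> s * U i (snd \<kappa> s) \<partial>lborel)"
    using inc by (intro ennreal_SUP_sum[symmetric]) (auto simp: incseq_def le_fun_def intro!: nn_integral_mono mult_left_mono)
  also have "\<dots> = (SUP i. \<integral>\<^sup>+ z. U i z \<partial>arclength \<Gamma>)" using seq by simp
  also have "\<dots> = (\<integral>\<^sup>+ z. (SUP i. U i z) \<partial>arclength \<Gamma>)"
    using inc seq(1) by (intro nn_integral_monotone_convergence_SUP[symmetric]) auto
  finally show ?case by (simp add: image_comp)
qed

text \<open>A null set for arc length can be the image of many parameters at which the derivative is
  0, so these are excepted in the conclusion. They do not affect integrals against
  \<open>dz\<close>, which carry the derivative as a factor.\<close>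

lemma AE_arclengthD:
  assumes "AE z in arclength \<Gamma>. P z" "\<kappa> \<in> \<Gamma>"
  shows "AE s in lborel. s \<in> fst \<kappa> \<longrightarrow> vector_derivative (snd \<kappa>) (at s) = 0 \<or> P (snd \<kappa> s)"
proof -
  obtain N where N: "N \<in> sets (arclength \<Gamma>)" "emeasure (arclength \<Gamma>) N = 0" "{z \<in> carrier_of \<Gamma>. \<not> P z} \<subseteq> N"
    using assms(1) by (auto elim!: AE_E)
  have m: "(indicator N :: complex \<Rightarrow> ennreal) \<in> borel_measurable (arclength \<Gamma>)" using N(1) by simp
  have "(\<Sum>\<kappa>\<in>\<Gamma>. \<integral>\<^sup>+ s. speed \<kappa> s * indicator N (snd \<kappa> s) \<partial>lborel) = 0"
    using nn_integral_arclength[OF m] N by simp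
  then have "(\<integral>\<^sup>+ s. speed \<kappa> s * indicator N (snd \<kappa> s) \<partial>lborel) = 0"
    using assms(2) sys by (simp add: sum_eq_0_iff contour_system_def)
  then have "AE s in lborel. speed \<kappa> s * indicator N (snd \<kappa> s) = 0"
    using pullback_speed_measurable[OF assms(2) m] by (simp add: nn_integral_0_iff_AE)
  then show ?thesis
  proof (rule AE_mp, intro AE_I2 impI)
    fix s assume s: "speed \<kappa> s * indicator N (snd \<kappa> s) = 0" "s \<in> fst \<kappa>"
    then show "vector_derivative (snd \<kappa>) (at s) = 0 \<or> P (snd \<kappa> s)"
      using N(3) mem_carrier_of[OF assms(2)] by (auto simp: speed_def indicator_def split: if_splits)
  qed
qed

lemma pullback_line_measurable:
  fixes \<phi> :: "complex \<Rightarrow> complex"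
  assumes "\<kappa> \<in> \<Gamma>" "\<phi> \<in> borel_measurable (arclength \<Gamma>)"
  shows "(\<lambda>s. indicator (fst \<kappa>) s *\<^sub>R (\<phi> (snd \<kappa> s) * vector_derivative (snd \<kappa>) (at s))) \<in> borel_measurable lborel"
proof -
  have "(\<lambda>s. indicator (fst \<kappa>) s *\<^sub>R \<phi> (snd \<kappa> s)) \<in> borel_measurable borel"
    using pullback_measurable[OF assms] contour_domain(1)[OF sys assms(1)]
    by (simp add: borel_measurable_restrict_space_iff)
  moreover have "(\<lambda>s. indicator (fst \<kappa>) s *\<^sub>R vector_derivative (snd \<kappa>) (at s)) \<in> borel_measurable borel"
    using contour_borel(3)[of "fst \<kappa>" "snd \<kappa>"] contour_cases[OF sys assms(1)] by simp
  ultimately have "(\<lambda>s. (indicator (fst \<kappa>) s *\<^sub>R \<phi> (snd \<kappa> s)) * (indicator (fst \<kappa>) s *\<^sub>R vector_derivative (snd \<kappa>) (at s))) \<in> borel_measurable borel"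
    by (rule borel_measurable_times)
  also have "(\<lambda>s. (indicator (fst \<kappa>) s *\<^sub>R \<phi> (snd \<kappa> s)) * (indicator (fst \<kappa>) s *\<^sub>R vector_derivative (snd \<kappa>) (at s)))
     = (\<lambda>s. indicator (fst \<kappa>) s *\<^sub>R (\<phi> (snd \<kappa> s) * vector_derivative (snd \<kappa>) (at s)))"
    by (auto simp: indicator_def fun_eq_iff)
  finally show ?thesis by simp
qed

lemma dz_integrable_arclength:
  fixes \<phi> :: "complex \<Rightarrow> complex"
  assumes "integrable (arclength \<Gamma>) \<phi>"
  shows "dz_integrable \<Gamma> \<phi>"
  unfolding dz_integrable_iff line_integrable_def set_integrable_def
proof (intro ballI integrableI_bounded)
  fix \<kappa> assume k: "\<kappa> \<in> \<Gamma>"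
  have m: "\<phi> \<in> borel_measurable (arclength \<Gamma>)" using assms by simp
  show "(\<lambda>s. indicator (fst \<kappa>) s *\<^sub>R (\<phi> (snd \<kappa> s) * vector_derivative (snd \<kappa>) (at s))) \<in> borel_measurable lborel"
    by (rule pullback_line_measurable[OF k m])
  have "(\<Sum>\<kappa>\<in>\<Gamma>. \<integral>\<^sup>+ s. speed \<kappa> s * ennreal (cmod (\<phi> (snd \<kappa> s))) \<partial>lborel) < \<infinity>"
  proof -
    have "(\<lambda>z. ennreal (cmod (\<phi> z))) \<in> borel_measurable (arclength \<Gamma>)" using m by measurable
    from nn_integral_arclength[OF this] show ?thesis using assms by (simp add: integrable_iff_bounded)
  qed
  then have "(\<integral>\<^sup>+ s. speed \<kappa> s * ennreal (cmod (\<phi> (snd \<kappa> s))) \<partial>lborel) < \<infinity>"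
    using k sys by (simp add: contour_system_def less_top[symmetric])
  also have "(\<integral>\<^sup>+ s. speed \<kappa> s * ennreal (cmod (\<phi> (snd \<kappa> s))) \<partial>lborel)
    = (\<integral>\<^sup>+ s. ennreal (cmod (indicator (fst \<kappa>) s *\<^sub>R (\<phi> (snd \<kappa> s) * vector_derivative (snd \<kappa>) (at s)))) \<partial>lborel)"
    by (intro nn_integral_cong) (auto simp: speed_def indicator_def norm_mult mult.commute simp flip: ennreal_mult)
  finally show "(\<integral>\<^sup>+ s. ennreal (cmod (indicator (fst \<kappa>) s *\<^sub>R (\<phi> (snd \<kappa> s) * vector_derivative (snd \<kappa>) (at s)))) \<partial>lborel) < \<infinity>" .
qed

lemma dz_AE_cong:
  fixes \<phi> \<psi> :: "complex \<Rightarrow> complex"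
  assumes "dz_integrable \<Gamma> \<phi>" "AE z in arclength \<Gamma>. \<phi> z = \<psi> z" "\<psi> \<in> borel_measurable (arclength \<Gamma>)"
  shows "dz_integrable \<Gamma> \<psi>" "dz_integral \<Gamma> \<psi> = dz_integral \<Gamma> \<phi>"
proof -
  have *: "AE s in lborel. indicator (fst \<kappa>) s *\<^sub>R (\<phi> (snd \<kappa> s) * vector_derivative (snd \<kappa>) (at s)) =
     indicator (fst \<kappa>) s *\<^sub>R (\<psi> (snd \<kappa> s) * vector_derivative (snd \<kappa>) (at s))" if k: "\<kappa> \<in> \<Gamma>" for \<kappa>
    using AE_arclengthD[OF assms(2) k] by (rule AE_mp) (auto intro!: AE_I2 simp: indicator_def)
  have i: "integrable lborel (\<lambda>s. indicator (fst \<kappa>) s *\<^sub>R (\<psi> (snd \<kappa> s) * vector_derivative (snd \<kappa>) (at s)))" if k: "\<kappa> \<in> \<Gamma>" for \<kappa>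
    using assms(1) k integrable_cong_AE_imp[OF _ pullback_line_measurable[OF k assms(3)] *[OF k]]
    by (auto simp: dz_integrable_iff line_integrable_def set_integrable_def)
  then show "dz_integrable \<Gamma> \<psi>" by (simp add: dz_integrable_iff line_integrable_def set_integrable_def)
  have "line_integral \<kappa> \<psi> = line_integral \<kappa> \<phi>" if k: "\<kappa> \<in> \<Gamma>" for \<kappa>
    unfolding line_integral_def set_lebesgue_integral_def
    using i[OF k] assms(1) k AE_symmetric[OF *[OF k]]
    by (intro integral_cong_AE) (auto simp: dz_integrable_iff line_integrable_def set_integrable_def)
  then show "dz_integral \<Gamma> \<psi> = dz_integral \<Gamma> \<phi>" by (simp add: dz_integral_eq cong: sum.cong)
qed

lemma continuous_measurable_arclength:
  fixes h :: "complex \<Rightarrow> complex"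
  assumes "\<And>\<kappa>. \<kappa> \<in> \<Gamma> \<Longrightarrow> continuous_on (contour_image \<kappa>) h"
  shows "h \<in> borel_measurable (arclength \<Gamma>)"
proof -
  have "continuous_on (\<Union>\<kappa>\<in>\<Gamma>. contour_image \<kappa>) h"
    using sys assms closed_contour_image[OF sys] by (intro continuous_on_closed_Union) (auto simp: contour_system_def)
  then show ?thesis unfolding measurable_arclength carrier_of_def by (rule borel_measurable_continuous_on_restrict)
qed

end

section \<open>Square integrable functions\<close>

lemma L2_bound:
  assumes "\<phi> \<in> L2 \<Gamma>" "\<psi> \<in> borel_measurable (arclength \<Gamma>)" "\<And>z. z \<in> carrier_of \<Gamma> \<Longrightarrow> cmod (\<psi> z) \<le> cmod (\<phi> z)"
  shows "\<psi> \<in> L2 \<Gamma>"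
proof -
  have "integrable (arclength \<Gamma>) (\<lambda>z. (norm (\<psi> z))\<^sup>2)"
  proof (rule Bochner_Integration.integrable_bound)
    show "integrable (arclength \<Gamma>) (\<lambda>z. (norm (\<phi> z))\<^sup>2)" using assms(1) by (simp add: L2_def)
    show "(\<lambda>z. (norm (\<psi> z))\<^sup>2) \<in> borel_measurable (arclength \<Gamma>)" using assms(2) by measurable
    show "AE z in arclength \<Gamma>. norm ((norm (\<psi> z))\<^sup>2) \<le> norm ((norm (\<phi> z))\<^sup>2)"
      using assms(3) by (intro AE_I2) (auto intro!: power_mono)
  qed
  then show ?thesis using assms(2) by (simp add: L2_def)
qed

lemma L2_cmult: "\<phi> \<in> L2 \<Gamma> \<Longrightarrow> (\<lambda>z. a * \<phi> z) \<in> L2 \<Gamma>"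
  unfolding L2_def by (auto simp: norm_mult power_mult_distrib)

lemma L2_add:
  assumes "\<phi> \<in> L2 \<Gamma>" "\<psi> \<in> L2 \<Gamma>"
  shows "(\<lambda>z. \<phi> z + \<psi> z) \<in> L2 \<Gamma>"
proof -
  have m: "\<phi> \<in> borel_measurable (arclength \<Gamma>)" "\<psi> \<in> borel_measurable (arclength \<Gamma>)"
    using assms by (auto simp: L2_def)
  have "integrable (arclength \<Gamma>) (\<lambda>z. (norm (\<phi> z + \<psi> z))\<^sup>2)"
  proof (rule Bochner_Integration.integrable_bound)
    show "integrable (arclength \<Gamma>) (\<lambda>z. 2 * (norm (\<phi> z))\<^sup>2 + 2 * (norm (\<psi> z))\<^sup>2)"
      using assms by (simp add: L2_def)
    show "(\<lambda>z. (norm (\<phi> z + \<psi> z))\<^sup>2) \<in> borel_measurable (arclength \<Gamma>)" using m by measurable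
    show "AE z in arclength \<Gamma>. norm ((norm (\<phi> z + \<psi> z))\<^sup>2) \<le> norm (2 * (norm (\<phi> z))\<^sup>2 + 2 * (norm (\<psi> z))\<^sup>2)"
    proof (intro AE_I2)
      fix z
      have "(norm (\<phi> z + \<psi> z))\<^sup>2 \<le> (norm (\<phi> z) + norm (\<psi> z))\<^sup>2" by (intro power_mono norm_triangle_ineq) auto
      also have "\<dots> \<le> 2 * (norm (\<phi> z))\<^sup>2 + 2 * (norm (\<psi> z))\<^sup>2"
        using zero_le_power2[of "norm (\<phi> z) - norm (\<psi> z)"] by (simp add: power2_eq_square algebra_simps)
      finally show "norm ((norm (\<phi> z + \<psi> z))\<^sup>2) \<le> norm (2 * (norm (\<phi> z))\<^sup>2 + 2 * (norm (\<psi> z))\<^sup>2)" by simp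
    qed
  qed
  then show ?thesis using m by (simp add: L2_def)
qed

lemma L2_sum: "finite A \<Longrightarrow> (\<And>i. i \<in> A \<Longrightarrow> \<phi> i \<in> L2 \<Gamma>) \<Longrightarrow> (\<lambda>z. \<Sum>i\<in>A. \<phi> i z) \<in> L2 \<Gamma>"
proof (induction A rule: finite_induct)
  case (insert x A)
  then show ?case by (simp add: L2_add)
qed (simp add: L2_def)

lemma L2_norm_nonneg: "0 \<le> L2_norm \<Gamma> \<phi>"
  by (simp add: L2_norm_def)

lemma L2_norm_mono:
  assumes "\<phi> \<in> L2 \<Gamma>" "\<psi> \<in> L2 \<Gamma>" "AE z in arclength \<Gamma>. cmod (\<phi> z) \<le> cmod (\<psi> z)"
  shows "L2_norm \<Gamma> \<phi> \<le> L2_norm \<Gamma> \<psi>"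
  unfolding L2_norm_def
proof (rule real_sqrt_le_mono, rule integral_mono_AE)
  show "AE z in arclength \<Gamma>. (norm (\<phi> z))\<^sup>2 \<le> (norm (\<psi> z))\<^sup>2"
    using assms(3) by (rule AE_mp) (auto intro!: AE_I2 power_mono)
qed (use assms in \<open>auto simp: L2_def\<close>)

lemma L2_norm_cmult: "L2_norm \<Gamma> (\<lambda>z. a * \<phi> z) = cmod a * L2_norm \<Gamma> \<phi>"
  unfolding L2_norm_def by (simp add: norm_mult power_mult_distrib real_sqrt_mult)

lemma L2_mult_integrable:
  assumes "\<phi> \<in> L2 \<Gamma>" "\<psi> \<in> L2 \<Gamma>"
  shows "integrable (arclength \<Gamma>) (\<lambda>z. \<phi> z * \<psi> z)"
proof (rule Bochner_Integration.integrable_bound)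
  show "integrable (arclength \<Gamma>) (\<lambda>z. (norm (\<phi> z))\<^sup>2 + (norm (\<psi> z))\<^sup>2)"
    using assms by (simp add: L2_def)
  show "(\<lambda>z. \<phi> z * \<psi> z) \<in> borel_measurable (arclength \<Gamma>)" using assms by (auto simp: L2_def)
  show "AE z in arclength \<Gamma>. norm (\<phi> z * \<psi> z) \<le> norm ((norm (\<phi> z))\<^sup>2 + (norm (\<psi> z))\<^sup>2)"
  proof (intro AE_I2)
    fix z
    have "0 \<le> norm (\<phi> z) * norm (\<psi> z)" by simp
    then have "norm (\<phi> z) * norm (\<psi> z) \<le> (norm (\<phi> z))\<^sup>2 + (norm (\<psi> z))\<^sup>2"
      using sum_squares_bound[of "norm (\<phi> z)" "norm (\<psi> z)"] by linarith
    then show "norm (\<phi> z * \<psi> z) \<le> norm ((norm (\<phi> z))\<^sup>2 + (norm (\<psi> z))\<^sup>2)" by (simp add: norm_mult)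
  qed
qed

text \<open>The Lipschitz constant \<open>1 / R\<close> is what counts: it bounds the difference
  quotient that arises as commutator of the cutoff with the Cauchy kernel.\<close>

definition cutoff :: "real \<Rightarrow> complex \<Rightarrow> complex" where
  "cutoff R u = of_real (max 0 (min 1 (2 - cmod u / R)))"

lemma cutoff_bounds:
  assumes "0 < R"
  shows "cmod (cutoff R u) \<le> 1" "cmod u \<le> R \<Longrightarrow> cutoff R u = 1" "2 * R \<le> cmod u \<Longrightarrow> cutoff R u = 0"
    "cmod (cutoff R u - cutoff R v) \<le> cmod (u - v) / R" "continuous_on A (cutoff R)"
proof -
  show "cmod (cutoff R u) \<le> 1" "cmod u \<le> R \<Longrightarrow> cutoff R u = 1" "2 * R \<le> cmod u \<Longrightarrow> cutoff R u = 0"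
    using assms by (auto simp: cutoff_def divide_simps)
  have "\<bar>max 0 (min 1 a) - max 0 (min 1 b)\<bar> \<le> \<bar>a - b\<bar>" for a b :: real by linarith
  from this[of "2 - cmod u / R" "2 - cmod v / R"]
  have "cmod (cutoff R u - cutoff R v) \<le> \<bar>(2 - cmod u / R) - (2 - cmod v / R)\<bar>"
    by (simp only: cutoff_def of_real_diff[symmetric] norm_of_real)
  also have "\<dots> = \<bar>cmod u / R - cmod v / R\<bar>" by linarith
  also have "\<dots> = \<bar>cmod u - cmod v\<bar> / R" using assms by (simp flip: diff_divide_distrib)
  also have "\<dots> \<le> cmod (u - v) / R" using assms norm_triangle_ineq3[of u v] by (intro divide_right_mono) auto
  finally show "cmod (cutoff R u - cutoff R v) \<le> cmod (u - v) / R" .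
  show "continuous_on A (cutoff R)" unfolding cutoff_def using assms by (intro continuous_intros) auto
qed

text \<open>One parameter value together with its gauge factor: the bridge between the operator,
  which is determined only up to null sets, and the pointwise equation \<open>sol\<close>.\<close>

locale jump_operator = jump_data \<Gamma> U V for \<Gamma> and U V :: "complex \<Rightarrow> 'n::finite \<Rightarrow> complex" +
  fixes w :: "'n \<Rightarrow> real \<times> real \<times> real" and c :: "complex \<Rightarrow> complex" and K :: "complex \<Rightarrow> complex \<Rightarrow> complex"
    and R :: "(complex \<Rightarrow> complex) \<Rightarrow> complex \<Rightarrow> complex"
  assumes c_nz: "\<And>u. u \<in> carrier_of \<Gamma> \<Longrightarrow> c u \<noteq> 0"
    and kernel: "\<And>u v. u \<in> carrier_of \<Gamma> \<Longrightarrow> v \<in> carrier_of \<Gamma> \<Longrightarrow> K u v = (\<Sum>i\<in>UNIV. c u * F w i u * (G w i v / c v)) / (u - v)"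
    and f_L2: "\<And>i. (\<lambda>u. c u * F w i u) \<in> L2 \<Gamma>"
    and g_L2: "\<And>i. (\<lambda>u. G w i u / c u) \<in> L2 \<Gamma>"
    and bounded_K: "bounded_on_L2 \<Gamma> (int_op \<Gamma> K)"
    and inverse: "is_inverse_one_minus \<Gamma> K R"
begin

text \<open>The kernel is 0 for \<open>v\<close> on contours where all components of
  \<open>V\<close> vanish, so \<open>\<theta>\<close> has to be prescribed only on the others. The
  proof of uniqueness applies this to two functions that differ only there.\<close>

lemma int_op_eq:
  assumes u: "u \<in> \<Omega>" and \<phi>: "\<And>i. dz_integrable \<Gamma> (\<lambda>v. G w i v * \<phi> v)"
    and \<theta>: "\<And>v. v \<in> \<Omega> \<Longrightarrow> V v \<noteq> (\<lambda>_. 0) \<Longrightarrow> \<theta> v = c v * \<phi> v"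
  shows "int_op \<Gamma> K \<theta> u = c u * (\<Sum>i\<in>UNIV. F w i u * cterm w \<phi> i u)"
proof -
  have "int_op \<Gamma> K \<theta> u = dz_integral \<Gamma> (\<lambda>v. \<Sum>i\<in>UNIV. c u * F w i u * (G w i v * \<phi> v / (u - v)))"
    unfolding int_op_def
  proof (rule dz_integral_cong)
    fix v assume v: "v \<in> \<Omega>"
    show "K u v * \<theta> v = (\<Sum>i\<in>UNIV. c u * F w i u * (G w i v * \<phi> v / (u - v)))"
    proof (cases "V v = (\<lambda>_. 0)")
      case True
      then show ?thesis by (simp add: kernel[OF u v] G_def)
    next
      case False
      then show ?thesis using c_nz[OF v]
        by (simp add: kernel[OF u v] \<theta>[OF v] sum_divide_distrib sum_distrib_right mult.assoc)
    qed
  qed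
  also have "\<dots> = (\<Sum>i\<in>UNIV. dz_integral \<Gamma> (\<lambda>v. c u * F w i u * (G w i v * \<phi> v / (u - v))))"
  proof (rule dz_integral_sum)
    fix i
    show "dz_integrable \<Gamma> (\<lambda>v. c u * F w i u * (G w i v * \<phi> v / (u - v)))"
    proof (cases "U u i = 0")
      case False
      show ?thesis by (rule dz_integrable_cmult[OF Cauchy_term_integrable'[OF u False \<phi>]])
    qed (simp add: F_def)
  qed
  also have "\<dots> = c u * (\<Sum>i\<in>UNIV. F w i u * cterm w \<phi> i u)"
    by (simp only: dz_integral_cmult mult.assoc F_cterm sum_distrib_left)
  finally show ?thesis .
qed

text \<open>The inverse yields a function that is determined only almost everywhere. Inserting it
  into the right-hand side of the equation once produces a representative that is continuous on
  every contour and satisfies the equation at every point, with unchanged integrals.\<close>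

lemma extraction:
  fixes a :: 'n
  defines "\<theta> \<equiv> R (\<lambda>u. c u * F w a u)"
  shows "\<exists>\<eta>. sol w (\<lambda>i. if i = a then 1 else 0) \<eta> \<and>
    (\<forall>j. dz_integral \<Gamma> (\<lambda>s. \<theta> s * (G w j s / c s)) = dz_integral \<Gamma> (\<lambda>s. G w j s * \<eta> s))"
proof -
  have \<theta>: "\<theta> \<in> L2 \<Gamma>" using inverse f_L2 by (simp add: is_inverse_one_minus_def bounded_on_L2_def \<theta>_def)
  have res: "AE u in arclength \<Gamma>. \<theta> u - int_op \<Gamma> K \<theta> u = c u * F w a u"
    using inverse f_L2[of a] by (simp add: is_inverse_one_minus_def \<theta>_def)
  define \<phi> where "\<phi> = (\<lambda>u. \<theta> u / c u)"
  have g\<theta>: "integrable (arclength \<Gamma>) (\<lambda>v. G w i v / c v * \<theta> v)" for i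
    by (rule L2_mult_integrable[OF g_L2 \<theta>])
  have eq: "G w i v / c v * \<theta> v = G w i v * \<phi> v" for i v by (simp add: \<phi>_def)
  have \<phi>i: "dz_integrable \<Gamma> (\<lambda>v. G w i v * \<phi> v)" for i
    using dz_integrable_arclength[OF system g\<theta>[of i]] by (simp only: eq)
  define \<eta> where "\<eta> = (\<lambda>u. F w a u + (\<Sum>i\<in>UNIV. F w i u * cterm w \<phi> i u))"
  have \<eta>c: "continuous_on (contour_image \<kappa>) \<eta>" if "\<kappa> \<in> \<Gamma>" for \<kappa>
    unfolding \<eta>_def by (intro continuous_intros continuous_on_F continuous_cterm that \<phi>i)
  have "AE u in arclength \<Gamma>. \<phi> u = \<eta> u"
    using res
  proof (rule AE_mp, intro AE_I2 impI)
    fix u assume u': "u \<in> space (arclength \<Gamma>)" and e: "\<theta> u - int_op \<Gamma> K \<theta> u = c u * F w a u"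
    then have u: "u \<in> \<Omega>" by simp
    have "int_op \<Gamma> K \<theta> u = c u * (\<Sum>i\<in>UNIV. F w i u * cterm w \<phi> i u)"
      by (rule int_op_eq[OF u \<phi>i]) (simp add: \<phi>_def c_nz)
    then have "\<theta> u = c u * \<eta> u" using e by (simp add: \<eta>_def algebra_simps)
    then show "\<phi> u = \<eta> u" using c_nz[OF u] by (simp add: \<phi>_def)
  qed
  then have ae: "AE u in arclength \<Gamma>. G w i u * \<phi> u = G w i u * \<eta> u" for i
    by (rule AE_mp) (auto intro!: AE_I2)
  have m: "(\<lambda>v. G w i v * \<eta> v) \<in> borel_measurable (arclength \<Gamma>)" for i
    by (intro continuous_measurable_arclength[OF system] continuous_intros continuous_on_G \<eta>c)
  note c1 = dz_AE_cong[OF system \<phi>i ae m]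
  have ct: "cterm w \<phi> i u = cterm w \<eta> i u" if u: "u \<in> \<Omega>" for i u
  proof (cases "U u i = 0")
    case False
    have "(\<lambda>v. (G w i v * \<eta> v) / (u - v)) \<in> borel_measurable (arclength \<Gamma>)"
    proof -
      have "(\<lambda>v. v) \<in> borel_measurable (arclength \<Gamma>)"
        by (intro continuous_measurable_arclength[OF system] continuous_intros)
      then show ?thesis using m[of i] by measurable
    qed
    moreover have "AE v in arclength \<Gamma>. G w i v * \<phi> v / (u - v) = G w i v * \<eta> v / (u - v)"
      using ae[of i] by (rule AE_mp) (auto intro!: AE_I2)
    ultimately show ?thesis using dz_AE_cong(2)[OF system Cauchy_term_integrable'[OF u False \<phi>i]] False
      by (simp add: cterm_def)
  qed (simp add: cterm_def)
  show ?thesis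
  proof (intro exI[of _ \<eta>] conjI allI)
    show "sol w (\<lambda>i. if i = a then 1 else 0) \<eta>"
      unfolding sol_def
    proof (intro conjI allI ballI c1(1))
      fix u assume u: "u \<in> \<Omega>"
      have "(\<Sum>i\<in>UNIV. F w i u * ((if i = a then 1 else 0) + dz_integral \<Gamma> (\<lambda>v. G w i v * \<eta> v / (u - v))))
         = (\<Sum>i\<in>UNIV. (if i = a then F w i u else 0) + F w i u * cterm w \<phi> i u)"
        by (intro sum.cong refl) (simp add: distrib_left F_cterm ct[OF u])
      also have "\<dots> = \<eta> u" by (simp add: sum.distrib \<eta>_def)
      finally show "\<eta> u = (\<Sum>i\<in>UNIV. F w i u * ((if i = a then 1 else 0) + dz_integral \<Gamma> (\<lambda>v. G w i v * \<eta> v / (u - v))))" by simp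
    qed
    fix j
    show "dz_integral \<Gamma> (\<lambda>s. \<theta> s * (G w j s / c s)) = dz_integral \<Gamma> (\<lambda>s. G w j s * \<eta> s)"
      unfolding c1(2) by (rule dz_integral_cong) (simp add: \<phi>_def)
  qed
qed

text \<open>
  A solution \<open>\<eta>\<close> of the homogeneous equation need not be square integrable. But \<open>1 - H\<close> applied to a cutoff of
  \<open>c * \<eta>\<close> at radius \<open>r\<close> is only the commutator of the cutoff with the Cauchy kernel, which is of size \<open>O(1 / r)\<close>
  relative to \<open>f\<close>; invertibility then forces \<open>\<eta> = 0\<close> where \<open>V \<noteq> 0\<close>, and the equation itself does the rest.
\<close>

theorem uniqueness:
  assumes sl: "sol w (\<lambda>_. 0) \<eta>" and z: "z \<in> \<Omega>"
  shows "\<eta> z = 0"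
proof -
  have \<eta>i: "dz_integrable \<Gamma> (\<lambda>v. G w i v * \<eta> v)" for i using sl by (simp add: sol_def)
  have \<eta>eq: "\<eta> u = (\<Sum>i\<in>UNIV. F w i u * cterm w \<eta> i u)" if "u \<in> \<Omega>" for u
    using sl that by (simp add: sol_def F_cterm)
  define f where "f = (\<lambda>u. \<Sum>i\<in>UNIV. complex_of_real (cmod (c u * F w i u)))"
  have fL: "f \<in> L2 \<Gamma>"
    unfolding f_def
  proof (rule L2_sum)
    fix i
    have "(\<lambda>u. c u * F w i u) \<in> borel_measurable (arclength \<Gamma>)" using f_L2[of i] by (simp add: L2_def)
    then have "(\<lambda>u. complex_of_real (cmod (c u * F w i u))) \<in> borel_measurable (arclength \<Gamma>)" by measurable
    then show "(\<lambda>u. complex_of_real (cmod (c u * F w i u))) \<in> L2 \<Gamma>" by (rule L2_bound[OF f_L2[of i]]) simp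
  qed simp
  have fn: "cmod (f u) = (\<Sum>i\<in>UNIV. cmod (c u * F w i u))" for u
    unfolding f_def of_real_sum[symmetric] norm_of_real by (intro abs_of_nonneg sum_nonneg) simp
  define L where "L = (\<Sum>i\<in>UNIV. dz_norm \<Gamma> (\<lambda>v. G w i v * \<eta> v))"
  have L0: "0 \<le> L" unfolding L_def by (intro sum_nonneg dz_norm_nonneg)
  have Li: "dz_norm \<Gamma> (\<lambda>v. G w i v * \<eta> v) \<le> L" for i
    unfolding L_def by (rule member_le_sum) (auto simp: dz_norm_nonneg)
  obtain Bd where Bd: "\<And>\<phi>. \<phi> \<in> L2 \<Gamma> \<Longrightarrow> L2_norm \<Gamma> (R \<phi>) \<le> Bd * L2_norm \<Gamma> \<phi>"
    using inverse by (auto simp: is_inverse_one_minus_def bounded_on_L2_def)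
  define vm where "vm = (\<lambda>u. if V u = (\<lambda>_. 0) then 0 else (1::complex))"
  have vm_c: "continuous_on (contour_image \<kappa>) vm" if k: "\<kappa> \<in> \<Gamma>" for \<kappa>
  proof -
    have "continuous_on (contour_image \<kappa>) (\<lambda>_. if Vc \<kappa> = (\<lambda>_. 0) then 0 else (1::complex))" by simp
    then show ?thesis by (rule continuous_on_eq) (use V_eq[OF k] in \<open>auto simp: vm_def\<close>)
  qed
  have vm1: "cmod (vm u) \<le> 1" for u by (simp add: vm_def)
  define D where "D = (\<lambda>r u. vm u * (cutoff r u * (c u * \<eta> u)))"
  have D_meas: "D r \<in> borel_measurable (arclength \<Gamma>)" if "0 < r" for r
  proof -
    have "vm \<in> borel_measurable (arclength \<Gamma>)" "cutoff r \<in> borel_measurable (arclength \<Gamma>)"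
      using vm_c cutoff_bounds(5)[OF that] by (auto intro: continuous_measurable_arclength[OF system])
    moreover have "cterm w \<eta> i \<in> borel_measurable (arclength \<Gamma>)" for i
      by (intro continuous_measurable_arclength[OF system] continuous_cterm \<eta>i)
    moreover have "(\<lambda>u. c u * F w i u) \<in> borel_measurable (arclength \<Gamma>)" for i using f_L2[of i] by (simp add: L2_def)
    ultimately have "(\<lambda>u. vm u * (cutoff r u * (\<Sum>i\<in>UNIV. c u * F w i u * cterm w \<eta> i u))) \<in> borel_measurable (arclength \<Gamma>)"
      by measurable
    then show ?thesis
      by (rule measurable_cong[THEN iffD1, rotated]) (simp add: D_def \<eta>eq sum_distrib_left mult.assoc)
  qed
  have D_L2: "D r \<in> L2 \<Gamma>" if r: "0 < r" for r
  proof -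
    have "\<exists>M\<ge>0. \<forall>u\<in>contour_image \<kappa>. cmod u \<le> 2 * r \<longrightarrow> cmod (cterm w \<eta> i u) \<le> M" if k: "\<kappa> \<in> \<Gamma>" for \<kappa> i
    proof -
      have "compact (contour_image \<kappa> \<inter> cball 0 (2 * r))"
        using closed_contour_image[OF system k] by (intro closed_Int_compact) auto
      then have "bounded (cterm w \<eta> i ` (contour_image \<kappa> \<inter> cball 0 (2 * r)))"
        by (intro compact_imp_bounded compact_continuous_image continuous_on_subset[OF continuous_cterm[OF k \<eta>i]]) auto
      then obtain M where "\<forall>x\<in>cterm w \<eta> i ` (contour_image \<kappa> \<inter> cball 0 (2 * r)). cmod x \<le> M" by (auto simp: bounded_iff)
      then show ?thesis by (intro exI[of _ "max 0 M"]) (auto simp: le_max_iff_disj)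
    qed
    then obtain M where M: "\<And>\<kappa> i. \<kappa> \<in> \<Gamma> \<Longrightarrow> 0 \<le> M \<kappa> i" "\<And>\<kappa> i u. \<kappa> \<in> \<Gamma> \<Longrightarrow> u \<in> contour_image \<kappa> \<Longrightarrow> cmod u \<le> 2 * r \<Longrightarrow> cmod (cterm w \<eta> i u) \<le> M \<kappa> i" by metis
    define M1 where "M1 = (\<Sum>\<kappa>\<in>\<Gamma>. \<Sum>i\<in>UNIV. M \<kappa> i)"
    have M1: "cmod (cterm w \<eta> i u) \<le> M1" if u: "u \<in> \<Omega>" "cmod u \<le> 2 * r" for i u
    proof -
      obtain \<kappa> where k: "\<kappa> \<in> \<Gamma>" "u \<in> contour_image \<kappa>" using u(1) unfolding carrier_of_def by blast
      have "cmod (cterm w \<eta> i u) \<le> M \<kappa> i" by (rule M(2)[OF k u(2)])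
      also have "\<dots> \<le> (\<Sum>i\<in>UNIV. M \<kappa> i)" using M(1)[OF k(1)] by (intro member_le_sum) auto
      also have "\<dots> \<le> M1" unfolding M1_def using M(1) k finite_\<Gamma>
        by (intro member_le_sum[of \<kappa> \<Gamma> "\<lambda>\<kappa>. \<Sum>i\<in>UNIV. M \<kappa> i"] sum_nonneg) auto
      finally show ?thesis .
    qed
    have M10: "0 \<le> M1" unfolding M1_def using M(1) by (intro sum_nonneg)
    show ?thesis
    proof (rule L2_bound[OF L2_cmult[OF fL, of "of_real M1"] D_meas[OF r]])
      fix u assume u: "u \<in> \<Omega>"
      show "cmod (D r u) \<le> cmod (of_real M1 * f u)"
      proof (cases "cmod u \<le> 2 * r")
        case True
        have "cmod (c u * \<eta> u) \<le> (\<Sum>i\<in>UNIV. cmod (c u * F w i u) * M1)"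
          unfolding \<eta>eq[OF u] sum_distrib_left mult.assoc[symmetric]
          by (intro order_trans[OF norm_sum] sum_mono) (simp add: norm_mult[of "c u * F w _ u"] mult_left_mono M1[OF u True])
        also have "\<dots> = cmod (of_real M1 * f u)" using M10 by (simp add: norm_mult fn sum_distrib_left mult.commute)
        finally have "cmod (c u * \<eta> u) \<le> cmod (of_real M1 * f u)" .
        moreover have "cmod (D r u) \<le> 1 * (1 * cmod (c u * \<eta> u))"
          unfolding D_def norm_mult[of "vm u"] norm_mult[of "cutoff r u"]
          using vm1 cutoff_bounds(1)[OF r] by (intro mult_mono) auto
        ultimately show ?thesis by simp
      next
        case False
        then show ?thesis using cutoff_bounds(3)[OF r, of u] by (simp add: D_def)
      qed
    qed
  qed
  define \<chi>\<eta> where "\<chi>\<eta> = (\<lambda>r u. cutoff r u * \<eta> u)"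
  have \<chi>i: "dz_integrable \<Gamma> (\<lambda>v. G w i v * \<chi>\<eta> r v)" if r: "0 < r" for r i
  proof -
    have "dz_integrable \<Gamma> (\<lambda>v. cutoff r v * (G w i v * \<eta> v))"
      by (rule dz_integrable_bound[OF system _ \<eta>i \<eta>i])
        (use cutoff_bounds[OF r] in \<open>auto simp: norm_mult[of "cutoff r _"] intro!: mult_left_le_one_le\<close>)
    then show ?thesis by (simp add: \<chi>\<eta>_def mult.left_commute)
  qed
  \<comment> \<open>On contours with \<open>V = 0\<close> the value is that of the operator applied
    to \<open>D r\<close>. The operator does not see the difference between \<open>D r\<close> and
    \<open>E r\<close>, so \<open>1 - H\<close> applied to \<open>E r\<close> vanishes
    there.\<close>
  define E where "E = (\<lambda>r u. D r u + (1 - vm u) * int_op \<Gamma> K (D r) u)"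
  have IK: "int_op \<Gamma> K (D r) \<in> L2 \<Gamma>" if "0 < r" for r
    using bounded_K D_L2[OF that] by (simp add: bounded_on_L2_def)
  have measurable_IK: "int_op \<Gamma> K (D r) \<in> borel_measurable (arclength \<Gamma>)" if "0 < r" for r
    using IK[OF that] by (simp add: L2_def)
  have E_L2: "E r \<in> L2 \<Gamma>" if r: "0 < r" for r
    unfolding E_def
  proof (rule L2_add[OF D_L2[OF r] L2_bound[OF IK[OF r]]])
    have "vm \<in> borel_measurable (arclength \<Gamma>)" using vm_c by (rule continuous_measurable_arclength[OF system])
    then show "(\<lambda>u. (1 - vm u) * int_op \<Gamma> K (D r) u) \<in> borel_measurable (arclength \<Gamma>)"
      using measurable_IK[OF r] by measurable
    show "cmod ((1 - vm u) * int_op \<Gamma> K (D r) u) \<le> cmod (int_op \<Gamma> K (D r) u)" for u by (simp add: vm_def)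
  qed
  have DE: "int_op \<Gamma> K (D r) u = c u * (\<Sum>i\<in>UNIV. F w i u * cterm w (\<chi>\<eta> r) i u)"
    "int_op \<Gamma> K (E r) u = c u * (\<Sum>i\<in>UNIV. F w i u * cterm w (\<chi>\<eta> r) i u)" if r: "0 < r" and u: "u \<in> \<Omega>" for r u
    by (rule int_op_eq[OF u \<chi>i[OF r]]; simp add: D_def E_def vm_def \<chi>\<eta>_def)+
  \<comment> \<open>The inverse takes \<open>T r\<close> back to \<open>E r\<close> almost
    everywhere, so a bound of order \<open>1 / r\<close> for \<open>T r\<close> passes to the norm
    of \<open>E r\<close>.\<close>
  define T where "T = (\<lambda>r u. E r u - int_op \<Gamma> K (E r) u)"
  have Tb: "cmod (T r u) \<le> cmod (of_real (L / r) * f u)" if r: "0 < r" and u: "u \<in> \<Omega>" for r u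
  proof (cases "V u = (\<lambda>_. 0)")
    case True
    then have "T r u = 0" using DE[OF r u] by (simp add: T_def E_def D_def vm_def)
    then show ?thesis by simp
  next
    case False
    have "T r u = cutoff r u * (c u * \<eta> u) - c u * (\<Sum>i\<in>UNIV. F w i u * cterm w (\<chi>\<eta> r) i u)"
      using False DE(2)[OF r u] by (simp add: T_def E_def D_def vm_def)
    also have "\<dots> = (\<Sum>i\<in>UNIV. c u * F w i u * (cutoff r u * cterm w \<eta> i u - cterm w (\<chi>\<eta> r) i u))"
      unfolding \<eta>eq[OF u] by (simp add: sum_distrib_left sum_subtractf[symmetric] algebra_simps)
    finally have Teq: "T r u = (\<Sum>i\<in>UNIV. c u * F w i u * (cutoff r u * cterm w \<eta> i u - cterm w (\<chi>\<eta> r) i u))" .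
    have tm: "cmod (cutoff r u * cterm w \<eta> i u - cterm w (\<chi>\<eta> r) i u) \<le> L / r" for i
    proof (cases "U u i = 0")
      case True
      then show ?thesis using L0 r by (simp add: cterm_def)
    next
      case U0: False
      note i1 = Cauchy_term_integrable'[OF u U0 \<eta>i[of i]] and i2 = Cauchy_term_integrable'[OF u U0 \<chi>i[OF r, of i]]
      have i3: "dz_integrable \<Gamma> (\<lambda>v. cutoff r u * (G w i v * \<eta> v / (u - v)) - G w i v * \<chi>\<eta> r v / (u - v))"
        by (intro dz_integrable_diff dz_integrable_cmult i1 i2)
      have "cutoff r u * cterm w \<eta> i u - cterm w (\<chi>\<eta> r) i u
        = dz_integral \<Gamma> (\<lambda>v. cutoff r u * (G w i v * \<eta> v / (u - v)) - G w i v * \<chi>\<eta> r v / (u - v))"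
        using dz_integral_diff[OF dz_integrable_cmult[OF i1, of "cutoff r u"] i2]
        by (simp only: cterm_def U0 if_False dz_integral_cmult)
      then have "cmod (cutoff r u * cterm w \<eta> i u - cterm w (\<chi>\<eta> r) i u)
        \<le> dz_norm \<Gamma> (\<lambda>v. cutoff r u * (G w i v * \<eta> v / (u - v)) - G w i v * \<chi>\<eta> r v / (u - v))"
        using norm_dz_integral_le[OF i3] by simp
      also have "\<dots> \<le> dz_norm \<Gamma> (\<lambda>v. of_real (1 / r) * (G w i v * \<eta> v))"
      proof (rule dz_norm_mono[OF i3 dz_integrable_cmult[OF \<eta>i]])
        fix v assume "v \<in> \<Omega>"
        \<comment> \<open>The Lipschitz bound of the cutoff cancels the Cauchy denominator and
          leaves \<open>1 / r\<close>; at \<open>u = v\<close> the quotient is 0 by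
          convention.\<close>
        have eq: "cutoff r u * (G w i v * \<eta> v / (u - v)) - G w i v * \<chi>\<eta> r v / (u - v) = (cutoff r u - cutoff r v) / (u - v) * (G w i v * \<eta> v)"
          by (simp add: \<chi>\<eta>_def diff_divide_distrib algebra_simps)
        have "cmod ((cutoff r u - cutoff r v) / (u - v)) \<le> 1 / r"
          using cutoff_bounds(4)[OF r, of u v] r by (cases "u = v") (auto simp: norm_divide divide_simps mult.commute)
        then show "cmod (cutoff r u * (G w i v * \<eta> v / (u - v)) - G w i v * \<chi>\<eta> r v / (u - v)) \<le> cmod (of_real (1 / r) * (G w i v * \<eta> v))"
          using r unfolding eq norm_mult[of "(cutoff r u - cutoff r v) / (u - v)"] norm_mult[of "of_real (1 / r)"] norm_of_real
          by (intro mult_right_mono) auto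
      qed
      also have "\<dots> \<le> L / r" using Li[of i] r unfolding dz_norm_cmult by (simp add: norm_divide divide_right_mono)
      finally show ?thesis .
    qed
    have "cmod (T r u) \<le> (\<Sum>i\<in>UNIV. cmod (c u * F w i u) * (L / r))"
      unfolding Teq using mult_left_mono[OF tm norm_ge_zero]
      by (intro order_trans[OF norm_sum] sum_mono) (simp add: norm_mult[of "c u * F w _ u"])
    also have "\<dots> = cmod (of_real (L / r) * f u)"
      using L0 r unfolding norm_mult[of "of_real (L / r)"] fn norm_of_real by (simp add: sum_distrib_left sum_distrib_right mult.commute)
    finally show ?thesis .
  qed
  have T_L2: "T r \<in> L2 \<Gamma>" if r: "0 < r" for r
  proof (rule L2_bound[OF L2_cmult[OF fL] _ Tb[OF r]])
    have "int_op \<Gamma> K (E r) \<in> L2 \<Gamma>" using bounded_K E_L2[OF r] by (simp add: bounded_on_L2_def)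
    then have "int_op \<Gamma> K (E r) \<in> borel_measurable (arclength \<Gamma>)" "E r \<in> borel_measurable (arclength \<Gamma>)"
      using E_L2[OF r] by (simp_all add: L2_def)
    then show "T r \<in> borel_measurable (arclength \<Gamma>)" unfolding T_def by (rule borel_measurable_diff[rotated])
  qed
  have E_small: "L2_norm \<Gamma> (E r) \<le> \<bar>Bd\<bar> * (L / r * L2_norm \<Gamma> f)" if r: "0 < r" for r
  proof -
    have RT: "R (T r) \<in> L2 \<Gamma>" using inverse T_L2[OF r] by (simp add: is_inverse_one_minus_def bounded_on_L2_def)
    have "AE u in arclength \<Gamma>. R (T r) u = E r u"
      using inverse E_L2[OF r] unfolding is_inverse_one_minus_def T_def by blast
    then have "L2_norm \<Gamma> (E r) \<le> L2_norm \<Gamma> (R (T r))"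
      by (intro L2_norm_mono E_L2[OF r] RT) (auto elim: AE_mp)
    also have "\<dots> \<le> Bd * L2_norm \<Gamma> (T r)" by (rule Bd[OF T_L2[OF r]])
    also have "\<dots> \<le> \<bar>Bd\<bar> * L2_norm \<Gamma> (T r)" by (intro mult_right_mono L2_norm_nonneg) auto
    also have "L2_norm \<Gamma> (T r) \<le> L2_norm \<Gamma> (\<lambda>u. of_real (L / r) * f u)"
      using Tb[OF r] by (intro L2_norm_mono T_L2[OF r] L2_cmult[OF fL] AE_I2) auto
    also have "\<dots> = L / r * L2_norm \<Gamma> f" using L0 r unfolding L2_norm_cmult norm_of_real by simp
    finally show ?thesis by (simp add: mult_left_mono)
  qed
  \<comment> \<open>The radius \<open>r1\<close> is fixed while \<open>r\<close> tends to infinity: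
    \<open>D1 r1\<close> is dominated by \<open>E r\<close> for all \<open>r \<ge> r1\<close>, and
    the norm of \<open>E r\<close> tends to 0.\<close>
  define D1 where "D1 = (\<lambda>r1 u. if cmod u \<le> r1 then vm u * (c u * \<eta> u) else 0)"
  have D1_0: "L2_norm \<Gamma> (D1 r1) = 0" and D1_L2: "D1 r1 \<in> L2 \<Gamma>" if r1: "0 < r1" for r1
  proof -
    have sub: "cmod (D1 r1 u) \<le> cmod (D r u)" if "r1 \<le> r" for r u
      using that r1 cutoff_bounds(2)[of r u] by (auto simp: D1_def D_def)
    have DE': "cmod (D r u) \<le> cmod (E r u)" for r u by (simp add: D_def E_def vm_def)
    have id: "(\<lambda>u. u) \<in> borel_measurable (arclength \<Gamma>)"
      by (intro continuous_measurable_arclength[OF system] continuous_intros)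
    have "{u \<in> space (arclength \<Gamma>). cmod u \<le> r1} \<in> sets (arclength \<Gamma>)" using id by measurable
    then have "(\<lambda>u. if cmod u \<le> r1 then D r1 u else 0) \<in> borel_measurable (arclength \<Gamma>)"
      using D_meas[OF r1] by (intro measurable_If) auto
    also have "(\<lambda>u. if cmod u \<le> r1 then D r1 u else 0) = D1 r1"
      using cutoff_bounds(2)[OF r1] by (auto simp: D1_def D_def fun_eq_iff)
    finally have meas: "D1 r1 \<in> borel_measurable (arclength \<Gamma>)" .
    show D1_L2: "D1 r1 \<in> L2 \<Gamma>" by (rule L2_bound[OF D_L2[OF r1] meas sub]) simp
    have le: "L2_norm \<Gamma> (D1 r1) \<le> \<bar>Bd\<bar> * (L * L2_norm \<Gamma> f) / r" if "r1 \<le> r" for r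
    proof -
      have r: "0 < r" using that r1 by simp
      have "L2_norm \<Gamma> (D1 r1) \<le> L2_norm \<Gamma> (E r)"
        using order_trans[OF sub[OF that] DE'] by (intro L2_norm_mono D1_L2 E_L2[OF r] AE_I2) auto
      also note E_small[OF r]
      finally show ?thesis by simp
    qed
    have "((\<lambda>r. \<bar>Bd\<bar> * (L * L2_norm \<Gamma> f) / r) \<longlongrightarrow> 0) at_top" by (intro tendsto_divide_0[OF tendsto_const] filterlim_at_top_imp_at_infinity filterlim_ident)
    then have "L2_norm \<Gamma> (D1 r1) \<le> 0"
      by (rule tendsto_lowerbound) (use le in \<open>auto simp: eventually_at_top_linorder\<close>)
    then show "L2_norm \<Gamma> (D1 r1) = 0" using L2_norm_nonneg[of \<Gamma> "D1 r1"] by simp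
  qed
  have "AE u in arclength \<Gamma>. D1 r1 u = 0" if r1: "0 < r1" for r1
  proof -
    have "(\<integral>z. (norm (D1 r1 z))\<^sup>2 \<partial>arclength \<Gamma>) = 0" using D1_0[OF r1] by (simp add: L2_norm_def)
    then have "AE z in arclength \<Gamma>. (norm (D1 r1 z))\<^sup>2 = 0"
      using D1_L2[OF r1] by (subst (asm) integral_nonneg_eq_0_iff_AE) (auto simp: L2_def)
    then show ?thesis by (rule AE_mp) auto
  qed
  then have "AE u in arclength \<Gamma>. D1 (real (Suc n)) u = 0" for n by simp
  then have "AE u in arclength \<Gamma>. \<forall>n. D1 (real (Suc n)) u = 0" by (simp add: AE_all_countable)
  then have "AE u in arclength \<Gamma>. 0 = G w i u * \<eta> u" for i
  proof (rule AE_mp, intro AE_I2 impI)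
    fix u assume u: "u \<in> space (arclength \<Gamma>)" and n: "\<forall>n. D1 (real (Suc n)) u = 0"
    obtain n where "cmod u \<le> real n" using real_arch_simple by blast
    then have "vm u * (c u * \<eta> u) = 0" using n[rule_format, of n] by (simp add: D1_def)
    then show "0 = G w i u * \<eta> u" using u c_nz[of u] by (auto simp: vm_def G_def split: if_splits)
  qed
  moreover have m: "(\<lambda>v. G w i v * \<eta> v) \<in> borel_measurable (arclength \<Gamma>)" for i
    by (intro continuous_measurable_arclength[OF system] continuous_intros continuous_on_G sol_continuous[OF sl])
  ultimately have ae: "AE u in arclength \<Gamma>. 0 = G w i u * \<eta> u" for i by blast
  \<comment> \<open>Since \<open>G w i * \<eta>\<close> vanishes almost everywhere, its Cauchy
    integrals vanish at every point, and the equation upgrades the conclusion from almost everywhere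
    to everywhere.\<close>
  have "cterm w \<eta> i z = 0" for i
  proof (cases "U z i = 0")
    case False
    have "(\<lambda>v. (G w i v * \<eta> v) / (z - v)) \<in> borel_measurable (arclength \<Gamma>)"
    proof -
      have "(\<lambda>v. v) \<in> borel_measurable (arclength \<Gamma>)"
        by (intro continuous_measurable_arclength[OF system] continuous_intros)
      then show ?thesis using m[of i] by measurable
    qed
    moreover have "AE u in arclength \<Gamma>. 0 = G w i u * \<eta> u / (z - u)" using ae[of i] by (rule AE_mp) (auto intro!: AE_I2)
    ultimately have "dz_integral \<Gamma> (\<lambda>v. (G w i v * \<eta> v) / (z - v)) = dz_integral \<Gamma> (\<lambda>v. 0)"
      by (intro dz_AE_cong(2)[OF system]) auto
    then show ?thesis by (simp add: cterm_def)
  qed (simp add: cterm_def)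
  then show ?thesis using \<eta>eq[OF z] by simp
qed

end

section \<open>Solutions for shifted parameters\<close>

text \<open>A density on the whole line instead of a restricted space: the integrands stay Borel
  functions of a real variable, and only the estimates have to look at the interval.\<close>

definition unit_measure :: "real measure" where
  "unit_measure = density lborel (\<lambda>s. ennreal (indicator {0..1} s))"

lemma sets_unit_measure [measurable_cong, simp]: "sets unit_measure = sets borel"
  by (simp add: unit_measure_def)

lemma space_unit_measure [simp]: "space unit_measure = UNIV"
  by (simp add: unit_measure_def)

lemma emeasure_unit_measure: "emeasure unit_measure UNIV = 1"
proof -
  have "emeasure unit_measure UNIV = (\<integral>\<^sup>+ s. indicator {0..1::real} s \<partial>lborel)"
    unfolding unit_measure_def by (subst emeasure_density) (simp_all add: ennreal_indicator)
  then show ?thesis by simp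
qed

interpretation unit_measure: finite_measure unit_measure
  by (rule finite_measureI) (simp add: emeasure_unit_measure)

interpretation unit_pair: pair_sigma_finite unit_measure "lborel :: real measure" ..

interpretation unit_square: pair_sigma_finite unit_measure unit_measure ..

lemma AE_unit_measure: "AE s in unit_measure. 0 < s \<and> s < 1"
proof -
  have "AE s in lborel. s \<noteq> (0::real)" "AE s in lborel. s \<noteq> (1::real)" by (rule AE_lborel_singleton)+
  then have "AE s in lborel. 0 < ennreal (indicator {0..1} s) \<longrightarrow> 0 < s \<and> s < (1::real)"
    by eventually_elim (auto simp: indicator_def)
  then show ?thesis unfolding unit_measure_def by (subst AE_density) auto
qed

lemma integral_unit_measure:
  fixes f :: "real \<Rightarrow> complex"
  assumes "f \<in> borel_measurable borel"
  shows "(\<integral>s. f s \<partial>unit_measure) = (\<integral>s. indicator {0..1} s *\<^sub>R f s \<partial>lborel)"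
  unfolding unit_measure_def using assms by (subst integral_density) auto

lemma unit_integrable:
  fixes f :: "real \<Rightarrow> complex"
  assumes "f \<in> borel_measurable borel" "\<And>s. 0 < s \<Longrightarrow> s < 1 \<Longrightarrow> cmod (f s) \<le> B"
  shows "integrable unit_measure f"
proof (rule unit_measure.integrable_const_bound)
  show "AE s in unit_measure. cmod (f s) \<le> B" using AE_unit_measure by eventually_elim (use assms(2) in auto)
qed (use assms(1) in simp)

text \<open>The sign condition on \<open>B\<close> covers the case that \<open>f\<close> is not
  integrable, where the integral is 0 by convention.\<close>

lemma unit_integral_le:
  fixes f :: "real \<Rightarrow> real"
  assumes "\<And>s. 0 < s \<Longrightarrow> s < 1 \<Longrightarrow> f s \<le> B" "0 \<le> B"
  shows "(\<integral>s. f s \<partial>unit_measure) \<le> B"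
proof (cases "integrable unit_measure f")
  case True
  have "(\<integral>s. f s \<partial>unit_measure) \<le> (\<integral>s. B \<partial>unit_measure)"
  proof (rule integral_mono_AE[OF True])
    show "AE s in unit_measure. f s \<le> B" using AE_unit_measure by eventually_elim (use assms(1) in blast)
  qed simp
  then show ?thesis by (simp add: measure_def emeasure_unit_measure)
qed (use assms in \<open>simp add: not_integrable_integral_eq\<close>)

lemma unit_integral_norm_le:
  fixes f :: "real \<Rightarrow> complex"
  assumes "\<And>s. 0 < s \<Longrightarrow> s < 1 \<Longrightarrow> cmod (f s) \<le> B" "0 \<le> B"
  shows "cmod (\<integral>s. f s \<partial>unit_measure) \<le> B"
  using order_trans[OF integral_norm_bound unit_integral_le[OF assms]] .

text \<open>Neumann series: by \<open>h\<close> each iteration at least halves the bound, so the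
  iterates are at most \<open>C * (1 / 2) ^ n\<close> and sum to at most \<open>2 * C\<close>. The
  finitely many indices make it a system of equations, whence the factor \<open>CARD('n)\<close> in
  the smallness condition.\<close>

lemma Fredholm_solution:
  fixes N :: "'n::finite \<Rightarrow> 'n \<Rightarrow> real \<Rightarrow> real \<Rightarrow> complex" and N0 :: "'n \<Rightarrow> real \<Rightarrow> complex" and h C :: real
  assumes N: "\<And>b i. (\<lambda>p. N b i (fst p) (snd p)) \<in> borel_measurable (borel \<Otimes>\<^sub>M borel)" "\<And>b i s \<sigma>. cmod (N b i s \<sigma>) \<le> C"
    and N0: "\<And>i. N0 i \<in> borel_measurable borel" "\<And>i \<sigma>. cmod (N0 i \<sigma>) \<le> C"
    and h: "\<bar>h\<bar> * (CARD('n) * C) \<le> 1 / 2"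
  obtains k where "\<And>i. k i \<in> borel_measurable borel" "\<And>i \<sigma>. cmod (k i \<sigma>) \<le> 2 * C"
    "\<And>i \<sigma>. k i \<sigma> = N0 i \<sigma> + of_real h * (\<Sum>b\<in>UNIV. \<integral>s. k b s * N b i s \<sigma> \<partial>unit_measure)"
proof -
  have C: "0 \<le> C" using order_trans[OF norm_ge_zero N(2)] by blast
  define D where "D = rec_nat N0 (\<lambda>_ Dn i \<sigma>. of_real h * (\<Sum>b\<in>UNIV. \<integral>s. Dn b s * N b i s \<sigma> \<partial>unit_measure))"
  have D0: "D 0 = N0" and DS: "D (Suc n) = (\<lambda>i \<sigma>. of_real h * (\<Sum>b\<in>UNIV. \<integral>s. D n b s * N b i s \<sigma> \<partial>unit_measure))" for n
    by (simp_all add: D_def)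
  have Ns: "(\<lambda>s. N b i s \<sigma>) \<in> borel_measurable borel" for b i \<sigma>
    using measurable_compose[OF _ N(1)[of b i], of "\<lambda>s. (s, \<sigma>)" borel] by simp
  have Nsw: "(\<lambda>p. N b i (snd p) (fst p)) \<in> borel_measurable (borel \<Otimes>\<^sub>M borel)" for b i
    using measurable_compose[OF _ N(1)[of b i], of "\<lambda>p. (snd p, fst p)" "borel \<Otimes>\<^sub>M borel"] by simp
  have D: "D n i \<in> borel_measurable borel \<and> (\<forall>\<sigma>. cmod (D n i \<sigma>) \<le> C * (1 / 2) ^ n)" for n i
  proof (induction n arbitrary: i)
    case 0
    then show ?case using N0 by (simp add: D0)
  next
    case (Suc n)
    have "(\<lambda>\<sigma>. \<integral>s. D n b s * N b i s \<sigma> \<partial>unit_measure) \<in> borel_measurable borel" for b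
    proof (rule unit_measure.borel_measurable_lebesgue_integral)
      have "(\<lambda>p. D n b (snd p) * N b i (snd p) (fst p)) \<in> borel_measurable (borel \<Otimes>\<^sub>M borel)"
        using Suc.IH[of b] Nsw[of b i] by (intro borel_measurable_times measurable_compose[OF measurable_snd]) auto
      then show "(\<lambda>(\<sigma>, s). D n b s * N b i s \<sigma>) \<in> borel_measurable (borel \<Otimes>\<^sub>M unit_measure)"
        by (simp add: case_prod_unfold cong: measurable_cong_sets sets_pair_measure_cong)
    qed
    then have "D (Suc n) i \<in> borel_measurable borel" unfolding DS by (intro borel_measurable_times borel_measurable_sum) auto
    moreover have "cmod (D (Suc n) i \<sigma>) \<le> C * (1 / 2) ^ Suc n" for \<sigma>
    proof -
      have "cmod (\<integral>s. D n b s * N b i s \<sigma> \<partial>unit_measure) \<le> C * (1 / 2) ^ n * C" for b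
        using Suc.IH[of b] N(2) C by (intro unit_integral_norm_le) (auto simp: norm_mult intro!: mult_mono)
      then have "cmod (\<Sum>b\<in>UNIV. \<integral>s. D n b s * N b i s \<sigma> \<partial>unit_measure) \<le> CARD('n) * (C * (1 / 2) ^ n * C)"
        by (intro order_trans[OF norm_sum] sum_bounded_above) auto
      then have "cmod (D (Suc n) i \<sigma>) \<le> \<bar>h\<bar> * (CARD('n) * (C * (1 / 2) ^ n * C))"
        unfolding DS norm_mult by (simp add: mult_left_mono)
      also have "\<dots> = (\<bar>h\<bar> * (CARD('n) * C)) * (C * (1 / 2) ^ n)" by (simp add: mult_ac)
      also have "\<dots> \<le> 1 / 2 * (C * (1 / 2) ^ n)" using C by (intro mult_right_mono h) auto
      finally show ?thesis by simp
    qed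
    ultimately show ?case by blast
  qed
  have geo: "(\<lambda>n. C * (1 / 2) ^ n) sums (2 * C)" using sums_mult[OF geometric_sums[of "1/2 :: real"], of C] by (simp add: mult.commute)
  have sD: "summable (\<lambda>n. cmod (D n i \<sigma>))" for i \<sigma>
    using D by (intro summable_comparison_test[OF _ sums_summable[OF geo]]) auto
  define k where "k i \<sigma> = (\<Sum>n. D n i \<sigma>)" for i \<sigma>
  show ?thesis
  proof (rule that[of k])
    show km: "k i \<in> borel_measurable borel" for i unfolding k_def[abs_def] using D by (intro borel_measurable_suminf) auto
    show "cmod (k i \<sigma>) \<le> 2 * C" for i \<sigma>
    proof -
      have "cmod (k i \<sigma>) \<le> (\<Sum>n. cmod (D n i \<sigma>))" unfolding k_def by (rule summable_norm[OF sD])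
      also have "\<dots> \<le> (\<Sum>n. C * (1 / 2) ^ n)" using D by (intro suminf_le sD sums_summable[OF geo]) auto
      finally show ?thesis using sums_unique[OF geo] by simp
    qed
    show "k i \<sigma> = N0 i \<sigma> + of_real h * (\<Sum>b\<in>UNIV. \<integral>s. k b s * N b i s \<sigma> \<partial>unit_measure)" for i \<sigma>
    proof -
      have int: "(\<lambda>n. \<integral>s. D n b s * N b i s \<sigma> \<partial>unit_measure) sums (\<integral>s. k b s * N b i s \<sigma> \<partial>unit_measure)" for b
      proof -
        have b: "cmod (D n b s * N b i s \<sigma>) \<le> C * (1 / 2) ^ n * C" for n s
          using D[of n b] N(2) C by (auto simp: norm_mult intro!: mult_mono)
        have "(\<lambda>n. \<integral>s. D n b s * N b i s \<sigma> \<partial>unit_measure) sums (\<integral>s. (\<Sum>n. D n b s * N b i s \<sigma>) \<partial>unit_measure)"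
        proof (rule sums_integral)
          show "integrable unit_measure (\<lambda>s. D n b s * N b i s \<sigma>)" for n
            by (rule unit_integrable[OF borel_measurable_times[OF conjunct1[OF D] Ns] b])
          show "AE s in unit_measure. summable (\<lambda>n. norm (D n b s * N b i s \<sigma>))"
            unfolding norm_mult by (intro AE_I2 summable_mult2 sD)
          show "summable (\<lambda>n. \<integral>s. norm (D n b s * N b i s \<sigma>) \<partial>unit_measure)"
          proof (rule summable_comparison_test[OF _ summable_mult2[OF sums_summable[OF geo], of C]], intro exI allI impI)
            fix n :: nat
            have "(\<integral>s. norm (D n b s * N b i s \<sigma>) \<partial>unit_measure) \<le> C * (1 / 2) ^ n * C"
              using b C by (intro unit_integral_le) auto
            then show "norm (\<integral>s. norm (D n b s * N b i s \<sigma>) \<partial>unit_measure) \<le> C * (1 / 2) ^ n * C" by simp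
          qed
        qed
        moreover have "(\<Sum>n. D n b s * N b i s \<sigma>) = k b s * N b i s \<sigma>" for s
          unfolding k_def using suminf_mult2[OF summable_norm_cancel[OF sD]] by metis
        ultimately show ?thesis by simp
      qed
      have "(\<lambda>n. D (Suc n) i \<sigma>) sums (of_real h * (\<Sum>b\<in>UNIV. \<integral>s. k b s * N b i s \<sigma> \<partial>unit_measure))"
        unfolding DS by (intro sums_mult sums_sum int)
      then show ?thesis unfolding k_def using suminf_split_head[OF summable_norm_cancel[OF sD], of i \<sigma>] by (simp add: D0 sums_iff diff_eq_eq add.commute)
    qed
  qed
qed

text \<open>By \<open>\<tau>\<close> every exponential that occurs is dominated by the weight with
  exponent \<open>\<epsilon>\<close>, so the double integral converges absolutely. The third
  conclusion is recorded because it contains the measurability of the inner integral in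
  \<open>s\<close>.\<close>

lemma dz_Fubini:
  fixes p :: "real \<Rightarrow> complex"
  assumes sys: "contour_system \<Gamma>" and \<psi>: "dz_integrable \<Gamma> (\<lambda>v. of_real (exp (\<epsilon> * cmod v)) * \<psi> v)"
    and p: "p \<in> borel_measurable borel" "\<And>s. 0 < s \<Longrightarrow> s < 1 \<Longrightarrow> cmod (p s) \<le> B"
    and \<tau>: "\<And>s. 0 < s \<Longrightarrow> s < 1 \<Longrightarrow> \<bar>\<alpha> + \<beta> * s\<bar> \<le> \<epsilon>"
  shows "dz_integrable \<Gamma> (\<lambda>v. (\<integral>s. p s * exp (of_real (\<alpha> + \<beta> * s) * v) \<partial>unit_measure) * \<psi> v)"
    and "dz_integral \<Gamma> (\<lambda>v. (\<integral>s. p s * exp (of_real (\<alpha> + \<beta> * s) * v) \<partial>unit_measure) * \<psi> v)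
      = (\<integral>s. p s * dz_integral \<Gamma> (\<lambda>v. exp (of_real (\<alpha> + \<beta> * s) * v) * \<psi> v) \<partial>unit_measure)"
    and "integrable unit_measure (\<lambda>s. p s * dz_integral \<Gamma> (\<lambda>v. exp (of_real (\<alpha> + \<beta> * s) * v) * \<psi> v))"
proof -
  have B: "0 \<le> B" using order_trans[OF norm_ge_zero p(2), of "1/2"] by simp
  have *: "line_integrable \<kappa> (\<lambda>v. (\<integral>s. p s * exp (of_real (\<alpha> + \<beta> * s) * v) \<partial>unit_measure) * \<psi> v) \<and>
      line_integral \<kappa> (\<lambda>v. (\<integral>s. p s * exp (of_real (\<alpha> + \<beta> * s) * v) \<partial>unit_measure) * \<psi> v)
      = (\<integral>s. p s * line_integral \<kappa> (\<lambda>v. exp (of_real (\<alpha> + \<beta> * s) * v) * \<psi> v) \<partial>unit_measure) \<and>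
      integrable unit_measure (\<lambda>s. p s * line_integral \<kappa> (\<lambda>v. exp (of_real (\<alpha> + \<beta> * s) * v) * \<psi> v))" if k: "\<kappa> \<in> \<Gamma>" for \<kappa>
  proof -
    let ?\<gamma> = "snd \<kappa>"
    let ?w = "\<lambda>r. indicator (fst \<kappa>) r *\<^sub>R ((of_real (exp (\<epsilon> * cmod (?\<gamma> r))) * \<psi> (?\<gamma> r)) * vector_derivative ?\<gamma> (at r))"
    let ?g = "\<lambda>r. indicator (fst \<kappa>) r *\<^sub>R ?\<gamma> r"
    \<comment> \<open>The density is recovered from the integrable function \<open>?w\<close> by
      dividing the weight out again, which makes it measurable.\<close>
    let ?f = "\<lambda>r. of_real (exp (- \<epsilon> * cmod (?g r))) * ?w r"
    let ?Q = "\<lambda>s r. p s * exp (of_real (\<alpha> + \<beta> * s) * ?g r) * ?f r"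
    have w: "integrable lborel ?w" using \<psi> k by (auto simp: dz_integrable_iff line_integrable_def set_integrable_def)
    have g[measurable]: "?g \<in> borel_measurable borel" using contour_measurable[OF sys k, of "\<lambda>z. z"] by simp
    have w'[measurable]: "?w \<in> borel_measurable borel" using w by (simp add: borel_measurable_integrable)
    note p(1)[measurable]
    have Qm: "(\<lambda>(s, r). ?Q s r) \<in> borel_measurable (unit_measure \<Otimes>\<^sub>M lborel)" by measurable
    have f: "?f r = indicator (fst \<kappa>) r *\<^sub>R (\<psi> (?\<gamma> r) * vector_derivative ?\<gamma> (at r))" for r
      by (auto simp: indicator_def exp_minus field_simps of_real_inverse)
    have Qb: "cmod (?Q s r) \<le> B * cmod (?w r)" if s: "0 < s" "s < 1" for s r
    proof -
      have "cmod (exp (of_real (\<alpha> + \<beta> * s) * ?g r)) \<le> exp (\<epsilon> * cmod (?g r))"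
      proof -
        have "(\<alpha> + \<beta> * s) * Re (?g r) \<le> \<bar>\<alpha> + \<beta> * s\<bar> * \<bar>Re (?g r)\<bar>" by (metis abs_ge_self abs_mult)
        also have "\<dots> \<le> \<epsilon> * cmod (?g r)"
          using order_trans[OF abs_ge_zero \<tau>[OF s]] by (intro mult_mono \<tau> s abs_Re_le_cmod) auto
        finally have "(\<alpha> + \<beta> * s) * Re (?g r) \<le> \<epsilon> * cmod (?g r)" .
        moreover have "Re (of_real a * z) = a * Re z" for a z by simp
        ultimately show ?thesis unfolding norm_exp_eq_Re by (simp only: exp_le_cancel_iff)
      qed
      then have "cmod (?Q s r) \<le> (B * exp (\<epsilon> * cmod (?g r))) * (exp (- \<epsilon> * cmod (?g r)) * cmod (?w r))"
        unfolding norm_mult[of "_ * _" "?f r"] norm_mult[of "p s"] norm_mult[of "of_real _" "?w r"] norm_of_real abs_exp_cancel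
        using p(2)[OF s] B by (intro mult_right_mono mult_mono) auto
      also have "\<dots> = B * (exp (\<epsilon> * cmod (?g r)) * exp (- \<epsilon> * cmod (?g r))) * cmod (?w r)" by (simp only: mult_ac)
      also have "\<dots> = B * cmod (?w r)" by (simp flip: exp_add)
      finally show ?thesis .
    qed
    have Qi: "integrable lborel (?Q s)" if "0 < s" "s < 1" for s
    proof (rule Bochner_Integration.integrable_bound[OF integrable_mult_right[OF integrable_norm[OF w], of B]])
      show "?Q s \<in> borel_measurable lborel" by measurable
      show "AE r in lborel. cmod (?Q s r) \<le> norm (B * cmod (?w r))" using Qb[OF that] B by (auto simp: abs_mult)
    qed
    have int: "integrable (unit_measure \<Otimes>\<^sub>M lborel) (\<lambda>(s, r). ?Q s r)"
    proof (rule unit_pair.Fubini_integrable[OF Qm])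
      have "(\<integral>r. cmod (?Q s r) \<partial>lborel) \<le> (\<integral>r. B * cmod (?w r) \<partial>lborel)" if "0 < s" "s < 1" for s
        by (intro integral_mono integrable_norm[OF Qi[OF that]] integrable_mult_right integrable_norm[OF w] Qb[OF that])
      moreover have "norm (\<integral>r. cmod (?Q s r) \<partial>lborel) = (\<integral>r. cmod (?Q s r) \<partial>lborel)" for s
        unfolding real_norm_def by (intro abs_of_nonneg integral_nonneg) simp
      ultimately have "norm (\<integral>r. cmod (?Q s r) \<partial>lborel) \<le> (\<integral>r. B * cmod (?w r) \<partial>lborel)" if "0 < s \<and> s < 1" for s
        using that by (simp only: not_False_eq_True)
      then have "AE s in unit_measure. norm (\<integral>r. cmod (?Q s r) \<partial>lborel) \<le> (\<integral>r. B * cmod (?w r) \<partial>lborel)"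
        by (rule eventually_mono[OF AE_unit_measure])
      moreover have "(\<lambda>s. \<integral>r. cmod (?Q s r) \<partial>lborel) \<in> borel_measurable unit_measure"
        by (rule lborel.borel_measurable_lebesgue_integral) (use Qm in measurable)
      ultimately have "integrable unit_measure (\<lambda>s. \<integral>r. cmod (?Q s r) \<partial>lborel)" by (rule unit_measure.integrable_const_bound)
      then show "integrable unit_measure (\<lambda>s. \<integral>r. norm (case (s, r) of (s, r) \<Rightarrow> ?Q s r) \<partial>lborel)" by simp
      show "AE s in unit_measure. integrable lborel (\<lambda>r. case (s, r) of (s, r) \<Rightarrow> ?Q s r)"
        using AE_unit_measure by eventually_elim (use Qi in simp)
    qed
    have e1: "(\<integral>s. ?Q s r \<partial>unit_measure) = indicator (fst \<kappa>) r *\<^sub>R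
        ((\<integral>s. p s * exp (of_real (\<alpha> + \<beta> * s) * ?\<gamma> r) \<partial>unit_measure) * \<psi> (?\<gamma> r) * vector_derivative ?\<gamma> (at r))" for r
    proof -
      have "(\<integral>s. ?Q s r \<partial>unit_measure) = (\<integral>s. p s * exp (of_real (\<alpha> + \<beta> * s) * ?g r) \<partial>unit_measure) * ?f r"
        by (rule integral_mult_left_zero)
      then show ?thesis unfolding f by (auto simp: indicator_def)
    qed
    have e2: "(\<integral>r. ?Q s r \<partial>lborel) = p s * line_integral \<kappa> (\<lambda>v. exp (of_real (\<alpha> + \<beta> * s) * v) * \<psi> v)" for s
    proof -
      have "(\<integral>r. ?Q s r \<partial>lborel) = (\<integral>r. p s * (indicator (fst \<kappa>) r *\<^sub>R (exp (of_real (\<alpha> + \<beta> * s) * ?\<gamma> r) * \<psi> (?\<gamma> r) * vector_derivative ?\<gamma> (at r))) \<partial>lborel)"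
        unfolding f by (intro Bochner_Integration.integral_cong refl) (auto simp: indicator_def)
      also have "\<dots> = p s * (\<integral>r. indicator (fst \<kappa>) r *\<^sub>R (exp (of_real (\<alpha> + \<beta> * s) * ?\<gamma> r) * \<psi> (?\<gamma> r) * vector_derivative ?\<gamma> (at r)) \<partial>lborel)"
        by (rule integral_mult_right_zero)
      finally show ?thesis unfolding line_integral_def set_lebesgue_integral_def .
    qed
    have "(\<integral>r. (\<integral>s. ?Q s r \<partial>unit_measure) \<partial>lborel) = (\<integral>s. (\<integral>r. ?Q s r \<partial>lborel) \<partial>unit_measure)"
      by (rule unit_pair.Fubini_integral[OF int])
    moreover have "integrable lborel (\<lambda>r. \<integral>s. ?Q s r \<partial>unit_measure)" by (rule unit_pair.integrable_snd[OF int])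
    moreover have "integrable unit_measure (\<lambda>s. \<integral>r. ?Q s r \<partial>lborel)" by (rule unit_pair.integrable_fst[OF int])
    ultimately show ?thesis unfolding e1 e2 line_integrable_def line_integral_def[of _ "\<lambda>v. _ v * \<psi> v"] set_integrable_def set_lebesgue_integral_def by simp
  qed
  show "dz_integrable \<Gamma> (\<lambda>v. (\<integral>s. p s * exp (of_real (\<alpha> + \<beta> * s) * v) \<partial>unit_measure) * \<psi> v)"
    using * by (simp add: dz_integrable_iff)
  have s: "p s * dz_integral \<Gamma> (\<lambda>v. exp (of_real (\<alpha> + \<beta> * s) * v) * \<psi> v) =
      (\<Sum>\<kappa>\<in>\<Gamma>. p s * line_integral \<kappa> (\<lambda>v. exp (of_real (\<alpha> + \<beta> * s) * v) * \<psi> v))" for s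
    by (simp only: dz_integral_eq sum_distrib_left)
  show "integrable unit_measure (\<lambda>s. p s * dz_integral \<Gamma> (\<lambda>v. exp (of_real (\<alpha> + \<beta> * s) * v) * \<psi> v))"
    unfolding s using * by (intro Bochner_Integration.integrable_sum) blast
  have "(\<integral>s. (\<Sum>\<kappa>\<in>\<Gamma>. p s * line_integral \<kappa> (\<lambda>v. exp (of_real (\<alpha> + \<beta> * s) * v) * \<psi> v)) \<partial>unit_measure)
    = (\<Sum>\<kappa>\<in>\<Gamma>. \<integral>s. p s * line_integral \<kappa> (\<lambda>v. exp (of_real (\<alpha> + \<beta> * s) * v) * \<psi> v) \<partial>unit_measure)"
    using * by (intro Bochner_Integration.integral_sum) blast
  then show "dz_integral \<Gamma> (\<lambda>v. (\<integral>s. p s * exp (of_real (\<alpha> + \<beta> * s) * v) \<partial>unit_measure) * \<psi> v)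
      = (\<integral>s. p s * dz_integral \<Gamma> (\<lambda>v. exp (of_real (\<alpha> + \<beta> * s) * v) * \<psi> v) \<partial>unit_measure)"
    unfolding s by (simp only: dz_integral_eq sum.cong[OF refl conjunct1[OF conjunct2[OF *]]])
qed

text \<open>
  The sign of \<open>\<sigma>\<close> in the oriented integral from \<open>s\<close> to \<open>of_bool K\<close>.
\<close>

definition flow_sign :: "bool \<Rightarrow> real \<Rightarrow> real \<Rightarrow> complex" where
  "flow_sign K s \<sigma> = (if K then (if s \<le> \<sigma> then 1 else 0) else (if \<sigma> \<le> s then - 1 else 0))"

text \<open>The left side integrates the derivative of \<open>exp (of_real (h * \<sigma>) * u) * exp
  (of_real (h * (s - \<sigma>)) * v)\<close> with respect to \<open>\<sigma>\<close>, which is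
  \<open>of_real h * (u - v)\<close> times the function itself. The factor \<open>u - v\<close> is
  there to cancel a Cauchy denominator.\<close>

lemma flow_sign_integral:
  assumes s: "0 \<le> s" "s \<le> 1"
  shows "of_real h * (u - v) * (\<integral>\<sigma>. flow_sign K s \<sigma> * (exp (of_real (h * \<sigma>) * u) * exp (of_real (h * (s - \<sigma>)) * v)) \<partial>unit_measure)
    = exp (of_real (h * of_bool K) * u) * exp (of_real (h * (s - of_bool K)) * v) - exp (of_real (h * s) * u)"
proof -
  define E where "E \<sigma> = exp (of_real (h * \<sigma>) * u) * exp (of_real (h * (s - \<sigma>)) * v)" for \<sigma>
  have cE: "continuous_on A E" for A unfolding E_def[abs_def] by (intro continuous_intros)
  have dE: "(E has_vector_derivative of_real h * (u - v) * E \<sigma>) (at \<sigma> within A)" for \<sigma> A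
  proof -
    have E': "E = (\<lambda>\<sigma>. exp (of_real (h * s) * v + of_real \<sigma> * (of_real h * (u - v))))"
      unfolding E_def by (auto simp: fun_eq_iff algebra_simps simp flip: exp_add)
    have "((\<lambda>z. exp (of_real (h * s) * v + z * (of_real h * (u - v)))) has_field_derivative of_real h * (u - v) * E \<sigma>) (at (of_real \<sigma>))"
      unfolding E' by (auto intro!: derivative_eq_intros)
    then have "((\<lambda>z. exp (of_real (h * s) * v + z * (of_real h * (u - v)))) \<circ> of_real has_vector_derivative of_real 1 * (of_real h * (u - v) * E \<sigma>)) (at \<sigma>)"
      by (intro field_vector_diff_chain_at) (auto intro!: has_vector_derivative_of_real derivative_eq_intros)
    then show ?thesis unfolding E' by (auto simp: o_def intro: has_vector_derivative_at_within)
  qed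
  have ftc: "of_real h * (u - v) * (\<integral>\<sigma>. indicator {a..b} \<sigma> *\<^sub>R E \<sigma> \<partial>lborel) = E b - E a" if "a \<le> b" for a b
  proof -
    have "(\<integral>\<sigma>. indicator {a..b} \<sigma> *\<^sub>R (of_real h * (u - v) * E \<sigma>) \<partial>lborel) = E b - E a"
      by (rule integral_FTC_atLeastAtMost[OF that dE]) (intro continuous_intros cE)
    then show ?thesis by (simp flip: integral_mult_right_zero)
  qed
  have m: "flow_sign K s \<in> borel_measurable borel" unfolding flow_sign_def[abs_def] by (cases K) auto
  have "E \<in> borel_measurable borel" by (rule borel_measurable_continuous_onI[OF cE])
  then have "(\<integral>\<sigma>. flow_sign K s \<sigma> * E \<sigma> \<partial>unit_measure) = (\<integral>\<sigma>. indicator {0..1} \<sigma> *\<^sub>R (flow_sign K s \<sigma> * E \<sigma>) \<partial>lborel)"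
    using m by (intro integral_unit_measure) auto
  also have "\<dots> = (if K then \<integral>\<sigma>. indicator {s..1} \<sigma> *\<^sub>R E \<sigma> \<partial>lborel else - (\<integral>\<sigma>. indicator {0..s} \<sigma> *\<^sub>R E \<sigma> \<partial>lborel))"
    unfolding flow_sign_def using s by (auto simp flip: Bochner_Integration.integral_minus intro!: Bochner_Integration.integral_cong simp: indicator_def)
  finally have "(\<integral>\<sigma>. flow_sign K s \<sigma> * E \<sigma> \<partial>unit_measure) = \<dots>" .
  then have "of_real h * (u - v) * (\<integral>\<sigma>. flow_sign K s \<sigma> * E \<sigma> \<partial>unit_measure) = E (of_bool K) - E s"
    using ftc[of s 1] ftc[of 0 s] s by (cases K) simp_all
  then show ?thesis by (simp add: E_def)
qed

lemma unit_integral_cong: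
  fixes f g :: "real \<Rightarrow> complex"
  assumes "f \<in> borel_measurable borel" "g \<in> borel_measurable borel" "\<And>s. 0 < s \<Longrightarrow> s < 1 \<Longrightarrow> f s = g s"
  shows "(\<integral>s. f s \<partial>unit_measure) = (\<integral>s. g s \<partial>unit_measure)"
proof (rule integral_cong_AE)
  show "AE s in unit_measure. f s = g s" using AE_unit_measure by eventually_elim (use assms(3) in blast)
qed (use assms in simp_all)

lemma unit_integral_const [simp]: "(\<integral>s. c \<partial>unit_measure) = (c :: complex)"
  by (simp add: measure_def emeasure_unit_measure)

lemma unit_Fubini:
  fixes Q :: "real \<Rightarrow> real \<Rightarrow> complex"
  assumes Q: "(\<lambda>p. Q (fst p) (snd p)) \<in> borel_measurable (borel \<Otimes>\<^sub>M borel)"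
    and B: "\<And>s \<sigma>. 0 < s \<Longrightarrow> s < 1 \<Longrightarrow> 0 < \<sigma> \<Longrightarrow> \<sigma> < 1 \<Longrightarrow> cmod (Q s \<sigma>) \<le> B" "0 \<le> B"
  shows "(\<integral>s. (\<integral>\<sigma>. Q s \<sigma> \<partial>unit_measure) \<partial>unit_measure) = (\<integral>\<sigma>. (\<integral>s. Q s \<sigma> \<partial>unit_measure) \<partial>unit_measure)"
    and "(\<lambda>s. \<integral>\<sigma>. Q s \<sigma> \<partial>unit_measure) \<in> borel_measurable borel"
    and "(\<lambda>\<sigma>. \<integral>s. Q s \<sigma> \<partial>unit_measure) \<in> borel_measurable borel"
proof -
  have Qm: "(\<lambda>(s, \<sigma>). Q s \<sigma>) \<in> borel_measurable (unit_measure \<Otimes>\<^sub>M unit_measure)"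
    using Q by (simp add: case_prod_unfold cong: measurable_cong_sets sets_pair_measure_cong)
  have Qs: "Q s \<in> borel_measurable borel" for s
    using measurable_compose[OF _ Q, of "\<lambda>\<sigma>. (s, \<sigma>)" borel] by simp
  have int: "integrable (unit_measure \<Otimes>\<^sub>M unit_measure) (\<lambda>(s, \<sigma>). Q s \<sigma>)"
  proof (rule unit_square.Fubini_integrable[OF Qm])
    have le: "norm (\<integral>\<sigma>. cmod (Q s \<sigma>) \<partial>unit_measure) \<le> B" if "0 < s \<and> s < 1" for s
    proof -
      have "(\<integral>\<sigma>. cmod (Q s \<sigma>) \<partial>unit_measure) \<le> B" using that B by (intro unit_integral_le) auto
      then show ?thesis by simp
    qed
    have "(\<lambda>s. \<integral>\<sigma>. cmod (Q s \<sigma>) \<partial>unit_measure) \<in> borel_measurable unit_measure"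
      by (rule unit_measure.borel_measurable_lebesgue_integral) (use measurable_compose[OF Qm borel_measurable_norm] in \<open>simp add: case_prod_unfold\<close>)
    then have "integrable unit_measure (\<lambda>s. \<integral>\<sigma>. cmod (Q s \<sigma>) \<partial>unit_measure)"
      by (intro unit_measure.integrable_const_bound[OF eventually_mono[OF AE_unit_measure le]])
    then show "integrable unit_measure (\<lambda>s. \<integral>\<sigma>. norm (case (s, \<sigma>) of (s, \<sigma>) \<Rightarrow> Q s \<sigma>) \<partial>unit_measure)" by simp
    have "integrable unit_measure (Q s)" if "0 < s \<and> s < 1" for s
      using that B Qs by (intro unit_integrable[where B=B]) auto
    then show "AE s in unit_measure. integrable unit_measure (\<lambda>\<sigma>. case (s, \<sigma>) of (s, \<sigma>) \<Rightarrow> Q s \<sigma>)"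
      by (intro eventually_mono[OF AE_unit_measure]) simp
  qed
  show "(\<integral>s. (\<integral>\<sigma>. Q s \<sigma> \<partial>unit_measure) \<partial>unit_measure) = (\<integral>\<sigma>. (\<integral>s. Q s \<sigma> \<partial>unit_measure) \<partial>unit_measure)"
    by (rule unit_square.Fubini_integral[OF int, symmetric])
  show "(\<lambda>s. \<integral>\<sigma>. Q s \<sigma> \<partial>unit_measure) \<in> borel_measurable borel"
    using borel_measurable_integrable[OF unit_square.integrable_fst[OF int]] by simp
  show "(\<lambda>\<sigma>. \<integral>s. Q s \<sigma> \<partial>unit_measure) \<in> borel_measurable borel"
    using borel_measurable_integrable[OF unit_square.integrable_snd[OF int]] by simp
qed

lemma norm_exp_of_real_mult_le: "cmod (exp (of_real a * z)) \<le> exp (\<bar>a\<bar> * cmod z)"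
proof -
  have "a * Re z \<le> \<bar>a\<bar> * \<bar>Re z\<bar>" by (metis abs_ge_self abs_mult)
  also have "\<dots> \<le> \<bar>a\<bar> * cmod z" by (intro mult_left_mono abs_Re_le_cmod) simp
  finally show ?thesis by simp
qed

lemma norm_exp_unit_le:
  fixes \<sigma> :: real
  assumes "0 < \<sigma>" "\<sigma> < 1"
  shows "cmod (exp (of_real (h * \<sigma>) * u)) \<le> exp (\<bar>h\<bar> * cmod u)"
proof -
  have "\<bar>h * \<sigma>\<bar> * cmod u \<le> \<bar>h\<bar> * cmod u" unfolding abs_mult using assms by (intro mult_right_mono mult_left_le) auto
  then show ?thesis by (intro order_trans[OF norm_exp_of_real_mult_le]) (simp only: exp_le_cancel_iff)
qed

lemma norm_exp_minus_1_le: "cmod (exp z - 1) \<le> exp (cmod z) * cmod z"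
proof -
  have "cmod (exp z - 1) \<le> exp \<bar>Re z\<bar> * cmod z" using Taylor_exp[of z 0] by simp
  also have "\<dots> \<le> exp (cmod z) * cmod z" by (intro mult_right_mono) (auto simp: abs_Re_le_cmod)
  finally show ?thesis .
qed

lemma norm_exp_minus_1_minus_le: "cmod (exp z - 1 - z) \<le> exp (cmod z) * (cmod z)\<^sup>2"
proof -
  have "cmod (exp z - 1 - z) \<le> exp \<bar>Re z\<bar> * (cmod z)\<^sup>2" using Taylor_exp[of z 1] by (simp add: power2_eq_square algebra_simps)
  also have "\<dots> \<le> exp (cmod z) * (cmod z)\<^sup>2" by (intro mult_right_mono) (auto simp: abs_Re_le_cmod)
  finally show ?thesis .
qed

definition shift :: "('n \<Rightarrow> real \<times> real \<times> real) \<Rightarrow> 'n \<Rightarrow> real \<Rightarrow> 'n \<Rightarrow> real \<times> real \<times> real" where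
  "shift w k h = (\<lambda>i. case w i of (t, y, x) \<Rightarrow> (t, y, x + h * of_bool (i = k)))"

lemma cubic_shift: "cubic (shift w k h) i u = of_real (h * of_bool (i = k)) * u + cubic w i u"
  by (simp add: cubic_def shift_def case_prod_unfold distrib_right)

section \<open>Exponentially shifted moments and the kernel of the Fredholm equation\<close>

locale flow = jump_data \<Gamma> U V for \<Gamma> and U V :: "complex \<Rightarrow> 'n::finite \<Rightarrow> complex" +
  fixes w :: "'n \<Rightarrow> real \<times> real \<times> real" and \<eta> :: "'n \<Rightarrow> complex \<Rightarrow> complex" and \<delta> :: real and k :: 'n
  assumes sl: "\<And>a. sol w (unit_row a) (\<eta> a)" and m: "margin w \<delta>"
begin

abbreviation d :: "'n \<Rightarrow> real" where "d i \<equiv> of_bool (i = k)"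

lemma F_shift: "F (shift w k h) i u = exp (of_real (h * d i) * u) * F w i u"
  by (simp only: F_def cubic_shift exp_add mult.assoc)

lemma G_shift: "G (shift w k h) i u = exp (of_real (- (h * d i)) * u) * G w i u"
  unfolding G_def cubic_shift minus_add_distrib exp_add of_real_minus mult_minus_left by (simp only: mult_ac)

lemma delta_pos: "0 < \<delta>" using m by (simp add: margin_def)

definition wt :: "nat \<Rightarrow> 'n \<Rightarrow> 'n \<Rightarrow> complex \<Rightarrow> complex" where
  "wt n b j v = of_real (exp (\<delta> / 2 * cmod v)) * (v ^ n * (G w j v * \<eta> b v))"

lemma wt_integrable: "dz_integrable \<Gamma> (wt n b j)"
proof -
  have "dz_integrable \<Gamma> (\<lambda>v. (of_real (exp (\<delta> / 2 * cmod v)) * v ^ n) * (G w j v * \<eta> b v))"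
  proof (rule sol_weighted(1)[OF sl m, where B=1 and n=n])
    show "cmod (of_real (exp (\<delta> / 2 * cmod v)) * v ^ n) \<le> 1 * exp (\<delta> / 2 * cmod v) * (1 + cmod v) ^ n" for v
      unfolding norm_mult norm_power norm_of_real abs_exp_cancel by (simp add: power_mono)
  qed (intro continuous_intros, simp)
  then show ?thesis by (simp add: wt_def[abs_def] mult.assoc)
qed

definition W :: "nat \<Rightarrow> 'n \<Rightarrow> 'n \<Rightarrow> real" where "W n b j = dz_norm \<Gamma> (wt n b j)"

lemma W_nonneg: "0 \<le> W n b j" by (simp add: W_def dz_norm_nonneg)

lemma weight_bound:
  assumes c: "\<And>\<kappa>. \<kappa> \<in> \<Gamma> \<Longrightarrow> continuous_on (contour_image \<kappa>) f"
    and le: "\<And>v. cmod (f v) \<le> B * exp (\<delta> / 2 * cmod v) * cmod v ^ l" and B: "0 \<le> B"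
  shows "dz_integrable \<Gamma> (\<lambda>v. f v * (v ^ n * (G w j v * \<eta> b v)))"
    and "cmod (dz_integral \<Gamma> (\<lambda>v. f v * (v ^ n * (G w j v * \<eta> b v)))) \<le> B * W (n + l) b j"
proof -
  have i: "dz_integrable \<Gamma> (\<lambda>v. of_real B * wt (n + l) b j v)" by (rule dz_integrable_cmult[OF wt_integrable])
  have le': "cmod (f v * (v ^ n * (G w j v * \<eta> b v))) \<le> cmod (of_real B * wt (n + l) b j v)" for v
  proof -
    have "cmod (f v * (v ^ n * (G w j v * \<eta> b v))) \<le> (B * exp (\<delta> / 2 * cmod v) * cmod v ^ l) * (cmod v ^ n * cmod (G w j v * \<eta> b v))"
      unfolding norm_mult[of "f v"] norm_mult[of "v ^ n"] norm_power by (intro mult_right_mono le) simp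
    also have "\<dots> = B * (exp (\<delta> / 2 * cmod v) * (cmod v ^ (n + l) * cmod (G w j v * \<eta> b v)))" by (simp only: power_add mult_ac)
    also have "\<dots> = cmod (of_real B * wt (n + l) b j v)"
      unfolding wt_def norm_mult[of "of_real _"] norm_mult[of "v ^ _"] norm_power norm_of_real abs_exp_cancel using B by simp
    finally show ?thesis .
  qed
  show I: "dz_integrable \<Gamma> (\<lambda>v. f v * (v ^ n * (G w j v * \<eta> b v)))"
    by (rule dz_integrable_bound[OF system c sol_poly(1)[OF sl m] i le'])
  have "cmod (dz_integral \<Gamma> (\<lambda>v. f v * (v ^ n * (G w j v * \<eta> b v)))) \<le> dz_norm \<Gamma> (\<lambda>v. of_real B * wt (n + l) b j v)"
    using norm_dz_integral_le[OF I] dz_norm_mono[OF I i le'] by linarith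
  then show "cmod (dz_integral \<Gamma> (\<lambda>v. f v * (v ^ n * (G w j v * \<eta> b v)))) \<le> B * W (n + l) b j"
    unfolding dz_norm_cmult W_def using B by simp
qed

text \<open>A generating function of the moments: formally, differentiation in \<open>\<tau>\<close>
  raises \<open>n\<close> by one. \<open>X_Lipschitz\<close> and \<open>X_Taylor\<close> are the
  quantitative forms of this.\<close>

definition X :: "nat \<Rightarrow> 'n \<Rightarrow> 'n \<Rightarrow> real \<Rightarrow> complex" where
  "X n b j \<tau> = dz_integral \<Gamma> (\<lambda>v. exp (of_real \<tau> * v) * (v ^ n * (G w j v * \<eta> b v)))"

lemma X_0: "X n b j 0 = moment w (\<eta> b) n j" by (simp add: X_def moment_def)

lemma exp_weight:
  assumes "\<bar>\<tau>\<bar> \<le> \<delta> / 6"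
  shows "cmod (exp (of_real \<tau> * v)) \<le> 1 * exp (\<delta> / 2 * cmod v) * cmod v ^ 0"
proof -
  have "\<bar>\<tau>\<bar> * cmod v \<le> \<delta> / 2 * cmod v" using assms delta_pos by (intro mult_right_mono) auto
  then have "cmod (exp (of_real \<tau> * v)) \<le> exp (\<delta> / 2 * cmod v)"
    by (intro order_trans[OF norm_exp_of_real_mult_le]) (simp only: exp_le_cancel_iff)
  then show ?thesis by simp
qed

lemma X_integrable: "\<bar>\<tau>\<bar> \<le> \<delta> / 6 \<Longrightarrow> dz_integrable \<Gamma> (\<lambda>v. exp (of_real \<tau> * v) * (v ^ n * (G w j v * \<eta> b v)))"
  by (rule weight_bound(1)[OF _ exp_weight]) (intro continuous_intros, simp_all)

lemma X_le:
  assumes "\<bar>\<tau>\<bar> \<le> \<delta> / 6"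
  shows "cmod (X n b j \<tau>) \<le> W n b j"
proof -
  have "cmod (dz_integral \<Gamma> (\<lambda>v. exp (of_real \<tau> * v) * (v ^ n * (G w j v * \<eta> b v)))) \<le> 1 * W (n + 0) b j"
    by (rule weight_bound(2)[OF _ exp_weight[OF assms]]) (intro continuous_intros, simp_all)
  then show ?thesis by (simp add: X_def)
qed

text \<open>The exponents \<open>\<bar>\<tau>'\<bar>\<close> and
  \<open>\<bar>\<tau> - \<tau>'\<bar>\<close> add up to at most three times
  \<open>\<delta> / 6\<close>, exactly the weight \<open>\<delta> / 2\<close> that solutions admit.
  This is the origin of the radius \<open>\<delta> / 6\<close>.\<close>

lemma X_Lipschitz:
  assumes \<tau>: "\<bar>\<tau>\<bar> \<le> \<delta> / 6" "\<bar>\<tau>'\<bar> \<le> \<delta> / 6"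
  shows "cmod (X n b j \<tau> - X n b j \<tau>') \<le> \<bar>\<tau> - \<tau>'\<bar> * W (n + 1) b j"
proof -
  have "cmod (exp (of_real \<tau> * v) - exp (of_real \<tau>' * v)) \<le> \<bar>\<tau> - \<tau>'\<bar> * exp (\<delta> / 2 * cmod v) * cmod v ^ 1" for v
  proof -
    have "exp (of_real \<tau> * v) - exp (of_real \<tau>' * v) = exp (of_real \<tau>' * v) * (exp (of_real (\<tau> - \<tau>') * v) - 1)"
      by (simp add: algebra_simps flip: exp_add)
    then have "cmod (exp (of_real \<tau> * v) - exp (of_real \<tau>' * v)) = cmod (exp (of_real \<tau>' * v)) * cmod (exp (of_real (\<tau> - \<tau>') * v) - 1)"
      by (simp only: norm_mult[of "exp _"])
    also have "\<dots> \<le> exp (\<bar>\<tau>'\<bar> * cmod v) * (exp (cmod (of_real (\<tau> - \<tau>') * v)) * cmod (of_real (\<tau> - \<tau>') * v))"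
      by (rule mult_mono[OF norm_exp_of_real_mult_le norm_exp_minus_1_le]) simp_all
    also have "\<dots> = \<bar>\<tau> - \<tau>'\<bar> * exp ((\<bar>\<tau>'\<bar> + \<bar>\<tau> - \<tau>'\<bar>) * cmod v) * cmod v ^ 1"
      unfolding norm_mult norm_of_real distrib_right exp_add by simp
    also have "\<dots> \<le> \<bar>\<tau> - \<tau>'\<bar> * exp (\<delta> / 2 * cmod v) * cmod v ^ 1"
    proof -
      have "(\<bar>\<tau>'\<bar> + \<bar>\<tau> - \<tau>'\<bar>) * cmod v \<le> \<delta> / 2 * cmod v" using \<tau> abs_triangle_ineq4[of \<tau> \<tau>'] by (intro mult_right_mono) auto
      then show ?thesis by (intro mult_right_mono mult_left_mono) simp_all
    qed
    finally show ?thesis .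
  qed
  then have "cmod (dz_integral \<Gamma> (\<lambda>v. (exp (of_real \<tau> * v) - exp (of_real \<tau>' * v)) * (v ^ n * (G w j v * \<eta> b v)))) \<le> \<bar>\<tau> - \<tau>'\<bar> * W (n + 1) b j"
    by (intro weight_bound(2)) (intro continuous_intros, simp_all)
  then show ?thesis unfolding left_diff_distrib dz_integral_diff[OF X_integrable[OF \<tau>(1)] X_integrable[OF \<tau>(2)]] X_def .
qed

lemma X_Taylor:
  assumes \<tau>: "\<bar>\<tau>\<bar> \<le> \<delta> / 6"
  shows "cmod (X n b j \<tau> - X n b j 0 - of_real \<tau> * X (n + 1) b j 0) \<le> \<tau>\<^sup>2 * W (n + 2) b j"
proof -
  have "cmod (exp (of_real \<tau> * v) - 1 - of_real \<tau> * v) \<le> \<tau>\<^sup>2 * exp (\<delta> / 2 * cmod v) * cmod v ^ 2" for v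
  proof -
    have "cmod (exp (of_real \<tau> * v) - 1 - of_real \<tau> * v) \<le> exp (\<bar>\<tau>\<bar> * cmod v) * (\<bar>\<tau>\<bar> * cmod v)\<^sup>2"
      using norm_exp_minus_1_minus_le[of "of_real \<tau> * v"] unfolding norm_mult norm_of_real .
    also have "\<dots> = \<tau>\<^sup>2 * exp (\<bar>\<tau>\<bar> * cmod v) * cmod v ^ 2" by (simp add: power_mult_distrib)
    also have "\<dots> \<le> \<tau>\<^sup>2 * exp (\<delta> / 2 * cmod v) * cmod v ^ 2"
    proof -
      have "\<bar>\<tau>\<bar> * cmod v \<le> \<delta> / 2 * cmod v" using \<tau> delta_pos by (intro mult_right_mono) auto
      then show ?thesis by (intro mult_right_mono mult_left_mono) simp_all
    qed
    finally show ?thesis .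
  qed
  then have "cmod (dz_integral \<Gamma> (\<lambda>v. (exp (of_real \<tau> * v) - 1 - of_real \<tau> * v) * (v ^ n * (G w j v * \<eta> b v)))) \<le> \<tau>\<^sup>2 * W (n + 2) b j"
    by (intro weight_bound(2)) (intro continuous_intros, simp_all)
  moreover have "dz_integral \<Gamma> (\<lambda>v. (exp (of_real \<tau> * v) - 1 - of_real \<tau> * v) * (v ^ n * (G w j v * \<eta> b v)))
    = dz_integral \<Gamma> (\<lambda>v. exp (of_real \<tau> * v) * (v ^ n * (G w j v * \<eta> b v)) - v ^ n * (G w j v * \<eta> b v) - of_real \<tau> * (v ^ (n + 1) * (G w j v * \<eta> b v)))"
    by (simp add: algebra_simps)
  moreover have "\<dots> = X n b j \<tau> - X n b j 0 - of_real \<tau> * X (n + 1) b j 0"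
    unfolding dz_integral_diff[OF dz_integrable_diff[OF X_integrable[OF \<tau>] sol_poly(1)[OF sl m]] dz_integrable_cmult[OF sol_poly(1)[OF sl m]]]
      dz_integral_diff[OF X_integrable[OF \<tau>] sol_poly(1)[OF sl m]] dz_integral_cmult X_0 by (simp add: X_def moment_def)
  ultimately show ?thesis by simp
qed

text \<open>
  \<open>X\<close> is junk outside \<open>[- \<delta> / 6, \<delta> / 6]\<close>, where its integral may diverge.
\<close>

definition clamp :: "real \<Rightarrow> real" where "clamp \<tau> = max (- (\<delta> / 6)) (min (\<delta> / 6) \<tau>)"

lemma clamp_abs: "\<bar>clamp \<tau>\<bar> \<le> \<delta> / 6" using delta_pos by (auto simp: clamp_def)

lemma clamp_id: "\<bar>\<tau>\<bar> \<le> \<delta> / 6 \<Longrightarrow> clamp \<tau> = \<tau>" by (auto simp: clamp_def)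

lemma continuous_X_clamp: "continuous_on A (\<lambda>\<tau>. X n b j (clamp \<tau>))"
proof -
  have "(W (n + 1) b j)-lipschitz_on {- (\<delta> / 6)..\<delta> / 6} (X n b j)"
    by (rule lipschitz_onI) (use X_Lipschitz[of _ _ n b j] W_nonneg in \<open>auto simp: dist_norm mult.commute abs_le_iff\<close>)
  then have "continuous_on {- (\<delta> / 6)..\<delta> / 6} (X n b j)" by (rule lipschitz_on_continuous_on)
  moreover have "continuous_on A clamp" unfolding clamp_def[abs_def] by (intro continuous_intros)
  moreover have "clamp ` A \<subseteq> {- (\<delta> / 6)..\<delta> / 6}" using delta_pos by (auto simp: clamp_def)
  ultimately show ?thesis by (rule continuous_on_compose2)
qed

definition N :: "real \<Rightarrow> 'n \<Rightarrow> 'n \<Rightarrow> real \<Rightarrow> real \<Rightarrow> complex" where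
  "N h b i s \<sigma> = flow_sign (i = k) s \<sigma> * X 0 b i (clamp (h * (s - \<sigma>)))"

definition C :: real where "C = (\<Sum>b\<in>UNIV. \<Sum>i\<in>UNIV. W 0 b i)"

lemma W_le_C: "W 0 b i \<le> C"
proof -
  have "W 0 b i \<le> (\<Sum>i\<in>UNIV. W 0 b i)" by (rule member_le_sum) (auto simp: W_nonneg)
  also have "\<dots> \<le> C" unfolding C_def by (rule member_le_sum) (auto simp: W_nonneg sum_nonneg)
  finally show ?thesis .
qed

lemma norm_N_le: "cmod (N h b i s \<sigma>) \<le> C"
proof -
  have "cmod (N h b i s \<sigma>) \<le> 1 * W 0 b i"
    unfolding N_def norm_mult by (intro mult_mono X_le clamp_abs) (auto simp: flow_sign_def W_nonneg)
  then show ?thesis using W_le_C[of b i] by simp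
qed

lemma measurable_X_clamp [measurable]: "(\<lambda>\<tau>. X n b j (clamp \<tau>)) \<in> borel_measurable borel"
  by (rule borel_measurable_continuous_onI[OF continuous_X_clamp])

lemma N_measurable: "(\<lambda>p. N h b i (fst p) (snd p)) \<in> borel_measurable (borel \<Otimes>\<^sub>M borel)"
  unfolding N_def flow_sign_def by (cases "i = k") simp_all

lemma N_measurable' [measurable]:
  "f \<in> borel_measurable M \<Longrightarrow> g \<in> borel_measurable M \<Longrightarrow> (\<lambda>x. N h b i (f x) (g x)) \<in> borel_measurable M"
  using measurable_compose[OF measurable_Pair[of f M borel g borel] N_measurable] by simp

lemma exp_weighted: "dz_integrable \<Gamma> (\<lambda>v. of_real (exp (\<delta> / 6 * cmod v)) * (v ^ n * (G w i v * \<eta> b v)))"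
proof (rule weight_bound(1)[where B=1 and l=0])
  have "\<delta> / 6 * cmod v \<le> \<delta> / 2 * cmod v" for v :: complex using delta_pos by (intro mult_right_mono) auto
  then show "cmod (of_real (exp (\<delta> / 6 * cmod v))) \<le> 1 * exp (\<delta> / 2 * cmod v) * cmod v ^ 0" for v :: complex
    unfolding norm_of_real abs_exp_cancel by simp
qed (intro continuous_intros, simp)

text \<open>The difference of \<open>exp (of_real (h * d i) * u) * exp (of_real (h * (s - d i)) *
  v)\<close> and \<open>exp (of_real (h * s) * u)\<close> vanishes at \<open>v = u\<close>, and
  \<open>flow_sign_integral\<close> exhibits the factor \<open>u - v\<close> in it. This factor
  cancels the Cauchy denominator, so Fubini leaves a superposition of the shifted moments
  \<open>X\<close>. At \<open>v = u\<close> itself \<open>G w i v\<close> vanishes, because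
  \<open>U u i \<noteq> 0\<close>.\<close>

lemma kernel_transform:
  assumes h: "\<bar>h\<bar> \<le> \<delta> / 6" and s: "0 \<le> s" "s \<le> 1" and u: "u \<in> \<Omega>" and U0: "U u i \<noteq> 0"
  shows "exp (of_real (h * d i) * u) * dz_integral \<Gamma> (\<lambda>v. exp (of_real (h * (s - d i)) * v) * (G w i v * \<eta> b v / (u - v)))
    = exp (of_real (h * s) * u) * cterm w (\<eta> b) i u + of_real h * (\<integral>\<sigma>. exp (of_real (h * \<sigma>) * u) * N h b i s \<sigma> \<partial>unit_measure)"
proof -
  let ?\<psi> = "\<lambda>v. G w i v * \<eta> b v"
  let ?p = "\<lambda>\<sigma>. flow_sign (i = k) s \<sigma> * exp (of_real (h * \<sigma>) * u)"
  have V0: "V u i = 0" using orth[OF u, of i] U0 by simp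
  have hs: "\<bar>h * (s - \<sigma>)\<bar> \<le> \<delta> / 6" if "0 < \<sigma>" "\<sigma> < 1" for \<sigma>
  proof -
    have "\<bar>h * (s - \<sigma>)\<bar> \<le> \<bar>h\<bar> * 1" unfolding abs_mult using that s by (intro mult_left_mono) auto
    then show ?thesis using h by simp
  qed
  have pm: "?p \<in> borel_measurable borel" unfolding flow_sign_def by (cases "i = k") simp_all
  have pb: "cmod (?p \<sigma>) \<le> 1 * exp (\<bar>h\<bar> * cmod u)" if "0 < \<sigma>" "\<sigma> < 1" for \<sigma>
    unfolding norm_mult by (rule mult_mono[OF _ norm_exp_unit_le[OF that]]) (auto simp: flow_sign_def)
  have e0: "dz_integrable \<Gamma> (\<lambda>v. of_real (exp (\<delta> / 6 * cmod v)) * ?\<psi> v)"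
    using exp_weighted[of 0] by simp
  have hb: "\<bar>h * s + - h * \<sigma>\<bar> \<le> \<delta> / 6" if "0 < \<sigma>" "\<sigma> < 1" for \<sigma> using hs[OF that] by (simp add: algebra_simps)
  note fub = dz_Fubini[OF system e0 pm pb hb]
  have i0: "dz_integrable \<Gamma> (\<lambda>v. ?\<psi> v / (u - v))"
    using Cauchy_term_integrable'[OF u U0] sl by (simp add: sol_def)
  have "exp (of_real (h * d i) * u) * dz_integral \<Gamma> (\<lambda>v. exp (of_real (h * (s - d i)) * v) * (?\<psi> v / (u - v)))
    = dz_integral \<Gamma> (\<lambda>v. exp (of_real (h * d i) * u) * (exp (of_real (h * (s - d i)) * v) * (?\<psi> v / (u - v))))"
    by (rule dz_integral_cmult[symmetric])
  also have "\<dots> = dz_integral \<Gamma> (\<lambda>v. exp (of_real (h * s) * u) * (?\<psi> v / (u - v))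
      + of_real h * ((\<integral>\<sigma>. ?p \<sigma> * exp (of_real (h * s + - h * \<sigma>) * v) \<partial>unit_measure) * ?\<psi> v))"
  proof (rule dz_integral_cong)
    fix v
    have e: "(\<integral>\<sigma>. ?p \<sigma> * exp (of_real (h * s + - h * \<sigma>) * v) \<partial>unit_measure) =
      (\<integral>\<sigma>. flow_sign (i = k) s \<sigma> * (exp (of_real (h * \<sigma>) * u) * exp (of_real (h * (s - \<sigma>)) * v)) \<partial>unit_measure)" (is "?I = _")
      by (intro Bochner_Integration.integral_cong refl) (simp add: algebra_simps)
    have fs: "of_real h * (u - v) * ?I = exp (of_real (h * d i) * u) * exp (of_real (h * (s - d i)) * v) - exp (of_real (h * s) * u)"
      unfolding e by (rule flow_sign_integral[OF s])
    show "exp (of_real (h * d i) * u) * (exp (of_real (h * (s - d i)) * v) * (?\<psi> v / (u - v)))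
      = exp (of_real (h * s) * u) * (?\<psi> v / (u - v)) + of_real h * (?I * ?\<psi> v)"
    proof (cases "u = v")
      case True
      then show ?thesis using V0 by (simp add: G_def)
    next
      case False
      then have "of_real h * (?I * ?\<psi> v) = (of_real h * (u - v) * ?I) * (?\<psi> v / (u - v))" by simp
      then have I: "of_real h * (?I * ?\<psi> v) = (exp (of_real (h * d i) * u) * exp (of_real (h * (s - d i)) * v) - exp (of_real (h * s) * u)) * (?\<psi> v / (u - v))"
        by (simp only: fs)
      show ?thesis unfolding I unfolding left_diff_distrib mult.assoc by (simp only: add_diff_eq add_diff_cancel_left')
    qed
  qed
  also have "\<dots> = exp (of_real (h * s) * u) * dz_integral \<Gamma> (\<lambda>v. ?\<psi> v / (u - v))
      + of_real h * (\<integral>\<sigma>. ?p \<sigma> * dz_integral \<Gamma> (\<lambda>v. exp (of_real (h * s + - h * \<sigma>) * v) * ?\<psi> v) \<partial>unit_measure)"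
    by (simp only: dz_integral_add[OF dz_integrable_cmult[OF i0] dz_integrable_cmult[OF fub(1)]] dz_integral_cmult fub(2))
  also have "(\<integral>\<sigma>. ?p \<sigma> * dz_integral \<Gamma> (\<lambda>v. exp (of_real (h * s + - h * \<sigma>) * v) * ?\<psi> v) \<partial>unit_measure)
      = (\<integral>\<sigma>. exp (of_real (h * \<sigma>) * u) * N h b i s \<sigma> \<partial>unit_measure)"
  proof (rule unit_integral_cong)
    show "(\<lambda>\<sigma>. ?p \<sigma> * dz_integral \<Gamma> (\<lambda>v. exp (of_real (h * s + - h * \<sigma>) * v) * ?\<psi> v)) \<in> borel_measurable borel"
      using borel_measurable_integrable[OF fub(3)] by simp
    show "(\<lambda>\<sigma>. exp (of_real (h * \<sigma>) * u) * N h b i s \<sigma>) \<in> borel_measurable borel" by measurable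
    fix \<sigma> :: real assume \<sigma>: "0 < \<sigma>" "\<sigma> < 1"
    have "X 0 b i (clamp (h * (s - \<sigma>))) = dz_integral \<Gamma> (\<lambda>v. exp (of_real (h * s + - h * \<sigma>) * v) * ?\<psi> v)"
      unfolding clamp_id[OF hs[OF \<sigma>]] X_def by (simp add: right_diff_distrib)
    then show "?p \<sigma> * dz_integral \<Gamma> (\<lambda>v. exp (of_real (h * s + - h * \<sigma>) * v) * ?\<psi> v) = exp (of_real (h * \<sigma>) * u) * N h b i s \<sigma>"
      by (simp only: N_def mult_ac)
  qed
  finally show ?thesis using U0 by (simp add: cterm_def)
qed

end

text \<open>
  The solution at the parameters shifted by \<open>h\<close> is sought in the form
  \<open>exp (h d\<^sub>a u) \<eta>\<^sub>a(u) + h \<Sum>\<^sub>b (\<integral> \<xi>\<^sub>a\<^sub>b(s) exp (h s u) ds) \<eta>\<^sub>b(u)\<close>. Inserting \<open>exp (h s u) \<eta>\<^sub>b(u)\<close> into the shifted equation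
  leaves \<open>exp (h s u) F\<^sub>b(u) - h \<Sum>\<^sub>i F\<^sub>i(u) \<integral> exp (h \<sigma> u) N\<^sub>b\<^sub>i(s, \<sigma>) d\<sigma>\<close>, so the ansatz works exactly when \<open>\<xi>\<close> solves
  a Fredholm equation with kernel \<open>h N\<close>.
\<close>

locale flow_step = flow +
  fixes h :: real and \<xi> :: "'a \<Rightarrow> 'a \<Rightarrow> real \<Rightarrow> complex"
  assumes h: "\<bar>h\<bar> \<le> \<delta> / 6"
    and xi_measurable: "\<And>a b. \<xi> a b \<in> borel_measurable borel" and xi_le: "\<And>a b s. cmod (\<xi> a b s) \<le> 2 * C"
    and xi_eq: "\<And>a i \<sigma>. \<xi> a i \<sigma> = N h a i (d a) \<sigma> + of_real h * (\<Sum>b\<in>UNIV. \<integral>s. \<xi> a b s * N h b i s \<sigma> \<partial>unit_measure)"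
begin

definition Z :: "'a \<Rightarrow> 'a \<Rightarrow> complex \<Rightarrow> complex" where
  "Z a b u = (\<integral>s. \<xi> a b s * exp (of_real (h * s) * u) \<partial>unit_measure)"

definition \<eta>' :: "'a \<Rightarrow> complex \<Rightarrow> complex" where
  "\<eta>' a u = exp (of_real (h * d a) * u) * \<eta> a u + of_real h * (\<Sum>b\<in>UNIV. Z a b u * \<eta> b u)"

lemma C_nonneg: "0 \<le> C"
  using order_trans[OF W_nonneg W_le_C] .

lemma d_bounds: "0 \<le> d i" "d i \<le> 1" by simp_all

lemma exponent_le:
  assumes "0 \<le> s" "s \<le> 1" "0 \<le> e" "e \<le> 1"
  shows "\<bar>h * (s - e)\<bar> \<le> \<delta> / 6"
proof -
  have "\<bar>h * (s - e)\<bar> \<le> \<bar>h\<bar> * 1" unfolding abs_mult using assms by (intro mult_left_mono) auto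
  then show ?thesis using h by simp
qed

lemma exponent_le': "0 < s \<Longrightarrow> s < 1 \<Longrightarrow> \<bar>- h * d i + h * s\<bar> \<le> \<delta> / 6"
  using exponent_le[of s "d i"] by (simp add: algebra_simps)

lemma G_Z: "G (shift w k h) i v * Z a b v = (\<integral>s. \<xi> a b s * exp (of_real (- h * d i + h * s) * v) \<partial>unit_measure) * G w i v"
proof -
  have "exp (of_real (- (h * d i)) * v) * Z a b v = (\<integral>s. exp (of_real (- (h * d i)) * v) * (\<xi> a b s * exp (of_real (h * s) * v)) \<partial>unit_measure)"
    unfolding Z_def by (rule integral_mult_right_zero[symmetric])
  also have "\<dots> = (\<integral>s. \<xi> a b s * exp (of_real (- h * d i + h * s) * v) \<partial>unit_measure)"
  proof (intro Bochner_Integration.integral_cong refl)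
    fix s
    have "exp (of_real (- h * d i + h * s) * v) = exp (of_real (- (h * d i)) * v) * exp (of_real (h * s) * v)"
      unfolding exp_add[symmetric] by (simp add: algebra_simps)
    then show "exp (of_real (- (h * d i)) * v) * (\<xi> a b s * exp (of_real (h * s) * v)) = \<xi> a b s * exp (of_real (- h * d i + h * s) * v)"
      by (simp only: mult_ac)
  qed
  finally show ?thesis unfolding G_shift by (simp only: mult_ac)
qed

lemma G_\<eta>': "G (shift w k h) i v * \<eta>' a v = exp (of_real (h * (d a - d i)) * v) * (G w i v * \<eta> a v)
    + of_real h * (\<Sum>b\<in>UNIV. (\<integral>s. \<xi> a b s * exp (of_real (- h * d i + h * s) * v) \<partial>unit_measure) * (G w i v * \<eta> b v))"
proof -
  have e: "exp (of_real (- (h * d i)) * v) * exp (of_real (h * d a) * v) = exp (of_real (h * (d a - d i)) * v)"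
    by (simp add: algebra_simps flip: exp_add)
  have "G (shift w k h) i v * \<eta>' a v = (exp (of_real (- (h * d i)) * v) * exp (of_real (h * d a) * v)) * (G w i v * \<eta> a v)
     + of_real h * (\<Sum>b\<in>UNIV. G (shift w k h) i v * Z a b v * \<eta> b v)"
    unfolding \<eta>'_def distrib_left by (simp only: G_shift sum_distrib_left mult_ac)
  then show ?thesis unfolding e G_Z by (simp only: mult.assoc)
qed

lemmas moment_Fubini = dz_Fubini[OF system exp_weighted xi_measurable xi_le exponent_le']

lemma moment_expansion:
  shows "dz_integrable \<Gamma> (\<lambda>v. v ^ n * (G (shift w k h) i v * \<eta>' a v))"
    and "moment (shift w k h) (\<eta>' a) n i = X n a i (h * (d a - d i))
      + of_real h * (\<Sum>b\<in>UNIV. \<integral>s. \<xi> a b s * X n b i (- h * d i + h * s) \<partial>unit_measure)"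
proof -
  have e: "v ^ n * (G (shift w k h) i v * \<eta>' a v) = exp (of_real (h * (d a - d i)) * v) * (v ^ n * (G w i v * \<eta> a v))
    + of_real h * (\<Sum>b\<in>UNIV. (\<integral>s. \<xi> a b s * exp (of_real (- h * d i + h * s) * v) \<partial>unit_measure) * (v ^ n * (G w i v * \<eta> b v)))" for v
    unfolding G_\<eta>' distrib_left by (simp only: sum_distrib_left mult_ac)
  have f1: "dz_integrable \<Gamma> (\<lambda>v. (\<integral>s. \<xi> a b s * exp (of_real (- h * d i + h * s) * v) \<partial>unit_measure) * (v ^ n * (G w i v * \<eta> b v)))" for b
    by (rule moment_Fubini(1))
  have f2: "dz_integral \<Gamma> (\<lambda>v. (\<integral>s. \<xi> a b s * exp (of_real (- h * d i + h * s) * v) \<partial>unit_measure) * (v ^ n * (G w i v * \<eta> b v)))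
      = (\<integral>s. \<xi> a b s * X n b i (- h * d i + h * s) \<partial>unit_measure)" for b
    unfolding X_def by (rule moment_Fubini(2))
  have i1: "dz_integrable \<Gamma> (\<lambda>v. exp (of_real (h * (d a - d i)) * v) * (v ^ n * (G w i v * \<eta> a v)))"
    by (rule X_integrable[OF exponent_le[OF d_bounds d_bounds]])
  note i2 = dz_integrable_cmult[OF dz_integrable_sum[OF f1]]
  show "dz_integrable \<Gamma> (\<lambda>v. v ^ n * (G (shift w k h) i v * \<eta>' a v))"
    unfolding e by (rule dz_integrable_add[OF i1 i2])
  show "moment (shift w k h) (\<eta>' a) n i = X n a i (h * (d a - d i))
      + of_real h * (\<Sum>b\<in>UNIV. \<integral>s. \<xi> a b s * X n b i (- h * d i + h * s) \<partial>unit_measure)"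
    unfolding moment_def e dz_integral_add[OF i1 i2] dz_integral_cmult dz_integral_sum[OF f1] f2 by (simp only: X_def)
qed

text \<open>The transformation \<open>kernel_transform\<close> is applied to every exponential under
  the integral over \<open>s\<close>. The first terms reproduce the ansatz with \<open>cterm\<close>
  in place of the solution; the remainders are what the Fredholm equation was designed to
  absorb.\<close>

lemma Cauchy_expansion:
  assumes u: "u \<in> \<Omega>"
  shows "F (shift w k h) i u * dz_integral \<Gamma> (\<lambda>v. G (shift w k h) i v * \<eta>' a v / (u - v))
    = F w i u * (exp (of_real (h * d a) * u) * cterm w (\<eta> a) i u + of_real h * (\<Sum>b\<in>UNIV. Z a b u * cterm w (\<eta> b) i u) + of_real h * Z a i u)"
proof (cases "U u i = 0")
  case True
  then show ?thesis by (simp add: F_def)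
next
  case U0: False
  let ?E = "exp (of_real (h * d i) * u)"
  let ?q = "\<lambda>b v. G w i v * \<eta> b v / (u - v)"
  define L where "L b s = dz_integral \<Gamma> (\<lambda>v. exp (of_real (h * (s - d i)) * v) * ?q b v)" for b s
  define A where "A b s = exp (of_real (h * s) * u) * cterm w (\<eta> b) i u + of_real h * (\<integral>\<sigma>. exp (of_real (h * \<sigma>) * u) * N h b i s \<sigma> \<partial>unit_measure)" for b s
  have LA: "?E * L b s = A b s" if "0 \<le> s" "s \<le> 1" for b s
    unfolding L_def A_def by (rule kernel_transform[OF h that u U0])
  have wq: "dz_integrable \<Gamma> (\<lambda>v. of_real (exp (\<delta> / 6 * cmod v)) * ?q b v)" for b
  proof -
    have "dz_integrable \<Gamma> (\<lambda>v. G w i v * (of_real (exp (\<delta> / 6 * cmod v)) * \<eta> b v))"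
      using exp_weighted[of 0 i b] by (simp add: mult.left_commute)
    from Cauchy_term_integrable'[OF u U0 this] show ?thesis by (simp add: mult.left_commute)
  qed
  note fub = dz_Fubini[OF system wq xi_measurable xi_le exponent_le']
  have L': "dz_integral \<Gamma> (\<lambda>v. exp (of_real (- h * d i + h * s) * v) * ?q b v) = L b s" for b s
    unfolding L_def by (simp add: algebra_simps)
  have i1: "dz_integrable \<Gamma> (\<lambda>v. exp (of_real (h * (d a - d i)) * v) * ?q a v)"
  proof -
    have "dz_integrable \<Gamma> (\<lambda>v. G w i v * (exp (of_real (h * (d a - d i)) * v) * \<eta> a v))"
      using X_integrable[OF exponent_le[OF d_bounds d_bounds], of a i 0 i a] by (simp add: mult.left_commute)
    from Cauchy_term_integrable'[OF u U0 this] show ?thesis by (simp add: mult.left_commute)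
  qed
  have f1: "dz_integrable \<Gamma> (\<lambda>v. (\<integral>s. \<xi> a b s * exp (of_real (- h * d i + h * s) * v) \<partial>unit_measure) * ?q b v)" for b
    by (rule fub(1))
  have f2: "dz_integral \<Gamma> (\<lambda>v. (\<integral>s. \<xi> a b s * exp (of_real (- h * d i + h * s) * v) \<partial>unit_measure) * ?q b v)
      = (\<integral>s. \<xi> a b s * L b s \<partial>unit_measure)" for b
    unfolding L'[symmetric] by (rule fub(2))
  have f3: "integrable unit_measure (\<lambda>s. \<xi> a b s * L b s)" for b
    unfolding L'[symmetric] by (rule fub(3))
  note i2 = dz_integrable_cmult[OF dz_integrable_sum[OF f1]]
  have "dz_integral \<Gamma> (\<lambda>v. G (shift w k h) i v * \<eta>' a v / (u - v)) = dz_integral \<Gamma> (\<lambda>v. exp (of_real (h * (d a - d i)) * v) * ?q a v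
     + of_real h * (\<Sum>b\<in>UNIV. (\<integral>s. \<xi> a b s * exp (of_real (- h * d i + h * s) * v) \<partial>unit_measure) * ?q b v))"
    unfolding G_\<eta>' by (simp only: add_divide_distrib times_divide_eq_right[symmetric] sum_divide_distrib)
  also have "\<dots> = L a (d a) + of_real h * (\<Sum>b\<in>UNIV. \<integral>s. \<xi> a b s * L b s \<partial>unit_measure)"
    unfolding dz_integral_add[OF i1 i2] dz_integral_cmult dz_integral_sum[OF f1] f2 by (simp only: L_def)
  finally have E: "?E * dz_integral \<Gamma> (\<lambda>v. G (shift w k h) i v * \<eta>' a v / (u - v)) =
      ?E * L a (d a) + of_real h * (\<Sum>b\<in>UNIV. ?E * (\<integral>s. \<xi> a b s * L b s \<partial>unit_measure))"
    by (simp only: distrib_left sum_distrib_left mult.left_commute)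
  have T: "?E * (\<integral>s. \<xi> a b s * L b s \<partial>unit_measure) = Z a b u * cterm w (\<eta> b) i u + of_real h * (\<integral>\<sigma>. exp (of_real (h * \<sigma>) * u) * (\<integral>s. \<xi> a b s * N h b i s \<sigma> \<partial>unit_measure) \<partial>unit_measure)" for b
  proof -
    note xi_measurable[measurable]
    have Lm: "(\<lambda>s. \<xi> a b s * L b s) \<in> borel_measurable borel"
      using borel_measurable_integrable[OF f3] by simp
    let ?Q = "\<lambda>s \<sigma>. \<xi> a b s * (exp (of_real (h * \<sigma>) * u) * N h b i s \<sigma>)"
    have Qb: "cmod (?Q s \<sigma>) \<le> 2 * C * (exp (\<bar>h\<bar> * cmod u) * C)" if "0 < \<sigma>" "\<sigma> < 1" for s \<sigma>
      unfolding norm_mult using C_nonneg by (intro mult_mono xi_le norm_exp_unit_le that norm_N_le) auto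
    have Qm: "(\<lambda>p. ?Q (fst p) (snd p)) \<in> borel_measurable (borel \<Otimes>\<^sub>M borel)" by measurable
    note qf = unit_Fubini[OF Qm Qb mult_nonneg_nonneg]
    have Q1: "(\<integral>\<sigma>. ?Q s \<sigma> \<partial>unit_measure) = \<xi> a b s * (\<integral>\<sigma>. exp (of_real (h * \<sigma>) * u) * N h b i s \<sigma> \<partial>unit_measure)" for s
      by (rule integral_mult_right_zero)
    have Q2: "(\<integral>s. ?Q s \<sigma> \<partial>unit_measure) = exp (of_real (h * \<sigma>) * u) * (\<integral>s. \<xi> a b s * N h b i s \<sigma> \<partial>unit_measure)" for \<sigma>
      unfolding mult.left_commute[of "\<xi> a b _"] by (rule integral_mult_right_zero)
    have qm: "(\<lambda>s. \<integral>\<sigma>. ?Q s \<sigma> \<partial>unit_measure) \<in> borel_measurable borel"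
      by (rule qf(2)) (use C_nonneg in auto)
    have xe: "integrable unit_measure (\<lambda>s. \<xi> a b s * exp (of_real (h * s) * u))"
    proof (rule unit_integrable[where B="2 * C * exp (\<bar>h\<bar> * cmod u)"])
      show "cmod (\<xi> a b s * exp (of_real (h * s) * u)) \<le> 2 * C * exp (\<bar>h\<bar> * cmod u)" if "0 < s" "s < 1" for s
        unfolding norm_mult using C_nonneg by (intro mult_mono xi_le norm_exp_unit_le that) auto
    qed measurable
    have qi: "integrable unit_measure (\<lambda>s. \<integral>\<sigma>. ?Q s \<sigma> \<partial>unit_measure)"
      by (rule unit_integrable[OF qm unit_integral_norm_le[OF Qb]]) (use C_nonneg in auto)
    have AQ: "\<xi> a b s * A b s = (\<xi> a b s * exp (of_real (h * s) * u)) * cterm w (\<eta> b) i u + of_real h * (\<integral>\<sigma>. ?Q s \<sigma> \<partial>unit_measure)" for s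
      unfolding A_def Q1 by (simp add: algebra_simps)
    have Am: "(\<lambda>s. \<xi> a b s * A b s) \<in> borel_measurable borel"
      unfolding AQ by (intro borel_measurable_add borel_measurable_times qm) measurable
    have "?E * (\<integral>s. \<xi> a b s * L b s \<partial>unit_measure) = (\<integral>s. ?E * (\<xi> a b s * L b s) \<partial>unit_measure)"
      by (rule integral_mult_right_zero[symmetric])
    also have "\<dots> = (\<integral>s. \<xi> a b s * A b s \<partial>unit_measure)"
      by (rule unit_integral_cong[OF borel_measurable_times[OF borel_measurable_const Lm] Am]) (simp add: LA[symmetric] mult.left_commute)
    also have "\<dots> = (\<integral>s. \<xi> a b s * exp (of_real (h * s) * u) * cterm w (\<eta> b) i u \<partial>unit_measure) + (\<integral>s. of_real h * (\<integral>\<sigma>. ?Q s \<sigma> \<partial>unit_measure) \<partial>unit_measure)"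
      unfolding AQ by (rule Bochner_Integration.integral_add[OF integrable_mult_left[OF xe] integrable_mult_right[OF qi]])
    also have "\<dots> = Z a b u * cterm w (\<eta> b) i u + of_real h * (\<integral>s. (\<integral>\<sigma>. ?Q s \<sigma> \<partial>unit_measure) \<partial>unit_measure)"
      unfolding Z_def by (rule arg_cong2[of _ _ _ _ "(+)", OF integral_mult_left_zero integral_mult_right_zero])
    also have "(\<integral>s. (\<integral>\<sigma>. ?Q s \<sigma> \<partial>unit_measure) \<partial>unit_measure) = (\<integral>\<sigma>. (\<integral>s. ?Q s \<sigma> \<partial>unit_measure) \<partial>unit_measure)"
      by (rule qf(1)) (use C_nonneg in auto)
    finally show ?thesis unfolding Q2 .
  qed
  have 1: "?E * dz_integral \<Gamma> (\<lambda>v. G (shift w k h) i v * \<eta>' a v / (u - v)) =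
     exp (of_real (h * d a) * u) * cterm w (\<eta> a) i u + of_real h * (\<Sum>b\<in>UNIV. Z a b u * cterm w (\<eta> b) i u)
     + of_real h * ((\<integral>\<sigma>. exp (of_real (h * \<sigma>) * u) * N h a i (d a) \<sigma> \<partial>unit_measure)
       + of_real h * (\<Sum>b\<in>UNIV. \<integral>\<sigma>. exp (of_real (h * \<sigma>) * u) * (\<integral>s. \<xi> a b s * N h b i s \<sigma> \<partial>unit_measure) \<partial>unit_measure))"
    unfolding E T LA[OF d_bounds] A_def sum.distrib sum_distrib_left[symmetric] by (simp only: distrib_left add_ac)
  \<comment> \<open>This is \<open>xi_eq\<close> integrated against
    \<open>exp (of_real (h * \<sigma>) * u)\<close>. It collapses the remainder in the previous
    identity to \<open>Z a i u\<close>.\<close>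
  have 2: "Z a i u = (\<integral>\<sigma>. exp (of_real (h * \<sigma>) * u) * N h a i (d a) \<sigma> \<partial>unit_measure)
       + of_real h * (\<Sum>b\<in>UNIV. \<integral>\<sigma>. exp (of_real (h * \<sigma>) * u) * (\<integral>s. \<xi> a b s * N h b i s \<sigma> \<partial>unit_measure) \<partial>unit_measure)"
  proof -
    note xi_measurable[measurable]
    let ?J = "\<lambda>b \<sigma>. \<integral>s. \<xi> a b s * N h b i s \<sigma> \<partial>unit_measure"
    have xN: "cmod (\<xi> a b s * N h b i s \<sigma>) \<le> 2 * C * C" for b s \<sigma>
      unfolding norm_mult using C_nonneg by (intro mult_mono xi_le norm_N_le) auto
    have Jm: "?J b \<in> borel_measurable borel" for b
      by (rule unit_Fubini(3)[where B="2 * C * C"]) (measurable, use xN C_nonneg in auto)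
    have Jb: "cmod (?J b \<sigma>) \<le> 2 * C * C" for b \<sigma>
      using xN C_nonneg by (intro unit_integral_norm_le) auto
    have i0: "integrable unit_measure (\<lambda>\<sigma>. exp (of_real (h * \<sigma>) * u) * N h a i (d a) \<sigma>)"
    proof (rule unit_integrable[where B="exp (\<bar>h\<bar> * cmod u) * C"])
      show "cmod (exp (of_real (h * s) * u) * N h a i (d a) s) \<le> exp (\<bar>h\<bar> * cmod u) * C" if "0 < s" "s < 1" for s
        unfolding norm_mult using C_nonneg by (intro mult_mono norm_N_le norm_exp_unit_le that) auto
    qed measurable
    have iJ: "integrable unit_measure (\<lambda>\<sigma>. exp (of_real (h * \<sigma>) * u) * ?J b \<sigma>)" for b
    proof (rule unit_integrable[where B="exp (\<bar>h\<bar> * cmod u) * (2 * C * C)"])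
      show "cmod (exp (of_real (h * s) * u) * ?J b s) \<le> exp (\<bar>h\<bar> * cmod u) * (2 * C * C)" if "0 < s" "s < 1" for s
        unfolding norm_mult[of "exp _"] using C_nonneg by (intro mult_mono Jb norm_exp_unit_le that) auto
      show "(\<lambda>\<sigma>. exp (of_real (h * \<sigma>) * u) * ?J b \<sigma>) \<in> borel_measurable borel"
        by (intro borel_measurable_times Jm) measurable
    qed
    have "Z a i u = (\<integral>\<sigma>. exp (of_real (h * \<sigma>) * u) * N h a i (d a) \<sigma> + of_real h * (\<Sum>b\<in>UNIV. exp (of_real (h * \<sigma>) * u) * ?J b \<sigma>) \<partial>unit_measure)"
      unfolding Z_def by (intro Bochner_Integration.integral_cong refl) (subst xi_eq, simp add: algebra_simps sum_distrib_left)
    also have "\<dots> = (\<integral>\<sigma>. exp (of_real (h * \<sigma>) * u) * N h a i (d a) \<sigma> \<partial>unit_measure) + of_real h * (\<Sum>b\<in>UNIV. \<integral>\<sigma>. exp (of_real (h * \<sigma>) * u) * ?J b \<sigma> \<partial>unit_measure)"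
      by (simp only: Bochner_Integration.integral_add[OF i0 integrable_mult_right[OF Bochner_Integration.integrable_sum[OF iJ]]] integral_mult_right_zero
          Bochner_Integration.integral_sum[OF iJ])
    finally show ?thesis .
  qed
  have "F (shift w k h) i u * dz_integral \<Gamma> (\<lambda>v. G (shift w k h) i v * \<eta>' a v / (u - v))
    = F w i u * (?E * dz_integral \<Gamma> (\<lambda>v. G (shift w k h) i v * \<eta>' a v / (u - v)))"
    by (simp only: F_shift mult_ac)
  then show ?thesis unfolding 1 2[symmetric] .
qed

text \<open>The terms \<open>of_real h * Z a i u\<close> of \<open>Cauchy_expansion\<close> supply
  the free terms \<open>F w b u\<close> that are missing to turn the sums of Cauchy terms back into
  the solutions \<open>\<eta> b\<close>.\<close>

lemma sol_\<eta>': "sol (shift w k h) (unit_row a) (\<eta>' a)"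
  unfolding sol_def
proof (intro conjI allI ballI)
  show "dz_integrable \<Gamma> (\<lambda>v. G (shift w k h) i v * \<eta>' a v)" for i
    using moment_expansion(1)[of 0 i a] by simp
  fix u assume u: "u \<in> \<Omega>"
  have s: "\<eta> b u = F w b u + (\<Sum>i\<in>UNIV. F w i u * cterm w (\<eta> b) i u)" for b
  proof -
    have "(\<Sum>i\<in>UNIV. F w i u * unit_row b i) = (\<Sum>i\<in>UNIV. if i = b then F w i u else 0)"
      by (intro sum.cong) (auto simp: unit_row_def)
    then show ?thesis using sol_cterm[OF sl u, of b] by (simp add: distrib_left sum.distrib)
  qed
  have fu: "(\<Sum>i\<in>UNIV. F (shift w k h) i u * unit_row a i) = exp (of_real (h * d a) * u) * F w a u"
  proof -
    have "(\<Sum>i\<in>UNIV. F (shift w k h) i u * unit_row a i) = (\<Sum>i\<in>UNIV. if i = a then F (shift w k h) i u else 0)"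
      by (intro sum.cong) (auto simp: unit_row_def)
    then show ?thesis by (simp add: F_shift)
  qed
  have "(\<Sum>i\<in>UNIV. F (shift w k h) i u * (unit_row a i + dz_integral \<Gamma> (\<lambda>v. G (shift w k h) i v * \<eta>' a v / (u - v))))
    = exp (of_real (h * d a) * u) * F w a u + (\<Sum>i\<in>UNIV. F w i u * (exp (of_real (h * d a) * u) * cterm w (\<eta> a) i u
      + of_real h * (\<Sum>b\<in>UNIV. Z a b u * cterm w (\<eta> b) i u) + of_real h * Z a i u))"
    unfolding distrib_left[of "F (shift w k h) _ u"] Cauchy_expansion[OF u] sum.distrib fu ..
  also have "\<dots> = exp (of_real (h * d a) * u) * F w a u + exp (of_real (h * d a) * u) * (\<Sum>i\<in>UNIV. F w i u * cterm w (\<eta> a) i u)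
     + of_real h * ((\<Sum>b\<in>UNIV. Z a b u * F w b u) + (\<Sum>i\<in>UNIV. \<Sum>b\<in>UNIV. Z a b u * (F w i u * cterm w (\<eta> b) i u)))"
    unfolding distrib_left sum.distrib sum_distrib_left by (simp add: mult_ac)
  also have "(\<Sum>i\<in>UNIV. \<Sum>b\<in>UNIV. Z a b u * (F w i u * cterm w (\<eta> b) i u)) = (\<Sum>b\<in>UNIV. Z a b u * (\<Sum>i\<in>UNIV. F w i u * cterm w (\<eta> b) i u))"
    unfolding sum_distrib_left by (rule sum.swap)
  also have "exp (of_real (h * d a) * u) * F w a u + exp (of_real (h * d a) * u) * (\<Sum>i\<in>UNIV. F w i u * cterm w (\<eta> a) i u)
     + of_real h * ((\<Sum>b\<in>UNIV. Z a b u * F w b u) + (\<Sum>b\<in>UNIV. Z a b u * (\<Sum>i\<in>UNIV. F w i u * cterm w (\<eta> b) i u)))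
     = exp (of_real (h * d a) * u) * (F w a u + (\<Sum>i\<in>UNIV. F w i u * cterm w (\<eta> a) i u))
     + of_real h * (\<Sum>b\<in>UNIV. Z a b u * (F w b u + (\<Sum>i\<in>UNIV. F w i u * cterm w (\<eta> b) i u)))"
    by (simp only: distrib_left sum.distrib)
  finally show "\<eta>' a u = (\<Sum>i\<in>UNIV. F (shift w k h) i u * (unit_row a i + dz_integral \<Gamma> (\<lambda>v. G (shift w k h) i v * \<eta>' a v / (u - v))))"
    unfolding \<eta>'_def s[symmetric] ..
qed

definition K :: "nat \<Rightarrow> 'a \<Rightarrow> 'a \<Rightarrow> real" where
  "K n a i = W (n + 2) a i + (\<Sum>b\<in>UNIV. (W 1 a b + CARD('a) * (2 * C * C)) * W n b i + 2 * C * W (n + 1) b i)"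

text \<open>To first order \<open>\<xi> a b\<close> is \<open>d b - d a\<close> times a moment of
  order 0, with an error of order \<open>h\<close> from the Lipschitz bound of \<open>X\<close> and
  from the iterated term; the prefactor \<open>h\<close> makes this error quadratic. The leading
  exponential of the ansatz contributes the moment of order \<open>n + 1\<close> through
  \<open>X_Taylor\<close>.\<close>

lemma moment_derivative:
  "cmod (moment (shift w k h) (\<eta>' a) n i - moment w (\<eta> a) n i - of_real h * (of_real (d a - d i) * moment w (\<eta> a) (n + 1) i
     + (\<Sum>b\<in>UNIV. of_real (d b - d a) * moment w (\<eta> a) 0 b * moment w (\<eta> b) n i))) \<le> h\<^sup>2 * K n a i"
proof -
  define \<beta> where "\<beta> b = of_real (d b - d a) * X 0 a b 0" for b
  have xb: "cmod (\<xi> a b s - \<beta> b) \<le> \<bar>h\<bar> * (W 1 a b + CARD('a) * (2 * C * C))" if s: "0 < s" "s < 1" for b s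
  proof -
    \<comment> \<open>The number \<open>d a\<close> is 0 or 1, and the strict bounds on
      \<open>s\<close> decide the comparisons in \<open>flow_sign\<close>.\<close>
    have f: "flow_sign (b = k) (d a) s = of_real (d b - d a)" using s by (auto simp: flow_sign_def)
    have "cmod (N h a b (d a) s - \<beta> b) = cmod (of_real (d b - d a)) * cmod (X 0 a b (clamp (h * (d a - s))) - X 0 a b 0)"
      unfolding N_def f \<beta>_def by (simp only: right_diff_distrib[symmetric] norm_mult)
    also have "\<dots> \<le> 1 * (\<bar>h * (d a - s)\<bar> * W 1 a b)"
    proof (rule mult_mono)
      have c: "clamp (h * (d a - s)) = h * (d a - s)" using exponent_le[of "d a" s] s by (intro clamp_id) simp
      have "\<bar>0\<bar> \<le> \<delta> / 6" using delta_pos by simp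
      from X_Lipschitz[OF clamp_abs this, of 0 a b "h * (d a - s)"]
      show "cmod (X 0 a b (clamp (h * (d a - s))) - X 0 a b 0) \<le> \<bar>h * (d a - s)\<bar> * W 1 a b" unfolding c by simp
    qed (auto simp: norm_of_real simp del: of_real_diff)
    also have "\<dots> \<le> \<bar>h\<bar> * W 1 a b"
      unfolding abs_mult mult_1 using s by (intro mult_right_mono mult_left_le W_nonneg) auto
    finally have 1: "cmod (N h a b (d a) s - \<beta> b) \<le> \<bar>h\<bar> * W 1 a b" .
    have "cmod (\<integral>r. \<xi> a c r * N h c b r s \<partial>unit_measure) \<le> 2 * C * C" for c
      by (rule unit_integral_norm_le) (use C_nonneg in \<open>auto simp: norm_mult intro!: mult_mono xi_le norm_N_le\<close>)
    then have "cmod (\<Sum>c\<in>UNIV. \<integral>r. \<xi> a c r * N h c b r s \<partial>unit_measure) \<le> CARD('a) * (2 * C * C)"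
      by (intro order_trans[OF norm_sum] sum_bounded_above) auto
    then have 2: "cmod (of_real h * (\<Sum>c\<in>UNIV. \<integral>r. \<xi> a c r * N h c b r s \<partial>unit_measure)) \<le> \<bar>h\<bar> * (CARD('a) * (2 * C * C))"
      unfolding norm_mult norm_of_real by (intro mult_left_mono) auto
    have "\<xi> a b s - \<beta> b = (N h a b (d a) s - \<beta> b) + of_real h * (\<Sum>c\<in>UNIV. \<integral>r. \<xi> a c r * N h c b r s \<partial>unit_measure)"
      by (subst xi_eq) simp
    then show ?thesis using order_trans[OF norm_triangle_ineq add_mono[OF 1 2]] by (simp only: distrib_left)
  qed
  have int: "cmod ((\<integral>s. \<xi> a b s * X n b i (- h * d i + h * s) \<partial>unit_measure) - \<beta> b * X n b i 0)
     \<le> \<bar>h\<bar> * ((W 1 a b + CARD('a) * (2 * C * C)) * W n b i + 2 * C * W (n + 1) b i)" for b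
  proof -
    have i: "integrable unit_measure (\<lambda>s. \<xi> a b s * X n b i (- h * d i + h * s))"
      unfolding X_def by (rule moment_Fubini(3))
    have z: "\<bar>0\<bar> \<le> \<delta> / 6" using delta_pos by simp
    have e: "(\<integral>s. \<xi> a b s * X n b i (- h * d i + h * s) \<partial>unit_measure) - \<beta> b * X n b i 0
      = (\<integral>s. \<xi> a b s * X n b i (- h * d i + h * s) - \<beta> b * X n b i 0 \<partial>unit_measure)"
      by (simp only: Bochner_Integration.integral_diff[OF i unit_measure.integrable_const] unit_integral_const)
    show ?thesis unfolding e
    proof (rule unit_integral_norm_le)
      fix s :: real assume s: "0 < s" "s < 1"
      have "\<bar>- h * d i + h * s - 0\<bar> \<le> \<bar>h\<bar> * 1"
      proof -
        have "- h * d i + h * s - 0 = h * (s - d i)" by (simp add: algebra_simps)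
        then show ?thesis unfolding abs_mult using s by (simp only: abs_mult) (intro mult_left_mono, auto)
      qed
      then have l: "cmod (X n b i (- h * d i + h * s) - X n b i 0) \<le> \<bar>h\<bar> * W (n + 1) b i"
        using order_trans[OF X_Lipschitz[OF exponent_le'[OF s] z] mult_right_mono[OF _ W_nonneg]] by simp
      have "\<xi> a b s * X n b i (- h * d i + h * s) - \<beta> b * X n b i 0
        = (\<xi> a b s - \<beta> b) * X n b i 0 + \<xi> a b s * (X n b i (- h * d i + h * s) - X n b i 0)" by (simp add: algebra_simps)
      then have "cmod (\<xi> a b s * X n b i (- h * d i + h * s) - \<beta> b * X n b i 0)
        \<le> cmod (\<xi> a b s - \<beta> b) * cmod (X n b i 0) + cmod (\<xi> a b s) * cmod (X n b i (- h * d i + h * s) - X n b i 0)"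
        by (simp only: norm_mult[symmetric] norm_triangle_ineq)
      also have "\<dots> \<le> \<bar>h\<bar> * (W 1 a b + CARD('a) * (2 * C * C)) * W n b i + 2 * C * (\<bar>h\<bar> * W (n + 1) b i)"
        using C_nonneg W_nonneg by (intro add_mono mult_mono xb s X_le z xi_le l) auto
      finally show "cmod (\<xi> a b s * X n b i (- h * d i + h * s) - \<beta> b * X n b i 0)
        \<le> \<bar>h\<bar> * ((W 1 a b + CARD('a) * (2 * C * C)) * W n b i + 2 * C * W (n + 1) b i)" by (simp add: algebra_simps)
    qed (use C_nonneg W_nonneg in auto)
  qed
  have hd: "(h * (d a - d i))\<^sup>2 \<le> h\<^sup>2" by (cases "a = k"; cases "i = k") simp_all
  have t: "cmod (X n a i (h * (d a - d i)) - X n a i 0 - of_real (h * (d a - d i)) * X (n + 1) a i 0) \<le> h\<^sup>2 * W (n + 2) a i"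
    using order_trans[OF X_Taylor[OF exponent_le[OF d_bounds d_bounds]] mult_right_mono[OF hd W_nonneg]] .
  have "cmod (of_real h * (\<Sum>b\<in>UNIV. (\<integral>s. \<xi> a b s * X n b i (- h * d i + h * s) \<partial>unit_measure) - \<beta> b * X n b i 0))
     \<le> \<bar>h\<bar> * (\<Sum>b\<in>UNIV. \<bar>h\<bar> * ((W 1 a b + CARD('a) * (2 * C * C)) * W n b i + 2 * C * W (n + 1) b i))"
    unfolding norm_mult norm_of_real by (intro mult_left_mono order_trans[OF norm_sum] sum_mono int) simp
  also have "\<dots> = h\<^sup>2 * (\<Sum>b\<in>UNIV. (W 1 a b + CARD('a) * (2 * C * C)) * W n b i + 2 * C * W (n + 1) b i)"
    unfolding sum_distrib_left[symmetric] mult.assoc[symmetric] by (simp add: power2_eq_square)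
  finally have r: "cmod (of_real h * (\<Sum>b\<in>UNIV. (\<integral>s. \<xi> a b s * X n b i (- h * d i + h * s) \<partial>unit_measure) - \<beta> b * X n b i 0)) \<le> \<dots>" .
  have "moment (shift w k h) (\<eta>' a) n i - moment w (\<eta> a) n i - of_real h * (of_real (d a - d i) * moment w (\<eta> a) (n + 1) i
     + (\<Sum>b\<in>UNIV. of_real (d b - d a) * moment w (\<eta> a) 0 b * moment w (\<eta> b) n i))
    = (X n a i (h * (d a - d i)) - X n a i 0 - of_real (h * (d a - d i)) * X (n + 1) a i 0)
     + of_real h * (\<Sum>b\<in>UNIV. (\<integral>s. \<xi> a b s * X n b i (- h * d i + h * s) \<partial>unit_measure) - \<beta> b * X n b i 0)"
    unfolding moment_expansion(2) X_0[symmetric] \<beta>_def sum_subtractf by (simp add: algebra_simps)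
  then show ?thesis using order_trans[OF norm_triangle_ineq add_mono[OF t r]] unfolding K_def by (simp only: distrib_left)
qed

end

context jump_data
begin

text \<open>Entrywise form of the commutator formula for the partial derivative: with a diagonal
  matrix unit, the commutators become differences of Kronecker symbols. The remainder is quadratic
  with a constant independent of \<open>h\<close>, which is what differentiability needs.\<close>

lemma moment_flow:
  assumes sl: "\<And>a. sol w (unit_row a) (\<eta> a)" and m: "margin w \<delta>"
  shows "\<exists>B h0. 0 < h0 \<and> (\<forall>h. \<bar>h\<bar> \<le> h0 \<longrightarrow> (\<exists>\<eta>'. (\<forall>a. sol (shift w k h) (unit_row a) (\<eta>' a)) \<and>
    (\<forall>a i. cmod (moment (shift w k h) (\<eta>' a) n i - moment w (\<eta> a) n i
      - of_real h * (of_real (of_bool (a = k) - of_bool (i = k)) * moment w (\<eta> a) (n + 1) i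
        + (\<Sum>b\<in>UNIV. of_real (of_bool (b = k) - of_bool (a = k)) * moment w (\<eta> a) 0 b * moment w (\<eta> b) n i))) \<le> h\<^sup>2 * B)))"
proof -
  interpret flow \<Gamma> U V w \<eta> \<delta> k by unfold_locales (fact sl m)+
  \<comment> \<open>The first bound keeps all shifted exponents inside the weight, the second makes
    the Neumann series converge; the summand 1 avoids a zero denominator.\<close>
  define h0 where "h0 = min (\<delta> / 6) (1 / (2 * (CARD('n) * C + 1)))"
  have C0: "0 \<le> C" using order_trans[OF W_nonneg W_le_C] .
  then have C1: "0 < CARD('n) * C + 1" by (simp add: add_nonneg_pos)
  define B where "B = (\<Sum>a\<in>UNIV. \<Sum>i\<in>UNIV. W (n + 2) a i + (\<Sum>b\<in>UNIV. (W 1 a b + CARD('n) * (2 * C * C)) * W n b i + 2 * C * W (n + 1) b i))"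
  show ?thesis
  proof (rule exI[of _ B], rule exI[of _ h0], intro conjI allI impI)
    show "0 < h0" using delta_pos C1 by (simp add: h0_def)
    fix h :: real assume h: "\<bar>h\<bar> \<le> h0"
    have h1: "\<bar>h\<bar> \<le> \<delta> / 6" using h by (simp add: h0_def)
    have "\<bar>h\<bar> * (CARD('n) * C) \<le> 1 / (2 * (CARD('n) * C + 1)) * (CARD('n) * C + 1)"
      using h C0 by (intro mult_mono) (auto simp: h0_def)
    also have "\<dots> = 1 / 2" using C1 by simp
    finally have h2: "\<bar>h\<bar> * (CARD('n) * C) \<le> 1 / 2" .
    have "\<exists>\<xi>. (\<forall>b. \<xi> b \<in> borel_measurable borel) \<and> (\<forall>b s. cmod (\<xi> b s) \<le> 2 * C) \<and>
       (\<forall>i \<sigma>. \<xi> i \<sigma> = N h a i (of_bool (a = k)) \<sigma> + of_real h * (\<Sum>b\<in>UNIV. \<integral>s. \<xi> b s * N h b i s \<sigma> \<partial>unit_measure))" for a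
    proof -
      have m: "N h a i (of_bool (a = k)) \<in> borel_measurable borel" for i
        by (rule N_measurable'[where f="\<lambda>_. of_bool (a = k)" and g="\<lambda>\<sigma>. \<sigma>"]) simp_all
      show ?thesis
        by (rule Fredholm_solution[of "N h" C "\<lambda>i. N h a i (of_bool (a = k))" h, OF N_measurable norm_N_le m norm_N_le h2]) blast
    qed
    then have "\<forall>a. \<exists>\<xi>. (\<forall>b. \<xi> b \<in> borel_measurable borel) \<and> (\<forall>b s. cmod (\<xi> b s) \<le> 2 * C) \<and>
       (\<forall>i \<sigma>. \<xi> i \<sigma> = N h a i (of_bool (a = k)) \<sigma> + of_real h * (\<Sum>b\<in>UNIV. \<integral>s. \<xi> b s * N h b i s \<sigma> \<partial>unit_measure))" by blast
    from choice[OF this] obtain \<xi> where \<xi>: "\<And>a b. \<xi> a b \<in> borel_measurable borel" "\<And>a b s. cmod (\<xi> a b s) \<le> 2 * C"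
       "\<And>a i \<sigma>. \<xi> a i \<sigma> = N h a i (of_bool (a = k)) \<sigma> + of_real h * (\<Sum>b\<in>UNIV. \<integral>s. \<xi> a b s * N h b i s \<sigma> \<partial>unit_measure)"
      by blast
    interpret flow_step \<Gamma> U V w \<eta> \<delta> k h \<xi>
      by unfold_locales (fact h1 \<xi>(1) \<xi>(2) \<xi>(3))+
    have KB: "K n a i \<le> B" for a i
    proof -
      have nn: "0 \<le> K n a i" for a i unfolding K_def using W_nonneg C0 by (intro add_nonneg_nonneg sum_nonneg mult_nonneg_nonneg) auto
      have "K n a i \<le> (\<Sum>i\<in>UNIV. K n a i)" by (rule member_le_sum) (use nn in auto)
      also have "\<dots> \<le> (\<Sum>a\<in>UNIV. \<Sum>i\<in>UNIV. K n a i)" by (rule member_le_sum[of a UNIV "\<lambda>a. \<Sum>i\<in>UNIV. K n a i"]) (use nn in \<open>auto intro: sum_nonneg\<close>)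
      finally show ?thesis by (simp only: B_def K_def)
    qed
    show "\<exists>\<eta>'. (\<forall>a. sol (shift w k h) (unit_row a) (\<eta>' a)) \<and>
    (\<forall>a i. cmod (moment (shift w k h) (\<eta>' a) n i - moment w (\<eta> a) n i
      - of_real h * (of_real (of_bool (a = k) - of_bool (i = k)) * moment w (\<eta> a) (n + 1) i
        + (\<Sum>b\<in>UNIV. of_real (of_bool (b = k) - of_bool (a = k)) * moment w (\<eta> a) 0 b * moment w (\<eta> b) n i))) \<le> h\<^sup>2 * B)"
    proof (intro exI[of _ \<eta>'] conjI allI sol_\<eta>')
      fix a i
      show "cmod (moment (shift w k h) (\<eta>' a) n i - moment w (\<eta> a) n i
      - of_real h * (of_real (of_bool (a = k) - of_bool (i = k)) * moment w (\<eta> a) (n + 1) i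
        + (\<Sum>b\<in>UNIV. of_real (of_bool (b = k) - of_bool (a = k)) * moment w (\<eta> a) 0 b * moment w (\<eta> b) n i))) \<le> h\<^sup>2 * B"
        by (rule order_trans[OF moment_derivative mult_left_mono[OF KB zero_le_power2]])
    qed
  qed
qed

end

section \<open>Elimination of the higher moments\<close>

lemma matrix_mult_simps:
  fixes A A' :: "complex^'n^'m" and B B' :: "complex^'k^'n"
  shows "(A + A') ** B = A ** B + A' ** B" "(A - A') ** B = A ** B - A' ** B" "A ** (B - B') = A ** B - A ** B'"
    "(- A) ** B = - (A ** B)" "A ** (- B) = - (A ** B)" "(r *\<^sub>R A) ** B = r *\<^sub>R (A ** B)" "A ** (r *\<^sub>R B) = r *\<^sub>R (A ** B)"
    "(0 :: complex^'n^'m) ** B = 0" "A ** (0 :: complex^'k^'n) = 0"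
  by (simp_all add: matrix_matrix_mult_def vec_eq_iff distrib_right left_diff_distrib right_diff_distrib sum.distrib sum_subtractf sum_negf scaleR_sum_right)

lemmas matrix_ring = matrix_mult_simps matrix_add_ldistrib matrix_mul_assoc[symmetric]

text \<open>
  \<open>str\<close> determines \<open>c * D1\<close> in terms of \<open>M0\<close>, \<open>M1\<close> and \<open>D0\<close>; in the commutator with \<open>S\<close> the matrix \<open>M1\<close> then
  occurs only through \<open>D0\<close>.
\<close>

lemma second_order_identity:
  fixes S Y X M0 M1 M2 D0 D1 DD P Q :: "complex^'n^'n" and c :: real
  assumes SY: "S ** Y = Y ** S" and SX: "S ** X = X ** S"
    and d0: "D0 = commutator S M1 + commutator M0 S ** M0"
    and d1: "D1 = commutator S M2 + commutator M0 S ** M1"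
    and dd: "DD = commutator S D1 + (commutator D0 S ** M0 + commutator M0 S ** D0)"
    and P: "P = 2 *\<^sub>R Y + (3 * c) *\<^sub>R commutator M0 S"
    and Q: "Q = X + 2 *\<^sub>R (M0 ** Y) - (3 * c) *\<^sub>R commutator S M1 - P ** M0"
    and str: "(3 * c) *\<^sub>R commutator S M2 + P ** M1 + Q ** M0 = 2 *\<^sub>R (M1 ** Y) + M0 ** X"
  shows "(3 * c) *\<^sub>R DD - (3 * c) *\<^sub>R commutator (commutator M0 S) D0 - 2 *\<^sub>R commutator D0 Y
    + 2 *\<^sub>R commutator (commutator M0 S) (commutator M0 Y) + commutator (commutator M0 S) X = 0"
proof -
  define e where "e = 3 * c"
  have SY': "S ** (Y ** Z) = Y ** (S ** Z)" and SX': "S ** (X ** Z) = X ** (S ** Z)" for Z :: "complex^'n^'n"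
    by (simp_all add: matrix_mul_assoc SY SX)
  define A where "A = e *\<^sub>R (D0 ** M0) - 2 *\<^sub>R commutator Y M1 - commutator X M0 - 2 *\<^sub>R (commutator M0 Y ** M0)"
  have "e *\<^sub>R D1 - A = (e *\<^sub>R commutator S M2 + P ** M1 + Q ** M0) - (2 *\<^sub>R (M1 ** Y) + M0 ** X)"
    unfolding A_def d1 d0 Q P e_def[symmetric] commutator_def by (simp add: matrix_ring algebra_simps)
  then have D1: "e *\<^sub>R D1 = A" using str by (simp add: e_def)
  have "e *\<^sub>R DD = commutator S (e *\<^sub>R D1) + e *\<^sub>R (commutator D0 S ** M0 + commutator M0 S ** D0)"
    unfolding dd commutator_def by (simp add: matrix_ring algebra_simps)
  then have "e *\<^sub>R DD = commutator S A + e *\<^sub>R (commutator D0 S ** M0 + commutator M0 S ** D0)" by (simp only: D1)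
  then have DD: "e *\<^sub>R DD = e *\<^sub>R commutator (commutator M0 S) D0 - 2 *\<^sub>R commutator S (commutator Y M1) - commutator S (commutator X M0)
     - 2 *\<^sub>R commutator S (commutator M0 Y ** M0)"
    unfolding A_def commutator_def by (simp add: matrix_ring algebra_simps)
  \<comment> \<open>The Jacobi identity, as \<open>S\<close> and \<open>X\<close> commute.\<close>
  have 1: "commutator S (commutator X M0) = commutator (commutator M0 S) X"
    unfolding commutator_def by (simp add: matrix_ring algebra_simps SX SX')
  \<comment> \<open>Here \<open>M1\<close> disappears: since \<open>S\<close> and \<open>Y\<close>
    commute, the Jacobi identity cancels \<open>commutator S (commutator Y M1)\<close> against the
    part \<open>commutator (commutator S M1) Y\<close> of \<open>commutator D0 Y\<close>.\<close>
  have 2: "commutator S (commutator Y M1) + commutator S (commutator M0 Y ** M0) + commutator D0 Y = commutator (commutator M0 S) (commutator M0 Y)"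
    unfolding d0 commutator_def by (simp add: matrix_ring algebra_simps SY SY')
  show ?thesis unfolding e_def[symmetric] DD 1 2[symmetric] by (simp add: algebra_simps)
qed

definition block_s :: "complex^('m::finite option)^('m option) \<Rightarrow> complex^1^1" where
  "block_s M = (\<chi> i j. M $ None $ None)"

text \<open>The 0 in the last place belongs to the index without exponential factor.\<close>

definition lift_diag :: "real^'m \<Rightarrow> complex^('m::finite option)^('m option)" where
  "lift_diag s = diag_mat (\<chi> i. case i of None \<Rightarrow> 0 | Some j \<Rightarrow> complex_of_real (s $ j))"

lemma sum_option: "(\<Sum>i\<in>UNIV. f i) = f None + (\<Sum>j\<in>UNIV. f (Some j))" for f :: "'m::finite option \<Rightarrow> 'b::comm_monoid_add"
  by (simp add: UNIV_option_conv sum.reindex)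

lemma block_mult:
  "block_q (A ** B) = block_q A ** block_q B + block_p A ** block_r B"
  "block_p (A ** B) = block_q A ** block_p B + block_p A ** block_s B"
  "block_r (A ** B) = block_r A ** block_q B + block_s A ** block_r B"
  "block_s (A ** B) = block_r A ** block_p B + block_s A ** block_s B"
  by (simp_all add: block_q_def block_p_def block_r_def block_s_def matrix_matrix_mult_def vec_eq_iff sum_option add.commute)

lemma block_linear:
  "block_q (A + B) = block_q A + block_q B" "block_q (A - B) = block_q A - block_q B" "block_q (r *\<^sub>R A) = r *\<^sub>R block_q A" "block_q 0 = 0"
  "block_p (A + B) = block_p A + block_p B" "block_p (A - B) = block_p A - block_p B" "block_p (r *\<^sub>R A) = r *\<^sub>R block_p A" "block_p 0 = 0"
  "block_r (A + B) = block_r A + block_r B" "block_r (A - B) = block_r A - block_r B" "block_r (r *\<^sub>R A) = r *\<^sub>R block_r A" "block_r 0 = 0"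
  "block_s (A + B) = block_s A + block_s B" "block_s (A - B) = block_s A - block_s B" "block_s (r *\<^sub>R A) = r *\<^sub>R block_s A" "block_s 0 = 0"
  by (simp_all add: block_q_def block_p_def block_r_def block_s_def vec_eq_iff)

lemma block_lift_diag [simp]:
  "block_q (lift_diag s) = real_diag s" "block_p (lift_diag s) = 0" "block_r (lift_diag s) = 0" "block_s (lift_diag s) = 0"
  by (simp_all add: block_q_def block_p_def block_r_def block_s_def lift_diag_def real_diag_def diag_mat_def vec_eq_iff)

lemma diag_mat_mult: "diag_mat a ** diag_mat b = diag_mat (\<chi> i. a $ i * b $ i)"
  by (simp add: diag_mat_def matrix_matrix_mult_def vec_eq_iff if_distrib[of "\<lambda>x. x * _"] cong: if_cong)

lemma lift_diag_commute: "lift_diag s ** lift_diag y = lift_diag y ** lift_diag s"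
  by (simp add: lift_diag_def diag_mat_mult mult.commute)

text \<open>The lower right block of \<open>M\<close> never enters: it drops out of a commutator
  with a matrix whose only nonzero block is the upper left one. The lower right block of
  \<open>D0\<close> does enter the last two equations, and \<open>ds\<close> expresses it by the
  other blocks.\<close>

lemma block_equations:
  fixes M D0 DD :: "complex^('m::finite option)^('m option)" and s y x :: "real^'m" and c :: real
  defines "q \<equiv> block_q M" and "p \<equiv> block_p M" and "r \<equiv> block_r M"
    and "S \<equiv> real_diag s" and "Y \<equiv> real_diag y" and "X \<equiv> real_diag x"
  assumes E: "(3 * c) *\<^sub>R DD - (3 * c) *\<^sub>R commutator (commutator M (lift_diag s)) D0 - 2 *\<^sub>R commutator D0 (lift_diag y)
    + 2 *\<^sub>R commutator (commutator M (lift_diag s)) (commutator M (lift_diag y)) + commutator (commutator M (lift_diag s)) (lift_diag x) = 0"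
    and ds: "block_s D0 = r ** S ** p"
  shows "(3 * c) *\<^sub>R block_q DD - 2 *\<^sub>R commutator (block_q D0) Y - (3 * c) *\<^sub>R commutator (commutator q S) (block_q D0)
      + (3 * c) *\<^sub>R (S ** p ** block_r D0) + (3 * c) *\<^sub>R (block_p D0 ** r ** S)
      + 2 *\<^sub>R commutator (commutator q S) (commutator q Y)
      - 2 *\<^sub>R (S ** p ** r ** Y) + 2 *\<^sub>R (Y ** p ** r ** S)
      + commutator (commutator q S) X = 0"
    and "(3 * c) *\<^sub>R block_p DD + 2 *\<^sub>R (Y ** block_p D0) - (3 * c) *\<^sub>R (block_q D0 ** S ** p) - (3 * c) *\<^sub>R (commutator q S ** block_p D0)
      + (3 * c) *\<^sub>R (S ** p ** r ** S ** p) - 2 *\<^sub>R ((Y ** q ** S - S ** q ** Y) ** p) + X ** S ** p = 0"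
    and "(3 * c) *\<^sub>R block_r DD - 2 *\<^sub>R (block_r D0 ** Y) - (3 * c) *\<^sub>R (r ** S ** block_q D0) + (3 * c) *\<^sub>R (block_r D0 ** commutator q S)
      + (3 * c) *\<^sub>R (r ** S ** p ** r ** S) - 2 *\<^sub>R (r ** (Y ** q ** S - S ** q ** Y)) + r ** S ** X = 0"
proof -
  define e where "e = 3 * c"
  have SY: "S ** Y = Y ** S" and SX: "S ** X = X ** S"
    by (simp_all add: S_def Y_def X_def real_diag_def diag_mat_mult mult.commute)
  have SYm: "S ** (Y ** Z) = Y ** (S ** Z)" and SXm: "S ** (X ** Z) = X ** (S ** Z)" for Z :: "complex^'k^'m"
    by (simp_all add: matrix_mul_assoc SY SX)
  note E' = E[folded e_def]
  have "block_q 0 = e *\<^sub>R block_q DD - 2 *\<^sub>R commutator (block_q D0) Y - e *\<^sub>R commutator (commutator q S) (block_q D0)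
      + e *\<^sub>R (S ** p ** block_r D0) + e *\<^sub>R (block_p D0 ** r ** S)
      + 2 *\<^sub>R commutator (commutator q S) (commutator q Y)
      - 2 *\<^sub>R (S ** p ** r ** Y) + 2 *\<^sub>R (Y ** p ** r ** S)
      + commutator (commutator q S) X"
    unfolding E'[symmetric] commutator_def q_def p_def r_def S_def Y_def X_def
    by (simp add: block_mult block_linear matrix_ring algebra_simps)
  then show "(3 * c) *\<^sub>R block_q DD - 2 *\<^sub>R commutator (block_q D0) Y - (3 * c) *\<^sub>R commutator (commutator q S) (block_q D0)
      + (3 * c) *\<^sub>R (S ** p ** block_r D0) + (3 * c) *\<^sub>R (block_p D0 ** r ** S)
      + 2 *\<^sub>R commutator (commutator q S) (commutator q Y)
      - 2 *\<^sub>R (S ** p ** r ** Y) + 2 *\<^sub>R (Y ** p ** r ** S)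
      + commutator (commutator q S) X = 0" by (simp add: e_def block_linear)
  have "block_p 0 = e *\<^sub>R block_p DD + 2 *\<^sub>R (Y ** block_p D0) - e *\<^sub>R (block_q D0 ** S ** p) - e *\<^sub>R (commutator q S ** block_p D0)
      + e *\<^sub>R (S ** p ** r ** S ** p) - 2 *\<^sub>R ((Y ** q ** S - S ** q ** Y) ** p) + X ** S ** p"
    unfolding E'[symmetric] commutator_def
    by (simp add: block_mult block_linear matrix_ring algebra_simps ds SY SX SYm SXm q_def[symmetric] p_def[symmetric] r_def[symmetric] S_def[symmetric] Y_def[symmetric] X_def[symmetric])
  then show "(3 * c) *\<^sub>R block_p DD + 2 *\<^sub>R (Y ** block_p D0) - (3 * c) *\<^sub>R (block_q D0 ** S ** p) - (3 * c) *\<^sub>R (commutator q S ** block_p D0)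
      + (3 * c) *\<^sub>R (S ** p ** r ** S ** p) - 2 *\<^sub>R ((Y ** q ** S - S ** q ** Y) ** p) + X ** S ** p = 0" by (simp add: e_def block_linear)
  have "block_r 0 = e *\<^sub>R block_r DD - 2 *\<^sub>R (block_r D0 ** Y) - e *\<^sub>R (r ** S ** block_q D0) + e *\<^sub>R (block_r D0 ** commutator q S)
      + e *\<^sub>R (r ** S ** p ** r ** S) - 2 *\<^sub>R (r ** (Y ** q ** S - S ** q ** Y)) + r ** S ** X"
    unfolding E'[symmetric] commutator_def
    by (simp add: block_mult block_linear matrix_ring algebra_simps ds SY SX SYm SXm q_def[symmetric] p_def[symmetric] r_def[symmetric] S_def[symmetric] Y_def[symmetric] X_def[symmetric])
  then show "(3 * c) *\<^sub>R block_r DD - 2 *\<^sub>R (block_r D0 ** Y) - (3 * c) *\<^sub>R (r ** S ** block_q D0) + (3 * c) *\<^sub>R (block_r D0 ** commutator q S)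
      + (3 * c) *\<^sub>R (r ** S ** p ** r ** S) - 2 *\<^sub>R (r ** (Y ** q ** S - S ** q ** Y)) + r ** S ** X = 0" by (simp add: e_def block_linear)
qed

text \<open>For the vector of ones the upper left block of \<open>S\<close> is the identity, so
  \<open>d0\<close> gives the upper left block of \<open>D0\<close> as \<open>- (p ** r)\<close>.
  Substituting this, the term with \<open>block_q D0\<close> doubles the cubic term, whence the
  coefficient \<open>6 * c\<close>.\<close>

lemma block_equations_one:
  fixes M D0 DD M1 :: "complex^('m::finite option)^('m option)" and y x :: "real^'m" and c :: real
  defines "q \<equiv> block_q M" and "p \<equiv> block_p M" and "r \<equiv> block_r M" and "S \<equiv> lift_diag 1"
    and "Y \<equiv> real_diag y" and "X \<equiv> real_diag x"
  assumes E: "(3 * c) *\<^sub>R DD - (3 * c) *\<^sub>R commutator (commutator M S) D0 - 2 *\<^sub>R commutator D0 (lift_diag y)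
    + 2 *\<^sub>R commutator (commutator M S) (commutator M (lift_diag y)) + commutator (commutator M S) (lift_diag x) = 0"
    and d0: "D0 = commutator S M1 + commutator M S ** M"
  shows "block_q D0 + p ** r = 0"
    and "(3 * c) *\<^sub>R block_p DD + 2 *\<^sub>R (Y ** block_p D0) + (6 * c) *\<^sub>R (p ** r ** p) - 2 *\<^sub>R (commutator Y q ** p) + X ** p = 0"
    and "(3 * c) *\<^sub>R block_r DD - 2 *\<^sub>R (block_r D0 ** Y) + (6 * c) *\<^sub>R (r ** p ** r) - 2 *\<^sub>R (r ** commutator Y q) + r ** X = 0"
proof -
  have one: "real_diag (1 :: real^'m) = mat 1" by (simp add: real_diag_def diag_mat_def mat_def vec_eq_iff)
  have "block_q D0 = - (p ** r)"
    unfolding d0 commutator_def by (simp add: block_mult block_linear matrix_ring one S_def p_def r_def)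
  then show dq: "block_q D0 + p ** r = 0" by simp
  then have dq': "block_q D0 = - (p ** r)" by (simp add: eq_neg_iff_add_eq_0)
  have ds: "block_s D0 = r ** real_diag 1 ** p"
    unfolding d0 commutator_def by (simp add: block_mult block_linear matrix_ring one S_def p_def r_def)
  note be = block_equations[OF E[unfolded S_def] ds[unfolded p_def r_def], folded q_def p_def r_def Y_def X_def, unfolded one dq']
  define e where "e = 3 * c"
  have c6: "6 * c = 2 * e" by (simp add: e_def)
  show "(3 * c) *\<^sub>R block_p DD + 2 *\<^sub>R (Y ** block_p D0) + (6 * c) *\<^sub>R (p ** r ** p) - 2 *\<^sub>R (commutator Y q ** p) + X ** p = 0"
    using be(2) unfolding commutator_def c6 e_def[symmetric] by (simp add: matrix_ring algebra_simps scaleR_2 flip: scaleR_scaleR)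
  show "(3 * c) *\<^sub>R block_r DD - 2 *\<^sub>R (block_r D0 ** Y) + (6 * c) *\<^sub>R (r ** p ** r) - 2 *\<^sub>R (r ** commutator Y q) + r ** X = 0"
    using be(3) unfolding commutator_def c6 e_def[symmetric] by (simp add: matrix_ring algebra_simps scaleR_2 flip: scaleR_scaleR)
qed

section \<open>Strongly cubic integrable operators\<close>

lemma has_vector_derivative_vec:
  fixes f :: "real \<Rightarrow> 'a::real_normed_vector^'n"
  assumes "\<And>i. ((\<lambda>h. f h $ i) has_vector_derivative f' $ i) (at x)"
  shows "(f has_vector_derivative f') (at x)"
  unfolding has_vector_derivative_def has_derivative_at_within
proof
  show "bounded_linear (\<lambda>h. h *\<^sub>R f')" by (rule bounded_linear_scaleR_left)
  show "((\<lambda>y. (f y - f x - (y - x) *\<^sub>R f') /\<^sub>R norm (y - x)) \<longlongrightarrow> 0) (at x)"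
  proof (rule vec_tendstoI)
    fix i
    show "((\<lambda>y. ((f y - f x - (y - x) *\<^sub>R f') /\<^sub>R norm (y - x)) $ i) \<longlongrightarrow> 0 $ i) (at x)"
      using assms[of i] unfolding has_vector_derivative_def has_derivative_at_within
      by (simp only: vector_scaleR_component vector_minus_component zero_index)
  qed
qed

lemma quadratic_remainder_derivative:
  fixes f :: "real \<Rightarrow> complex"
  assumes "0 < r" and le: "\<And>h. \<bar>h\<bar> < r \<Longrightarrow> cmod (f h - f 0 - of_real h * A) \<le> h\<^sup>2 * B"
  shows "(f has_vector_derivative A) (at 0)"
  unfolding has_vector_derivative_def has_derivative_at_within
proof
  show "bounded_linear (\<lambda>h. h *\<^sub>R A)" by (rule bounded_linear_scaleR_left)
  show "((\<lambda>y. (f y - f 0 - (y - 0) *\<^sub>R A) /\<^sub>R norm (y - 0)) \<longlongrightarrow> 0) (at 0)"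
  proof (rule Lim_null_comparison)
    have "\<forall>\<^sub>F y in at (0::real). \<bar>y\<bar> < r" unfolding eventually_at using \<open>0 < r\<close> by (intro exI[of _ r]) (simp add: dist_real_def)
    then show "\<forall>\<^sub>F y in at 0. norm ((f y - f 0 - (y - 0) *\<^sub>R A) /\<^sub>R norm (y - 0)) \<le> \<bar>y\<bar> * B"
    proof eventually_elim
      case (elim y)
      have "norm ((f y - f 0 - (y - 0) *\<^sub>R A) /\<^sub>R norm (y - 0)) = cmod (f y - f 0 - of_real y * A) / \<bar>y\<bar>"
        unfolding norm_scaleR unfolding scaleR_conv_of_real by (simp add: divide_inverse)
      also have "\<dots> \<le> y\<^sup>2 * B / \<bar>y\<bar>" by (intro divide_right_mono le elim) simp
      also have "\<dots> = \<bar>y\<bar> * B" by (cases "y = 0") (auto simp: field_simps power2_eq_square abs_if)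
      finally show ?case .
    qed
    have "((\<lambda>y. \<bar>y\<bar> * B) \<longlongrightarrow> \<bar>0\<bar> * B) (at (0::real))" by (intro tendsto_intros)
    then show "((\<lambda>y. \<bar>y\<bar> * B) \<longlongrightarrow> 0) (at (0::real))" by simp
  qed
qed

lemma bounded_bilinear_matrix_mult: "bounded_bilinear ((**) :: complex^'n^'n \<Rightarrow> complex^'n^'n \<Rightarrow> complex^'n^'n)"
  unfolding bilinear_conv_bounded_bilinear[symmetric] bilinear_def
  by (auto intro!: linearI simp: matrix_mult_simps matrix_add_ldistrib)

lemma matrix_inv_diag_mat:
  fixes d :: "complex^'n"
  assumes "\<And>i. d $ i \<noteq> 0"
  shows "matrix_inv (diag_mat d) = diag_mat (\<chi> i. inverse (d $ i))"
proof -
  let ?B = "diag_mat (\<chi> i. inverse (d $ i))"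
  have 1: "diag_mat d ** ?B = mat 1" "?B ** diag_mat d = mat 1"
    using assms by (simp_all add: diag_mat_mult) (simp_all add: diag_mat_def mat_def vec_eq_iff)
  have "diag_mat d ** matrix_inv (diag_mat d) = mat 1 \<and> matrix_inv (diag_mat d) ** diag_mat d = mat 1"
    unfolding matrix_inv_def by (rule someI[of "\<lambda>B. diag_mat d ** B = mat 1 \<and> B ** diag_mat d = mat 1" ?B]) (simp add: 1)
  then have "?B = (?B ** diag_mat d) ** matrix_inv (diag_mat d)" by (simp add: matrix_mul_assoc[symmetric])
  then show ?thesis by (simp add: 1)
qed

lemma diag_mat_vector: "(diag_mat d *v v) $ i = d $ i * v $ i" for d v :: "complex^'n"
  by (simp add: diag_mat_def matrix_vector_mult_def if_distrib[of "\<lambda>x. x * _"] cong: if_cong)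

definition opt0 :: "real^'m \<Rightarrow> 'm option \<Rightarrow> real" where
  "opt0 s i = (case i of None \<Rightarrow> 0 | Some j \<Rightarrow> s $ j)"

lemma lift_diag_eq: "lift_diag s = diag_mat (\<chi> i. of_real (opt0 s i))"
  unfolding lift_diag_def opt0_def by (rule arg_cong[of _ _ diag_mat]) (simp add: vec_eq_iff split: option.split)

lemma lift_diag_mult:
  fixes B :: "complex^('m::finite option)^('m option)"
  shows "(lift_diag s ** B) $ a $ j = of_real (opt0 s a) * B $ a $ j" "(B ** lift_diag s) $ a $ j = B $ a $ j * of_real (opt0 s j)"
  by (simp_all add: lift_diag_eq diag_mat_def matrix_matrix_mult_def if_distrib[of "\<lambda>x. x * _"] if_distrib[of "\<lambda>x. _ * x"] cong: if_cong)

lemma linear_lift_diag: "linear (lift_diag :: real^'m::finite \<Rightarrow> _)"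
  by (rule linearI) (simp_all add: lift_diag_eq diag_mat_def vec_eq_iff opt0_def scaleR_conv_of_real[where 'a=complex] split: option.split)

text \<open>The order changes: parameters list \<open>x\<close> first, the triples list
  \<open>t\<close> first.\<close>

definition cubic_params :: "'m::finite params \<Rightarrow> 'm option \<Rightarrow> real \<times> real \<times> real" where
  "cubic_params = (\<lambda>(x, y, t) i. (opt0 t i, opt0 y i, opt0 x i))"

lemma cubic_params_shift: "cubic_params (x + h *\<^sub>R axis k 1, y, t) = shift (cubic_params (x, y, t)) (Some k) h"
  by (auto simp: fun_eq_iff cubic_params_def shift_def axis_def opt0_def split: option.split)

lemma cubic_exp_eq: "(case i of Some j \<Rightarrow> cubic_exp \<omega> j z | None \<Rightarrow> 1) = exp (cubic (cubic_params \<omega>) i z)"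
  by (cases \<omega>; cases i) (simp_all add: cubic_exp_def cubic_def cubic_params_def opt0_def)

text \<open>
  Moving \<open>x\<^sub>k\<close> and \<open>y\<^sub>k\<close> by \<open>\<plusminus>\<epsilon>\<close> multiplies \<open>F\<^sub>i G\<^sub>j\<close> by \<open>exp (\<plusminus>\<epsilon> z \<plusminus> \<epsilon> z\<^sup>2)\<close>; this estimate turns integrability for all
  four choices of signs into an exponential margin in \<open>\<bar>z\<bar>\<close>.
\<close>

lemma norm_le_Re_square: "cmod z \<le> 3 * (\<bar>Re z\<bar> + \<bar>Re (z\<^sup>2)\<bar> + 1)"
proof -
  define a b where "a = \<bar>Re z\<bar>" and "b = \<bar>Im z\<bar>"
  have n: "cmod z \<le> a + b" unfolding a_def b_def by (rule cmod_le)
  have r: "\<bar>Re (z\<^sup>2)\<bar> = \<bar>(a - b) * (a + b)\<bar>" by (simp add: a_def b_def power2_eq_square algebra_simps)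
  have ab: "0 \<le> a" "0 \<le> b" by (simp_all add: a_def b_def)
  show ?thesis
  proof (cases "b \<le> a + 1")
    case True
    then have "cmod z \<le> 2 * a + 1" using n by linarith
    also have "\<dots> \<le> 3 * (a + \<bar>Re (z\<^sup>2)\<bar> + 1)" using ab by simp
    finally show ?thesis by (simp add: a_def)
  next
    case False
    then have "1 * (a + b) \<le> (b - a) * (a + b)" using ab by (intro mult_right_mono) auto
    also have "\<dots> \<le> \<bar>Re (z\<^sup>2)\<bar>" unfolding r by (metis abs_ge_self abs_minus_commute abs_mult mult_right_mono abs_ge_zero ab add_nonneg_nonneg abs_of_nonneg)
    finally have "cmod z \<le> \<bar>Re (z\<^sup>2)\<bar>" using n by simp
    also have "\<dots> \<le> 3 * (a + \<bar>Re (z\<^sup>2)\<bar> + 1)" using ab by simp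
    finally show ?thesis by (simp add: a_def)
  qed
qed

context jump_data
begin

lemma sol_diff:
  assumes s: "sol w e \<phi>" "sol w e \<psi>"
  shows "sol w (\<lambda>_. 0) (\<lambda>v. \<phi> v - \<psi> v)"
proof -
  have i: "dz_integrable \<Gamma> (\<lambda>v. G w i v * \<phi> v)" "dz_integrable \<Gamma> (\<lambda>v. G w i v * \<psi> v)" for i
    using s by (simp_all add: sol_def)
  show ?thesis
    unfolding sol_def
  proof (intro conjI allI ballI)
    show "dz_integrable \<Gamma> (\<lambda>v. G w i v * (\<phi> v - \<psi> v))" for i
      unfolding right_diff_distrib by (rule dz_integrable_diff[OF i])
    fix u assume u: "u \<in> \<Omega>"
    have "(\<Sum>i\<in>UNIV. F w i u * (0 + dz_integral \<Gamma> (\<lambda>v. G w i v * (\<phi> v - \<psi> v) / (u - v)))) = (\<Sum>i\<in>UNIV. F w i u * (e i + cterm w \<phi> i u) - F w i u * (e i + cterm w \<psi> i u))"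
      by (intro sum.cong refl) (simp only: add_0_left F_cterm cterm_diff[OF u i], simp add: algebra_simps)
    then show "\<phi> u - \<psi> u = (\<Sum>i\<in>UNIV. F w i u * (0 + dz_integral \<Gamma> (\<lambda>v. G w i v * (\<phi> v - \<psi> v) / (u - v))))"
      by (simp add: sum_subtractf sol_cterm[OF s(1) u] sol_cterm[OF s(2) u])
  qed
qed

end

section \<open>The family of operators over an open set of parameters\<close>

locale cubic_family =
  fixes \<Gamma> :: "contour set" and c :: "'m::finite params \<Rightarrow> complex \<Rightarrow> complex"
    and U V :: "complex \<Rightarrow> complex^('m option)" and D :: "'m params set" and \<omega>0 :: "'m params"
  assumes system: "contour_system \<Gamma>" and open_D: "open D"
    and cubic_op: "\<And>\<omega>. \<omega> \<in> D \<Longrightarrow> strongly_cubic_integrable \<Gamma> c U V \<omega>"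
    and invertible_op: "\<And>\<omega>. \<omega> \<in> D \<Longrightarrow> one_minus_invertible \<Gamma> (H_kernel c U V \<omega>)"
    and base: "\<omega>0 \<in> D"

text \<open>Constancy and orthogonality of \<open>U\<close> and \<open>V\<close> do not involve the
  parameter; they are extracted at the base parameter \<open>\<omega>0\<close>.\<close>

sublocale cubic_family \<subseteq> J: jump_data \<Gamma> "\<lambda>u i. U u $ i" "\<lambda>u i. V u $ i"
proof
  have sc: "strongly_cubic_integrable \<Gamma> c U V \<omega>0" by (rule cubic_op[OF base])
  show "contour_system \<Gamma>" by (rule system)
  \<comment> \<open>A contour is connected, hence contained in a single component of the
    carrier.\<close>
  have const: "f u = f v" if f: "\<forall>C\<in>components (carrier_of \<Gamma>). f constant_on C"
    and k: "\<kappa> \<in> \<Gamma>" "u \<in> contour_image \<kappa>" "v \<in> contour_image \<kappa>" for f :: "complex \<Rightarrow> complex^('m option)" and \<kappa> u v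
  proof -
    have "connected (contour_image \<kappa>)"
      unfolding contour_image_def case_prod_unfold by (intro connected_continuous_image contour_domain[OF system k(1)])
    moreover have "contour_image \<kappa> \<subseteq> carrier_of \<Gamma>" using image_subset_carrier[OF k(1)] by blast
    moreover have "carrier_of \<Gamma> \<noteq> {}" using image_subset_carrier[OF k(1,2)] by blast
    ultimately obtain C where "C \<in> components (carrier_of \<Gamma>)" "contour_image \<kappa> \<subseteq> C"
      using exists_component_superset by metis
    then have "f constant_on C" "u \<in> C" "v \<in> C" using f k by blast+
    then show ?thesis by (auto simp: constant_on_def)
  qed
  show "(\<lambda>i. U u $ i) = (\<lambda>i. U v $ i)" "(\<lambda>i. V u $ i) = (\<lambda>i. V v $ i)"
    if "\<kappa> \<in> \<Gamma>" "u \<in> contour_image \<kappa>" "v \<in> contour_image \<kappa>" for \<kappa> u v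
    using const[of U, OF _ that] const[of V, OF _ that] sc by (simp_all add: strongly_cubic_integrable_def)
  fix u i assume u: "u \<in> carrier_of \<Gamma>"
  have "unit_diag i *v V u = (\<chi> j. if j = i then V u $ i else 0)"
    by (auto simp: unit_diag_def matrix_vector_mult_def vec_eq_iff if_distrib[of "\<lambda>x. x * _"] cong: if_cong)
  then have "scalar_product (U u) (unit_diag i *v V u) = U u $ i * V u $ i"
    by (simp add: scalar_product_def if_distrib[of "\<lambda>x. _ * x"] cong: if_cong)
  then show "U u $ i * V u $ i = 0" using sc u by (simp add: strongly_cubic_integrable_def)
qed

context cubic_family
begin

abbreviation w :: "'m params \<Rightarrow> 'm option \<Rightarrow> real \<times> real \<times> real" where "w \<equiv> cubic_params"

lemma f_vec_eq: "f_vec c U \<omega> u $ i = c \<omega> u * J.F (w \<omega>) i u"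
  by (simp add: f_vec_def Delta_def diag_mat_vector cubic_exp_eq J.F_def)

lemma g_vec_eq: "g_vec c V \<omega> u $ i = J.G (w \<omega>) i u / c \<omega> u"
proof -
  have "matrix_inv (Delta \<omega> u) = diag_mat (\<chi> i. inverse (exp (cubic (w \<omega>) i u)))"
    unfolding Delta_def cubic_exp_eq by (subst matrix_inv_diag_mat) simp_all
  then show ?thesis by (simp add: g_vec_def diag_mat_vector J.G_def exp_minus field_simps)
qed

lemma jump_operator:
  assumes \<omega>: "\<omega> \<in> D"
  shows "jump_operator \<Gamma> (\<lambda>u i. U u $ i) (\<lambda>u i. V u $ i) (w \<omega>) (c \<omega>) (H_kernel c U V \<omega>) (inverse_one_minus \<Gamma> (H_kernel c U V \<omega>))"
proof
  note sc = cubic_op[OF \<omega>]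
  show "c \<omega> u \<noteq> 0" if "u \<in> carrier_of \<Gamma>" for u using sc that by (simp add: strongly_cubic_integrable_def)
  \<comment> \<open>On the diagonal both sides are 0, the right one through division by
    zero.\<close>
  show "H_kernel c U V \<omega> u v = (\<Sum>i\<in>UNIV. c \<omega> u * J.F (w \<omega>) i u * (J.G (w \<omega>) i v / c \<omega> v)) / (u - v)" for u v
    by (simp add: H_kernel_def scalar_product_def f_vec_eq g_vec_eq)
  show "(\<lambda>u. c \<omega> u * J.F (w \<omega>) i u) \<in> L2 \<Gamma>" for i
    using sc unfolding strongly_cubic_integrable_def f_vec_eq by blast
  show "(\<lambda>u. J.G (w \<omega>) i u / c \<omega> u) \<in> L2 \<Gamma>" for i
    using sc unfolding strongly_cubic_integrable_def g_vec_eq by blast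
  show "bounded_on_L2 \<Gamma> (int_op \<Gamma> (H_kernel c U V \<omega>))"
    using sc by (simp add: strongly_cubic_integrable_def bounded_integral_operator_def)
  show "is_inverse_one_minus \<Gamma> (H_kernel c U V \<omega>) (inverse_one_minus \<Gamma> (H_kernel c U V \<omega>))"
    using invertible_op[OF \<omega>] unfolding one_minus_invertible_def inverse_one_minus_def by (rule someI_ex)
qed

lemma sol_unique: "\<omega> \<in> D \<Longrightarrow> J.sol (w \<omega>) (\<lambda>_. 0) \<zeta> \<Longrightarrow> z \<in> J.\<Omega> \<Longrightarrow> \<zeta> z = 0"
  by (rule jump_operator.uniqueness[OF jump_operator])

lemma sol_exists:
  assumes \<omega>: "\<omega> \<in> D"
  shows "\<exists>\<eta>. J.sol (w \<omega>) (unit_row a) \<eta> \<and> (\<forall>j. Phi1 \<Gamma> c U V \<omega> $ a $ j = J.moment (w \<omega>) \<eta> 0 j)"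
proof -
  have u: "unit_row a = (\<lambda>i. if i = a then 1 else 0)" by (simp add: fun_eq_iff unit_row_def)
  show ?thesis
    using jump_operator.extraction[OF jump_operator[OF \<omega>], of a]
    unfolding u Phi1_def J.moment_def g_vec_eq f_vec_eq by simp
qed

definition row :: "'m params \<Rightarrow> 'm option \<Rightarrow> complex \<Rightarrow> complex" where
  "row \<omega> a = (SOME \<eta>. J.sol (w \<omega>) (unit_row a) \<eta>)"

lemma row:
  assumes "\<omega> \<in> D"
  shows "J.sol (w \<omega>) (unit_row a) (row \<omega> a)"
proof -
  obtain \<eta> where "J.sol (w \<omega>) (unit_row a) \<eta>" using sol_exists[OF assms, of a] by blast
  then show ?thesis unfolding row_def by (rule someI[of "J.sol (w \<omega>) (unit_row a)"])
qed

definition M :: "nat \<Rightarrow> 'm params \<Rightarrow> complex^('m option)^('m option)" where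
  "M n \<omega> = (\<chi> a j. J.moment (w \<omega>) (row \<omega> a) n j)"

text \<open>By uniqueness the moments do not depend on the chosen solution, so an explicitly
  constructed one may be used to compute them.\<close>

lemma M_eq:
  assumes "\<omega> \<in> D" "J.sol (w \<omega>) (unit_row a) \<zeta>"
  shows "M n \<omega> $ a $ j = J.moment (w \<omega>) \<zeta> n j"
proof -
  have "row \<omega> a v = \<zeta> v" if "v \<in> J.\<Omega>" for v
    using sol_unique[OF assms(1) J.sol_diff[OF row[OF assms(1)] assms(2)] that] by simp
  then have "J.moment (w \<omega>) (row \<omega> a) n j = J.moment (w \<omega>) \<zeta> n j"
    unfolding J.moment_def by (intro dz_integral_cong) simp
  then show ?thesis by (simp add: M_def)
qed

lemma Phi1_eq: "\<omega> \<in> D \<Longrightarrow> Phi1 \<Gamma> c U V \<omega> = M 0 \<omega>"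
  unfolding vec_eq_iff using sol_exists M_eq by metis

text \<open>The gauge factor cancels in the product of a component of \<open>f\<close> with a
  component of \<open>g\<close>, and a product of two L2 functions is integrable.\<close>

lemma FG_integrable:
  assumes \<omega>: "\<omega> \<in> D"
  shows "dz_integrable \<Gamma> (\<lambda>v. J.F (w \<omega>) i v * J.G (w \<omega>) j v)"
proof -
  have "integrable (arclength \<Gamma>) (\<lambda>v. f_vec c U \<omega> v $ i * g_vec c V \<omega> v $ j)"
    using cubic_op[OF \<omega>] by (intro L2_mult_integrable) (simp_all add: strongly_cubic_integrable_def)
  then have "dz_integrable \<Gamma> (\<lambda>v. f_vec c U \<omega> v $ i * g_vec c V \<omega> v $ j)" by (rule dz_integrable_arclength[OF system])
  moreover have "dz_integrable \<Gamma> (\<lambda>v. f_vec c U \<omega> v $ i * g_vec c V \<omega> v $ j) \<longleftrightarrow> dz_integrable \<Gamma> (\<lambda>v. J.F (w \<omega>) i v * J.G (w \<omega>) j v)"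
    using cubic_op[OF \<omega>] by (intro dz_integrable_cong) (simp add: f_vec_eq g_vec_eq strongly_cubic_integrable_def)
  ultimately show ?thesis by simp
qed

lemma cubic_perturb:
  "cubic (w (x + \<alpha> *\<^sub>R axis k 1, y + \<beta> *\<^sub>R axis k 1, t)) i z
    = cubic (w (x, y, t)) i z + (if i = Some k then of_real \<alpha> * z + of_real \<beta> * z\<^sup>2 else 0)"
  by (auto simp: cubic_def cubic_params_def axis_def opt0_def algebra_simps split: option.split)

text \<open>For equal indices the product vanishes by orthogonality. For different ones at least one
  index has the form \<open>Some k\<close>, and moving \<open>x\<close> and \<open>y\<close> in the
  coordinate \<open>k\<close> changes only one of the two exponentials. With
  \<open>\<epsilon> = r / 3\<close> both moves together stay inside the ball, and the factor 3 of
  \<open>norm_le_Re_square\<close> turns \<open>\<epsilon>\<close> into the margin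
  \<open>\<epsilon> / 3\<close>.\<close>

lemma margin_exists:
  assumes \<omega>: "(x, y, t) \<in> D"
  shows "\<exists>\<delta>. J.margin (w (x, y, t)) \<delta>"
proof -
  obtain r where r: "0 < r" "ball (x, y, t) r \<subseteq> D" using open_D \<omega> open_contains_ball by blast
  define \<epsilon> where "\<epsilon> = r / 3"
  have e0: "0 < \<epsilon>" using r by (simp add: \<epsilon>_def)
  have near: "(x + \<alpha> *\<^sub>R axis k 1, y + \<beta> *\<^sub>R axis k 1, t) \<in> D" if "\<bar>\<alpha>\<bar> = \<epsilon>" "\<bar>\<beta>\<bar> = \<epsilon>" for \<alpha> \<beta> k
  proof -
    have "dist (x + \<alpha> *\<^sub>R axis k 1, y + \<beta> *\<^sub>R axis k 1, t) (x, y, t) = norm (\<alpha> *\<^sub>R axis k 1 :: real^'m, \<beta> *\<^sub>R axis k 1 :: real^'m, 0 :: real^'m)"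
      by (simp add: dist_norm)
    also have "\<dots> \<le> norm (\<alpha> *\<^sub>R axis k 1 :: real^'m) + (norm (\<beta> *\<^sub>R axis k 1 :: real^'m) + norm (0 :: real^'m))"
      by (intro order_trans[OF norm_Pair_le] add_mono norm_Pair_le order_refl)
    also have "\<dots> < r" using that r by (simp add: \<epsilon>_def)
    finally show ?thesis using r(2) by (auto simp: dist_commute)
  qed
  have "J.margin (w (x, y, t)) (\<epsilon> / 3)"
    unfolding J.margin_def
  proof (intro conjI allI)
    show "0 < \<epsilon> / 3" using e0 by simp
    fix i j :: "'m option"
    let ?FG = "\<lambda>v. J.F (w (x, y, t)) i v * J.G (w (x, y, t)) j v"
    show "dz_integrable \<Gamma> (\<lambda>v. of_real (exp (\<epsilon> / 3 * cmod v)) * ?FG v)"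
    proof (cases "i = j")
      case True
      have "dz_integrable \<Gamma> (\<lambda>v. of_real (exp (\<epsilon> / 3 * cmod v)) * ?FG v) \<longleftrightarrow> dz_integrable \<Gamma> (\<lambda>v. 0)"
        by (rule dz_integrable_cong) (use J.orth True in \<open>auto simp: J.F_def J.G_def\<close>)
      then show ?thesis by simp
    next
      case False
      obtain k \<sigma> where k: "\<sigma> = 1 \<or> \<sigma> = - (1::real)" "\<And>\<alpha> \<beta> z. J.F (w (x + \<alpha> *\<^sub>R axis k 1, y + \<beta> *\<^sub>R axis k 1, t)) i z * J.G (w (x + \<alpha> *\<^sub>R axis k 1, y + \<beta> *\<^sub>R axis k 1, t)) j z
         = exp (of_real \<sigma> * (of_real \<alpha> * z + of_real \<beta> * z\<^sup>2)) * (J.F (w (x, y, t)) i z * J.G (w (x, y, t)) j z)"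
      proof (cases i)
        case (Some k)
        show ?thesis
          by (rule that[of 1 k]) (use False Some in \<open>simp_all add: J.F_def J.G_def cubic_perturb exp_add\<close>)
      next
        case None
        then obtain k where jk: "j = Some k" using False by (cases j) auto
        show ?thesis
          by (rule that[of "-1" k]) (use None jk in \<open>simp_all add: J.F_def J.G_def cubic_perturb exp_add exp_diff exp_minus field_simps\<close>)
      qed
      let ?S = "{(\<epsilon>, \<epsilon>), (\<epsilon>, - \<epsilon>), (- \<epsilon>, \<epsilon>), (- \<epsilon>, - \<epsilon>)}"
      let ?\<theta> = "\<lambda>p v. of_real (exp \<epsilon>) * (exp (of_real \<sigma> * (of_real (fst p) * v + of_real (snd p) * v\<^sup>2)) * ?FG v)"
      show ?thesis
      proof (rule dz_integrable_dominated[OF system, where I="?S" and \<theta>="?\<theta>"])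
        show "continuous_on (contour_image \<kappa>) (\<lambda>v. of_real (exp (\<epsilon> / 3 * cmod v)) * ?FG v)" if "\<kappa> \<in> \<Gamma>" for \<kappa>
          by (intro continuous_intros J.continuous_on_F[OF that] J.continuous_on_G[OF that])
        show "dz_integrable \<Gamma> (?\<theta> p)" if "p \<in> ?S" for p
        proof (rule dz_integrable_cmult)
          have "(x + fst p *\<^sub>R axis k 1, y + snd p *\<^sub>R axis k 1, t) \<in> D" using that e0 by (intro near) auto
          from FG_integrable[OF this, of i j] show "dz_integrable \<Gamma> (\<lambda>v. exp (of_real \<sigma> * (of_real (fst p) * v + of_real (snd p) * v\<^sup>2)) * ?FG v)"
            unfolding k(2) .
        qed
        fix v
        \<comment> \<open>The two signs are chosen at each point separately, so that both summands
          of the exponent become nonnegative.\<close>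
        have "\<exists>p\<in>?S. \<epsilon> * \<bar>Re v\<bar> + \<epsilon> * \<bar>Re (v\<^sup>2)\<bar> \<le> \<sigma> * (fst p * Re v + snd p * Re (v\<^sup>2))"
        proof (rule bexI[of _ "(if 0 \<le> \<sigma> * Re v then \<epsilon> else - \<epsilon>, if 0 \<le> \<sigma> * Re (v\<^sup>2) then \<epsilon> else - \<epsilon>)"])
          show "\<epsilon> * \<bar>Re v\<bar> + \<epsilon> * \<bar>Re (v\<^sup>2)\<bar> \<le> \<sigma> * (fst (if 0 \<le> \<sigma> * Re v then \<epsilon> else - \<epsilon>, if 0 \<le> \<sigma> * Re (v\<^sup>2) then \<epsilon> else - \<epsilon>) * Re v
             + snd (if 0 \<le> \<sigma> * Re v then \<epsilon> else - \<epsilon>, if 0 \<le> \<sigma> * Re (v\<^sup>2) then \<epsilon> else - \<epsilon>) * Re (v\<^sup>2))"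
            using k(1) by (elim disjE) (simp_all add: abs_if algebra_simps del: Re_power2)
        qed simp
        then obtain p where p: "p \<in> ?S" "\<epsilon> * \<bar>Re v\<bar> + \<epsilon> * \<bar>Re (v\<^sup>2)\<bar> \<le> \<sigma> * (fst p * Re v + snd p * Re (v\<^sup>2))" by blast
        have "\<epsilon> / 3 * cmod v \<le> \<epsilon> / 3 * (3 * (\<bar>Re v\<bar> + \<bar>Re (v\<^sup>2)\<bar> + 1))" using e0 by (intro mult_left_mono norm_le_Re_square) simp
        also have "\<dots> = \<epsilon> + (\<epsilon> * \<bar>Re v\<bar> + \<epsilon> * \<bar>Re (v\<^sup>2)\<bar>)" by (simp add: algebra_simps del: Re_power2)
        also have "\<dots> \<le> \<epsilon> + \<sigma> * (fst p * Re v + snd p * Re (v\<^sup>2))" using p(2) by simp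
        finally have "exp (\<epsilon> / 3 * cmod v) \<le> exp \<epsilon> * exp (\<sigma> * (fst p * Re v + snd p * Re (v\<^sup>2)))" by (simp flip: exp_add)
        also have "exp (\<sigma> * (fst p * Re v + snd p * Re (v\<^sup>2))) = cmod (exp (of_real \<sigma> * (of_real (fst p) * v + of_real (snd p) * v\<^sup>2)))"
          unfolding norm_exp_eq_Re by (simp del: Re_power2)
        finally have e: "exp (\<epsilon> / 3 * cmod v) \<le> exp \<epsilon> * cmod (exp (of_real \<sigma> * (of_real (fst p) * v + of_real (snd p) * v\<^sup>2)))" .
        have "cmod (of_real (exp (\<epsilon> / 3 * cmod v)) * ?FG v) = exp (\<epsilon> / 3 * cmod v) * cmod (?FG v)"
          by (simp only: norm_mult norm_of_real abs_exp_cancel mult.assoc)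
        also have "\<dots> \<le> exp \<epsilon> * cmod (exp (of_real \<sigma> * (of_real (fst p) * v + of_real (snd p) * v\<^sup>2))) * cmod (?FG v)"
          by (rule mult_right_mono[OF e]) simp
        also have "\<dots> = cmod (?\<theta> p v)"
          by (simp only: norm_mult norm_of_real abs_exp_cancel mult.assoc)
        also have "\<dots> \<le> (\<Sum>p\<in>?S. cmod (?\<theta> p v))" by (rule member_le_sum[OF p(1)]) auto
        finally show "cmod (of_real (exp (\<epsilon> / 3 * cmod v)) * ?FG v) \<le> (\<Sum>p\<in>?S. cmod (?\<theta> p v))" .
      qed
    qed
  qed
  then show ?thesis by blast
qed

text \<open>The derivative of \<open>M n\<close> in the direction \<open>s\<close> of the
  \<open>x\<close> space. Being linear in \<open>s\<close>, it yields the partial derivatives for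
  the unit vectors, \<open>D_t\<close> for \<open>s = t\<close> and \<open>D_x\<close> for the
  vector of ones.\<close>

definition dM :: "real^'m \<Rightarrow> nat \<Rightarrow> 'm params \<Rightarrow> complex^('m option)^('m option)" where
  "dM s n \<omega> = commutator (lift_diag s) (M (n + 1) \<omega>) + commutator (M 0 \<omega>) (lift_diag s) ** M n \<omega>"

lemma near_line:
  assumes "(x, y, t) \<in> D"
  obtains r where "0 < r" "\<And>h. \<bar>h\<bar> < r \<Longrightarrow> (x + h *\<^sub>R axis k 1, y, t) \<in> D"
proof -
  obtain r where r: "0 < r" "ball (x, y, t) r \<subseteq> D" using open_D assms open_contains_ball by blast
  have "(x + h *\<^sub>R axis k 1, y, t) \<in> ball (x, y, t) r" if "\<bar>h\<bar> < r" for h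
    using that by (simp add: dist_norm norm_Pair)
  then show ?thesis using r that by blast
qed

text \<open>The solution built by \<open>moment_flow\<close> belongs to the shifted parameter, which
  is in \<open>D\<close> for small \<open>h\<close>; there \<open>M_eq\<close> identifies its
  moments with the entries of \<open>M n\<close>.\<close>

lemma M_derivative:
  assumes \<omega>: "(x, y, t) \<in> D"
  shows "((\<lambda>h. M n (x + h *\<^sub>R axis k 1, y, t)) has_vector_derivative dM (axis k 1) n (x, y, t)) (at 0)"
proof (intro has_vector_derivative_vec)
  fix a j :: "'m option"
  let ?w = "w (x, y, t)" and ?\<eta> = "row (x, y, t)"
  obtain \<delta> where m: "J.margin ?w \<delta>" using margin_exists[OF \<omega>] by blast
  obtain B h0 where B: "0 < h0" "\<And>h. \<bar>h\<bar> \<le> h0 \<Longrightarrow> (\<exists>\<eta>'. (\<forall>a. J.sol (shift ?w (Some k) h) (unit_row a) (\<eta>' a)) \<and>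
    (\<forall>a i. cmod (J.moment (shift ?w (Some k) h) (\<eta>' a) n i - J.moment ?w (?\<eta> a) n i
      - of_real h * (of_real (of_bool (a = Some k) - of_bool (i = Some k)) * J.moment ?w (?\<eta> a) (n + 1) i
        + (\<Sum>b\<in>UNIV. of_real (of_bool (b = Some k) - of_bool (a = Some k)) * J.moment ?w (?\<eta> a) 0 b * J.moment ?w (?\<eta> b) n i))) \<le> h\<^sup>2 * B))"
    using J.moment_flow[of ?w ?\<eta> \<delta> "Some k" n, OF row[OF \<omega>] m] by blast
  obtain r where r: "0 < r" "\<And>h. \<bar>h\<bar> < r \<Longrightarrow> (x + h *\<^sub>R axis k 1, y, t) \<in> D" using near_line[OF \<omega>] by blast
  have opt: "opt0 (axis k 1) b = of_bool (b = Some k)" for b by (auto simp: opt0_def axis_def split: option.split)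
  have d: "dM (axis k 1) n (x, y, t) $ a $ j = of_real (of_bool (a = Some k) - of_bool (j = Some k)) * J.moment ?w (?\<eta> a) (n + 1) j
        + (\<Sum>b\<in>UNIV. of_real (of_bool (b = Some k) - of_bool (a = Some k)) * J.moment ?w (?\<eta> a) 0 b * J.moment ?w (?\<eta> b) n j)"
    unfolding dM_def commutator_def matrix_matrix_mult_def[of "M 0 _ ** _ - _"]
    by (simp add: lift_diag_mult opt M_def algebra_simps)
  show "((\<lambda>h. M n (x + h *\<^sub>R axis k 1, y, t) $ a $ j) has_vector_derivative dM (axis k 1) n (x, y, t) $ a $ j) (at 0)"
  proof (rule quadratic_remainder_derivative)
    show "0 < min h0 r" using B(1) r(1) by simp
    fix h :: real assume h: "\<bar>h\<bar> < min h0 r"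
    have wD: "(x + h *\<^sub>R axis k 1, y, t) \<in> D" using r(2) h by simp
    obtain \<eta>' where \<eta>': "\<And>a. J.sol (shift ?w (Some k) h) (unit_row a) (\<eta>' a)"
      "\<And>a i. cmod (J.moment (shift ?w (Some k) h) (\<eta>' a) n i - J.moment ?w (?\<eta> a) n i
      - of_real h * (of_real (of_bool (a = Some k) - of_bool (i = Some k)) * J.moment ?w (?\<eta> a) (n + 1) i
        + (\<Sum>b\<in>UNIV. of_real (of_bool (b = Some k) - of_bool (a = Some k)) * J.moment ?w (?\<eta> a) 0 b * J.moment ?w (?\<eta> b) n i))) \<le> h\<^sup>2 * B"
      using B(2)[of h] h by auto
    have "M n (x + h *\<^sub>R axis k 1, y, t) $ a $ j = J.moment (shift ?w (Some k) h) (\<eta>' a) n j"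
      using M_eq[OF wD, of a "\<eta>' a" n j] \<eta>'(1)[of a] by (simp add: cubic_params_shift)
    moreover have "M n (x + 0 *\<^sub>R axis k 1, y, t) $ a $ j = J.moment ?w (?\<eta> a) n j" by (simp add: M_def)
    ultimately show "cmod (M n (x + h *\<^sub>R axis k 1, y, t) $ a $ j - M n (x + 0 *\<^sub>R axis k 1, y, t) $ a $ j - of_real h * dM (axis k 1) n (x, y, t) $ a $ j) \<le> h\<^sup>2 * B"
      using \<eta>'(2)[of a j] unfolding d by simp
  qed
qed

text \<open>A diagonal factor on the left carries the parameter of the row index, one on the right
  that of the column index; with this reading \<open>string_identity\<close> becomes an equation of
  matrices.\<close>

lemma string_matrix:
  fixes x y t :: "real^'m"
  assumes \<omega>: "(x, y, t) \<in> D"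
  defines "T \<equiv> lift_diag t" and "Y \<equiv> lift_diag y" and "X \<equiv> lift_diag x" and "N \<equiv> \<lambda>n. M n (x, y, t)"
  defines "P \<equiv> 2 *\<^sub>R Y + 3 *\<^sub>R commutator (N 0) T"
  defines "Q \<equiv> X + 2 *\<^sub>R (N 0 ** Y) - 3 *\<^sub>R commutator T (N 1) - P ** N 0"
  shows "3 *\<^sub>R commutator T (N 2) + P ** N 1 + Q ** N 0 = 2 *\<^sub>R (N 1 ** Y) + N 0 ** X"
proof -
  let ?w = "w (x, y, t)" and ?\<eta> = "row (x, y, t)"
  obtain \<delta> where m: "J.margin ?w \<delta>" using margin_exists[OF \<omega>] by blast
  have wi: "?w i = (opt0 t i, opt0 y i, opt0 x i)" for i by (simp add: cubic_params_def)
  have uniq: "\<forall>\<zeta>. J.sol ?w (\<lambda>_. 0) \<zeta> \<longrightarrow> (\<forall>z\<in>J.\<Omega>. \<zeta> z = 0)" using sol_unique[OF \<omega>] by blast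
  note str = J.string_identity[where w="?w" and t="opt0 t" and y="opt0 y" and x="opt0 x" and \<eta>="?\<eta>" and \<delta>=\<delta>, OF wi row[OF \<omega>] m uniq]
  have Mm: "J.moment ?w (?\<eta> a) n j = N n $ a $ j" for a n j by (simp add: N_def M_def)
  have dg: "lift_diag s $ a $ b = of_real (opt0 s a) * unit_row a b" for s :: "real^'m" and a b
    by (simp add: lift_diag_eq diag_mat_def unit_row_def)
  have P: "2 * of_real (opt0 y a) * unit_row a b + 3 * of_real (opt0 t b) * N 0 $ a $ b - 3 * of_real (opt0 t a) * N 0 $ a $ b = P $ a $ b" for a b
    by (simp add: P_def Y_def T_def commutator_def lift_diag_mult dg scaleR_conv_of_real algebra_simps)
  have PN: "(\<Sum>c\<in>UNIV. P $ a $ c * N n $ c $ b) = (P ** N n) $ a $ b" for a b n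
    by (simp add: matrix_matrix_mult_def)
  have Q: "of_real (opt0 x a) * unit_row a b + 3 * of_real (opt0 t b) * N 1 $ a $ b + 2 * of_real (opt0 y b) * N 0 $ a $ b
    - 3 * of_real (opt0 t a) * N 1 $ a $ b - (P ** N 0) $ a $ b = Q $ a $ b" for a b
    by (simp add: Q_def X_def Y_def T_def commutator_def lift_diag_mult dg scaleR_conv_of_real algebra_simps)
  have QN: "(\<Sum>c\<in>UNIV. Q $ a $ c * N n $ c $ b) = (Q ** N n) $ a $ b" for a b n
    by (simp add: matrix_matrix_mult_def)
  have "3 * of_real (opt0 t a) * N 2 $ a $ j + (P ** N 1) $ a $ j + (Q ** N 0) $ a $ j
    = 3 * of_real (opt0 t j) * N 2 $ a $ j + 2 * of_real (opt0 y j) * N 1 $ a $ j + of_real (opt0 x j) * N 0 $ a $ j" for a j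
    using str[of a j] unfolding Mm P PN Q QN .
  then show ?thesis
    by (simp add: vec_eq_iff commutator_def T_def Y_def X_def lift_diag_mult scaleR_conv_of_real algebra_simps)
qed

text \<open>The product rule for \<open>dM s 0\<close> in the direction \<open>v\<close>. The
  coefficient \<open>s\<close> is held fixed, as \<open>t\<close> is under derivatives in
  \<open>x\<close>.\<close>

definition ddM :: "real^'m \<Rightarrow> real^'m \<Rightarrow> 'm params \<Rightarrow> complex^('m option)^('m option)" where
  "ddM s v \<omega> = commutator (lift_diag s) (dM v 1 \<omega>) + (commutator (dM v 0 \<omega>) (lift_diag s) ** M 0 \<omega> + commutator (M 0 \<omega>) (lift_diag s) ** dM v 0 \<omega>)"

lemma linear_dM: "linear (\<lambda>s. dM s n \<omega>)"
  by (rule linearI) (simp_all add: dM_def commutator_def linear_add[OF linear_lift_diag] linear_scale[OF linear_lift_diag] matrix_ring algebra_simps)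

lemma linear_ddM: "linear (\<lambda>v. ddM s v \<omega>)"
  by (rule linearI) (simp_all add: ddM_def commutator_def linear_add[OF linear_dM] linear_scale[OF linear_dM] matrix_ring algebra_simps)

lemma sum_axis: "(\<Sum>k\<in>UNIV. s $ k *\<^sub>R f (axis k 1)) = f s" if "linear f" for f :: "real^'m \<Rightarrow> complex^('m option)^('m option)"
proof -
  have "(\<Sum>k\<in>UNIV. s $ k *\<^sub>R f (axis k 1)) = f (\<Sum>k\<in>UNIV. s $ k *s axis k 1)"
    by (simp add: linear_sum[OF that] linear_scale[OF that] scalar_mult_eq_scaleR)
  then show ?thesis by (simp add: basis_expansion)
qed

lemma dM_derivative:
  assumes \<omega>: "(x, y, t) \<in> D"
  shows "((\<lambda>h. dM s 0 (x + h *\<^sub>R axis k 1, y, t)) has_vector_derivative ddM s (axis k 1) (x, y, t)) (at 0)"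
proof -
  let ?S = "lift_diag s"
  have lin: "bounded_linear (\<lambda>B. commutator ?S B)" "bounded_linear (\<lambda>B. commutator B ?S)"
    unfolding linear_conv_bounded_linear[symmetric]
    by (rule linearI; simp add: commutator_def matrix_ring algebra_simps)+
  note d = bounded_linear.has_vector_derivative[OF lin(1) M_derivative[OF \<omega>, of 1 k]]
    bounded_linear.has_vector_derivative[OF lin(2) M_derivative[OF \<omega>, of 0 k]]
  note p = bounded_bilinear.has_vector_derivative[OF bounded_bilinear_matrix_mult d(2) M_derivative[OF \<omega>, of 0 k]]
  show ?thesis
    using has_vector_derivative_add[OF d(1) p] unfolding dM_def[abs_def] ddM_def by (simp add: add.commute)
qed

context
  fixes L :: "complex^('m option)^('m option) \<Rightarrow> 'b::real_normed_vector"
  assumes L: "bounded_linear L"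
begin

abbreviation "LPhi \<equiv> \<lambda>\<omega>. L (Phi1 \<Gamma> c U V \<omega>)"

text \<open>The matrices \<open>Phi1\<close> and \<open>M 0\<close> are known to agree on
  \<open>D\<close> only, so the derivative is transferred along a short segment inside
  \<open>D\<close>.\<close>

lemma LPhi_derivative:
  assumes \<omega>: "(x, y, t) \<in> D"
  shows "((\<lambda>h. LPhi (x + h *\<^sub>R axis k 1, y, t)) has_vector_derivative L (dM (axis k 1) 0 (x, y, t))) (at 0)"
proof -
  obtain r where r: "0 < r" "\<And>h. \<bar>h\<bar> < r \<Longrightarrow> (x + h *\<^sub>R axis k 1, y, t) \<in> D" using near_line[OF \<omega>] by blast
  show ?thesis
    by (rule has_vector_derivative_transform_within[OF bounded_linear.has_vector_derivative[OF L M_derivative[OF \<omega>]] r(1)])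
      (simp_all add: dist_real_def Phi1_eq r(2))
qed

lemma partial_LPhi: "\<omega> \<in> D \<Longrightarrow> partial_x k LPhi \<omega> = L (dM (axis k 1) 0 \<omega>)"
  using vector_derivative_at[OF LPhi_derivative] by (cases \<omega>) (simp add: partial_x_def)

lemma second_derivative:
  assumes \<omega>: "(x, y, t) \<in> D" and g: "\<And>x'. (x', y, t) \<in> D \<Longrightarrow> g (x', y, t) = L (dM s 0 (x', y, t))"
  shows "((\<lambda>h. g (x + h *\<^sub>R axis k 1, y, t)) has_vector_derivative L (ddM s (axis k 1) (x, y, t))) (at 0)"
proof -
  obtain r where r: "0 < r" "\<And>h. \<bar>h\<bar> < r \<Longrightarrow> (x + h *\<^sub>R axis k 1, y, t) \<in> D" using near_line[OF \<omega>] by blast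
  show ?thesis
    by (rule has_vector_derivative_transform_within[OF bounded_linear.has_vector_derivative[OF L dM_derivative[OF \<omega>]] r(1)])
      (simp_all add: dist_real_def g r(2))
qed

lemma twice_partial_LPhi:
  assumes \<omega>: "(x, y, t) \<in> D"
  shows "twice_partial_x LPhi (x, y, t)"
  unfolding twice_partial_x_def has_partial_x_def prod.case
  using differentiableI_vector[OF LPhi_derivative[OF \<omega>]] differentiableI_vector[OF second_derivative[OF \<omega> partial_LPhi]] by blast

lemma sum_L: "linear f \<Longrightarrow> (\<Sum>k\<in>UNIV. s $ k *\<^sub>R L (f (axis k 1))) = L (f s)"
  for f :: "real^'m \<Rightarrow> complex^('m option)^('m option)"
  unfolding linear_scale[OF bounded_linear.linear[OF L], symmetric] linear_sum[OF bounded_linear.linear[OF L], symmetric]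
  by (rule arg_cong[where f=L], rule sum_axis[where f=f])

lemma D_t_LPhi: "(x, y, t) \<in> D \<Longrightarrow> D_t LPhi (x, y, t) = L (dM t 0 (x, y, t))"
  unfolding D_t_def prod.case by (simp add: partial_LPhi sum_L[OF linear_dM])

lemma D_t_D_t_LPhi:
  assumes \<omega>: "(x, y, t) \<in> D"
  shows "D_t (D_t LPhi) (x, y, t) = L (ddM t t (x, y, t))"
proof -
  have "partial_x k (D_t LPhi) (x, y, t) = L (ddM t (axis k 1) (x, y, t))" for k
    using vector_derivative_at[OF second_derivative[OF \<omega> D_t_LPhi]] by (simp add: partial_x_def)
  then show ?thesis unfolding D_t_def[of "D_t LPhi"] prod.case by (simp add: sum_L[OF linear_ddM])
qed

lemma D_x_LPhi: "\<omega> \<in> D \<Longrightarrow> D_x LPhi \<omega> = L (dM 1 0 \<omega>)"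
  unfolding D_x_def using sum_L[OF linear_dM, of 1] by (simp add: partial_LPhi)

lemma D_x_D_x_LPhi:
  assumes \<omega>: "(x, y, t) \<in> D"
  shows "D_x (D_x LPhi) (x, y, t) = L (ddM 1 1 (x, y, t))"
proof -
  have "partial_x k (D_x LPhi) (x, y, t) = L (ddM 1 (axis k 1) (x, y, t))" for k
    using vector_derivative_at[OF second_derivative[OF \<omega> D_x_LPhi]] by (simp add: partial_x_def)
  then show ?thesis unfolding D_x_def[of "D_x LPhi"] using sum_L[OF linear_ddM, of 1] by simp
qed

end

text \<open>The factorization of \<open>t\<close> serves both halves of the claim:
  \<open>\<tau> = 1\<close> with \<open>s = t\<close> in general, and the vector of ones for
  \<open>s\<close> when all \<open>t $ i\<close> equal \<open>\<tau>\<close>. In the latter case the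
  derivatives are taken along \<open>s\<close>, so there is no division by \<open>\<tau>\<close> and
  the value 0 is included.\<close>

lemma second_order_M:
  assumes \<omega>: "(x, y, t) \<in> D" and t: "t = \<tau> *\<^sub>R s"
  defines "N \<equiv> M 0 (x, y, t)" and "S \<equiv> lift_diag s" and "D0 \<equiv> dM s 0 (x, y, t)"
  shows "(3 * \<tau>) *\<^sub>R ddM s s (x, y, t) - (3 * \<tau>) *\<^sub>R commutator (commutator N S) D0 - 2 *\<^sub>R commutator D0 (lift_diag y)
    + 2 *\<^sub>R commutator (commutator N S) (commutator N (lift_diag y)) + commutator (commutator N S) (lift_diag x) = 0"
proof (rule second_order_identity)
  have T: "lift_diag t = \<tau> *\<^sub>R S" unfolding t S_def by (rule linear_scale[OF linear_lift_diag])
  have cT: "3 *\<^sub>R commutator (lift_diag t) A = (3 * \<tau>) *\<^sub>R commutator S A" "3 *\<^sub>R commutator A (lift_diag t) = (3 * \<tau>) *\<^sub>R commutator A S" for A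
    unfolding T commutator_def by (simp_all add: matrix_ring scaleR_diff_right)
  show "S ** lift_diag y = lift_diag y ** S" "S ** lift_diag x = lift_diag x ** S" by (simp_all add: S_def lift_diag_commute)
  show "D0 = commutator S (M 1 (x, y, t)) + commutator N S ** N" by (simp add: D0_def dM_def N_def S_def)
  show "dM s 1 (x, y, t) = commutator S (M 2 (x, y, t)) + commutator N S ** M 1 (x, y, t)"
    by (simp add: dM_def N_def S_def numeral_2_eq_2)
  show "ddM s s (x, y, t) = commutator S (dM s 1 (x, y, t)) + (commutator D0 S ** N + commutator N S ** D0)"
    by (simp add: ddM_def D0_def N_def S_def)
  show "(3 * \<tau>) *\<^sub>R commutator S (M 2 (x, y, t)) + (2 *\<^sub>R lift_diag y + (3 * \<tau>) *\<^sub>R commutator N S) ** M 1 (x, y, t)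
    + (lift_diag x + 2 *\<^sub>R (N ** lift_diag y) - (3 * \<tau>) *\<^sub>R commutator S (M 1 (x, y, t)) - (2 *\<^sub>R lift_diag y + (3 * \<tau>) *\<^sub>R commutator N S) ** N) ** N
    = 2 *\<^sub>R (M 1 (x, y, t) ** lift_diag y) + N ** lift_diag x"
    using string_matrix[OF \<omega>] unfolding cT N_def .
qed (rule refl)+

lemma dM_decomposition: "dM s 0 \<omega> = commutator (lift_diag s) (M 1 \<omega>) + commutator (M 0 \<omega>) (lift_diag s) ** M 0 \<omega>"
  by (simp add: dM_def)

text \<open>The commutator with \<open>M 1\<close> has no lower right block, so only the product
  term contributes.\<close>

lemma block_s_dM: "block_s (dM s 0 \<omega>) = block_r (M 0 \<omega>) ** real_diag s ** block_p (M 0 \<omega>)"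
  unfolding dM_decomposition commutator_def by (simp add: block_mult block_linear matrix_ring)

end

lemma bounded_linear_blocks: "bounded_linear block_q" "bounded_linear block_p" "bounded_linear block_r"
  unfolding linear_conv_bounded_linear[symmetric] by (rule linearI; simp add: block_linear)+

theorem corollary2p8:
  fixes \<Gamma> :: "contour set"
    and c :: "'m::finite params \<Rightarrow> complex \<Rightarrow> complex"
    and U V :: "complex \<Rightarrow> complex^('m option)"
    and D :: "'m params set"
  assumes "contour_system \<Gamma>"
    and "open D"
    and "\<And>\<omega>. \<omega> \<in> D \<Longrightarrow> strongly_cubic_integrable \<Gamma> c U V \<omega>"
    and "\<And>\<omega>. \<omega> \<in> D \<Longrightarrow> one_minus_invertible \<Gamma> (H_kernel c U V \<omega>)"
    and "(x, y, t) \<in> D"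
  defines "Q \<equiv> \<lambda>\<omega>. block_q (Phi1 \<Gamma> c U V \<omega>)"
    and "P \<equiv> \<lambda>\<omega>. block_p (Phi1 \<Gamma> c U V \<omega>)"
    and "R \<equiv> \<lambda>\<omega>. block_r (Phi1 \<Gamma> c U V \<omega>)"
  defines "q \<equiv> Q (x, y, t)" and "p \<equiv> P (x, y, t)" and "r \<equiv> R (x, y, t)"
    and "dq \<equiv> D_t Q (x, y, t)" and "dp \<equiv> D_t P (x, y, t)" and "dr \<equiv> D_t R (x, y, t)"
    and "ddq \<equiv> D_t (D_t Q) (x, y, t)" and "ddp \<equiv> D_t (D_t P) (x, y, t)"
    and "ddr \<equiv> D_t (D_t R) (x, y, t)"
    and "T \<equiv> real_diag t" and "Y \<equiv> real_diag y" and "X \<equiv> real_diag x"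
  shows "(twice_partial_x Q (x, y, t) \<and> twice_partial_x P (x, y, t) \<and> twice_partial_x R (x, y, t)) \<and>
    3 *\<^sub>R ddq - 2 *\<^sub>R commutator dq Y - 3 *\<^sub>R commutator (commutator q T) dq
      + 3 *\<^sub>R (T ** p ** dr) + 3 *\<^sub>R (dp ** r ** T)
      + 2 *\<^sub>R commutator (commutator q T) (commutator q Y)
      - 2 *\<^sub>R (T ** p ** r ** Y) + 2 *\<^sub>R (Y ** p ** r ** T)
      + commutator (commutator q T) X = 0 \<and>
    3 *\<^sub>R ddp + 2 *\<^sub>R (Y ** dp) - 3 *\<^sub>R (dq ** T ** p) - 3 *\<^sub>R (commutator q T ** dp)
      + 3 *\<^sub>R (T ** p ** r ** T ** p) - 2 *\<^sub>R ((Y ** q ** T - T ** q ** Y) ** p)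
      + X ** T ** p = 0 \<and>
    3 *\<^sub>R ddr - 2 *\<^sub>R (dr ** Y) - 3 *\<^sub>R (r ** T ** dq) + 3 *\<^sub>R (dr ** commutator q T)
      + 3 *\<^sub>R (r ** T ** p ** r ** T) - 2 *\<^sub>R (r ** (Y ** q ** T - T ** q ** Y))
      + r ** T ** X = 0 \<and>
    (\<forall>\<tau>. (\<forall>i. t $ i = \<tau>) \<longrightarrow>
      D_x Q (x, y, t) + p ** r = 0 \<and>
      (3 * \<tau>) *\<^sub>R D_x (D_x P) (x, y, t) + 2 *\<^sub>R (Y ** D_x P (x, y, t))
        + (6 * \<tau>) *\<^sub>R (p ** r ** p) - 2 *\<^sub>R (commutator Y q ** p) + X ** p = 0 \<and>
      (3 * \<tau>) *\<^sub>R D_x (D_x R) (x, y, t) - 2 *\<^sub>R (D_x R (x, y, t) ** Y)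
        + (6 * \<tau>) *\<^sub>R (r ** p ** r) - 2 *\<^sub>R (r ** commutator Y q) + r ** X = 0)"
proof -
  interpret cubic_family \<Gamma> c U V D "(x, y, t)" by unfold_locales (use assms in blast)+
  let ?w = "(x, y, t)"
  have \<omega>: "?w \<in> D" by fact
  note L = bounded_linear_blocks
  have Phi: "q = block_q (M 0 ?w)" "p = block_p (M 0 ?w)" "r = block_r (M 0 ?w)"
    unfolding q_def p_def r_def Q_def P_def R_def by (simp_all add: Phi1_eq[OF \<omega>])
  have d: "dq = block_q (dM t 0 ?w)" "dp = block_p (dM t 0 ?w)" "dr = block_r (dM t 0 ?w)"
    unfolding dq_def dp_def dr_def Q_def P_def R_def by (simp_all only: D_t_LPhi[OF L(1) \<omega>] D_t_LPhi[OF L(2) \<omega>] D_t_LPhi[OF L(3) \<omega>])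
  have dd: "ddq = block_q (ddM t t ?w)" "ddp = block_p (ddM t t ?w)" "ddr = block_r (ddM t t ?w)"
    unfolding ddq_def ddp_def ddr_def Q_def P_def R_def
    by (simp_all only: D_t_D_t_LPhi[OF L(1) \<omega>] D_t_D_t_LPhi[OF L(2) \<omega>] D_t_D_t_LPhi[OF L(3) \<omega>])
  have tw: "twice_partial_x Q ?w \<and> twice_partial_x P ?w \<and> twice_partial_x R ?w"
    unfolding Q_def P_def R_def by (intro conjI twice_partial_LPhi[OF L(1) \<omega>] twice_partial_LPhi[OF L(2) \<omega>] twice_partial_LPhi[OF L(3) \<omega>])
  have "t = 1 *\<^sub>R t" by simp
  from second_order_M[OF \<omega> this]
  have eqs: "3 *\<^sub>R ddq - 2 *\<^sub>R commutator dq Y - 3 *\<^sub>R commutator (commutator q T) dq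
      + 3 *\<^sub>R (T ** p ** dr) + 3 *\<^sub>R (dp ** r ** T)
      + 2 *\<^sub>R commutator (commutator q T) (commutator q Y)
      - 2 *\<^sub>R (T ** p ** r ** Y) + 2 *\<^sub>R (Y ** p ** r ** T)
      + commutator (commutator q T) X = 0"
    "3 *\<^sub>R ddp + 2 *\<^sub>R (Y ** dp) - 3 *\<^sub>R (dq ** T ** p) - 3 *\<^sub>R (commutator q T ** dp)
      + 3 *\<^sub>R (T ** p ** r ** T ** p) - 2 *\<^sub>R ((Y ** q ** T - T ** q ** Y) ** p)
      + X ** T ** p = 0"
    "3 *\<^sub>R ddr - 2 *\<^sub>R (dr ** Y) - 3 *\<^sub>R (r ** T ** dq) + 3 *\<^sub>R (dr ** commutator q T)
      + 3 *\<^sub>R (r ** T ** p ** r ** T) - 2 *\<^sub>R (r ** (Y ** q ** T - T ** q ** Y))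
      + r ** T ** X = 0"
    unfolding Phi d dd T_def Y_def X_def using block_equations[OF _ block_s_dM, of 1] by simp_all
  have one: "D_x Q ?w + p ** r = 0 \<and>
      (3 * \<tau>) *\<^sub>R D_x (D_x P) ?w + 2 *\<^sub>R (Y ** D_x P ?w)
        + (6 * \<tau>) *\<^sub>R (p ** r ** p) - 2 *\<^sub>R (commutator Y q ** p) + X ** p = 0 \<and>
      (3 * \<tau>) *\<^sub>R D_x (D_x R) ?w - 2 *\<^sub>R (D_x R ?w ** Y)
        + (6 * \<tau>) *\<^sub>R (r ** p ** r) - 2 *\<^sub>R (r ** commutator Y q) + r ** X = 0" if "\<forall>i. t $ i = \<tau>" for \<tau>
  proof -
    have "t = \<tau> *\<^sub>R 1" using that by (simp add: vec_eq_iff)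
    note b = block_equations_one[OF second_order_M[OF \<omega> this] dM_decomposition]
    show ?thesis
      unfolding Q_def P_def R_def D_x_LPhi[OF L(1) \<omega>] D_x_LPhi[OF L(2) \<omega>] D_x_LPhi[OF L(3) \<omega>] D_x_D_x_LPhi[OF L(2) \<omega>] D_x_D_x_LPhi[OF L(3) \<omega>]
      unfolding Phi Y_def X_def by (intro conjI b)
  qed
  show ?thesis using tw eqs one by blast
qed

end
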